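(* Let $K$ be a number field of degree $n$ with $s$ real embeddings $\sigma_1,\dots,\sigma_s$ and $t$ pairs of complex embeddings, one from each pair denoted $\tau_1,\dots,\tau_t$; let $\Sigma=\{\sigma_1,\dots,\sigma_s,\tau_1,\dots,\tau_t\}$. For each $\rho\in\Sigma$ let $\psi_\rho: I_K\to\mathbb{R}_{\geq 0}$ be a function, and put $$\Psi(\mathfrak{n})=\prod_{\rho \text{ real}}\psi_\rho(\mathfrak{n})\prod_{\rho\text{ complex}}\psi_\rho(\mathfrak{n})^2 .$$ Suppose that $$\sum_{\mathfrak{n}\in I_K}\Phi(\mathfrak{n})\Psi(\mathfrak{n})=\infty,$$ that $$\limsup_{R\to\infty}\frac{\sum_{\mathfrak{n}\in I_K,\ \mathrm{Nm}(\mathfrak{n})\le R}\Phi(\mathfrak{n})\Psi(\mathfrak{n})}{\sum_{\mathfrak{n}\in I_K,\ \mathrm{Nm}(\mathfrak{n})\le R}\mathrm{Nm}(\mathfrak{n})\Psi(\mathfrak{n})}>0,$$ and that for every $\rho\in\Sigma$ and every $\mathfrak{n}\in I_K$, $$\psi_\rho(\mathfrak{n})\le \frac{1}{2\,\mathrm{Nm}(\mathfrak{n})^{1/(s+t)}}.$$ Then the set $\mathcal{A}'(\underline{\psi})$ has Lebesgue measure $\lambda(D_K)$.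
   Context: $\mathcal{O}_K$ is the ring of integers of $K$ and $I_K$ the set of nonzero integral ideals of $\mathcal{O}_K$. For $\mathfrak{n}\in I_K$, $\mathrm{Nm}(\mathfrak{n})=\#(\mathcal{O}_K/\mathfrak{n})$ and $\Phi(\mathfrak{n})=\#(\mathcal{O}_K/\mathfrak{n})^{\times}$. For real $\rho$, $|\cdot|_\rho$ is the usual absolute value on $\mathbb{R}$; for complex $\rho$, $|\cdot|_\rho$ is the square of the usual absolute value on $\mathbb{C}$. The map $\iota:K\to\mathbb{R}^s\times\mathbb{C}^t$ is $\iota(\alpha)=(\sigma_1(\alpha),\dots,\sigma_s(\alpha),\tau_1(\alpha),\dots,\tau_t(\alpha))$; $\iota(\mathcal{O}_K)$ is a lattice and $D_K$ is a fixed fundamental domain for it. $\lambda$ is Lebesgue measure on $\mathbb{R}^s\times\mathbb{C}^t\cong\mathbb{R}^n$. For $\gamma\in K^\times$, write uniquely $(\gamma)=\mathfrak{a}/\mathfrak{n}$ with $\mathfrak{a},\mathfrak{n}\in I_K$ coprime, and set $\mathrm{dnm}(\gamma)=\mathfrak{n}$. For $\mathbf{x}=(x_\rho)_{\rho\in\Sigma}\in\mathbb{R}^s\times\mathbb{C}^t$, $\gamma\in K$ is a $\underline{\psi}$-good approximation to $\mathbf{x}$ if $|x_\rho-\rho(\gamma)|_\rho\le\psi_\rho(\mathrm{dnm}(\gamma))$ for every $\rho\in\Sigma$. Then $\mathcal{A}'(\underline{\psi})$ is the set of $\mathbf{x}\in D_K$ for which there exist infinitely many $\gamma\in K$ that are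 $\underline{\psi}$-good approximations to $\mathbf{x}$. *)

theory Defs
  imports "HOL-Analysis.Analysis" "HOL-Algebra.QuotRing"
begin

definition number_field :: "'k::field_char_0 itself \<Rightarrow> bool" where
  "number_field TYPE('k) \<longleftrightarrow>
     (\<exists>B. finite B \<and> module.span (\<lambda>(q::rat) (x::'k). of_rat q * x) B = UNIV)"

definition field_degree :: "'k::field_char_0 itself \<Rightarrow> nat" where
  "field_degree TYPE('k) = vector_space.dim (\<lambda>(q::rat) (x::'k). of_rat q * x) UNIV"

definition field_embedding :: "('a::field \<Rightarrow> 'b::field) \<Rightarrow> bool" where
  "field_embedding f \<longleftrightarrow>
     f 1 = 1 \<and> (\<forall>x y. f (x + y) = f x + f y) \<and> (\<forall>x y. f (x * y) = f x * f y)"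

definition enumerates_real_embeddings :: "nat \<Rightarrow> (nat \<Rightarrow> 'k::field_char_0 \<Rightarrow> real) \<Rightarrow> bool" where
  "enumerates_real_embeddings s \<sigma> \<longleftrightarrow> bij_betw \<sigma> {1..s} {f. field_embedding f}"

definition nonreal_embeddings :: "('k::field_char_0 \<Rightarrow> complex) set" where
  "nonreal_embeddings = {f. field_embedding f \<and> \<not> range f \<subseteq> \<real>}"

text \<open>
  The uniqueness of \<open>j\<close> makes \<open>\<tau> 1, \<dots>, \<tau> t\<close> distinct and pairwise non-conjugate.
\<close>

definition represents_complex_pairs :: "nat \<Rightarrow> (nat \<Rightarrow> 'k::field_char_0 \<Rightarrow> complex) \<Rightarrow> bool" where
  "represents_complex_pairs t \<tau> \<longleftrightarrow>
     (\<forall>j\<in>{1..t}. \<tau> j \<in> nonreal_embeddings) \<and>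
     (\<forall>f\<in>nonreal_embeddings. \<exists>!j. j \<in> {1..t} \<and> (f = \<tau> j \<or> f = cnj \<circ> \<tau> j))"

definition ring_of_integers :: "'k::field_char_0 ring" (\<open>\<O>\<close>) where
  "\<O> = \<lparr>carrier = {x. algebraic_int x}, mult = (*), one = 1, zero = 0, add = (+)\<rparr>"

definition integral_ideals :: "'k::field_char_0 set set" where
  "integral_ideals = {\<nn>. ideal \<nn> \<O> \<and> \<nn> \<noteq> {0}}"

definition ideal_Nm :: "'k::field_char_0 set \<Rightarrow> nat" where
  "ideal_Nm \<nn> = card (carrier (\<O> Quot \<nn>))"

definition ideal_\<Phi> :: "'k::field_char_0 set \<Rightarrow> nat" where
  "ideal_\<Phi> \<nn> = card (Units (\<O> Quot \<nn>))"

definition coprime_ideals :: "'k::field_char_0 set \<Rightarrow> 'k set \<Rightarrow> bool" where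
  "coprime_ideals \<aa> \<nn> \<longleftrightarrow> \<aa> <+>\<^bsub>\<O>\<^esub> \<nn> = carrier \<O>"

text \<open>
  The equation \<open>(\<gamma>) = \<aa> / \<nn>\<close> of fractional ideals says that \<open>\<gamma>\<nn> = \<aa>\<close>. Only the case
  \<open>\<gamma> \<noteq> 0\<close> is canonical; for \<open>\<gamma> = 0\<close> the convention is \<open>(0) = (0) / (1)\<close>.
\<close>

definition dnm :: "'k::field_char_0 \<Rightarrow> 'k set" where
  "dnm \<gamma> = (if \<gamma> = 0 then carrier \<O> else
     (THE \<nn>. \<nn> \<in> integral_ideals \<and>
        (\<exists>\<aa>\<in>integral_ideals. coprime_ideals \<aa> \<nn> \<and> (\<lambda>x. \<gamma> * x) ` \<nn> = \<aa>)))"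

text \<open>
  Since \<open>s\<close> or \<open>t\<close> may be \<open>0\<close>, \<open>\<real>\<^sup>s \<times> \<complex>\<^sup>t\<close> is modelled by functions that are extensional
  on \<open>{1..s}\<close> and \<open>{1..t}\<close>; the completion turns the Borel product measure into Lebesgue measure.
\<close>

type_synonym point = "(nat \<Rightarrow> real) \<times> (nat \<Rightarrow> complex)"

definition lebesgue_st :: "nat \<Rightarrow> nat \<Rightarrow> point measure" where
  "lebesgue_st s t =
     completion ((\<Pi>\<^sub>M i\<in>{1..s}. (lborel :: real measure)) \<Otimes>\<^sub>M (\<Pi>\<^sub>M j\<in>{1..t}. (lborel :: complex measure)))"

definition \<iota> ::
  "nat \<Rightarrow> nat \<Rightarrow> (nat \<Rightarrow> 'k::field_char_0 \<Rightarrow> real) \<Rightarrow> (nat \<Rightarrow> 'k \<Rightarrow> complex) \<Rightarrow> 'k \<Rightarrow> point" where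
  "\<iota> s t \<sigma> \<tau> \<alpha> = (\<lambda>i\<in>{1..s}. \<sigma> i \<alpha>, \<lambda>j\<in>{1..t}. \<tau> j \<alpha>)"

definition point_add :: "nat \<Rightarrow> nat \<Rightarrow> point \<Rightarrow> point \<Rightarrow> point" where
  "point_add s t x y = (\<lambda>i\<in>{1..s}. fst x i + fst y i, \<lambda>j\<in>{1..t}. snd x j + snd y j)"

text \<open>
  Boundaries are treated modulo null sets, so that half-open, open and closed fundamental
  parallelepipeds and exact systems of coset representatives are all covered.
\<close>

definition fundamental_domain :: "nat \<Rightarrow> nat \<Rightarrow> point set \<Rightarrow> point set \<Rightarrow> bool" where
  "fundamental_domain s t L D \<longleftrightarrow>
     D \<in> sets (lebesgue_st s t) \<and>
     (AE x in lebesgue_st s t. \<exists>l\<in>L. \<exists>d\<in>D. x = point_add s t d l) \<and>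
     (\<forall>l\<in>L. \<forall>l'\<in>L. l \<noteq> l' \<longrightarrow>
        (\<lambda>d. point_add s t d l) ` D \<inter> (\<lambda>d. point_add s t d l') ` D \<in> null_sets (lebesgue_st s t))"

text \<open>
  A family \<open>\<psi>\<close> indexed by the real and the chosen complex embeddings is given by its two parts:
  \<open>\<psi>\<^sub>r i\<close> belongs to \<open>\<sigma> i\<close> and \<open>\<psi>\<^sub>c j\<close> to \<open>\<tau> j\<close>. At a complex embedding the normalised
  absolute value is the square of the usual one.
\<close>

definition good_approximation ::
  "nat \<Rightarrow> nat \<Rightarrow> (nat \<Rightarrow> 'k::field_char_0 \<Rightarrow> real) \<Rightarrow> (nat \<Rightarrow> 'k \<Rightarrow> complex) \<Rightarrow>
   (nat \<Rightarrow> 'k set \<Rightarrow> real) \<Rightarrow> (nat \<Rightarrow> 'k set \<Rightarrow> real) \<Rightarrow> point \<Rightarrow> 'k \<Rightarrow> bool" where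
  "good_approximation s t \<sigma> \<tau> \<psi>\<^sub>r \<psi>\<^sub>c x \<gamma> \<longleftrightarrow>
     (\<forall>i\<in>{1..s}. \<bar>fst x i - \<sigma> i \<gamma>\<bar> \<le> \<psi>\<^sub>r i (dnm \<gamma>)) \<and>
     (\<forall>j\<in>{1..t}. (cmod (snd x j - \<tau> j \<gamma>))\<^sup>2 \<le> \<psi>\<^sub>c j (dnm \<gamma>))"

definition approximable_set ::
  "nat \<Rightarrow> nat \<Rightarrow> (nat \<Rightarrow> 'k::field_char_0 \<Rightarrow> real) \<Rightarrow> (nat \<Rightarrow> 'k \<Rightarrow> complex) \<Rightarrow>
   (nat \<Rightarrow> 'k set \<Rightarrow> real) \<Rightarrow> (nat \<Rightarrow> 'k set \<Rightarrow> real) \<Rightarrow> point set \<Rightarrow> point set" where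
  "approximable_set s t \<sigma> \<tau> \<psi>\<^sub>r \<psi>\<^sub>c D =
     {x \<in> D. infinite {\<gamma>. good_approximation s t \<sigma> \<tau> \<psi>\<^sub>r \<psi>\<^sub>c x \<gamma>}}"

definition \<Psi> ::
  "nat \<Rightarrow> nat \<Rightarrow> (nat \<Rightarrow> 'k::field_char_0 set \<Rightarrow> real) \<Rightarrow> (nat \<Rightarrow> 'k set \<Rightarrow> real) \<Rightarrow> 'k set \<Rightarrow> real" where
  "\<Psi> s t \<psi>\<^sub>r \<psi>\<^sub>c \<nn> = (\<Prod>i\<in>{1..s}. \<psi>\<^sub>r i \<nn>) * (\<Prod>j\<in>{1..t}. (\<psi>\<^sub>c j \<nn>)\<^sup>2)"

end

theory Submission
  imports Defs "Jordan_Normal_Form.Char_Poly" "HOL-Computational_Algebra.Computational_Algebra"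
    "HOL-Computational_Algebra.Field_as_Ring"
begin

text \<open>
  Balls around the reduced fractions with denominator \<open>\<nn>\<close> cover, counted with multiplicity, a volume
  proportional to \<open>\<Phi>(\<nn>) \<Psi>(\<nn>)\<close> modulo \<open>\<O>\<close>. By the limsup condition the series of these volumes
  still diverges over the ideals with \<open>\<Phi>(\<nn>) \<ge> c Nm(\<nn>)\<close>. Two distinct fractions with denominators
  \<open>\<nn>\<close> and \<open>\<mm>\<close> differ by an element of \<open>(\<nn> \<inter> \<mm>)\<^sup>-\<^sup>1\<close>, whose norm is bounded below by a multiple
  of \<open>1 / Nm(\<nn> \<inter> \<mm>)\<close>; a packing argument then bounds the pairwise overlaps on average, so the
  counting functions of the balls, normalised to mean one, are bounded in \<open>L\<^sup>2\<close>. A second moment of the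
  character sums over reduced fractions shows that they equidistribute, \<open>\<bar>\<Sum> \<chi>\<bar>\<^sup>2\<close> being at most a
  constant times \<open>Nm(\<nn>)\<close>. Hence the normalised counting functions converge weakly to a constant. On a
  set where the counting functions stay bounded they tend to zero after normalisation, so such a set
  is null: this gives full measure without a zero-one law.
\<close>

section \<open>Algebraic integers and embeddings\<close>

text \<open>The overlap bound loses a constant factor, so a second moment by itself would only yield
  positive measure. The \<open>L\<^sup>2\<close> bound therefore acts as a compactness statement:
  with Young's inequality it carries convergence against trigonometric polynomials over to bounded
  pointwise limits of test functions, and so to indicators of all measurable sets. The restriction
  to \<Phi>(n) \<ge> c Nm(n) acts twice. It turns the factors Nm(n) of the overlap bound into
  \<Phi>(n), so that the second moment is comparable to the square of the first; and it makes the
  character sum error, of order sqrt(Nm(n)), small relative to \<Phi>(n) once the norm is large,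
  while the finitely many ideals of small norm are outweighed by the divergent sum. On the algebraic
  side the embeddings are shown to span the additive functions on the field; the resulting dual
  basis translates between lattice coordinates and archimedean places. The arithmetic of ideals
  rests on their invertibility, obtained from the finiteness of residue rings.\<close>

interpretation zmod: Modules.module "\<lambda>(n::int) (x::'k::field_char_0). of_int n * x"
  by unfold_locales (auto simp: algebra_simps)

interpretation qvs: Vector_Spaces.vector_space "\<lambda>(q::rat) (x::'k::field_char_0). of_rat q * x"
  by unfold_locales (auto simp: algebra_simps of_rat_add of_rat_mult)

text \<open>Multiplication by \<open>x\<close> acts on the vector \<open>v\<close> as the matrix
  \<open>A\<close> pushed through \<open>h\<close>, so \<open>x\<close> is an eigenvalue. Leaving
  \<open>h\<close> open serves integer matrices, for integrality, and rational ones, for minimal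
  polynomials.\<close>

lemma poly_char_poly_eigen:
  fixes v :: "nat \<Rightarrow> 'k::field" and A :: "nat \<Rightarrow> nat \<Rightarrow> 'a::comm_ring_1"
  assumes h: "comm_ring_hom h"
    and eq: "\<And>i. i < n \<Longrightarrow> x * v i = (\<Sum>j<n. h (A i j) * v j)"
    and nz: "\<exists>i<n. v i \<noteq> 0"
  shows "poly (map_poly h (char_poly (mat n n (\<lambda>(i, j). A i j)))) x = 0"
proof -
  interpret h: comm_ring_hom h by (rule h)
  let ?A = "mat n n (\<lambda>(i, j). A i j)"
  have A: "?A \<in> carrier_mat n n" by simp
  have "map_poly h (char_poly ?A) = char_poly (map_mat h ?A)"
    by (rule h.char_poly_hom[OF A, symmetric])
  moreover have "eigenvalue (map_mat h ?A) x"
    unfolding eigenvalue_def eigenvector_def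
  proof (intro exI[of _ "vec n v"] conjI)
    show "vec n v \<in> carrier_vec (dim_row (map_mat h ?A))" by simp
    show "vec n v \<noteq> 0\<^sub>v (dim_row (map_mat h ?A))"
    proof
      assume "vec n v = 0\<^sub>v (dim_row (map_mat h ?A))"
      moreover obtain i where i: "i < n" "v i \<noteq> 0" using nz by auto
      ultimately have "vec n v $ i = 0\<^sub>v n $ i" by simp
      with i show False by simp
    qed
    show "map_mat h ?A *\<^sub>v vec n v = x \<cdot>\<^sub>v vec n v"
      by (rule eq_vecI) (auto simp: scalar_prod_def eq atLeast0LessThan)
  qed
  ultimately show ?thesis
    using eigenvalue_root_char_poly[of "map_mat h ?A" n x] by simp
qed

lemma algebraic_int_if_int_matrix:
  fixes v :: "nat \<Rightarrow> 'k::field_char_0" and A :: "nat \<Rightarrow> nat \<Rightarrow> int"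
  assumes "\<And>i. i < n \<Longrightarrow> x * v i = (\<Sum>j<n. of_int (A i j) * v j)"
    and "\<exists>i<n. v i \<noteq> 0"
  shows "algebraic_int x"
proof -
  let ?A = "mat n n (\<lambda>(i, j). A i j)"
  have "poly (map_poly of_int (char_poly ?A)) x = 0"
    by (rule poly_char_poly_eigen[where v = v]) (use assms in \<open>auto intro: of_int_hom.comm_ring_hom_axioms\<close>)
  moreover have "lead_coeff (char_poly ?A) = 1"
    using degree_monic_char_poly[of ?A n] by simp
  ultimately show ?thesis unfolding algebraic_int_altdef_ipoly by blast
qed

text \<open>Expressing the products \<open>x * s\<close> in the generators gives an integer matrix,
  and the characteristic polynomial of an integer matrix is monic.\<close>

lemma algebraic_int_if_stable:
  fixes S :: "'k::field_char_0 set"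
  assumes "finite S" "\<not> S \<subseteq> {0}" and st: "\<And>s. s \<in> S \<Longrightarrow> x * s \<in> zmod.span S"
  shows "algebraic_int x"
proof -
  obtain n and v :: "nat \<Rightarrow> 'k" where v: "bij_betw v {..<n} S"
    using \<open>finite S\<close> by (metis bij_betw_from_nat_into_finite)
  have "\<forall>s\<in>S. \<exists>u. x * s = (\<Sum>t\<in>S. of_int (u t) * t)"
    using st unfolding zmod.span_finite[OF \<open>finite S\<close>] by auto
  then obtain u where u: "\<And>s. s \<in> S \<Longrightarrow> x * s = (\<Sum>t\<in>S. of_int (u s t) * t)" by metis
  show ?thesis
  proof (rule algebraic_int_if_int_matrix[of n x v "\<lambda>i j. u (v i) (v j)"])
    show "x * v i = (\<Sum>j<n. of_int (u (v i) (v j)) * v j)" if "i < n" for i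
    proof -
      have "v i \<in> S" using v that by (auto simp: bij_betw_def)
      then show ?thesis using u sum.reindex_bij_betw[OF v, of "\<lambda>t. of_int (u (v i) t) * t"] by simp
    qed
    show "\<exists>i<n. v i \<noteq> 0"
      using v \<open>\<not> S \<subseteq> {0}\<close> by (auto simp: bij_betw_def image_subset_iff)
  qed
qed

lemma zspan_mult_closed:
  assumes "\<And>s. s \<in> S \<Longrightarrow> x * s \<in> zmod.span S" "y \<in> zmod.span S"
  shows "x * y \<in> zmod.span S"
  using assms(2)
proof (induction rule: zmod.span_induct_alt)
  case base
  then show ?case by (simp add: zmod.span_zero)
next
  case (step c s y)
  have "x * (of_int c * s + y) = of_int c * (x * s) + x * y" by (simp add: algebra_simps)
  then show ?case using step assms(1) by (metis zmod.span_add zmod.span_scale)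
qed

lemma algebraic_int_add_mult:
  fixes x y :: "'k::field_char_0"
  assumes "algebraic_int x" "algebraic_int y"
  shows "algebraic_int (x + y)" "algebraic_int (x * y)"
proof -
  obtain p q where p: "poly (map_poly of_int p) x = 0" "lead_coeff p = 1"
    and q: "poly (map_poly of_int q) y = 0" "lead_coeff q = 1"
    using assms unfolding algebraic_int_altdef_ipoly by blast
  \<comment> \<open>Powers below the degrees suffice, since the monic relations rewrite
    \<open>x ^ degree p\<close> and \<open>y ^ degree q\<close> in lower powers. The span is stable
    under \<open>x\<close> and under \<open>y\<close>, hence under their sum and product.\<close>
  define S where "S = (\<lambda>(i, j). x ^ i * y ^ j) ` ({..<degree p} \<times> {..<degree q})"
  have pow: "z ^ degree r = - (\<Sum>i<degree r. of_int (coeff r i) * z ^ i)"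
    if "poly (map_poly of_int r) z = 0" "lead_coeff r = 1" for r and z :: 'k
  proof -
    have "0 = (\<Sum>i\<le>degree r. of_int (coeff r i) * z ^ i)"
      using that(1) by (simp add: poly_altdef degree_map_poly coeff_map_poly)
    also have "{..degree r} = insert (degree r) {..<degree r}" by auto
    finally show ?thesis using that(2) by (simp add: add_eq_0_iff)
  qed
  have deg0: "degree r > 0" if "poly (map_poly of_int r) z = 0" "lead_coeff r = 1" for r and z :: 'k
    using pow[OF that] by (intro Nat.gr0I) auto
  have mem: "x ^ i * y ^ j \<in> zmod.span S" if "i < degree p" "j < degree q" for i j
    using that by (intro zmod.span_base) (auto simp: S_def)
  have X: "x * s \<in> zmod.span S" if s: "s \<in> S" for s
  proof -
    obtain i j where ij: "s = x ^ i * y ^ j" "i < degree p" "j < degree q"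
      using s by (auto simp: S_def)
    show ?thesis
    proof (cases "Suc i < degree p")
      case True
      then show ?thesis using mem[of "Suc i" j] ij by (simp add: mult_ac)
    next
      case False
      then have "x * s = x ^ degree p * y ^ j" using ij by (metis Suc_lessI mult.assoc power_Suc)
      also have "\<dots> = - (\<Sum>i<degree p. of_int (coeff p i) * (x ^ i * y ^ j))"
        by (simp add: pow[OF p] sum_distrib_left sum_negf mult_ac)
      finally show ?thesis
        using ij by (auto intro!: zmod.span_neg zmod.span_sum zmod.span_scale mem)
    qed
  qed
  have Y: "y * s \<in> zmod.span S" if s: "s \<in> S" for s
  proof -
    obtain i j where ij: "s = x ^ i * y ^ j" "i < degree p" "j < degree q"
      using s by (auto simp: S_def)
    show ?thesis
    proof (cases "Suc j < degree q")
      case True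
      then show ?thesis using mem[of i "Suc j"] ij by (simp add: mult_ac)
    next
      case False
      then have "y * s = x ^ i * y ^ degree q"
        using ij by (metis Suc_lessI mult.left_commute power_Suc)
      also have "\<dots> = - (\<Sum>j<degree q. of_int (coeff q j) * (x ^ i * y ^ j))"
        by (simp add: pow[OF q] sum_distrib_left sum_negf mult_ac)
      finally show ?thesis
        using ij by (auto intro!: zmod.span_neg zmod.span_sum zmod.span_scale mem)
    qed
  qed
  have "finite S" by (simp add: S_def)
  \<comment> \<open>A constant polynomial with leading coefficient 1 has no root, so both degrees
    are positive and \<open>x ^ 0 * y ^ 0\<close> is among the generators.\<close>
  moreover have "1 \<in> S" using deg0[OF p] deg0[OF q] by (force simp: S_def)
  then have "\<not> S \<subseteq> {0}" by auto
  moreover have "(x + y) * s \<in> zmod.span S" "x * y * s \<in> zmod.span S" if "s \<in> S" for s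
    using zmod.span_add[OF X[OF that] Y[OF that]] zspan_mult_closed[OF X Y[OF that]]
    by (auto simp: distrib_right mult.assoc)
  ultimately show "algebraic_int (x + y)" "algebraic_int (x * y)"
    by (auto intro: algebraic_int_if_stable[of S])
qed

section \<open>Field embeddings and their linear independence\<close>

lemma field_embedding_simps:
  assumes "field_embedding f"
  shows "f 0 = 0" "f 1 = 1" "f (x + y) = f x + f y" "f (x * y) = f x * f y"
    "f (- x) = - f x" "f (x - y) = f x - f y"
proof -
  show *: "f 1 = 1" "f (x + y) = f x + f y" "f (x * y) = f x * f y" for x y
    using assms by (auto simp: field_embedding_def)
  show 0: "f 0 = 0" using *(2)[of 0 0] by (metis add_0 add_cancel_right_right)
  show n: "f (- x) = - f x" for x using *(2)[of x "- x"] 0 by (simp add: add_eq_0_iff)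
  show "f (x - y) = f x - f y" using *(2)[of x "- y"] n by simp
qed

lemma field_embedding_sum:
  "field_embedding f \<Longrightarrow> f (sum g A) = (\<Sum>x\<in>A. f (g x))"
  by (induction A rule: infinite_finite_induct) (auto simp: field_embedding_simps)

lemma field_embedding_power: "field_embedding f \<Longrightarrow> f (x ^ n) = f x ^ n"
  by (induction n) (auto simp: field_embedding_simps)

lemma field_embedding_nonzero: "field_embedding f \<Longrightarrow> x \<noteq> 0 \<Longrightarrow> f x \<noteq> 0"
  using field_embedding_simps(4)[of f x "inverse x"] field_embedding_simps(2)[of f] by auto

text \<open>Additivity gives linearity over the integers, and clearing the denominator extends it.
  Additive maps can thus be treated as rational-linear ones whatever their target field of
  characteristic zero.\<close>

lemma additive_rat_linear:
  fixes f :: "'a::field_char_0 \<Rightarrow> 'b::field_char_0"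
  assumes add: "\<And>x y. f (x + y) = f x + f y"
  shows "f (of_rat q * x) = of_rat q * f x"
proof -
  have 0: "f 0 = 0" using add[of 0 0] by (metis add_0 add_cancel_right_right)
  have neg: "f (- x) = - f x" for x using add[of x "- x"] 0 by (simp add: add_eq_0_iff)
  have nat: "f (of_nat n * x) = of_nat n * f x" for n x
    by (induction n) (auto simp: 0 add distrib_right)
  have int: "f (of_int n * x) = of_int n * f x" for n x
    by (cases n rule: int_cases2) (auto simp: nat neg)
  obtain a b where q: "q = of_int a / of_int b" "b > 0"
    by (metis Fract_of_int_quotient quotient_of_denom_pos quotient_of_div surj_pair)
  have "of_int b * f (of_rat q * x) = f (of_int b * (of_rat q * x))" by (rule int[symmetric])
  also have "of_int b * (of_rat q * x) = of_int a * x"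
    using q by (simp add: of_rat_divide)
  also have "f \<dots> = of_int a * f x" by (rule int)
  finally have "f (of_rat q * x) = of_int a / of_int b * f x"
    using q(2) by (simp add: eq_divide_eq mult.commute)
  then show ?thesis using q by (simp add: of_rat_divide)
qed

lemma field_embedding_of_rat:
  fixes f :: "'a::field_char_0 \<Rightarrow> 'b::field_char_0"
  assumes "field_embedding f" shows "f (of_rat q) = of_rat q"
  using additive_rat_linear[of f q 1] assms by (simp add: field_embedding_simps)

lemma field_embedding_of_int:
  fixes f :: "'a::field_char_0 \<Rightarrow> 'b::field_char_0"
  assumes "field_embedding f" shows "f (of_int q) = of_int q"
  using field_embedding_of_rat[OF assms, of "of_int q"] by simp

lemma field_embedding_poly:
  fixes f :: "'a::field_char_0 \<Rightarrow> 'b::field_char_0"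
  assumes "field_embedding f"
  shows "f (poly (map_poly of_rat p) x) = poly (map_poly of_rat p) (f x)"
  using assms
  by (simp add: poly_altdef degree_map_poly coeff_map_poly field_embedding_simps
      field_embedding_sum field_embedding_power field_embedding_of_rat)

lemma field_embedding_algebraic_int:
  fixes f :: "'a::field_char_0 \<Rightarrow> 'b::field_char_0"
  assumes "field_embedding f" "algebraic_int x"
  shows "algebraic_int (f x)"
proof -
  obtain p where p: "poly (map_poly of_int p) x = 0" "lead_coeff p = 1"
    using assms(2) algebraic_int_altdef_ipoly by blast
  have "poly (map_poly of_int p) (f x) = f (poly (map_poly of_int p) x)"
    using assms(1)
    by (simp add: poly_altdef degree_map_poly coeff_map_poly field_embedding_simps
        field_embedding_sum field_embedding_power field_embedding_of_int)
  then show ?thesis using p algebraic_int_altdef_ipoly field_embedding_simps(1)[OF assms(1)] by metis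
qed

text \<open>Dedekind's argument: subtracting \<open>g y\<close> times the relation at
  \<open>x\<close> from the relation at \<open>y * x\<close> cancels the term of \<open>g\<close>
  and multiplies the coefficient of \<open>h\<close> by \<open>h y - g y\<close>, which is nonzero
  for a suitable \<open>y\<close>.\<close>

lemma embeddings_independent:
  assumes "finite F" "\<And>f. f \<in> F \<Longrightarrow> field_embedding f"
    and "\<And>x. (\<Sum>f\<in>F. c f * f x) = (0 :: 'b::field)" "f \<in> F"
  shows "c f = 0"
  using assms
proof (induction F arbitrary: c f rule: finite_induct)
  case (insert g F)
  have rest: "c f = 0" if "f \<in> F" for f
  proof -
    from that insert.hyps have "f \<noteq> g" by auto
    then obtain y where y: "f y \<noteq> g y" by auto
    have "(\<Sum>h\<in>F. (c h * (h y - g y)) * h x) = 0" for x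
    proof -
      have "c g * g (y * x) + (\<Sum>h\<in>F. c h * h (y * x)) = 0"
        using insert.prems(2)[of "y * x"] insert.hyps by simp
      moreover have "c g * g x = - (\<Sum>h\<in>F. c h * h x)"
        using insert.prems(2)[of x] insert.hyps by (simp add: add_eq_0_iff2)
      moreover have m: "k (y * x) = k y * k x" if "k \<in> insert g F" for k
        using insert.prems(1)[OF that] by (simp add: field_embedding_simps)
      moreover have "c g * g (y * x) = g y * (c g * g x)" using m[of g] by simp
      ultimately have "(\<Sum>h\<in>F. c h * (h y * h x)) - g y * (\<Sum>h\<in>F. c h * h x) = 0"
        by simp
      then show ?thesis
        by (simp add: sum_distrib_left algebra_simps flip: sum_subtractf)
    qed
    from insert.IH[OF _ this \<open>f \<in> F\<close>] insert.prems(1) have "c f * (f y - g y) = 0" by auto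
    with y show ?thesis by simp
  qed
  have "c g * g 1 = 0" using insert.prems(2)[of 1] insert.hyps rest by simp
  then have "c g = 0" using field_embedding_simps(2)[of g] insert.prems(1)[of g] by simp
  with rest insert.prems show ?case by auto
qed simp

text \<open>
  The polynomial \<open>q\<close> acts on functions \<open>\<phi>\<close> on the field, the variable acting as
  \<open>\<phi> \<mapsto> \<phi> (x * _)\<close>. Splitting \<open>q\<close> into linear factors decomposes \<open>\<phi>\<close> into eigenfunctions.
\<close>

definition poly_act :: "'k::field \<Rightarrow> complex poly \<Rightarrow> ('k \<Rightarrow> complex) \<Rightarrow> 'k \<Rightarrow> complex" where
  "poly_act x q \<phi> y = (\<Sum>i\<le>degree q. coeff q i * \<phi> (x ^ i * y))"

lemma poly_act_bound:
  "degree q \<le> n \<Longrightarrow> poly_act x q \<phi> y = (\<Sum>i\<le>n. coeff q i * \<phi> (x ^ i * y))"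
  unfolding poly_act_def by (rule sum.mono_neutral_left) (auto simp: coeff_eq_0)

lemma poly_act_linear_factor:
  "poly_act x ([:- r, 1:] * q) \<phi> y = poly_act x q (\<lambda>y. \<phi> (x * y) - r * \<phi> y) y"
proof -
  let ?n = "Suc (degree q)"
  have "degree ([:- r, 1:] * q) \<le> ?n"
    by (metis degree_mult_le degree_pCons_eq_if One_nat_def add_Suc one_pCons plus_nat.add_0
        degree_0 degree_1 pCons_eq_0_iff zero_neq_one)
  then have "poly_act x ([:- r, 1:] * q) \<phi> y
      = (\<Sum>i\<le>?n. coeff ([:- r, 1:] * q) i * \<phi> (x ^ i * y))"
    by (rule poly_act_bound)
  also have "[:- r, 1:] * q = pCons 0 q + Polynomial.smult (- r) q" by simp
  also have "(\<Sum>i\<le>?n. coeff (pCons 0 q + Polynomial.smult (- r) q) i * \<phi> (x ^ i * y))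
      = (\<Sum>i\<le>?n. coeff (pCons 0 q) i * \<phi> (x ^ i * y)) - r * (\<Sum>i\<le>?n. coeff q i * \<phi> (x ^ i * y))"
    by (simp del: sum.atMost_Suc add: left_diff_distrib sum_subtractf sum_distrib_left mult.assoc)
  also have "(\<Sum>i\<le>?n. coeff (pCons 0 q) i * \<phi> (x ^ i * y))
      = (\<Sum>i\<le>degree q. coeff q i * \<phi> (x * (x ^ i * y)))"
    by (subst sum.atMost_Suc_shift) (simp add: mult.assoc)
  also have "(\<Sum>i\<le>?n. coeff q i * \<phi> (x ^ i * y)) = (\<Sum>i\<le>degree q. coeff q i * \<phi> (x ^ i * y))"
    using poly_act_bound[of q ?n x \<phi> y] poly_act_bound[of q "degree q" x \<phi> y] by simp
  finally show ?thesis
    by (simp add: poly_act_def sum_distrib_left algebra_simps sum_subtractf)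
qed

text \<open>The image \<theta> of \<phi> under the factor at \<open>s\<close> splits by induction.
  On the eigenspace of \<open>r\<close> that factor is multiplication by \<open>r - s\<close>, so
  dividing by \<open>r - s\<close> lifts the splitting to \<phi> up to a remainder in the eigenspace
  of \<open>s\<close>. The space \<open>W\<close> carries further invariants along, so that
  eigenspaces can be refined for several field elements in turn.\<close>

lemma eigen_decomposition:
  fixes x :: "'k::field" and W :: "('k \<Rightarrow> complex) set"
  assumes "finite R"
    and W_add: "\<And>\<phi> \<psi>. \<phi> \<in> W \<Longrightarrow> \<psi> \<in> W \<Longrightarrow> (\<lambda>y. \<phi> y + \<psi> y) \<in> W"
    and W_zero: "(\<lambda>y. 0) \<in> W"
    and W_scale: "\<And>c \<phi>. \<phi> \<in> W \<Longrightarrow> (\<lambda>y. c * \<phi> y) \<in> W"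
    and W_shift: "\<And>\<phi>. \<phi> \<in> W \<Longrightarrow> (\<lambda>y. \<phi> (x * y)) \<in> W"
    and "\<phi> \<in> W" "\<And>y. poly_act x (\<Prod>r\<in>R. [:- r, 1:]) \<phi> y = 0"
  shows "\<exists>\<psi>. (\<forall>r\<in>R. \<psi> r \<in> W \<and> (\<forall>y. \<psi> r (x * y) = r * \<psi> r y)) \<and> (\<forall>y. \<phi> y = (\<Sum>r\<in>R. \<psi> r y))"
  using assms(1,6,7)
proof (induction R arbitrary: \<phi> rule: finite_induct)
  case empty
  then show ?case by (simp add: poly_act_def)
next
  case (insert s R)
  have W_diff: "(\<lambda>y. \<phi> y - \<psi> y) \<in> W" if "\<phi> \<in> W" "\<psi> \<in> W" for \<phi> \<psi>
    using W_add[OF that(1) W_scale[OF that(2), of "-1"]] by simp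
  have W_sum: "(\<lambda>y. \<Sum>r\<in>A. \<psi> r y) \<in> W" if "\<And>r. r \<in> A \<Longrightarrow> \<psi> r \<in> W" for A and \<psi> :: "complex \<Rightarrow> 'k \<Rightarrow> complex"
    using that by (induction A rule: infinite_finite_induct) (auto intro: W_add W_zero)
  define \<theta> where "\<theta> = (\<lambda>y. \<phi> (x * y) - s * \<phi> y)"
  have "\<theta> \<in> W" unfolding \<theta>_def by (intro W_diff W_shift W_scale insert.prems)
  moreover have "poly_act x (\<Prod>r\<in>R. [:- r, 1:]) \<theta> y = 0" for y
    using insert.prems(2)[of y] insert.hyps poly_act_linear_factor[of x s "\<Prod>r\<in>R. [:- r, 1:]" \<phi> y]
    by (simp add: \<theta>_def)
  ultimately obtain \<psi> where \<psi>: "\<And>r. r \<in> R \<Longrightarrow> \<psi> r \<in> W" "\<And>r y. r \<in> R \<Longrightarrow> \<psi> r (x * y) = r * \<psi> r y"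
    "\<And>y. \<theta> y = (\<Sum>r\<in>R. \<psi> r y)"
    using insert.IH by metis
  define \<psi>' where "\<psi>' r y = \<psi> r y / (r - s)" for r y
  have \<psi>'W: "\<psi>' r \<in> W" if "r \<in> R" for r
    using W_scale[OF \<psi>(1)[OF that], of "1 / (r - s)"] by (simp add: \<psi>'_def[abs_def])
  have \<psi>'e: "\<psi>' r (x * y) = r * \<psi>' r y" if "r \<in> R" for r y
    using \<psi>(2)[OF that] by (simp add: \<psi>'_def)
  define \<eta> where "\<eta> y = \<phi> y - (\<Sum>r\<in>R. \<psi>' r y)" for y
  have "\<eta> \<in> W" unfolding \<eta>_def[abs_def] by (intro W_diff W_sum \<psi>'W insert.prems)
  have "\<eta> (x * y) = s * \<eta> y" for y
  proof -
    have "(\<Sum>r\<in>R. \<psi>' r (x * y)) - s * (\<Sum>r\<in>R. \<psi>' r y) = (\<Sum>r\<in>R. (r - s) * \<psi>' r y)"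
      by (simp add: \<psi>'e sum_distrib_left left_diff_distrib sum_subtractf)
    also have "\<dots> = (\<Sum>r\<in>R. \<psi> r y)"
      using insert.hyps by (intro sum.cong) (auto simp: \<psi>'_def)
    also have "\<dots> = \<phi> (x * y) - s * \<phi> y" using \<psi>(3)[of y] by (simp add: \<theta>_def)
    finally show ?thesis by (simp add: \<eta>_def algebra_simps)
  qed
  moreover have "(\<Sum>r\<in>insert s R. (\<psi>'(s := \<eta>)) r y) = \<eta> y + (\<Sum>r\<in>R. \<psi>' r y)" for y
  proof -
    have "(\<Sum>r\<in>R. (\<psi>'(s := \<eta>)) r y) = (\<Sum>r\<in>R. \<psi>' r y)"
      using insert.hyps by (intro sum.cong) auto
    then show ?thesis using insert.hyps by simp
  qed
  ultimately show ?case
    using \<open>\<eta> \<in> W\<close> \<psi>'W \<psi>'e insert.hyps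
    by (intro exI[of _ "\<psi>'(s := \<eta>)"]) (auto simp: \<eta>_def)
qed

section \<open>Minimal polynomials have simple complex roots\<close>

lemma map_poly_of_rat_mult:
  "map_poly of_rat (p * q) = (map_poly of_rat p * map_poly of_rat q :: 'k::field_char_0 poly)"
  by (rule poly_eqI) (simp add: coeff_mult coeff_map_poly of_rat_sum of_rat_mult)

lemma map_poly_of_rat_add:
  "map_poly of_rat (p + q) = (map_poly of_rat p + map_poly of_rat q :: 'k::field_char_0 poly)"
  by (rule poly_eqI) (simp add: coeff_map_poly of_rat_add)

text \<open>If \<open>p = g * h\<close> with \<open>g\<close> the gcd of \<open>p\<close> and its
  derivative, then \<open>g\<close> or \<open>h\<close> vanishes at \<open>x\<close> and so has full
  degree. The divisor \<open>g\<close> of the derivative cannot, hence \<open>g\<close> is constant,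
  and the Bezout identity survives the passage to complex coefficients.\<close>

lemma minimal_poly_rsquarefree:
  fixes x :: "'k::field_char_0" and p :: "rat poly"
  assumes p: "p \<noteq> 0" "poly (map_poly of_rat p) x = 0"
    and min: "\<And>q. q \<noteq> 0 \<Longrightarrow> poly (map_poly of_rat q) x = 0 \<Longrightarrow> degree p \<le> degree q"
  shows "rsquarefree (map_poly of_rat p :: complex poly)"
proof -
  have deg: "degree p > 0"
  proof (rule ccontr)
    assume "\<not> degree p > 0"
    then obtain a where "p = [:a:]" by (metis degree_eq_zeroE gr0I)
    with p show False by simp
  qed
  then have p': "pderiv p \<noteq> 0" by (simp add: pderiv_eq_0_iff)
  define g where "g = gcd p (pderiv p)"
  have "g dvd p" "g dvd pderiv p" by (auto simp: g_def)
  obtain h where h: "p = g * h" using \<open>g dvd p\<close> by auto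
  have gh: "g \<noteq> 0" "h \<noteq> 0" using h p by auto
  then have dgh: "degree p = degree g + degree h" by (simp add: h degree_mult_eq)
  have "poly (map_poly of_rat g) x * poly (map_poly of_rat h) x = 0"
    using p(2) unfolding h by (simp add: map_poly_of_rat_mult)
  then have "degree g = 0"
  proof (elim mult_eq_0_iff[THEN iffD1, THEN disjE])
    assume "poly (map_poly of_rat g) x = 0"
    from min[OF gh(1) this] have "degree p \<le> degree (pderiv p)"
      using dvd_imp_degree_le[OF \<open>g dvd pderiv p\<close> p'] by simp
    then show ?thesis using deg by (simp add: degree_pderiv)
  next
    assume "poly (map_poly of_rat h) x = 0"
    from min[OF gh(2) this] show ?thesis using dgh by simp
  qed
  then have "is_unit g" using gh by (simp add: is_unit_iff_degree)
  then have "coprime p (pderiv p)" unfolding g_def by (simp only: is_unit_gcd)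
  then obtain a b where ab: "a * p + b * pderiv p = 1"
    using bezout_coefficients[of p "pderiv p"] by (metis coprime_iff_gcd_eq_1 prod.collapse)
  have "poly (map_poly of_rat a) z * poly (map_poly of_rat p) z
      + poly (map_poly of_rat b) z * poly (pderiv (map_poly of_rat p)) z = 1" for z :: complex
    using arg_cong[OF ab, of "\<lambda>q. poly (map_poly of_rat q :: complex poly) z"]
    by (simp add: map_poly_of_rat_mult of_rat_hom.map_poly_pderiv map_poly_of_rat_add)
  then show ?thesis
    unfolding rsquarefree_roots by (metis add_0 mult_zero_right zero_neq_one)
qed

section \<open>Coordinates with respect to a rational basis\<close>

locale qbasis =
  fixes d :: nat and b :: "nat \<Rightarrow> 'k::field_char_0" and \<phi> :: "nat \<Rightarrow> 'k \<Rightarrow> rat"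
  assumes expand: "x = (\<Sum>j<d. of_rat (\<phi> j x) * b j)"
    and coord_add: "j < d \<Longrightarrow> \<phi> j (x + y) = \<phi> j x + \<phi> j y"
    and coord_basis: "i < d \<Longrightarrow> j < d \<Longrightarrow> \<phi> j (b i) = (if i = j then 1 else 0)"

lemma qbasis_exI:
  fixes b :: "nat \<Rightarrow> 'k::field_char_0"
  assumes span: "\<And>x. \<exists>q. x = (\<Sum>j<d. of_rat (q j) * b j)"
    and indep: "\<And>q j. (\<Sum>j<d. of_rat (q j) * b j) = 0 \<Longrightarrow> j < d \<Longrightarrow> q j = 0"
  shows "\<exists>\<phi>. qbasis d b \<phi>"
proof -
  obtain Q where Q: "\<And>x. x = (\<Sum>j<d. of_rat (Q x j) * b j)" using span by metis
  have uniq: "Q x j = q j" if "x = (\<Sum>j<d. of_rat (q j) * b j)" "j < d" for x q j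
  proof -
    have "(\<Sum>j<d. of_rat (Q x j - q j) * b j) = 0"
      using Q[of x] that(1) by (simp add: of_rat_diff left_diff_distrib sum_subtractf)
    from indep[OF this that(2)] show ?thesis by simp
  qed
  have "qbasis d b (\<lambda>j x. Q x j)"
  proof
    show "x = (\<Sum>j<d. of_rat (Q x j) * b j)" for x by (rule Q)
    show "Q (x + y) j = Q x j + Q y j" if "j < d" for j x y
      by (rule uniq[OF _ that, where q = "\<lambda>j. Q x j + Q y j"])
        (use Q[of x] Q[of y] in \<open>simp add: of_rat_add distrib_right sum.distrib\<close>)
    show "Q (b i) j = (if i = j then 1 else 0)" if "i < d" "j < d" for i j
    proof (rule uniq[OF _ that(2), where q = "\<lambda>j. if i = j then 1 else 0"])
      have "(\<Sum>j<d. of_rat (if i = j then 1 else 0) * b j) = (\<Sum>j<d. if i = j then b j else 0)"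
        by (intro sum.cong) auto
      then show "b i = (\<Sum>j<d. of_rat (if i = j then 1 else 0) * b j)" using that by simp
    qed
  qed
  then show ?thesis by blast
qed

lemma number_field_qbasis:
  assumes "number_field TYPE('k::field_char_0)"
  shows "\<exists>d (b :: nat \<Rightarrow> 'k) \<phi>. qbasis d b \<phi>"
proof -
  obtain B :: "'k set" where B: "finite B" "qvs.span B = UNIV"
    using assms unfolding number_field_def by blast
  obtain C where C: "C \<subseteq> B" "qvs.independent C" "qvs.span C = UNIV"
    using qvs.maximal_independent_subset[of B] B(2) qvs.span_mono[of B "qvs.span _"]
    by (metis qvs.span_span top.extremum_uniqueI)
  have fC: "finite C" using B C finite_subset by blast
  obtain b :: "nat \<Rightarrow> 'k" and d where b: "bij_betw b {..<d} C"
    using fC by (metis bij_betw_from_nat_into_finite)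
  have "\<exists>\<phi>. qbasis d b \<phi>"
  proof (rule qbasis_exI)
    fix x :: 'k
    have "x \<in> qvs.span C" using C by simp
    then obtain u where "x = (\<Sum>v\<in>C. of_rat (u v) * v)"
      unfolding qvs.span_finite[OF fC] by auto
    then show "\<exists>q. x = (\<Sum>j<d. of_rat (q j) * b j)"
      using sum.reindex_bij_betw[OF b, of "\<lambda>v. of_rat (u v) * v"] by (intro exI[of _ "\<lambda>j. u (b j)"]) simp
  next
    fix q :: "nat \<Rightarrow> rat" and j
    assume q: "(\<Sum>j<d. of_rat (q j) * b j) = 0" and j: "j < d"
    let ?g = "the_inv_into {..<d} b"
    have g: "?g (b i) = i" if "i < d" for i
      using b that by (auto simp: bij_betw_def the_inv_into_f_f)
    have "(\<Sum>v\<in>C. of_rat (q (?g v)) * v) = (\<Sum>j<d. of_rat (q (?g (b j))) * b j)"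
      using sum.reindex_bij_betw[OF b, of "\<lambda>v. of_rat (q (?g v)) * v"] by simp
    also have "\<dots> = 0" using q g by simp
    finally have "q (?g (b j)) = 0"
      using qvs.independentD[OF C(2) fC subset_refl, of "\<lambda>v. q (?g v)" "b j"] j b
      by (auto simp: bij_betw_def)
    then show "q j = 0" using g[OF j] by simp
  qed
  then show ?thesis by blast
qed

lemma algebraic_int_sum: "(\<And>i. i \<in> A \<Longrightarrow> algebraic_int (f i)) \<Longrightarrow> algebraic_int (sum f A)"
  for f :: "'a \<Rightarrow> 'k::field_char_0"
  by (induction A rule: infinite_finite_induct) (auto intro: algebraic_int_add_mult)

lemma algebraic_int_diff: "algebraic_int x \<Longrightarrow> algebraic_int y \<Longrightarrow> algebraic_int (x - y)"
  for x :: "'k::field_char_0"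
  using algebraic_int_add_mult(1)[of x "- y"] by simp

lemma algebraic_int_of_rat_iff: "algebraic_int (of_rat q :: 'k::field_char_0) \<longleftrightarrow> q \<in> \<int>"
proof
  assume "algebraic_int (of_rat q :: 'k)"
  moreover have "(of_rat q :: 'k) \<in> \<rat>" by (rule Rats_of_rat)
  ultimately have "(of_rat q :: 'k) \<in> \<int>" by (rule rational_algebraic_int_is_int)
  then obtain m where "(of_rat q :: 'k) = of_rat (of_int m)" by (auto elim: Ints_cases)
  then show "q \<in> \<int>" by (simp only: of_rat_eq_iff Ints_of_int)
qed (auto elim!: Ints_cases)

lemma common_denominator:
  assumes "finite A" shows "\<exists>N::int. N > 0 \<and> (\<forall>q\<in>A. of_int N * (q::rat) \<in> \<int>)"
  using assms
proof (induction A rule: finite_induct)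
  case (insert q A)
  then obtain N where N: "N > 0" "\<forall>q\<in>A. of_int N * q \<in> \<int>" by auto
  obtain a c where q: "q = of_int a / of_int c" "c > 0"
    by (metis Fract_of_int_quotient quotient_of_denom_pos quotient_of_div surj_pair)
  have "of_int (N * c) * r \<in> \<int>" if "r \<in> insert q A" for r
  proof (cases "r = q")
    case True
    have "of_int (N * c) * q = of_int (N * a)" using q by simp
    then show ?thesis using True by (metis Ints_of_int)
  next
    case False
    then have "of_int N * r \<in> \<int>" using N that by auto
    from Ints_mult[OF Ints_of_int this] have "of_int c * (of_int N * r) \<in> \<int>" .
    then show ?thesis by (simp add: mult_ac)
  qed
  then show ?case using N q by (intro exI[of _ "N * c"]) auto
qed (auto intro: exI[of _ 1])

context qbasis
begin

lemma coord_rat_linear: "j < d \<Longrightarrow> \<phi> j (of_rat q * x) = q * \<phi> j x"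
  using additive_rat_linear[of "\<phi> j" q x] coord_add by simp

lemma coord_zero: "j < d \<Longrightarrow> \<phi> j 0 = 0"
  using coord_rat_linear[of j 0 0] by simp

lemma coord_minus: "j < d \<Longrightarrow> \<phi> j (- x) = - \<phi> j x"
  using coord_rat_linear[of j "-1" x] by simp

lemma coord_diff: "j < d \<Longrightarrow> \<phi> j (x - y) = \<phi> j x - \<phi> j y"
  using coord_add[of j x "- y"] coord_minus[of j y] by simp

lemma coord_sum: "j < d \<Longrightarrow> \<phi> j (sum f A) = (\<Sum>i\<in>A. \<phi> j (f i))"
  by (induction A rule: infinite_finite_induct) (auto simp: coord_zero coord_add)

lemma coord_eqI: "(\<And>j. j < d \<Longrightarrow> \<phi> j x = \<phi> j y) \<Longrightarrow> x = y"
  using expand[of x] expand[of y] by (metis (no_types, lifting) lessThan_iff sum.cong)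

lemma coord_combination: "j < d \<Longrightarrow> \<phi> j (\<Sum>i<d. of_rat (q i) * b i) = q j"
proof -
  assume j: "j < d"
  then have "\<phi> j (\<Sum>i<d. of_rat (q i) * b i) = (\<Sum>i<d. if i = j then q i else 0)"
    by (simp only: coord_sum coord_rat_linear) (intro sum.cong, auto simp: coord_basis)
  then show ?thesis using j by simp
qed

lemma additive_expand:
  fixes f :: "'k \<Rightarrow> 'b::field_char_0"
  assumes add: "\<And>x y. f (x + y) = f x + f y"
  shows "f (x * y) = (\<Sum>j<d. of_rat (\<phi> j x) * f (b j * y))"
proof -
  have 0: "f 0 = 0" using add[of 0 0] by (metis add_0 add_cancel_right_right)
  have "f (sum g A) = (\<Sum>i\<in>A. f (g i))" for g :: "nat \<Rightarrow> 'k" and A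
    by (induction A rule: infinite_finite_induct) (auto simp: 0 add)
  then have "f ((\<Sum>j<d. of_rat (\<phi> j x) * b j) * y) = (\<Sum>j<d. of_rat (\<phi> j x) * f (b j * y))"
    using additive_rat_linear[of f, OF add] by (simp add: sum_distrib_right mult.assoc)
  then show ?thesis using expand[of x] by simp
qed

lemma b_nonzero: "\<exists>i<d. b i \<noteq> 0"
proof (rule ccontr)
  assume "\<not> ?thesis"
  then have "(1::'k) = 0" using expand[of 1] by simp
  then show False by simp
qed

text \<open>Multiplication by \<open>x\<close> has a rational matrix in the basis; \<open>N\<close>
  clears its denominators, so \<open>N x\<close> acts on the basis through an integer
  matrix.\<close>

lemma multiple_algebraic_int: fixes x :: 'k shows "\<exists>N::int. N > 0 \<and> algebraic_int (of_int N * x)"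
proof -
  define S where "S = (\<lambda>(i, j). \<phi> j (x * b i)) ` ({..<d} \<times> {..<d})"
  have "finite S" by (simp add: S_def)
  then obtain N where N: "N > 0" "\<And>q. q \<in> S \<Longrightarrow> of_int N * q \<in> \<int>"
    using common_denominator by blast
  have "\<exists>a::int. of_int N * \<phi> j (x * b i) = of_int a" if "i < d" "j < d" for i j
    using N(2)[of "\<phi> j (x * b i)"] that by (force simp: S_def elim!: Ints_cases)
  then obtain A where A: "\<And>i j. i < d \<Longrightarrow> j < d \<Longrightarrow> of_int N * \<phi> j (x * b i) = of_int (A i j)"
    by metis
  have "algebraic_int (of_int N * x)"
  proof (rule algebraic_int_if_int_matrix[of d _ b A])
    fix i assume i: "i < d"
    have "of_int N * x * b i = of_int N * (\<Sum>j<d. of_rat (\<phi> j (x * b i)) * b j)"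
      using expand[of "x * b i"] by (simp add: mult.assoc)
    also have "\<dots> = (\<Sum>j<d. of_rat (of_int N * \<phi> j (x * b i)) * b j)"
      by (simp add: sum_distrib_left of_rat_mult mult.assoc)
    also have "\<dots> = (\<Sum>j<d. of_int (A i j) * b j)"
      by (intro sum.cong) (use A i in auto)
    finally show "of_int N * x * b i = (\<Sum>j<d. of_int (A i j) * b j)" .
  qed (rule b_nonzero)
  with N show ?thesis by blast
qed

text \<open>The characteristic polynomial of multiplication by \<open>x\<close> annihilates
  \<open>x\<close>, so a polynomial of least degree exists. Its simple complex roots are what makes
  multiplication by \<open>x\<close> diagonalisable on additive functions.\<close>

lemma minimal_poly_exists:
  fixes x :: 'k
  obtains p :: "rat poly" where "p \<noteq> 0" "poly (map_poly of_rat p) x = 0"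
    "rsquarefree (map_poly of_rat p :: complex poly)"
proof -
  let ?P = "\<lambda>p :: rat poly. p \<noteq> 0 \<and> poly (map_poly of_rat p) x = 0"
  let ?A = "Matrix.mat d d (\<lambda>(i, j). \<phi> j (x * b i))"
  have "poly (map_poly of_rat (char_poly ?A)) x = 0"
    by (rule poly_char_poly_eigen[where v = b])
      (use expand b_nonzero in \<open>auto intro: of_rat_hom.comm_ring_hom_axioms\<close>)
  moreover have "char_poly ?A \<noteq> 0"
    using degree_monic_char_poly[of ?A d] by auto
  ultimately have ex: "?P (char_poly ?A)" by simp
  define p where "p = arg_min degree ?P"
  have p: "?P p" unfolding p_def by (rule arg_min_natI[where P = ?P, OF ex])
  have "degree p \<le> degree q" if "?P q" for q
    unfolding p_def using arg_min_nat_le[where P = ?P, OF that] .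
  with p show ?thesis using that minimal_poly_rsquarefree[of p x] by blast
qed

section \<open>The embeddings as a basis of the additive functions\<close>

definition Emb :: "('k \<Rightarrow> complex) set" where
  "Emb = {f. field_embedding f}"

lemma Emb_expand: "f \<in> Emb \<Longrightarrow> f x = (\<Sum>j<d. of_rat (\<phi> j x) * f (b j))"
  using additive_expand[of f x 1] by (simp add: Emb_def field_embedding_simps)

text \<open>An embedding is determined by its values on the basis, and each value is a root of a
  fixed polynomial.\<close>

lemma finite_Emb: "finite Emb"
proof -
  have "\<forall>j. \<exists>p :: rat poly. p \<noteq> 0 \<and> poly (map_poly of_rat p) (b j) = 0"
    using minimal_poly_exists by metis
  then obtain p where p: "\<And>j. p j \<noteq> (0 :: rat poly)" "\<And>j. poly (map_poly of_rat (p j)) (b j) = 0"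
    by metis
  let ?R = "\<lambda>j. {z :: complex. poly (map_poly of_rat (p j)) z = 0}"
  have "inj_on (\<lambda>f. \<lambda>j\<in>{..<d}. f (b j)) Emb"
  proof (rule inj_onI)
    fix f g assume fg: "f \<in> Emb" "g \<in> Emb" "(\<lambda>j\<in>{..<d}. f (b j)) = (\<lambda>j\<in>{..<d}. g (b j))"
    then have "f (b j) = g (b j)" if "j < d" for j
      using that by (metis lessThan_iff restrict_apply')
    then have "f x = g x" for x using Emb_expand[OF fg(1), of x] Emb_expand[OF fg(2), of x] by simp
    then show "f = g" by blast
  qed
  moreover have "(\<lambda>f. \<lambda>j\<in>{..<d}. f (b j)) ` Emb \<subseteq> PiE {..<d} ?R"
  proof -
    have "poly (map_poly of_rat (p j)) (f (b j)) = 0" if "f \<in> Emb" for f j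
      using field_embedding_poly[of f "p j" "b j"] that p(2)[of j]
      by (simp add: Emb_def field_embedding_simps)
    then show ?thesis by (simp add: image_subset_iff restrict_PiE_iff)
  qed
  moreover have "finite (PiE {..<d} ?R)"
    using p(1) by (intro finite_PiE poly_roots_finite) auto
  ultimately show ?thesis by (metis finite_imageD finite_subset)
qed

text \<open>Multiplications by field elements commute, so splitting along one more \<open>x\<close>
  preserves the eigenvalue equations already reached. A list records the summands because equal ones
  may occur.\<close>

lemma simultaneous_eigenfunctions:
  assumes "finite X" "\<And>x y. \<psi> (x + y) = \<psi> x + \<psi> y"
  shows "\<exists>L :: ('k \<Rightarrow> complex) list. (\<forall>\<theta>\<in>set L. (\<forall>x y. \<theta> (x + y) = \<theta> x + \<theta> y)
      \<and> (\<forall>x\<in>X. \<exists>r. \<forall>y. \<theta> (x * y) = r * \<theta> y)) \<and> (\<forall>y. \<psi> y = (\<Sum>\<theta>\<leftarrow>L. \<theta> y))"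
  using assms
proof (induction X rule: finite_induct)
  case empty
  then show ?case by (intro exI[of _ "[\<psi>]"]) auto
next
  case (insert x X)
  let ?C = "\<lambda>X. {\<theta> :: 'k \<Rightarrow> complex. (\<forall>x y. \<theta> (x + y) = \<theta> x + \<theta> y) \<and> (\<forall>x\<in>X. \<exists>r. \<forall>y. \<theta> (x * y) = r * \<theta> y)}"
  obtain L where L: "set L \<subseteq> ?C X" "\<And>y. \<psi> y = (\<Sum>\<theta>\<leftarrow>L. \<theta> y)"
    using insert.IH[OF insert.prems] by fast
  have "\<exists>M. set M \<subseteq> ?C (insert x X) \<and> (\<forall>y. \<theta> y = (\<Sum>\<eta>\<leftarrow>M. \<eta> y))" if \<theta>: "\<theta> \<in> ?C X" for \<theta>
  proof -
    have "\<forall>z\<in>X. \<exists>r. \<forall>y. \<theta> (z * y) = r * \<theta> y" using \<theta> by simp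
    then obtain e where e: "\<And>z y. z \<in> X \<Longrightarrow> \<theta> (z * y) = e z * \<theta> y" by metis
    \<comment> \<open>The joint eigenspace for the eigenvalues \<open>e z\<close> attained by
      \<theta>; commutativity of multiplication makes it stable under the shift by
      \<open>x\<close>.\<close>
    define W where "W = {\<theta> :: 'k \<Rightarrow> complex. (\<forall>x y. \<theta> (x + y) = \<theta> x + \<theta> y) \<and> (\<forall>z\<in>X. \<forall>y. \<theta> (z * y) = e z * \<theta> y)}"
    obtain p :: "rat poly" where p: "p \<noteq> 0" "poly (map_poly of_rat p) x = 0"
      "rsquarefree (map_poly of_rat p :: complex poly)" by (rule minimal_poly_exists)
    let ?P = "map_poly of_rat p :: complex poly"
    define R where "R = {z. poly ?P z = 0}"
    have finR: "finite R" unfolding R_def using p(1) by (intro poly_roots_finite) auto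
    have dec: "Polynomial.smult (lead_coeff ?P) (\<Prod>r\<in>R. [:- r, 1:]) = ?P"
      unfolding R_def by (rule complex_poly_decompose_rsquarefree[OF p(3)])
    \<comment> \<open>An additive \<theta> is rational-linear, so a rational polynomial acts by
      evaluating \<theta> at \<open>p(x) * y\<close>, which is 0.\<close>
    have act: "poly_act x ?P \<theta> y = 0" for y
    proof -
      have lin: "\<theta> (of_rat q * z) = of_rat q * \<theta> z" for q z
        using additive_rat_linear[of \<theta>] \<theta> by simp
      have sm: "\<theta> (sum g A) = (\<Sum>i\<in>A. \<theta> (g i))" for g :: "nat \<Rightarrow> 'k" and A
        using \<theta> lin[of 0 0] by (induction A rule: infinite_finite_induct) auto
      have "poly_act x ?P \<theta> y = (\<Sum>i\<le>degree p. \<theta> (of_rat (coeff p i) * (x ^ i * y)))"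
        by (simp add: poly_act_def lin degree_map_poly coeff_map_poly)
      also have "\<dots> = \<theta> (poly (map_poly of_rat p) x * y)"
        by (simp add: poly_altdef sum_distrib_right sm degree_map_poly coeff_map_poly mult.assoc)
      also have "\<dots> = 0" using p(2) lin[of 0 0] by simp
      finally show ?thesis .
    qed
    have act0: "poly_act x (\<Prod>r\<in>R. [:- r, 1:]) \<theta> y = 0" for y
    proof -
      have lc: "lead_coeff ?P \<noteq> 0" using p(1) by simp
      then have "degree (Polynomial.smult (lead_coeff ?P) (\<Prod>r\<in>R. [:- r, 1:])) = degree (\<Prod>r\<in>R. [:- r, 1:])"
        by (rule degree_smult_eq[THEN trans, OF if_not_P])
      then have "poly_act x (Polynomial.smult (lead_coeff ?P) (\<Prod>r\<in>R. [:- r, 1:])) \<theta> y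
          = lead_coeff ?P * poly_act x (\<Prod>r\<in>R. [:- r, 1:]) \<theta> y"
        by (simp add: poly_act_def sum_distrib_left mult.assoc)
      then show ?thesis using act[of y] lc unfolding dec by simp
    qed
    have \<theta>W: "\<theta> \<in> W" using \<theta> e by (simp add: W_def)
    have W_shift: "(\<lambda>y. \<eta> (x * y)) \<in> W" if "\<eta> \<in> W" for \<eta>
      using that by (auto simp: W_def distrib_left mult.left_commute[of x])
    have W_add: "(\<lambda>y. \<eta> y + \<eta>' y) \<in> W" if "\<eta> \<in> W" "\<eta>' \<in> W" for \<eta> \<eta>'
      using that by (auto simp: W_def distrib_left)
    have W_scale: "(\<lambda>y. c * \<eta> y) \<in> W" if "\<eta> \<in> W" for c \<eta>
      using that by (auto simp: W_def distrib_left mult.left_commute[of c])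
    have W_zero: "(\<lambda>y. 0) \<in> W" by (simp add: W_def)
    obtain \<eta> where \<eta>: "\<And>r. r \<in> R \<Longrightarrow> \<eta> r \<in> W"
      "\<And>r y. r \<in> R \<Longrightarrow> \<eta> r (x * y) = r * \<eta> r y" "\<And>y. \<theta> y = (\<Sum>r\<in>R. \<eta> r y)"
      using eigen_decomposition[OF finR W_add W_zero W_scale W_shift \<theta>W act0] by blast
    obtain Rl where Rl: "set Rl = R" "distinct Rl" using finite_distinct_list[OF finR] by blast
    show ?thesis
    proof (intro exI[of _ "map \<eta> Rl"] conjI allI subsetI)
      fix g assume "g \<in> set (map \<eta> Rl)"
      then obtain r where "r \<in> R" "g = \<eta> r" using Rl by auto
      then show "g \<in> ?C (insert x X)" using \<eta>(1)[of r] \<eta>(2)[of r] unfolding W_def by auto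
    next
      show "\<theta> y = (\<Sum>g\<leftarrow>map \<eta> Rl. g y)" for y
        using \<eta>(3)[of y] Rl by (simp add: o_def sum_list_distinct_conv_sum_set)
    qed
  qed
  then have "\<forall>\<theta>. \<exists>M. \<theta> \<in> ?C X \<longrightarrow> set M \<subseteq> ?C (insert x X) \<and> (\<forall>y. \<theta> y = (\<Sum>\<eta>\<leftarrow>M. \<eta> y))"
    by blast
  from choice[OF this] obtain M where M': "\<forall>\<theta>. \<theta> \<in> ?C X \<longrightarrow> set (M \<theta>) \<subseteq> ?C (insert x X)
      \<and> (\<forall>y. \<theta> y = (\<Sum>\<eta>\<leftarrow>M \<theta>. \<eta> y))" by blast
  then have M: "\<And>\<theta>. \<theta> \<in> ?C X \<Longrightarrow> set (M \<theta>) \<subseteq> ?C (insert x X)"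
    "\<And>\<theta> y. \<theta> \<in> ?C X \<Longrightarrow> \<theta> y = (\<Sum>\<eta>\<leftarrow>M \<theta>. \<eta> y)" by blast+
  have "(\<Sum>\<theta>\<leftarrow>L. \<theta> y) = (\<Sum>\<eta>\<leftarrow>concat (map M L). \<eta> y)" for y
    using L(1)
  proof (induction L)
    case (Cons \<theta> L)
    then show ?case using M(2)[of \<theta> y] by simp
  qed simp
  moreover have "set (concat (map M L)) \<subseteq> ?C (insert x X)"
  proof -
    have "set (M \<theta>) \<subseteq> ?C (insert x X)" if "\<theta> \<in> set L" for \<theta> using M(1) L(1) that by blast
    then show ?thesis unfolding set_concat set_map by blast
  qed
  ultimately have "set (concat (map M L)) \<subseteq> ?C (insert x X) \<and> (\<forall>y. \<psi> y = (\<Sum>\<eta>\<leftarrow>concat (map M L). \<eta> y))"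
    using L(2) by metis
  then show ?case by blast
qed

text \<open>An eigenfunction for the basis elements is one for every \<open>x\<close>, with
  eigenvalue \<open>l x = \<theta> x / \<theta> 1\<close>. This \<open>l\<close> inherits additivity
  from \<theta> and multiplicativity from the eigenvalue equation, so \<theta> is a multiple of an
  embedding.\<close>

lemma eigenfunction_multiple_of_embedding:
  assumes add: "\<And>x y. \<theta> (x + y) = \<theta> x + (\<theta> y :: complex)"
    and eig: "\<And>j. j < d \<Longrightarrow> \<exists>r. \<forall>y. \<theta> (b j * y) = r * \<theta> y"
  shows "\<exists>c. \<forall>y. \<theta> y = (\<Sum>f\<in>Emb. c f * f y)"
proof (cases "\<forall>y. \<theta> y = 0")
  case True
  then show ?thesis by (intro exI[of _ "\<lambda>_. 0"]) simp
next
  case False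
  obtain r where r: "\<And>j y. j < d \<Longrightarrow> \<theta> (b j * y) = r j * \<theta> y" using eig by metis
  define l where "l x = (\<Sum>j<d. of_rat (\<phi> j x) * r j)" for x
  have l: "\<theta> (x * y) = l x * \<theta> y" for x y
    unfolding additive_expand[of \<theta> x y, OF add] l_def by (simp add: r sum_distrib_right mult.assoc)
  from False obtain z where "\<theta> z \<noteq> 0" by blast
  with l[of z 1] have one: "\<theta> 1 \<noteq> 0" by auto
  have lx: "l x = \<theta> x / \<theta> 1" for x using l[of x 1] one by simp
  have "field_embedding l"
    unfolding field_embedding_def
  proof (intro conjI allI)
    show "l 1 = 1" using one by (simp add: lx)
    show "l (x + y) = l x + l y" for x y by (simp add: lx add add_divide_distrib)
    show "l (x * y) = l x * l y" for x y using l[of x y] lx[of "x * y"] lx[of y] by simp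
  qed
  then have "l \<in> Emb" by (simp add: Emb_def)
  have "(\<Sum>f\<in>Emb. (if f = l then \<theta> 1 else 0) * f y) = \<theta> y" for y
  proof -
    have "(\<Sum>f\<in>Emb. (if f = l then \<theta> 1 else 0) * f y) = (\<Sum>f\<in>Emb. if f = l then \<theta> 1 * f y else 0)"
      by (intro sum.cong) auto
    also have "\<dots> = \<theta> y" using finite_Emb \<open>l \<in> Emb\<close> lx[of y] one by simp
    finally show ?thesis .
  qed
  then show ?thesis by (intro exI[of _ "\<lambda>f. if f = l then \<theta> 1 else 0"]) simp
qed

text \<open>Together with independence this makes the embeddings a basis of the additive functions,
  so the rational coordinates can be read off at the archimedean places.\<close>

theorem additive_combination_of_embeddings:
  assumes "\<And>x y. \<psi> (x + y) = \<psi> x + (\<psi> y :: complex)"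
  shows "\<exists>c. \<forall>y. \<psi> y = (\<Sum>f\<in>Emb. c f * f y)"
proof -
  obtain L :: "('k \<Rightarrow> complex) list" where L: "\<forall>\<theta>\<in>set L. (\<forall>x y. \<theta> (x + y) = \<theta> x + \<theta> y)
      \<and> (\<forall>x\<in>b ` {..<d}. \<exists>r. \<forall>y. \<theta> (x * y) = r * \<theta> y)" "\<And>y. \<psi> y = (\<Sum>\<theta>\<leftarrow>L. \<theta> y)"
    using simultaneous_eigenfunctions[of "b ` {..<d}" \<psi>] assms by auto
  have "\<exists>c. \<forall>y. (\<Sum>\<theta>\<leftarrow>L. \<theta> y) = (\<Sum>f\<in>Emb. c f * f y)"
    using L(1)
  proof (induction L)
    case Nil
    then show ?case by (intro exI[of _ "\<lambda>_. 0"]) simp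
  next
    case (Cons \<theta> L)
    then obtain c where c: "\<And>y. (\<Sum>\<theta>\<leftarrow>L. \<theta> y) = (\<Sum>f\<in>Emb. c f * f y)" by auto
    obtain c' where "\<And>y. \<theta> y = (\<Sum>f\<in>Emb. c' f * f y)"
      using eigenfunction_multiple_of_embedding[of \<theta>] Cons.prems by auto
    with c show ?case
      by (intro exI[of _ "\<lambda>f. c' f + c f"]) (simp add: sum.distrib distrib_right)
  qed
  with L(2) show ?thesis by simp
qed

end

lemma cnj_of_rat: "cnj (of_rat q) = of_rat q"
  by (rule field_embedding_of_rat) (simp add: field_embedding_def)

context qbasis
begin

lemma cnj_Emb: "f \<in> Emb \<Longrightarrow> cnj \<circ> f \<in> Emb"
  by (auto simp: Emb_def field_embedding_def)

lemma Emb_independent: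
  "(\<And>x. (\<Sum>f\<in>Emb. c f * f x) = 0) \<Longrightarrow> f \<in> Emb \<Longrightarrow> c f = 0"
  using embeddings_independent[OF finite_Emb, of c] by (auto simp: Emb_def)

text \<open>The \<open>c j f\<close> form the inverse of the matrix of the values
  \<open>f (b j)\<close>. Uniqueness of coefficients gives the duality relation, and also the
  compatibility with conjugation, because the coordinates are rational and so fixed by
  \<open>cnj\<close>.\<close>

lemma coordinates_via_embeddings:
  "\<exists>c :: nat \<Rightarrow> ('k \<Rightarrow> complex) \<Rightarrow> complex. (\<forall>j<d. \<forall>x. of_rat (\<phi> j x) = (\<Sum>f\<in>Emb. c j f * f x))
    \<and> (\<forall>f\<in>Emb. \<forall>g\<in>Emb. (\<Sum>j<d. c j f * g (b j)) = (if f = g then 1 else 0))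
    \<and> (\<forall>j<d. \<forall>f\<in>Emb. c j (cnj \<circ> f) = cnj (c j f))"
proof -
  have "\<exists>c. \<forall>x. of_rat (\<phi> j x) = (\<Sum>f\<in>Emb. c f * f x)" if "j < d" for j
    using that by (intro additive_combination_of_embeddings) (simp add: coord_add of_rat_add)
  then obtain c where c: "\<And>j x. j < d \<Longrightarrow> of_rat (\<phi> j x) = (\<Sum>f\<in>Emb. c j f * f x)" by metis
  have dual: "(\<Sum>j<d. c j f * g (b j)) = (if f = g then 1 else 0)" if "f \<in> Emb" "g \<in> Emb" for f g
  proof -
    have "(\<Sum>h\<in>Emb. ((\<Sum>j<d. c j h * g (b j)) - (if h = g then 1 else 0)) * h x) = 0" for x
    proof -
      have "(\<Sum>h\<in>Emb. (\<Sum>j<d. c j h * g (b j)) * h x) = (\<Sum>j<d. (\<Sum>h\<in>Emb. c j h * h x) * g (b j))"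
        unfolding sum_distrib_right by (subst sum.swap) (simp add: mult_ac)
      also have "\<dots> = g x" using Emb_expand[OF that(2), of x] by (simp add: c)
      finally have 1: "(\<Sum>h\<in>Emb. (\<Sum>j<d. c j h * g (b j)) * h x) = g x" .
      have "(\<Sum>h\<in>Emb. (if h = g then 1 else 0) * h x) = (\<Sum>h\<in>Emb. if h = g then h x else 0)"
        by (intro sum.cong) auto
      also have "\<dots> = g x" using that(2) finite_Emb by simp
      finally show ?thesis using 1 by (simp add: left_diff_distrib sum_subtractf)
    qed
    from Emb_independent[OF this that(1)] show ?thesis by simp
  qed
  have conj: "c j (cnj \<circ> f) = cnj (c j f)" if "j < d" "f \<in> Emb" for j f
  proof -
    have bij: "bij_betw (\<lambda>f. cnj \<circ> f) Emb Emb"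
      by (rule bij_betw_byWitness[where f' = "\<lambda>f. cnj \<circ> f"]) (auto simp: o_def intro: cnj_Emb[unfolded o_def])
    have "(\<Sum>h\<in>Emb. (c j h - cnj (c j (cnj \<circ> h))) * h x) = 0" for x
    proof -
      have "(\<Sum>h\<in>Emb. cnj (c j (cnj \<circ> h)) * h x) = cnj (\<Sum>h\<in>Emb. c j (cnj \<circ> h) * (cnj \<circ> h) x)"
        by simp
      also have "(\<Sum>h\<in>Emb. c j (cnj \<circ> h) * (cnj \<circ> h) x) = (\<Sum>h\<in>Emb. c j h * h x)"
        by (rule sum.reindex_bij_betw[OF bij])
      also have "\<dots> = of_rat (\<phi> j x)" using c[OF that(1), of x] by simp
      also have "cnj \<dots> = (\<Sum>h\<in>Emb. c j h * h x)"
        by (simp only: c[OF that(1), symmetric] cnj_of_rat)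
      finally have e: "(\<Sum>h\<in>Emb. cnj (c j (cnj \<circ> h)) * h x) = (\<Sum>h\<in>Emb. c j h * h x)" .
      show ?thesis by (simp only: left_diff_distrib sum_subtractf e diff_self)
    qed
    from Emb_independent[OF this that(2)] show ?thesis by (metis complex_cnj_cnj eq_iff_diff_eq_0)
  qed
  show ?thesis using c dual conj by blast
qed

definition emb_coeff :: "nat \<Rightarrow> ('k \<Rightarrow> complex) \<Rightarrow> complex" where
  "emb_coeff = (SOME c. (\<forall>j<d. \<forall>x. of_rat (\<phi> j x) = (\<Sum>f\<in>Emb. c j f * f x))
    \<and> (\<forall>f\<in>Emb. \<forall>g\<in>Emb. (\<Sum>j<d. c j f * g (b j)) = (if f = g then 1 else 0))
    \<and> (\<forall>j<d. \<forall>f\<in>Emb. c j (cnj \<circ> f) = cnj (c j f)))"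

lemma coord_emb_coeff: "j < d \<Longrightarrow> of_rat (\<phi> j x) = (\<Sum>f\<in>Emb. emb_coeff j f * f x)"
  and emb_coeff_dual: "f \<in> Emb \<Longrightarrow> g \<in> Emb \<Longrightarrow>
    (\<Sum>j<d. emb_coeff j f * g (b j)) = (if f = g then 1 else 0)"
  and emb_coeff_cnj: "j < d \<Longrightarrow> f \<in> Emb \<Longrightarrow> emb_coeff j (cnj \<circ> f) = cnj (emb_coeff j f)"
  using someI_ex[OF coordinates_via_embeddings] unfolding emb_coeff_def[symmetric] by blast+

section \<open>The trace of the multiplication matrix, and bounded denominators\<close>

definition Tr :: "'k \<Rightarrow> rat" where "Tr x = (\<Sum>j<d. \<phi> j (x * b j))"

lemma Tr_add: "Tr (x + y) = Tr x + Tr y"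
  by (simp add: Tr_def distrib_right coord_add sum.distrib)

lemma Tr_one: "Tr 1 \<noteq> 0"
proof -
  have "Tr 1 = of_nat d" by (simp add: Tr_def coord_basis)
  moreover have "d \<noteq> 0" using b_nonzero by auto
  ultimately show ?thesis by simp
qed

lemma Tr_embeddings: "of_rat (Tr x) = (\<Sum>f\<in>Emb. f x)"
proof -
  have "of_rat (Tr x) = (\<Sum>j<d. \<Sum>f\<in>Emb. emb_coeff j f * f (x * b j))"
    by (simp add: Tr_def of_rat_sum coord_emb_coeff)
  also have "\<dots> = (\<Sum>f\<in>Emb. f x * (\<Sum>j<d. emb_coeff j f * f (b j)))"
    by (subst sum.swap) (simp add: sum_distrib_left Emb_def field_embedding_simps mult_ac)
  also have "\<dots> = (\<Sum>f\<in>Emb. f x)" by (simp add: emb_coeff_dual)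
  finally show ?thesis .
qed

text \<open>The trace is a sum of conjugates, hence an algebraic integer, and it is
  rational.\<close>

lemma Tr_algebraic_int:
  assumes "algebraic_int x" shows "Tr x \<in> \<int>"
proof -
  have "algebraic_int (\<Sum>f\<in>Emb. f x)"
  proof (rule algebraic_int_sum)
    show "algebraic_int (f x)" if "f \<in> Emb" for f
      using field_embedding_algebraic_int[of f x] assms that by (simp add: Emb_def)
  qed
  then show ?thesis
    using algebraic_int_of_rat_iff[where 'k = complex, of "Tr x"] by (simp only: Tr_embeddings)
qed

text \<open>The values at \<open>b i * x\<close> are bounded on the unit cell, so integrality leaves
  finitely many possibilities. They determine \<open>x\<close>, since a nonzero difference
  \<open>w\<close> would be detected by \<open>\<psi> (z / w * w)\<close>. Applied to the trace this
  bounds denominators of algebraic integers; applied to an integer functional it bounds the kernel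
  of a character.\<close>

lemma finite_integral_functional:
  fixes \<psi> :: "'k \<Rightarrow> rat"
  assumes add: "\<And>x y. \<psi> (x + y) = \<psi> x + \<psi> y" and nz: "\<psi> z \<noteq> 0"
  shows "finite {x. (\<forall>j<d. \<phi> j x \<in> {0..<1}) \<and> (\<forall>i<d. \<psi> (b i * x) \<in> \<int>)}" (is "finite ?S")
proof -
  define C where "C = (\<Sum>i<d. \<Sum>j<d. \<bar>\<psi> (b i * b j)\<bar>)"
  define T where "T = (of_int :: int \<Rightarrow> rat) ` {-\<lceil>C\<rceil>..\<lceil>C\<rceil>}"
  have bnd: "\<psi> (b i * x) \<in> T" if xi: "x \<in> ?S" "i < d" for x i
  proof -
    have "\<psi> (b i * x) = (\<Sum>j<d. \<phi> j x * \<psi> (b i * b j))"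
      using additive_expand[of \<psi> x "b i", OF add] by (simp add: mult.commute)
    also have "\<bar>\<dots>\<bar> \<le> (\<Sum>j<d. \<bar>\<psi> (b i * b j)\<bar>)"
      by (rule order.trans[OF sum_abs sum_mono]) (use xi in \<open>auto simp: abs_mult intro!: mult_left_le_one_le\<close>)
    also have "\<dots> \<le> C" unfolding C_def
      by (rule member_le_sum[of i "{..<d}" "\<lambda>i. \<Sum>j<d. \<bar>\<psi> (b i * b j)\<bar>"]) (use xi in \<open>auto intro: sum_nonneg\<close>)
    finally have le: "\<bar>\<psi> (b i * x)\<bar> \<le> C" .
    have "\<psi> (b i * x) \<in> \<int>" using xi by simp
    then obtain m where m: "\<psi> (b i * x) = of_int m" by (rule Ints_cases)
    have "of_int \<bar>m\<bar> \<le> C" using le m by simp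
    then have "\<bar>m\<bar> \<le> \<lceil>C\<rceil>" by (metis le_of_int_ceiling of_int_le_iff order.trans)
    then have "m \<in> {-\<lceil>C\<rceil>..\<lceil>C\<rceil>}" by auto
    then show ?thesis using m unfolding T_def by (rule image_eqI[rotated])
  qed
  let ?F = "\<lambda>x. \<lambda>i\<in>{..<d}. \<psi> (b i * x)"
  have "inj_on ?F ?S"
  proof (rule inj_onI)
    fix x y assume xy: "x \<in> ?S" "y \<in> ?S" "?F x = ?F y"
    have dif: "\<psi> (u - v) = \<psi> u - \<psi> v" for u v using add[of "u - v" v] by simp
    have "\<psi> (b i * (x - y)) = 0" if "i < d" for i
      using fun_cong[OF xy(3), of i] that by (simp add: right_diff_distrib dif)
    then have "\<psi> (w * (x - y)) = 0" for w
      using additive_expand[of \<psi> w "x - y", OF add] by simp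
    from this[of "z / (x - y)"] show "x = y" using nz by (cases "x = y") auto
  qed
  moreover have "?F ` ?S \<subseteq> PiE {..<d} (\<lambda>_. T)"
    using bnd by (simp add: image_subset_iff restrict_PiE_iff)
  moreover have "finite (PiE {..<d} (\<lambda>_. T))" by (intro finite_PiE) (auto simp: T_def)
  ultimately show ?thesis by (rule inj_on_finite)
qed

definition floor_part :: "'k \<Rightarrow> 'k" where
  "floor_part x = (\<Sum>j<d. of_int \<lfloor>\<phi> j x\<rfloor> * b j)"

lemma coord_floor_part: "j < d \<Longrightarrow> \<phi> j (floor_part x) = of_int \<lfloor>\<phi> j x\<rfloor>"
  using coord_combination[of j "\<lambda>j. of_int \<lfloor>\<phi> j x\<rfloor>"] by (simp add: floor_part_def)

lemma coord_frac_part: "j < d \<Longrightarrow> \<phi> j (x - floor_part x) \<in> {0..<1}"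
  by (simp add: coord_diff coord_floor_part) linarith

end

locale integral_basis = qbasis d b \<phi>
  for d and b :: "nat \<Rightarrow> 'k::field_char_0" and \<phi> +
  assumes algebraic_int_iff_coords: "algebraic_int x \<longleftrightarrow> (\<forall>j<d. \<phi> j x \<in> \<int>)"

text \<open>
  The coordinates of algebraic integers with respect to a rational basis of algebraic integers have
  bounded denominators, and minimal elements along the flag of the basis generate all algebraic
  integers.
\<close>

lemma (in qbasis) integral_basis_exists:
  "\<exists>(w :: nat \<Rightarrow> 'k) \<theta>. integral_basis d w \<theta>"
proof -
  have "\<forall>j. \<exists>N::int. N > 0 \<and> algebraic_int (of_int N * b j)" using multiple_algebraic_int by blast
  then obtain N where N: "\<And>j. N j > (0::int)" "\<And>j. algebraic_int (of_int (N j) * b j)" by metis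
  define b' where "b' j = of_int (N j) * b j" for j
  have "qbasis d b' (\<lambda>j x. \<phi> j x / of_int (N j))"
  proof
    show "x = (\<Sum>j<d. of_rat (\<phi> j x / of_int (N j)) * b' j)" for x
    proof -
      have "of_int (N j) \<noteq> (0::'k)" for j using N(1)[of j] by simp
      then show ?thesis using expand[of x] by (simp add: b'_def of_rat_divide)
    qed
    show "\<phi> j (x + y) / of_int (N j) = \<phi> j x / of_int (N j) + \<phi> j y / of_int (N j)" if "j < d" for j x y
      using that by (simp add: coord_add add_divide_distrib)
    show "\<phi> j (b' i) / of_int (N j) = (if i = j then 1 else 0)" if "i < d" "j < d" for i j
      using that N(1)[of j] coord_rat_linear[of j "of_int (N i)" "b i"] by (auto simp: b'_def coord_basis)
  qed
  then obtain \<phi>' where "qbasis d b' \<phi>'" by blast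
  then interpret B: qbasis d b' \<phi>' .
  have b'int: "algebraic_int (b' j)" for j using N by (simp add: b'_def)
  let ?F = "{x. (\<forall>j<d. \<phi>' j x \<in> {0..<1}) \<and> (\<forall>i<d. B.Tr (b' i * x) \<in> \<int>)}"
  have finF: "finite ?F" using B.finite_integral_functional[of B.Tr 1] B.Tr_add B.Tr_one by simp
  obtain M where M: "M > (0::int)" "\<And>q. q \<in> (\<lambda>(j, x). \<phi>' j x) ` ({..<d} \<times> ?F) \<Longrightarrow> of_int M * q \<in> \<int>"
    using common_denominator[of "(\<lambda>(j, x). \<phi>' j x) ` ({..<d} \<times> ?F)"] finF by blast
  \<comment> \<open>Subtracting \<open>floor_part\<close> moves an algebraic integer into the finite
    set \<open>?F\<close> and changes its coordinates by integers only, so one \<open>M\<close>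
    serves all of them.\<close>
  have den: "of_int M * \<phi>' j x \<in> \<int>" if "algebraic_int x" "j < d" for x j
  proof -
    have "algebraic_int (B.floor_part x)"
      unfolding B.floor_part_def by (intro algebraic_int_sum algebraic_int_add_mult b'int) simp
    then have ai: "algebraic_int (x - B.floor_part x)" using that by (intro algebraic_int_diff)
    have "x - B.floor_part x \<in> ?F"
      using B.coord_frac_part[of _ x] B.Tr_algebraic_int algebraic_int_add_mult(2)[OF b'int ai] by blast
    then have "of_int M * \<phi>' j (x - B.floor_part x) \<in> \<int>"
      using that by (intro M(2) image_eqI[of _ _ "(j, x - B.floor_part x)"]) auto
    moreover have "of_int M * \<phi>' j x = of_int M * \<phi>' j (x - B.floor_part x) + of_int (M * \<lfloor>\<phi>' j x\<rfloor>)"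
      using that by (simp add: B.coord_diff B.coord_floor_part algebra_simps)
    ultimately show ?thesis by (metis Ints_add Ints_of_int)
  qed
  \<comment> \<open>Algebraic integers in the span of the basis vectors up to index
    \<open>j\<close>. The coordinate \<open>j\<close> takes values in the multiples of
    \<open>1 / M\<close> there, so a least positive value exists; division with remainder by it then
    yields generators.\<close>
  define Fl where "Fl j = {x. algebraic_int x \<and> (\<forall>i<d. i > j \<longrightarrow> \<phi>' i x = 0)}" for j :: nat
  have "\<exists>w. w \<in> Fl j \<and> \<phi>' j w > 0 \<and> (\<forall>x\<in>Fl j. \<phi>' j x > 0 \<longrightarrow> \<phi>' j w \<le> \<phi>' j x)" if "j < d" for j
  proof -
    let ?P = "\<lambda>x. x \<in> Fl j \<and> \<phi>' j x > 0"
    let ?m = "\<lambda>x. nat \<lfloor>of_int M * \<phi>' j x\<rfloor>"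
    have "?P (b' j)" using that b'int by (auto simp: Fl_def B.coord_basis)
    then have w: "?P (arg_min ?m ?P)" by (rule arg_min_natI[where P = ?P])
    have min: "?m (arg_min ?m ?P) \<le> ?m x" if "?P x" for x
      by (rule arg_min_nat_le[where P = ?P, OF that])
    have "\<phi>' j (arg_min ?m ?P) \<le> \<phi>' j x" if x: "?P x" for x
    proof -
      have fl: "of_int (int (?m y)) = of_int M * \<phi>' j y" if y: "?P y" for y
      proof -
        obtain k where k: "of_int M * \<phi>' j y = of_int k"
          using den[of y j] y \<open>j < d\<close> by (auto simp: Fl_def elim!: Ints_cases)
        moreover have "of_int M * \<phi>' j y > 0" using y M by simp
        ultimately show ?thesis by simp
      qed
      have "int (?m (arg_min ?m ?P)) \<le> int (?m x)" unfolding of_nat_le_iff by (rule min[OF x])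
      then have "(of_int (int (?m (arg_min ?m ?P))) :: rat) \<le> of_int (int (?m x))" by (simp only: of_int_le_iff)
      then have "of_int M * \<phi>' j (arg_min ?m ?P) \<le> of_int M * \<phi>' j x" by (simp only: fl[OF w] fl[OF x])
      then show ?thesis using M(1) by simp
    qed
    with w show ?thesis by blast
  qed
  then obtain w where w: "\<And>j. j < d \<Longrightarrow> w j \<in> Fl j" "\<And>j. j < d \<Longrightarrow> \<phi>' j (w j) > 0"
    "\<And>j x. j < d \<Longrightarrow> x \<in> Fl j \<Longrightarrow> \<phi>' j x > 0 \<Longrightarrow> \<phi>' j (w j) \<le> \<phi>' j x" by metis
  have gen: "\<exists>m :: nat \<Rightarrow> int. x = (\<Sum>j<n. of_int (m j) * w j)"
    if "n \<le> d" "algebraic_int x" "\<forall>i<d. i \<ge> n \<longrightarrow> \<phi>' i x = 0" for n x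
    using that
  proof (induction n arbitrary: x)
    case 0
    then have "x = 0" by (intro B.coord_eqI) (auto simp: B.coord_zero)
    then show ?case by simp
  next
    case (Suc n)
    then have n: "n < d" by simp
    define q where "q = \<phi>' n x / \<phi>' n (w n)"
    define y where "y = x - of_int \<lfloor>q\<rfloor> * w n"
    have wn: "algebraic_int (w n)" "\<And>i. i < d \<Longrightarrow> i > n \<Longrightarrow> \<phi>' i (w n) = 0"
      using w(1)[OF n] by (auto simp: Fl_def)
    have \<phi>y: "\<phi>' i y = \<phi>' i x - of_int \<lfloor>q\<rfloor> * \<phi>' i (w n)" if "i < d" for i
      using that B.coord_rat_linear[of i "of_int \<lfloor>q\<rfloor>" "w n"] by (simp add: y_def B.coord_diff)
    have yint: "algebraic_int y" unfolding y_def
      using Suc.prems wn(1) by (intro algebraic_int_diff algebraic_int_add_mult) auto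
    have yO: "\<phi>' i y = 0" if "i < d" "i > n" for i
      using Suc.prems wn(2) that by (simp add: \<phi>y)
    have "\<phi>' n y = (q - of_int \<lfloor>q\<rfloor>) * \<phi>' n (w n)"
      using n w(2)[OF n] by (simp add: \<phi>y q_def field_simps)
    moreover have "0 \<le> q - of_int \<lfloor>q\<rfloor>" "q - of_int \<lfloor>q\<rfloor> < 1" by linarith+
    ultimately have "0 \<le> \<phi>' n y" "\<phi>' n y < \<phi>' n (w n)" using w(2)[OF n] by auto
    moreover have "y \<in> Fl n" using yint yO by (simp add: Fl_def)
    ultimately have "\<phi>' n y = 0" using w(3)[OF n, of y] by force
    with yO have "\<forall>i<d. i \<ge> n \<longrightarrow> \<phi>' i y = 0" by (metis nless_le)
    from Suc.IH[OF _ yint this] n obtain m where m: "y = (\<Sum>j<n. of_int (m j) * w j)" by auto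
    have "x = y + of_int \<lfloor>q\<rfloor> * w n" by (simp add: y_def)
    also have "\<dots> = (\<Sum>j<Suc n. of_int ((m(n := \<lfloor>q\<rfloor>)) j) * w j)" using m by simp
    finally show ?case by blast
  qed
  have "\<exists>\<theta>. qbasis d w \<theta>"
  proof (rule qbasis_exI)
    fix x :: 'k
    obtain K where K: "K > (0::int)" "algebraic_int (of_int K * x)" using multiple_algebraic_int by blast
    obtain m :: "nat \<Rightarrow> int" where m: "of_int K * x = (\<Sum>j<d. of_int (m j) * w j)" using gen[of d, OF _ K(2)] by auto
    have "x = (\<Sum>j<d. of_int (m j) * w j) / of_int K" using K(1) m by (simp flip: m)
    also have "\<dots> = (\<Sum>j<d. of_rat (of_int (m j) / of_int K) * w j)"
      by (simp add: sum_divide_distrib of_rat_divide)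
    finally show "\<exists>q. x = (\<Sum>j<d. of_rat (q j) * w j)"
      by (intro exI[of _ "\<lambda>j. of_int (m j) / of_int K"])
  next
    fix q :: "nat \<Rightarrow> rat" and j
    assume q: "(\<Sum>j<d. of_rat (q j) * w j) = 0" and "j < d"
    \<comment> \<open>In the old coordinates the \<open>w j\<close> are triangular with positive
      diagonal, so the coefficients vanish from the top index downwards.\<close>
    have "\<forall>j<d. n \<le> j \<longrightarrow> q j = 0" if "n \<le> d" for n
      using that
    proof (induction rule: inc_induct)
      case base
      then show ?case by simp
    next
      case (step n)
      have "(\<Sum>j<d. of_rat (q j) * w j) = (\<Sum>j<Suc n. of_rat (q j) * w j)"
        using step by (intro sum.mono_neutral_right) (auto simp: not_less)
      then have "0 = \<phi>' n (\<Sum>j<Suc n. of_rat (q j) * w j)" using q step B.coord_zero by simp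
      also have "\<dots> = (\<Sum>j<Suc n. q j * \<phi>' n (w j))"
        using step by (simp add: B.coord_sum B.coord_rat_linear B.coord_add)
      also have "(\<Sum>j<n. q j * \<phi>' n (w j)) = 0"
        using step w(1) by (intro sum.neutral) (auto simp: Fl_def)
      then have "(\<Sum>j<Suc n. q j * \<phi>' n (w j)) = q n * \<phi>' n (w n)" by simp
      finally have "q n = 0" using w(2)[of n] step by simp
      then show ?case using step by (metis Suc_leI nless_le)
    qed
    from this[of 0] \<open>j < d\<close> show "q j = 0" by simp
  qed
  then obtain \<theta> where "qbasis d w \<theta>" by blast
  then interpret W: qbasis d w \<theta> .
  have "integral_basis d w \<theta>"
  proof
    fix x :: 'k
    show "algebraic_int x \<longleftrightarrow> (\<forall>j<d. \<theta> j x \<in> \<int>)"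
    proof
      assume "algebraic_int x"
      then obtain m :: "nat \<Rightarrow> int" where "x = (\<Sum>j<d. of_int (m j) * w j)" using gen[of d x] by auto
      then show "\<forall>j<d. \<theta> j x \<in> \<int>" using W.coord_combination[of _ "\<lambda>j. of_int (m j)"] by simp
    next
      assume "\<forall>j<d. \<theta> j x \<in> \<int>"
      then have "algebraic_int (of_rat (\<theta> j x) * w j)" if "j < d" for j
        using that w(1)[OF that] by (intro algebraic_int_add_mult) (auto simp: algebraic_int_of_rat_iff Fl_def)
      then have "algebraic_int (\<Sum>j<d. of_rat (\<theta> j x) * w j)" by (intro algebraic_int_sum) auto
      then show "algebraic_int x" using W.expand[of x] by simp
    qed
  qed
  then show ?thesis by blast
qed

section \<open>Ideals of the ring of integers\<close>

definition coset :: "'k::field_char_0 set \<Rightarrow> 'k \<Rightarrow> 'k set" where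
  "coset J x = (\<lambda>h. h + x) ` J"

definition nzideal :: "'k::field_char_0 set \<Rightarrow> bool" where
  "nzideal J \<longleftrightarrow> (\<forall>x\<in>J. algebraic_int x) \<and> 0 \<in> J \<and> (\<exists>x\<in>J. x \<noteq> 0) \<and> (\<forall>x\<in>J. \<forall>y\<in>J. x + y \<in> J)
     \<and> (\<forall>a. algebraic_int a \<longrightarrow> (\<forall>x\<in>J. a * x \<in> J))"

definition inv_ideal :: "'k::field_char_0 set \<Rightarrow> 'k set" where
  "inv_ideal J = {x. \<forall>y\<in>J. algebraic_int (x * y)}"

text \<open>The ideal of all denominators of \<gamma>, described without a representation as a
  quotient of ideals; it covers \<gamma> = 0 as well and turns out to be \<open>dnm\<close>.\<close>

definition denom :: "'k::field_char_0 \<Rightarrow> 'k set" where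
  "denom \<gamma> = {x. algebraic_int x \<and> algebraic_int (x * \<gamma>)}"

lemma nzidealD:
  assumes "nzideal J"
  shows "x \<in> J \<Longrightarrow> algebraic_int x" "0 \<in> J" "x \<in> J \<Longrightarrow> y \<in> J \<Longrightarrow> x + y \<in> J"
    "algebraic_int a \<Longrightarrow> x \<in> J \<Longrightarrow> a * x \<in> J" "x \<in> J \<Longrightarrow> - x \<in> J" "x \<in> J \<Longrightarrow> y \<in> J \<Longrightarrow> x - y \<in> J"
proof -
  show *: "x \<in> J \<Longrightarrow> algebraic_int x" "0 \<in> J" "x \<in> J \<Longrightarrow> y \<in> J \<Longrightarrow> x + y \<in> J"
    "algebraic_int a \<Longrightarrow> x \<in> J \<Longrightarrow> a * x \<in> J" for x y a
    using assms by (auto simp: nzideal_def)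
  show **: "x \<in> J \<Longrightarrow> - x \<in> J" for x using *(4)[of "-1" x] by simp
  show "x \<in> J \<Longrightarrow> y \<in> J \<Longrightarrow> x - y \<in> J" using *(3)[of x "- y"] **[of y] by simp
qed

lemma carrier_\<O> [simp]: "carrier \<O> = {x. algebraic_int x}"
  by (simp add: ring_of_integers_def)

lemma ring_\<O>_simps [simp]: "x \<oplus>\<^bsub>\<O>\<^esub> y = x + y" "x \<otimes>\<^bsub>\<O>\<^esub> y = x * y" "\<one>\<^bsub>\<O>\<^esub> = 1" "\<zero>\<^bsub>\<O>\<^esub> = 0"
  by (simp_all add: ring_of_integers_def)

lemma cring_\<O>: "cring (\<O> :: 'k::field_char_0 ring)"
proof (rule cringI)
  show "abelian_group (\<O> :: 'k ring)"
  proof (rule abelian_groupI)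
    show "\<exists>y\<in>carrier \<O>. y \<oplus>\<^bsub>\<O>\<^esub> x = \<zero>\<^bsub>\<O>\<^esub>" if "x \<in> carrier (\<O> :: 'k ring)" for x
      using that by (intro bexI[of _ "- x"]) auto
  qed (auto intro: algebraic_int_add_mult)
  show "Group.comm_monoid (\<O> :: 'k ring)"
    by (rule comm_monoidI) (auto intro: algebraic_int_add_mult)
qed (auto simp: distrib_right)

lemma ideal_\<O>_iff:
  "ideal J (\<O> :: 'k::field_char_0 ring) \<longleftrightarrow> (\<forall>x\<in>J. algebraic_int x) \<and> 0 \<in> J
     \<and> (\<forall>x\<in>J. \<forall>y\<in>J. x + y \<in> J) \<and> (\<forall>a. algebraic_int a \<longrightarrow> (\<forall>x\<in>J. a * x \<in> J))"
    (is "_ \<longleftrightarrow> ?R")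
proof
  assume "ideal J \<O>"
  then interpret ideal J "\<O> :: 'k ring" .
  have "J \<subseteq> carrier \<O>" by (rule a_subset)
  then have "\<forall>x\<in>J. algebraic_int x" by auto
  moreover have "x + y \<in> J" if "x \<in> J" "y \<in> J" for x y
    using additive_subgroup.a_closed[OF is_additive_subgroup that] by simp
  moreover have "a * x \<in> J" if "algebraic_int a" "x \<in> J" for a x
    using I_l_closed[OF that(2), of a] that(1) by simp
  moreover have "0 \<in> J" using additive_subgroup.zero_closed[OF is_additive_subgroup] by simp
  ultimately show ?R by simp
next
  assume R: ?R
  show "ideal J \<O>"
  proof (rule idealI)
    show "Ring.ring (\<O> :: 'k ring)" using cring_\<O> by (rule cring.axioms)
    show "subgroup J (add_monoid (\<O> :: 'k ring))"
    proof (rule group.subgroupI)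
      show "Group.group (add_monoid (\<O> :: 'k ring))"
        using cring_\<O> by (meson abelian_group.a_group cring_def ring_def)
      show "inv\<^bsub>add_monoid \<O>\<^esub> x \<in> J" if "x \<in> J" for x
      proof -
        interpret cring "\<O> :: 'k ring" by (rule cring_\<O>)
        have "\<ominus>\<^bsub>\<O>\<^esub> x = - x"
          using R that by (intro minus_equality) auto
        moreover have "- x \<in> J" using R that by (metis algebraic_int_1 algebraic_int_minus_iff mult_minus1)
        ultimately show ?thesis by (simp add: a_inv_def)
      qed
    qed (use R in auto)
    show "a \<otimes>\<^bsub>\<O>\<^esub> x \<in> J" if "a \<in> J" "x \<in> carrier \<O>" for a x
    proof -
      have "x * a \<in> J" using R that by auto
      then show ?thesis unfolding ring_\<O>_simps by (subst mult.commute)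
    qed
  qed (use R in auto)
qed

lemma integral_ideals_iff: "J \<in> integral_ideals \<longleftrightarrow> nzideal J"
  unfolding integral_ideals_def nzideal_def using ideal_\<O>_iff[of J] by auto

lemma coset_eq_iff: "nzideal J \<Longrightarrow> coset J x = coset J y \<longleftrightarrow> x - y \<in> J"
proof
  assume J: "nzideal J"
  { assume "coset J x = coset J y"
    moreover have "x \<in> coset J x" unfolding coset_def using nzidealD(2)[OF J] by (intro image_eqI[of _ _ 0]) auto
    ultimately obtain h where "h \<in> J" "x = h + y" by (auto simp: coset_def)
    then show "x - y \<in> J" by simp }
  { assume "x - y \<in> J"
    have *: "coset J x \<subseteq> coset J y" if "x - y \<in> J" for x y
    proof
      fix z assume "z \<in> coset J x"
      then obtain h where "h \<in> J" "z = h + x" by (auto simp: coset_def)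
      then show "z \<in> coset J y" unfolding coset_def
        using nzidealD(3)[OF J _ that] by (intro image_eqI[of _ _ "h + (x - y)"]) auto
    qed
    have "y - x \<in> J" using nzidealD(5)[OF J \<open>x - y \<in> J\<close>] by simp
    with * \<open>x - y \<in> J\<close> show "coset J x = coset J y" by blast }
qed

definition quo :: "'k::field_char_0 set \<Rightarrow> 'k set set" where
  "quo J = coset J ` {x. algebraic_int x}"

lemma carrier_Quot: "carrier (\<O> Quot J) = quo J"
  by (auto simp: FactRing_def A_RCOSETS_def' a_r_coset_def' quo_def coset_def)

lemma ideal_Nm_quo: "ideal_Nm J = card (quo J)"
  by (simp add: ideal_Nm_def carrier_Quot)

lemma ideal_\<Phi>_quo:
  assumes "nzideal J"
  shows "ideal_\<Phi> J = card (coset J ` {r. algebraic_int r \<and> (\<exists>s. algebraic_int s \<and> r * s - 1 \<in> J)})"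
proof -
  have id: "ideal J \<O>" using assms by (simp add: ideal_\<O>_iff nzideal_def)
  have co: "J +>\<^bsub>\<O>\<^esub> x = coset J x" for x
    by (auto simp: a_r_coset_def' coset_def)
  have mul: "coset J x \<otimes>\<^bsub>\<O> Quot J\<^esub> coset J y = coset J (x * y)" if "algebraic_int x" "algebraic_int y" for x y
    using ideal.rcoset_mult_add[OF id, of x y] that by (simp add: FactRing_def co)
  have one: "\<one>\<^bsub>\<O> Quot J\<^esub> = coset J 1" by (simp add: FactRing_def co)
  have "Units (\<O> Quot J) = coset J ` {r. algebraic_int r \<and> (\<exists>s. algebraic_int s \<and> r * s - 1 \<in> J)}"
  proof (intro equalityI subsetI)
    fix X assume "X \<in> Units (\<O> Quot J)"
    then obtain Y where XY: "X \<in> quo J" "Y \<in> quo J" "X \<otimes>\<^bsub>\<O> Quot J\<^esub> Y = \<one>\<^bsub>\<O> Quot J\<^esub>"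
      by (auto simp: Units_def carrier_Quot)
    then obtain r s where rs: "X = coset J r" "Y = coset J s" "algebraic_int r" "algebraic_int s"
      by (auto simp: quo_def)
    then have "r * s - 1 \<in> J" using XY(3) coset_eq_iff[OF assms] by (simp add: mul one)
    with rs show "X \<in> coset J ` {r. algebraic_int r \<and> (\<exists>s. algebraic_int s \<and> r * s - 1 \<in> J)}" by auto
  next
    fix X assume "X \<in> coset J ` {r. algebraic_int r \<and> (\<exists>s. algebraic_int s \<and> r * s - 1 \<in> J)}"
    then obtain r s where rs: "X = coset J r" "algebraic_int r" "algebraic_int s" "r * s - 1 \<in> J" by auto
    then have "X \<otimes>\<^bsub>\<O> Quot J\<^esub> coset J s = \<one>\<^bsub>\<O> Quot J\<^esub>" "coset J s \<otimes>\<^bsub>\<O> Quot J\<^esub> X = \<one>\<^bsub>\<O> Quot J\<^esub>"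
      using coset_eq_iff[OF assms] by (auto simp: mul one mult.commute)
    then show "X \<in> Units (\<O> Quot J)" using rs by (auto simp: Units_def carrier_Quot quo_def)
  qed
  then show ?thesis by (simp add: ideal_\<Phi>_def)
qed

lemma nzideal_Int: "nzideal J \<Longrightarrow> nzideal I \<Longrightarrow> nzideal (J \<inter> I)"
proof -
  assume J: "nzideal J" and I: "nzideal I"
  obtain x y where xy: "x \<in> J" "x \<noteq> 0" "y \<in> I" "y \<noteq> 0" using J I by (auto simp: nzideal_def)
  have "x * y \<in> J" using nzidealD(4)[OF J nzidealD(1)[OF I xy(3)] xy(1)] by (simp add: mult.commute)
  moreover have "x * y \<in> I" using nzidealD(4)[OF I nzidealD(1)[OF J xy(1)] xy(3)] .
  ultimately have "\<exists>z\<in>J \<inter> I. z \<noteq> 0" using xy by (intro bexI[of _ "x * y"]) auto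
  then show ?thesis using J I unfolding nzideal_def by blast
qed

definition ideal_sum :: "'k::field_char_0 set \<Rightarrow> 'k set \<Rightarrow> 'k set" where
  "ideal_sum J I = {x + y | x y. x \<in> J \<and> y \<in> I}"

lemma nzideal_ideal_sum: "nzideal J \<Longrightarrow> nzideal I \<Longrightarrow> nzideal (ideal_sum J I)"
proof -
  assume J: "nzideal J" and I: "nzideal I"
  have sub: "x \<in> ideal_sum J I" if "x \<in> J" for x
    using nzidealD(2)[OF I] that unfolding ideal_sum_def by (force intro: exI[of _ x] exI[of _ 0])
  show ?thesis unfolding nzideal_def
  proof (intro conjI ballI allI impI)
    show "algebraic_int x" if "x \<in> ideal_sum J I" for x
      using that nzidealD(1)[OF J] nzidealD(1)[OF I] by (auto simp: ideal_sum_def intro: algebraic_int_add_mult)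
    show "0 \<in> ideal_sum J I" using sub nzidealD(2)[OF J] by blast
    show "\<exists>x\<in>ideal_sum J I. x \<noteq> 0" using sub J by (auto simp: nzideal_def)
    show "x + y \<in> ideal_sum J I" if xy: "x \<in> ideal_sum J I" "y \<in> ideal_sum J I" for x y
    proof -
      obtain a b where 1: "x = a + b" "a \<in> J" "b \<in> I" using xy(1) by (auto simp: ideal_sum_def)
      obtain a' b' where 2: "y = a' + b'" "a' \<in> J" "b' \<in> I" using xy(2) by (auto simp: ideal_sum_def)
      have "x + y = (a + a') + (b + b')" using 1 2 by (simp add: algebra_simps)
      then show ?thesis using nzidealD(3)[OF J] nzidealD(3)[OF I] 1 2 unfolding ideal_sum_def by blast
    qed
    show "a * x \<in> ideal_sum J I" if "algebraic_int a" "x \<in> ideal_sum J I" for a x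
      using that nzidealD(4)[OF J] nzidealD(4)[OF I] unfolding ideal_sum_def by (force simp: distrib_left)
  qed
qed

section \<open>Fractional parts and finite residue rings\<close>

context integral_basis
begin

lemma floor_part_algebraic_int: "algebraic_int (floor_part x)"
  by (simp add: algebraic_int_iff_coords coord_floor_part)

lemma floor_part_add:
  assumes "algebraic_int a" shows "x + a - floor_part (x + a) = x - floor_part x"
proof (rule coord_eqI)
  fix j assume j: "j < d"
  have "\<phi> j a \<in> \<int>" using assms j by (simp add: algebraic_int_iff_coords)
  then obtain m where "\<phi> j a = of_int m" by (rule Ints_cases)
  then show "\<phi> j (x + a - floor_part (x + a)) = \<phi> j (x - floor_part x)"
    using j by (simp add: coord_add coord_diff coord_floor_part)
qed

definition cell :: "'k set" where "cell = {x. \<forall>j<d. \<phi> j x \<in> {0..<1}}"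

lemma frac_in_cell: "x - floor_part x \<in> cell"
  using coord_frac_part by (auto simp: cell_def)

lemma cell_eqI: "x \<in> cell \<Longrightarrow> y \<in> cell \<Longrightarrow> algebraic_int (x - y) \<Longrightarrow> x = y"
proof (rule coord_eqI)
  fix j assume j: "j < d" and *: "x \<in> cell" "y \<in> cell" "algebraic_int (x - y)"
  have "\<phi> j x - \<phi> j y \<in> \<int>" using * j by (auto simp: algebraic_int_iff_coords coord_diff)
  then obtain m where m: "\<phi> j x - \<phi> j y = of_int m" by (rule Ints_cases)
  have "-1 < \<phi> j x - \<phi> j y" "\<phi> j x - \<phi> j y < 1" using * j by (auto simp: cell_def) (fastforce+)
  then have "-1 < m" "m < 1" unfolding m by linarith+
  then show "\<phi> j x = \<phi> j y" using m by simp
qed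

lemma frac_of_cell: "x \<in> cell \<Longrightarrow> algebraic_int a \<Longrightarrow> x + a - floor_part (x + a) = x"
  using cell_eqI[OF frac_in_cell, of x "x + a"] floor_part_algebraic_int[of "x + a"]
  by (simp add: algebraic_int_diff)

lemma finite_cell_denominator: "finite {x \<in> cell. algebraic_int (of_int M * x)}" if "M > 0"
proof -
  define T where "T = (\<lambda>m. of_int m / of_int M :: rat) ` {0..M}"
  let ?S = "{x \<in> cell. algebraic_int (of_int M * x)}"
  let ?F = "\<lambda>x. \<lambda>i\<in>{..<d}. \<phi> i x"
  have "\<phi> i x \<in> T" if x: "x \<in> ?S" "i < d" for i x
  proof -
    have "\<phi> i (of_int M * x) = of_int M * \<phi> i x" using coord_rat_linear[of i "of_int M" x] x by simp
    then have "of_int M * \<phi> i x \<in> \<int>" using x by (auto simp: algebraic_int_iff_coords)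
    then obtain m where m: "of_int M * \<phi> i x = of_int m" by (rule Ints_cases)
    have b: "0 \<le> \<phi> i x" "\<phi> i x < 1" using x by (auto simp: cell_def)
    have "0 \<le> of_int M * \<phi> i x" "of_int M * \<phi> i x \<le> of_int M"
      using b \<open>M > 0\<close> by (auto intro: mult_left_le)
    then have "0 \<le> m" "m \<le> M" unfolding m by simp_all
    moreover have "\<phi> i x = of_int m / of_int M" using m \<open>M > 0\<close> by (simp add: field_simps)
    ultimately show ?thesis unfolding T_def by auto
  qed
  then have sub: "?F ` ?S \<subseteq> PiE {..<d} (\<lambda>_. T)" by (simp add: image_subset_iff restrict_PiE_iff)
  have "inj_on ?F ?S"
  proof (rule inj_onI, rule coord_eqI)
    fix x y j assume xy: "?F x = ?F y" and "j < d"
    then show "\<phi> j x = \<phi> j y" using xy by (metis lessThan_iff restrict_apply')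
  qed
  moreover have "finite (PiE {..<d} (\<lambda>_. T))" by (intro finite_PiE) (auto simp: T_def)
  ultimately show ?thesis using sub by (blast intro: inj_on_finite)
qed

text \<open>Some positive integer multiple of the inverse of a nonzero element of \<open>J\<close>
  is integral, and multiplying by the element gives the integer back.\<close>

lemma pos_int_in_ideal:
  assumes "nzideal (J :: 'k set)" shows "\<exists>M::int. M > 0 \<and> of_int M \<in> J"
proof -
  obtain a where a: "a \<in> J" "a \<noteq> 0" using assms by (auto simp: nzideal_def)
  obtain N where N: "N > (0::int)" "algebraic_int (of_int N * (1 / a))" using multiple_algebraic_int by blast
  have "of_int N * (1 / a) * a \<in> J" using nzidealD(4)[OF assms N(2) a(1)] .
  then show ?thesis using N a by auto
qed

text \<open>Reducing \<open>x / M\<close> to the cell, with an integer \<open>M\<close> in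
  \<open>J\<close>, changes \<open>x\<close> by a multiple of \<open>M\<close> and so by an element
  of \<open>J\<close>. Finitely many cell elements have denominator \<open>M\<close>.\<close>

lemma finite_quo: assumes "nzideal (J :: 'k set)" shows "finite (quo J)"
proof -
  obtain M where M: "M > (0::int)" "of_int M \<in> J" using pos_int_in_ideal[OF assms] by blast
  have "quo J \<subseteq> (\<lambda>x. coset J (of_int M * x)) ` {x \<in> cell. algebraic_int (of_int M * x)}"
  proof
    fix X assume "X \<in> quo J"
    then obtain x where x: "X = coset J x" "algebraic_int x" by (auto simp: quo_def)
    define y where "y = x / of_int M - floor_part (x / of_int M)"
    have e: "x - of_int M * y = of_int M * floor_part (x / of_int M)" using M by (simp add: y_def algebra_simps)
    have "x - of_int M * y \<in> J" unfolding e
      using nzidealD(4)[OF assms floor_part_algebraic_int M(2)] by (simp add: mult.commute)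
    then have "X = coset J (of_int M * y)" using x(1) coset_eq_iff[OF assms] by simp
    moreover have "y \<in> cell" unfolding y_def by (rule frac_in_cell)
    moreover have "algebraic_int (of_int M * y)"
      using algebraic_int_diff[OF x(2) nzidealD(1)[OF assms \<open>x - of_int M * y \<in> J\<close>]] by simp
    ultimately show "X \<in> (\<lambda>x. coset J (of_int M * x)) ` {x \<in> cell. algebraic_int (of_int M * x)}" by blast
  qed
  then show ?thesis using finite_cell_denominator[OF M(1)] finite_subset by blast
qed

lemma nzideal_principal: "M > 0 \<Longrightarrow> nzideal {x :: 'k. algebraic_int (x / of_int M)}" for M :: int
proof -
  assume M: "M > 0"
  have 1: "algebraic_int (of_int M * (x / of_int M))" if "algebraic_int (x / of_int M)" for x :: 'k
    using that by (intro algebraic_int_add_mult) auto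
  show ?thesis unfolding nzideal_def
  proof (intro conjI ballI allI impI)
    show "algebraic_int x" if "x \<in> {x :: 'k. algebraic_int (x / of_int M)}" for x using 1[of x] that M by simp
    show "\<exists>x\<in>{x :: 'k. algebraic_int (x / of_int M)}. x \<noteq> 0" using M by (intro bexI[of _ "of_int M"]) auto
    show "a * x \<in> {x :: 'k. algebraic_int (x / of_int M)}"
      if "algebraic_int a" "x \<in> {x :: 'k. algebraic_int (x / of_int M)}" for a x
      using algebraic_int_add_mult(2)[of a "x / of_int M"] that by simp
  qed (auto simp: add_divide_distrib intro: algebraic_int_add_mult)
qed

text \<open>
  In the finite ring \<open>\<O>/J\<close> localised at \<open>1 + J\<close> a minimal nonzero principal ideal is killed by
  \<open>J\<close>; a lift of its generator, divided by an integer of \<open>J\<close>, is the element we look for.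
\<close>

lemma proper_ideal_inverse_nontrivial:
  assumes J: "nzideal (J :: 'k set)" and proper: "1 \<notin> J"
  shows "\<exists>\<gamma>. \<not> algebraic_int \<gamma> \<and> (\<forall>x\<in>J. algebraic_int (\<gamma> * x))"
proof -
  obtain M where M: "M > (0::int)" "of_int M \<in> J" using pos_int_in_ideal[OF J] by blast
  let ?O = "{x :: 'k. algebraic_int x}"
  define I where "I = {x :: 'k. algebraic_int (x / of_int M)}"
  have I: "nzideal I" unfolding I_def by (rule nzideal_principal[OF M(1)])
  have IJ: "x \<in> J" if "x \<in> I" for x
    using nzidealD(4)[OF J, of "x / of_int M" "of_int M"] that M by (simp add: I_def)
  \<comment> \<open>The elements of the ring that die in the localisation at \<open>1 + J\<close>
    modulo \<open>M\<close>. That 1 is not among them is exactly the properness of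
    \<open>J\<close>.\<close>
  define N where "N = {x \<in> ?O. \<exists>j\<in>J. (1 - j) * x \<in> I}"
  have "1 \<notin> N"
  proof
    assume "1 \<in> N"
    then obtain j where j: "j \<in> J" "1 - j \<in> I" by (auto simp: N_def)
    then have "(1 - j) + j \<in> J" using IJ nzidealD(3)[OF J] by blast
    with proper show False by simp
  qed
  define P where "P b = coset I ` (\<lambda>r. b * r) ` ?O" for b
  have finP: "finite (P b)" if "algebraic_int b" for b
  proof (rule finite_subset[OF _ finite_quo[OF I]])
    show "P b \<subseteq> quo I" using that unfolding P_def quo_def by (auto intro: algebraic_int_add_mult)
  qed
  \<comment> \<open>Outside \<open>N\<close>, with the smallest principal ideal modulo
    \<open>I\<close>. If \<open>b * x\<close> with \<open>x\<close> in \<open>J\<close> were outside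
    \<open>N\<close> too, its ideal could not be smaller, so \<open>b\<close> would be congruent to
    a multiple of \<open>b * x\<close> and would be killed by some \<open>1 - r * x\<close>.\<close>
  define b where "b = arg_min (\<lambda>b. card (P b)) (\<lambda>b. algebraic_int b \<and> b \<notin> N)"
  have b: "algebraic_int b" "b \<notin> N"
    using arg_min_natI[of "\<lambda>b. algebraic_int b \<and> b \<notin> N" 1 "\<lambda>b. card (P b)"] \<open>1 \<notin> N\<close>
    by (auto simp: b_def)
  have bmin: "card (P b) \<le> card (P c)" if "algebraic_int c" "c \<notin> N" for c
    unfolding b_def using arg_min_nat_le[of "\<lambda>b. algebraic_int b \<and> b \<notin> N" c "\<lambda>b. card (P b)"] that by simp
  have bx: "b * x \<in> N" if x: "x \<in> J" for x
  proof (rule ccontr)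
    assume n: "b * x \<notin> N"
    have xi: "algebraic_int x" using nzidealD(1)[OF J x] .
    have sub: "P (b * x) \<subseteq> P b"
    proof
      fix X assume "X \<in> P (b * x)"
      then obtain r where "algebraic_int r" "X = coset I (b * x * r)" by (auto simp: P_def)
      then show "X \<in> P b" unfolding P_def using xi
        by (auto simp: mult.assoc intro!: imageI image_eqI[of _ _ "x * r"] algebraic_int_add_mult)
    qed
    have "card (P b) \<le> card (P (b * x))" using n b xi by (intro bmin algebraic_int_add_mult)
    then have "P (b * x) = P b" using sub finP[OF b(1)] by (simp add: card_seteq)
    moreover have "coset I b \<in> P b" unfolding P_def by (auto intro!: imageI image_eqI[of _ _ 1])
    ultimately have "coset I b \<in> P (b * x)" by simp
    then obtain r where r: "algebraic_int r" "coset I b = coset I (b * x * r)" by (auto simp: P_def)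
    have "b - b * x * r \<in> I" using r coset_eq_iff[OF I] by simp
    then have "(1 - r * x) * b \<in> I" by (simp add: algebra_simps)
    moreover have "r * x \<in> J" using nzidealD(4)[OF J r(1) x] .
    ultimately have "b \<in> N" using b(1) by (auto simp: N_def)
    with b show False by simp
  qed
  \<comment> \<open>Each \<open>x\<close> has its own multiplier \<open>1 - j\<close>; since
    \<open>(1 - j) * (1 - i) = 1 - ?k\<close> with \<open>?k\<close> in \<open>J\<close>, finitely
    many of them combine into one of the same form.\<close>
  have fin: "\<exists>j\<in>J. \<forall>x\<in>X. (1 - j) * (b * x) \<in> I" if "finite X" "X \<subseteq> J" for X
    using that
  proof (induction X rule: finite_induct)
    case empty
    then show ?case using nzidealD(2)[OF J] by auto
  next
    case (insert x X)
    then obtain j where j: "j \<in> J" "\<forall>x\<in>X. (1 - j) * (b * x) \<in> I" by auto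
    obtain i where i: "i \<in> J" "(1 - i) * (b * x) \<in> I" using bx[of x] insert.prems by (auto simp: N_def)
    let ?k = "j + i - j * i"
    have ji: "algebraic_int (1 - j)" "algebraic_int (1 - i)"
      using nzidealD(1)[OF J j(1)] nzidealD(1)[OF J i(1)] by (auto intro: algebraic_int_diff)
    have k: "(1 - ?k) * (b * y) = (1 - j) * ((1 - i) * (b * y))" "(1 - ?k) * (b * y) = (1 - i) * ((1 - j) * (b * y))"
      for y by (simp_all add: algebra_simps)
    have "?k \<in> J" using i j nzidealD(4)[OF J nzidealD(1)[OF J j(1)] i(1)]
      by (intro nzidealD(6)[OF J] nzidealD(3)[OF J])
    moreover have "(1 - ?k) * (b * y) \<in> I" if "y \<in> insert x X" for y
    proof (cases "y = x")
      case True
      then show ?thesis unfolding k(1) using nzidealD(4)[OF I ji(1) i(2)] by simp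
    next
      case False
      then show ?thesis unfolding k(2) using nzidealD(4)[OF I ji(2)] j(2) that by auto
    qed
    ultimately show ?case by blast
  qed
  \<comment> \<open>Being killed is a condition modulo \<open>I\<close>, and \<open>J\<close> has
    finitely many classes there, so a single \<open>j\<close> works for all of
    \<open>J\<close>.\<close>
  have "finite (coset I ` J)"
    by (rule finite_subset[OF _ finite_quo[OF I]]) (auto simp: quo_def nzidealD(1)[OF J])
  then obtain X where X: "finite X" "X \<subseteq> J" "coset I ` X = coset I ` J"
    by (metis finite_subset_image order_refl)
  obtain j where j: "j \<in> J" "\<forall>x\<in>X. (1 - j) * (b * x) \<in> I" using fin[OF X(1,2)] by blast
  have jb: "algebraic_int ((1 - j) * b)"
    using nzidealD(1)[OF J j(1)] b(1) by (intro algebraic_int_add_mult algebraic_int_diff) auto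
  have kill: "(1 - j) * b * x \<in> I" if x: "x \<in> J" for x
  proof -
    obtain y where y: "y \<in> X" "coset I x = coset I y" using X(3) x by (metis imageE imageI)
    then have "x - y \<in> I" using coset_eq_iff[OF I] by simp
    from nzidealD(3)[OF I nzidealD(4)[OF I jb this]] j(2) y(1)
    have "(1 - j) * b * (x - y) + (1 - j) * (b * y) \<in> I" by blast
    then show ?thesis by (simp add: algebra_simps)
  qed
  show ?thesis
  proof (intro exI[of _ "(1 - j) * b / of_int M"] conjI ballI)
    show "\<not> algebraic_int ((1 - j) * b / of_int M)"
      using b j(1) by (auto simp: N_def I_def)
    show "algebraic_int ((1 - j) * b / of_int M * x)" if "x \<in> J" for x
      using kill[OF that] by (simp add: I_def)
  qed
qed

section \<open>Invertibility of ideals and the denominator of a field element\<close>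

lemma inv_ideal_mult:
  assumes "x \<in> inv_ideal J" "algebraic_int a" shows "a * x \<in> inv_ideal (J :: 'k set)"
  unfolding inv_ideal_def
proof (intro CollectI ballI)
  fix y assume "y \<in> J"
  then have "algebraic_int (x * y)" using assms(1) by (simp add: inv_ideal_def)
  then show "algebraic_int (a * x * y)" using algebraic_int_add_mult(2)[OF assms(2)] by (simp add: mult.assoc)
qed

lemma inv_ideal_diff: "x \<in> inv_ideal J \<Longrightarrow> y \<in> inv_ideal J \<Longrightarrow> x - y \<in> inv_ideal (J :: 'k set)"
  by (auto simp: inv_ideal_def left_diff_distrib intro: algebraic_int_diff)

lemma inv_ideal_add: "x \<in> inv_ideal J \<Longrightarrow> y \<in> inv_ideal J \<Longrightarrow> x + y \<in> inv_ideal (J :: 'k set)"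
  by (auto simp: inv_ideal_def distrib_right intro: algebraic_int_add_mult)

lemma algebraic_int_in_inv_ideal: "nzideal J \<Longrightarrow> algebraic_int x \<Longrightarrow> x \<in> inv_ideal (J :: 'k set)"
  using nzidealD by (auto simp: inv_ideal_def intro: algebraic_int_add_mult)

text \<open>The inverse of \<open>J\<close> is a finitely generated group: the basis generates the
  algebraic integers in it, and it meets the cell in a finite set because an integer of
  \<open>J\<close> clears all its denominators. The stability criterion then applies.\<close>

lemma stabilizer_of_inv_ideal_integral:
  assumes J: "nzideal (J :: 'k set)" and st: "\<And>x. x \<in> inv_ideal J \<Longrightarrow> \<gamma> * x \<in> inv_ideal J"
  shows "algebraic_int \<gamma>"
proof -
  obtain M where M: "M > (0::int)" "of_int M \<in> J" using pos_int_in_ideal[OF J] by blast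
  define S where "S = {x \<in> inv_ideal J. x \<in> cell} \<union> b ` {..<d}"
  have bint: "algebraic_int (b i)" if "i < d" for i
    using that by (simp add: algebraic_int_iff_coords coord_basis)
  have "{x \<in> inv_ideal J. x \<in> cell} \<subseteq> {x \<in> cell. algebraic_int (of_int M * x)}"
    using M(2) by (auto simp: inv_ideal_def mult.commute)
  then have fin: "finite S"
    unfolding S_def using finite_cell_denominator[OF M(1)] finite_subset by blast
  obtain i where i: "i < d" "b i \<noteq> 0" using b_nonzero by blast
  then have nz: "\<not> S \<subseteq> {0}" by (auto simp: S_def)
  have gen: "x \<in> zmod.span S" if x: "x \<in> inv_ideal J" for x
  proof -
    have fl: "floor_part x \<in> inv_ideal J" using algebraic_int_in_inv_ideal[OF J floor_part_algebraic_int] .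
    have "x - floor_part x \<in> zmod.span S"
      using inv_ideal_diff[OF x fl] frac_in_cell[of x] by (intro zmod.span_base) (simp add: S_def)
    moreover have "floor_part x \<in> zmod.span S"
      unfolding floor_part_def by (intro zmod.span_sum zmod.span_scale zmod.span_base) (simp add: S_def)
    ultimately have "x - floor_part x + floor_part x \<in> zmod.span S" by (rule zmod.span_add)
    then show ?thesis by simp
  qed
  have "s \<in> inv_ideal J" if "s \<in> S" for s
    using that algebraic_int_in_inv_ideal[OF J] bint by (auto simp: S_def)
  then show ?thesis using algebraic_int_if_stable[OF fin nz] gen st by blast
qed

text \<open>If \<open>J\<close> times its inverse were a proper ideal, some non-integral \<gamma>
  would multiply it into the integers. Such a \<gamma> maps the inverse of \<open>J\<close> into
  itself and is therefore integral, a contradiction.\<close>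

theorem ideal_invertible:
  assumes J: "nzideal (J :: 'k set)"
  shows "1 \<in> zmod.span {y * x | x y. y \<in> J \<and> x \<in> inv_ideal J}"
proof (rule ccontr)
  let ?G = "{y * x | x y. y \<in> J \<and> x \<in> inv_ideal J}"
  let ?P = "zmod.span ?G"
  assume one: "1 \<notin> ?P"
  have J1: "1 \<in> inv_ideal J" by (rule algebraic_int_in_inv_ideal[OF J]) simp
  have "nzideal ?P" unfolding nzideal_def
  proof (intro conjI ballI allI impI)
    show "algebraic_int z" if "z \<in> ?P" for z
      using that
    proof (induction rule: zmod.span_induct_alt)
      case (step c x y)
      then have "algebraic_int x" by (auto simp: inv_ideal_def mult.commute)
      then show ?case using step by (intro algebraic_int_add_mult) auto
    qed simp
    show "0 \<in> ?P" by (rule zmod.span_zero)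
    obtain x where x: "x \<in> J" "x \<noteq> 0" using J by (auto simp: nzideal_def)
    have "x \<in> ?P" using J1 x(1) by (intro zmod.span_base CollectI exI[of _ 1] exI[of _ x]) simp
    then show "\<exists>x\<in>?P. x \<noteq> 0" using x by blast
    show "x + y \<in> ?P" if "x \<in> ?P" "y \<in> ?P" for x y using that by (rule zmod.span_add)
    show "a * x \<in> ?P" if "algebraic_int a" "x \<in> ?P" for a x
    proof (rule zspan_mult_closed[OF _ that(2)])
      fix s assume "s \<in> ?G"
      then obtain x y where s: "s = y * x" "y \<in> J" "x \<in> inv_ideal J" by blast
      have "a * s = (a * y) * x" using s by simp
      then show "a * s \<in> ?P" using s nzidealD(4)[OF J that(1)] by (intro zmod.span_base) blast
    qed
  qed
  from proper_ideal_inverse_nontrivial[OF this one] obtain \<gamma>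
    where \<gamma>: "\<not> algebraic_int \<gamma>" "\<And>z. z \<in> ?P \<Longrightarrow> algebraic_int (\<gamma> * z)" by blast
  have "algebraic_int \<gamma>"
  proof (rule stabilizer_of_inv_ideal_integral[OF J])
    fix x assume x: "x \<in> inv_ideal J"
    show "\<gamma> * x \<in> inv_ideal J" unfolding inv_ideal_def
    proof (intro CollectI ballI)
      fix y assume y: "y \<in> J"
      have "y * x \<in> ?P" using x y by (intro zmod.span_base) blast
      from \<gamma>(2)[OF this] show "algebraic_int (\<gamma> * x * y)" by (simp add: mult_ac)
    qed
  qed
  with \<gamma>(1) show False by simp
qed

lemma nzideal_denom: "nzideal (denom (\<gamma> :: 'k))"
  unfolding nzideal_def
proof (intro conjI ballI allI impI)
  obtain N where N: "N > (0::int)" "algebraic_int (of_int N * \<gamma>)" using multiple_algebraic_int by blast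
  then show "\<exists>x\<in>denom \<gamma>. x \<noteq> 0" by (intro bexI[of _ "of_int N"]) (auto simp: denom_def)
  show "a * x \<in> denom \<gamma>" if "algebraic_int a" "x \<in> denom \<gamma>" for a x
    using that algebraic_int_add_mult(2)[of a x] algebraic_int_add_mult(2)[of a "x * \<gamma>"]
    by (simp add: denom_def mult.assoc)
qed (auto simp: denom_def distrib_right intro: algebraic_int_add_mult)

text \<open>The module generated by 1 and \<gamma>, scaled by \<open>N\<close>, is an ideal
  \<open>J\<close> and hence invertible. The inverse of \<open>J\<close>, scaled by
  \<open>N\<close>, lies in \<open>denom \<gamma>\<close>, and an expansion of 1 separates into
  terms with and without a factor \<gamma>.\<close>

lemma denom_coprime: "\<exists>y\<in>denom \<gamma>. \<exists>z\<in>denom \<gamma>. \<gamma> * y + z = (1 :: 'k)"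
proof -
  obtain N where N: "N > (0::int)" "algebraic_int (of_int N * \<gamma>)" using multiple_algebraic_int by blast
  define J where "J = {of_int N * (u + v * \<gamma>) | u v. algebraic_int u \<and> algebraic_int v}"
  have inJ: "of_int N \<in> J" "of_int N * \<gamma> \<in> J" unfolding J_def
    by (intro CollectI exI[of _ 1] exI[of _ 0], simp) (intro CollectI exI[of _ 0] exI[of _ 1], simp)
  have J: "nzideal J" unfolding nzideal_def
  proof (intro conjI ballI allI impI)
    show "algebraic_int x" if "x \<in> J" for x
    proof -
      obtain u v where "x = of_int N * (u + v * \<gamma>)" "algebraic_int u" "algebraic_int v"
        using \<open>x \<in> J\<close> by (auto simp: J_def)
      moreover have "of_int N * (u + v * \<gamma>) = of_int N * u + v * (of_int N * \<gamma>)" by (simp add: algebra_simps)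
      ultimately show ?thesis using N by (metis algebraic_int_add_mult algebraic_int_of_int)
    qed
    show "0 \<in> J" unfolding J_def by (intro CollectI exI[of _ 0]) simp
    show "\<exists>x\<in>J. x \<noteq> 0" using N(1) inJ(1) by (intro bexI[of _ "of_int N"]) auto
    show "x + y \<in> J" if xy: "x \<in> J" "y \<in> J" for x y
    proof -
      obtain u v where 1: "x = of_int N * (u + v * \<gamma>)" "algebraic_int u" "algebraic_int v"
        using xy by (auto simp: J_def)
      obtain u' v' where 2: "y = of_int N * (u' + v' * \<gamma>)" "algebraic_int u'" "algebraic_int v'"
        using xy by (auto simp: J_def)
      have "x + y = of_int N * ((u + u') + (v + v') * \<gamma>)" using 1 2 by (simp add: algebra_simps)
      then show ?thesis unfolding J_def using 1 2 algebraic_int_add_mult by blast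
    qed
    show "a * x \<in> J" if ax: "algebraic_int a" "x \<in> J" for a x
    proof -
      obtain u v where 1: "x = of_int N * (u + v * \<gamma>)" "algebraic_int u" "algebraic_int v"
        using ax by (auto simp: J_def)
      have "a * x = of_int N * (a * u + (a * v) * \<gamma>)" using 1 by (simp add: algebra_simps)
      then show ?thesis unfolding J_def using 1 ax algebraic_int_add_mult by blast
    qed
  qed
  let ?Q = "{\<gamma> * y + z | y z. y \<in> denom \<gamma> \<and> z \<in> denom \<gamma>}"
  note D = nzidealD[OF nzideal_denom[of \<gamma>]]
  have "w \<in> ?Q" if "w \<in> zmod.span {y * x | x y. y \<in> J \<and> x \<in> inv_ideal J}" for w
    using that
  proof (induction rule: zmod.span_induct_alt)
    case base
    show ?case using D(2) by (intro CollectI exI[of _ 0]) simp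
  next
    case (step c g w)
    obtain x y where xy: "g = y * x" "y \<in> J" "x \<in> inv_ideal J" using step(1) by blast
    obtain u v where uv: "y = of_int N * (u + v * \<gamma>)" "algebraic_int u" "algebraic_int v"
      using xy by (auto simp: J_def)
    have "of_int N * x \<in> denom \<gamma>"
      using xy(3) inJ by (auto simp: inv_ideal_def denom_def mult_ac)
    then have uvx: "u * (of_int N * x) \<in> denom \<gamma>" "v * (of_int N * x) \<in> denom \<gamma>"
      using D(4) uv by blast+
    obtain y' z' where w: "w = \<gamma> * y' + z'" "y' \<in> denom \<gamma>" "z' \<in> denom \<gamma>" using step(2) by blast
    have "of_int c * g + w = \<gamma> * (of_int c * (v * (of_int N * x)) + y') + (of_int c * (u * (of_int N * x)) + z')"
      using xy uv w by (simp add: algebra_simps)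
    moreover have "of_int c * (v * (of_int N * x)) + y' \<in> denom \<gamma>" "of_int c * (u * (of_int N * x)) + z' \<in> denom \<gamma>"
      using uvx w by (auto intro!: D(3) D(4))
    ultimately show ?case by blast
  qed
  from this[OF ideal_invertible[OF J]] obtain y z where "1 = \<gamma> * y + z" "y \<in> denom \<gamma>" "z \<in> denom \<gamma>" by blast
  then show ?thesis by metis
qed

text \<open>The identity for 1 writes \<open>x\<close> as \<open>(x * \<gamma>) * y + x * z\<close>,
  which lies in \<open>n\<close> as soon as \<open>x * \<gamma>\<close> is integral.\<close>

lemma denom_eqI:
  assumes n: "nzideal n" and int: "\<And>x. x \<in> n \<Longrightarrow> algebraic_int (\<gamma> * x)"
    and yz: "y \<in> n" "z \<in> n" "\<gamma> * y + z = (1 :: 'k)"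
  shows "denom \<gamma> = n"
proof (intro equalityI subsetI)
  show "x \<in> denom \<gamma>" if "x \<in> n" for x
    using int[OF that] nzidealD(1)[OF n that] by (simp add: denom_def mult.commute)
  show "x \<in> n" if "x \<in> denom \<gamma>" for x
  proof -
    have "x = (x * \<gamma>) * y + x * z" using arg_cong[OF yz(3), of "\<lambda>w. x * w"] by (simp add: algebra_simps)
    moreover have "(x * \<gamma>) * y + x * z \<in> n"
      using that yz by (intro nzidealD(3)[OF n] nzidealD(4)[OF n]) (auto simp: denom_def)
    ultimately show ?thesis by simp
  qed
qed

text \<open>Existence of the coprime representation comes from \<open>denom_coprime\<close> and its
  uniqueness from \<open>denom_eqI\<close>; at 0 both sides are the whole ring, by the convention in
  \<open>dnm\<close>.\<close>

theorem dnm_eq_denom: "dnm \<gamma> = denom (\<gamma> :: 'k)"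
proof (cases "\<gamma> = 0")
  case True
  then show ?thesis by (simp add: dnm_def denom_def)
next
  case False
  let ?P = "\<lambda>\<nn>. \<nn> \<in> integral_ideals \<and>
        (\<exists>\<aa>\<in>integral_ideals. coprime_ideals \<aa> \<nn> \<and> (\<lambda>x. \<gamma> * x) ` \<nn> = \<aa>)"
  note D = nzidealD[OF nzideal_denom[of \<gamma>]]
  have "(THE \<nn>. ?P \<nn>) = denom \<gamma>"
  proof (rule the_equality)
    let ?a = "(\<lambda>x. \<gamma> * x) ` denom \<gamma>"
    have "nzideal ?a" unfolding nzideal_def
    proof (intro conjI ballI allI impI)
      show "algebraic_int x" if "x \<in> ?a" for x using that by (auto simp: denom_def mult.commute)
      show "0 \<in> ?a" using D(2) by (intro image_eqI[of _ _ 0]) auto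
      show "\<exists>x\<in>?a. x \<noteq> 0" using nzideal_denom[of \<gamma>] False by (auto simp: nzideal_def)
      show "x + y \<in> ?a" if "x \<in> ?a" "y \<in> ?a" for x y
        using that D(3) by (auto simp: distrib_left[symmetric] intro!: imageI)
      show "c * x \<in> ?a" if "algebraic_int c" "x \<in> ?a" for c x
        using that D(4) by (auto simp: mult.left_commute[of c] intro!: imageI)
    qed
    moreover have "coprime_ideals ?a (denom \<gamma>)"
    proof -
      obtain y z where yz: "y \<in> denom \<gamma>" "z \<in> denom \<gamma>" "\<gamma> * y + z = 1" using denom_coprime by blast
      have "x \<in> ?a <+>\<^bsub>\<O>\<^esub> denom \<gamma>" if "algebraic_int x" for x
      proof -
        have "x = \<gamma> * (x * y) + x * z" using arg_cong[OF yz(3), of "\<lambda>w. x * w"] by (simp add: algebra_simps)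
        moreover have "x * y \<in> denom \<gamma>" "x * z \<in> denom \<gamma>" using that yz D(4) by auto
        ultimately show ?thesis by (auto simp: set_add_def')
      qed
      moreover have "algebraic_int x" if "x \<in> ?a <+>\<^bsub>\<O>\<^esub> denom \<gamma>" for x
        using that by (auto simp: set_add_def' denom_def mult.commute intro!: algebraic_int_add_mult(1))
      ultimately show ?thesis by (auto simp: coprime_ideals_def)
    qed
    ultimately show "?P (denom \<gamma>)" using nzideal_denom by (auto simp: integral_ideals_iff)
  next
    fix n assume n: "?P n"
    then have nz: "nzideal n" "nzideal ((\<lambda>x. \<gamma> * x) ` n)" "coprime_ideals ((\<lambda>x. \<gamma> * x) ` n) n"
      by (auto simp: integral_ideals_iff)
    have "1 \<in> (\<lambda>x. \<gamma> * x) ` n <+>\<^bsub>\<O>\<^esub> n" using nz(3) by (simp add: coprime_ideals_def)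
    then obtain y z where "y \<in> n" "z \<in> n" "\<gamma> * y + z = 1" by (auto simp: set_add_def')
    then show "n = denom \<gamma>" using denom_eqI[OF nz(1), of \<gamma> y z] nzidealD(1)[OF nz(2)] by auto
  qed
  then show ?thesis using False by (simp add: dnm_def)
qed

text \<open>An ideal above \<open>J\<close> is determined by its image in the finite quotient by
  \<open>J\<close>.\<close>

lemma finite_ideals_above: "finite {I. nzideal I \<and> J \<subseteq> I}" if J: "nzideal (J :: 'k set)"
proof (rule inj_on_finite)
  show "finite (Pow (quo J))" using finite_quo[OF J] by simp
  show "(\<lambda>I. coset J ` I) ` {I. nzideal I \<and> J \<subseteq> I} \<subseteq> Pow (quo J)"
    using nzidealD(1) by (auto simp: quo_def)
  show "inj_on (\<lambda>I. coset J ` I) {I. nzideal I \<and> J \<subseteq> I}"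
  proof (rule inj_onI)
    have *: "I \<subseteq> I'" if "nzideal I" "nzideal I'" "J \<subseteq> I'" "coset J ` I = coset J ` I'" for I I'
    proof
      fix x assume "x \<in> I"
      then have "coset J x \<in> coset J ` I'" using that(4) by blast
      then obtain y where y: "y \<in> I'" "coset J x = coset J y" by blast
      then have "x - y \<in> I'" using coset_eq_iff[OF J] that by auto
      from nzidealD(3)[OF that(2) this y(1)] show "x \<in> I'" by simp
    qed
    show "I = I'" if "I \<in> {I. nzideal I \<and> J \<subseteq> I}" "I' \<in> {I. nzideal I \<and> J \<subseteq> I}"
      "coset J ` I = coset J ` I'" for I I'
      using *[of I I'] *[of I' I] that by blast
  qed
qed

section \<open>Every nonzero ideal is the denominator of some element\<close>

definition maximal_nzideal :: "'k set \<Rightarrow> bool" where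
  "maximal_nzideal p \<longleftrightarrow> nzideal p \<and> 1 \<notin> p \<and> (\<forall>I. nzideal I \<longrightarrow> p \<subseteq> I \<longrightarrow> 1 \<notin> I \<longrightarrow> I = p)"

lemma maximal_ideal_exists:
  assumes J: "nzideal J" "1 \<notin> J" shows "\<exists>p. maximal_nzideal p \<and> J \<subseteq> p"
proof -
  let ?S = "{I. nzideal I \<and> J \<subseteq> I \<and> 1 \<notin> I}"
  have "finite ?S" using finite_ideals_above[OF J(1)] by (rule finite_subset[rotated]) auto
  moreover have "J \<in> ?S" using J by simp
  ultimately obtain p where p: "p \<in> ?S" "\<forall>I\<in>?S. p \<subseteq> I \<longrightarrow> p = I"
    using finite_has_maximal2[of ?S J] by auto
  then show ?thesis unfolding maximal_nzideal_def by blast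
qed

lemma maximal_ideal_inverse:
  assumes p: "maximal_nzideal p" and r: "algebraic_int r" "r \<notin> p"
  shows "\<exists>s. algebraic_int s \<and> r * s - 1 \<in> p"
proof -
  have pz: "nzideal p" using p by (simp add: maximal_nzideal_def)
  define I where "I = {x + r * s | x s. x \<in> p \<and> algebraic_int s}"
  have pI: "p \<subseteq> I" unfolding I_def by (force intro: exI[of _ 0])
  have "nzideal I" unfolding nzideal_def
  proof (intro conjI ballI allI impI)
    show "algebraic_int x" if "x \<in> I" for x
      using that r(1) nzidealD(1)[OF pz] by (auto simp: I_def intro!: algebraic_int_add_mult)
    show "0 \<in> I" using pI nzidealD(2)[OF pz] by blast
    show "\<exists>x\<in>I. x \<noteq> 0" using pI pz by (auto simp: nzideal_def)
    show "x + y \<in> I" if xy: "x \<in> I" "y \<in> I" for x y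
    proof -
      obtain u s where 1: "x = u + r * s" "u \<in> p" "algebraic_int s" using xy by (auto simp: I_def)
      obtain u' s' where 2: "y = u' + r * s'" "u' \<in> p" "algebraic_int s'" using xy by (auto simp: I_def)
      have "x + y = (u + u') + r * (s + s')" using 1 2 by (simp add: algebra_simps)
      then show ?thesis unfolding I_def using 1 2 nzidealD(3)[OF pz] algebraic_int_add_mult by blast
    qed
    show "a * x \<in> I" if ax: "algebraic_int a" "x \<in> I" for a x
    proof -
      obtain u s where 1: "x = u + r * s" "u \<in> p" "algebraic_int s" using ax by (auto simp: I_def)
      have "a * x = a * u + r * (a * s)" using 1 by (simp add: algebra_simps)
      then show ?thesis unfolding I_def using 1 ax nzidealD(4)[OF pz] algebraic_int_add_mult by blast
    qed
  qed
  moreover have "r \<in> I" unfolding I_def using nzidealD(2)[OF pz] by (intro CollectI exI[of _ 0] exI[of _ 1]) simp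
  then have "I \<noteq> p" using r(2) by blast
  ultimately have "1 \<in> I" using p pI unfolding maximal_nzideal_def by blast
  then obtain x s where xs: "1 = x + r * s" "x \<in> p" "algebraic_int s" by (auto simp: I_def)
  then have "r * s - 1 = - x" by (simp add: algebra_simps)
  then show ?thesis using xs nzidealD(5)[OF pz] by auto
qed

lemma maximal_ideal_prime:
  assumes p: "maximal_nzideal p" and r: "algebraic_int r" "r \<notin> p" and x: "algebraic_int x" "r * x \<in> p"
  shows "x \<in> p"
proof -
  have pz: "nzideal p" using p by (simp add: maximal_nzideal_def)
  obtain s where s: "algebraic_int s" "r * s - 1 \<in> p" using maximal_ideal_inverse[OF p r] by blast
  have "s * (r * x) - x * (r * s - 1) \<in> p"
    using nzidealD(6)[OF pz nzidealD(4)[OF pz s(1) x(2)] nzidealD(4)[OF pz x(1) s(2)]] .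
  then show ?thesis by (simp add: algebra_simps)
qed

text \<open>If \<gamma> fails at the new ideal \<open>p\<close>, it is corrected by
  \<open>e * \<delta>\<close>: invertibility provides a \<delta> that works at \<open>p\<close>, and
  \<open>e\<close> lies in all earlier ideals but not in \<open>p\<close>, so that what was reached
  before is kept.\<close>

lemma generic_element_of_inverse:
  assumes n: "nzideal (n :: 'k set)"
  shows "finite S \<Longrightarrow> (\<And>p. p \<in> S \<Longrightarrow> maximal_nzideal p) \<Longrightarrow>
    \<exists>\<gamma>\<in>inv_ideal n. \<forall>p\<in>S. \<exists>x\<in>n. \<gamma> * x \<notin> p"
proof (induction S rule: finite_induct)
  case empty
  show ?case using algebraic_int_in_inv_ideal[OF n algebraic_int_1] by blast
next
  case (insert p S)
  then obtain \<gamma> where \<gamma>: "\<gamma> \<in> inv_ideal n" "\<And>q. q \<in> S \<Longrightarrow> \<exists>x\<in>n. \<gamma> * x \<notin> q" by blast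
  have pm: "maximal_nzideal p" using insert.prems by simp
  then have p: "nzideal p" "1 \<notin> p" by (auto simp: maximal_nzideal_def)
  show ?case
  proof (cases "\<exists>x\<in>n. \<gamma> * x \<notin> p")
    case True
    then show ?thesis using \<gamma> by blast
  next
    case False
    \<comment> \<open>Distinct maximal ideals do not contain one another. The product of elements
      chosen in each \<open>q\<close> outside \<open>p\<close> avoids \<open>p\<close>, because
      \<open>p\<close> is prime.\<close>
    have "\<exists>e. algebraic_int e \<and> e \<notin> p \<and> (\<forall>q\<in>T. e \<in> q)" if "finite T" "T \<subseteq> S" for T
      using that
    proof (induction T rule: finite_induct)
      case empty
      show ?case using p by (intro exI[of _ 1]) auto
    next
      case (insert q T)
      then obtain e where e: "algebraic_int e" "e \<notin> p" "\<forall>q\<in>T. e \<in> q" by blast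
      have qm: "maximal_nzideal q" using insert.prems \<open>\<And>p'. p' \<in> Set.insert p S \<Longrightarrow> maximal_nzideal p'\<close> by blast
      then have qz: "nzideal q" by (simp add: maximal_nzideal_def)
      have "q \<noteq> p" using insert.prems \<open>p \<notin> S\<close> by blast
      then have "\<not> q \<subseteq> p" using qm p unfolding maximal_nzideal_def by blast
      then obtain f where f: "f \<in> q" "f \<notin> p" by blast
      have fi: "algebraic_int f" using nzidealD(1)[OF qz f(1)] .
      have "e * f \<notin> p" using maximal_ideal_prime[OF pm e(1,2) fi] f(2) by blast
      moreover have "e * f \<in> q" using nzidealD(4)[OF qz e(1) f(1)] .
      moreover have "e * f \<in> q'" if "q' \<in> T" for q'
      proof -
        have "nzideal q'" using that insert.prems \<open>\<And>p'. p' \<in> Set.insert p S \<Longrightarrow> maximal_nzideal p'\<close>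
          unfolding maximal_nzideal_def by blast
        from nzidealD(4)[OF this fi, of e] e(3) that show ?thesis by (simp add: mult.commute)
      qed
      ultimately show ?case using algebraic_int_add_mult(2)[OF e(1) fi] by blast
    qed
    from this[OF \<open>finite S\<close> order_refl] obtain e where e: "algebraic_int e" "e \<notin> p" "\<forall>q\<in>S. e \<in> q" by blast
    have "\<exists>\<delta>\<in>inv_ideal n. \<exists>x\<in>n. \<delta> * x \<notin> p"
    proof (rule ccontr)
      assume neg: "\<not> ?thesis"
      have "w \<in> p" if "w \<in> zmod.span {y * x | x y. y \<in> n \<and> x \<in> inv_ideal n}" for w
        using that
      proof (induction rule: zmod.span_induct_alt)
        case base
        show ?case using nzidealD(2)[OF p(1)] .
      next
        case (step c g w)
        then have "g \<in> p" using neg by (auto simp: mult.commute)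
        then show ?case using step nzidealD(3,4)[OF p(1)] by auto
      qed
      from this[OF ideal_invertible[OF n]] p(2) show False by simp
    qed
    then obtain \<delta> x where \<delta>: "\<delta> \<in> inv_ideal n" "x \<in> n" "\<delta> * x \<notin> p" by blast
    let ?g = "\<gamma> + e * \<delta>"
    have "?g \<in> inv_ideal n" using inv_ideal_add[OF \<gamma>(1) inv_ideal_mult[OF \<delta>(1) e(1)]] .
    moreover have "\<exists>x\<in>n. ?g * x \<notin> q" if q: "q \<in> insert p S" for q
    proof (cases "q = p")
      case True
      have dx: "algebraic_int (\<delta> * x)" using \<delta> by (simp add: inv_ideal_def)
      have "?g * x \<notin> p"
      proof
        assume g: "?g * x \<in> p"
        have "\<gamma> * x \<in> p" using False \<delta>(2) by blast
        from nzidealD(6)[OF p(1) g this] have "e * (\<delta> * x) \<in> p" by (simp add: algebra_simps)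
        then show False using maximal_ideal_prime[OF pm e(1,2) dx] \<delta>(3) by blast
      qed
      with True \<delta>(2) show ?thesis by blast
    next
      case qp: False
      then have qS: "q \<in> S" using q by simp
      then have qz: "nzideal q" using insert.prems unfolding maximal_nzideal_def by blast
      obtain y where y: "y \<in> n" "\<gamma> * y \<notin> q" using \<gamma>(2)[OF qS] by blast
      have "algebraic_int (\<delta> * y)" using \<delta>(1) y(1) by (simp add: inv_ideal_def)
      from nzidealD(4)[OF qz this, of e] e(3) qS have ed: "\<delta> * y * e \<in> q" by blast
      have "?g * y \<notin> q"
      proof
        assume g: "?g * y \<in> q"
        from nzidealD(6)[OF qz g ed] y(2) show False by (simp add: algebra_simps)
      qed
      then show ?thesis using y(1) by blast
    qed
    ultimately show ?thesis by blast
  qed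
qed

text \<open>For a generic \<gamma> in the inverse of \<open>n\<close> the ideal \<gamma> n + n lies
  in no maximal ideal and so contains 1. Any maximal ideal containing it lies above
  \<open>n\<close>, and there are finitely many of those to avoid.\<close>

theorem denom_surjective:
  assumes n: "nzideal (n :: 'k set)" shows "\<exists>\<gamma>. denom \<gamma> = n"
proof -
  let ?S = "{p. maximal_nzideal p \<and> n \<subseteq> p}"
  have "finite ?S" using finite_ideals_above[OF n]
    by (rule finite_subset[rotated]) (auto simp: maximal_nzideal_def)
  then obtain \<gamma> where \<gamma>: "\<gamma> \<in> inv_ideal n" "\<And>p. p \<in> ?S \<Longrightarrow> \<exists>x\<in>n. \<gamma> * x \<notin> p"
    using generic_element_of_inverse[OF n, of ?S] by blast
  have int: "algebraic_int (\<gamma> * x)" if "x \<in> n" for x using \<gamma>(1) that by (simp add: inv_ideal_def)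
  define I where "I = {\<gamma> * y + z | y z. y \<in> n \<and> z \<in> n}"
  have nI: "n \<subseteq> I" unfolding I_def using nzidealD(2)[OF n] by (force intro: exI[of _ 0])
  have "nzideal I" unfolding nzideal_def
  proof (intro conjI ballI allI impI)
    show "algebraic_int x" if "x \<in> I" for x
      using that int nzidealD(1)[OF n] by (auto simp: I_def intro!: algebraic_int_add_mult(1))
    show "0 \<in> I" using nI nzidealD(2)[OF n] by blast
    show "\<exists>x\<in>I. x \<noteq> 0" using nI n by (auto simp: nzideal_def)
    show "x + y \<in> I" if xy: "x \<in> I" "y \<in> I" for x y
    proof -
      obtain u s where 1: "x = \<gamma> * u + s" "u \<in> n" "s \<in> n" using xy by (auto simp: I_def)
      obtain u' s' where 2: "y = \<gamma> * u' + s'" "u' \<in> n" "s' \<in> n" using xy by (auto simp: I_def)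
      have "x + y = \<gamma> * (u + u') + (s + s')" using 1 2 by (simp add: algebra_simps)
      then show ?thesis unfolding I_def using 1 2 nzidealD(3)[OF n] by blast
    qed
    show "a * x \<in> I" if ax: "algebraic_int a" "x \<in> I" for a x
    proof -
      obtain u s where 1: "x = \<gamma> * u + s" "u \<in> n" "s \<in> n" using ax by (auto simp: I_def)
      have "a * x = \<gamma> * (a * u) + a * s" using 1 by (simp add: algebra_simps)
      then show ?thesis unfolding I_def using 1 ax nzidealD(4)[OF n] by blast
    qed
  qed
  have "1 \<in> I"
  proof (rule ccontr)
    assume "1 \<notin> I"
    then obtain p where p: "maximal_nzideal p" "I \<subseteq> p" using maximal_ideal_exists[OF \<open>nzideal I\<close>] by blast
    then obtain x where x: "x \<in> n" "\<gamma> * x \<notin> p" using \<gamma>(2)[of p] nI by blast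
    have "\<gamma> * x + 0 \<in> I" unfolding I_def using x(1) nzidealD(2)[OF n] by blast
    with p x show False by auto
  qed
  then obtain y z where "y \<in> n" "z \<in> n" "\<gamma> * y + z = 1" unfolding I_def by auto
  then show ?thesis using denom_eqI[OF n int] by blast
qed

end

section \<open>Reduced fractions and character sums\<close>

lemma card_image_same_kernel:
  assumes "\<And>x y. x \<in> A \<Longrightarrow> y \<in> A \<Longrightarrow> f x = f y \<longleftrightarrow> g x = g y"
  shows "card (f ` A) = card (g ` A)"
proof -
  define h where "h z = g (SOME x. x \<in> A \<and> f x = z)" for z
  have h: "h (f x) = g x" if "x \<in> A" for x
  proof -
    have "(SOME y. y \<in> A \<and> f y = f x) \<in> A \<and> f (SOME y. y \<in> A \<and> f y = f x) = f x"
      by (rule someI[of "\<lambda>y. y \<in> A \<and> f y = f x" x]) (use that in simp)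
    then show ?thesis using assms that unfolding h_def by blast
  qed
  have "inj_on h (f ` A)" by (rule inj_onI) (use h assms in auto)
  moreover have "h ` f ` A = g ` A" using h by (auto simp: image_image)
  ultimately show ?thesis by (metis card_image)
qed

context integral_basis
begin

definition frac_part :: "'k \<Rightarrow> 'k" where "frac_part x = x - floor_part x"

lemma frac_part_in_cell: "frac_part x \<in> cell"
  unfolding frac_part_def by (rule frac_in_cell)

lemma frac_part_eq_iff: "frac_part x = frac_part y \<longleftrightarrow> algebraic_int (x - y)"
proof
  assume "frac_part x = frac_part y"
  then have "x - y = floor_part x - floor_part y" by (simp add: frac_part_def algebra_simps)
  then show "algebraic_int (x - y)" by (simp add: algebraic_int_diff floor_part_algebraic_int)
next
  assume "algebraic_int (x - y)"
  then show "frac_part x = frac_part y"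
    using floor_part_add[of "x - y" y] by (simp add: frac_part_def)
qed

lemma frac_part_cell: "x \<in> cell \<Longrightarrow> frac_part x = x"
  using frac_of_cell[of x 0] by (simp add: frac_part_def)

lemma algebraic_int_diff_frac_part: "algebraic_int (x - frac_part x)"
  by (simp add: frac_part_def floor_part_algebraic_int)

lemma denom_add: "algebraic_int a \<Longrightarrow> denom (x + a) = denom (x :: 'k)"
proof -
  assume a: "algebraic_int a"
  have "algebraic_int (y * (x + a)) \<longleftrightarrow> algebraic_int (y * x)" if y: "algebraic_int y" for y
  proof
    have ya: "algebraic_int (y * a)" using y a by (rule algebraic_int_add_mult)
    show "algebraic_int (y * x)" if "algebraic_int (y * (x + a))"
      using algebraic_int_diff[OF that ya] by (simp add: algebra_simps)
    show "algebraic_int (y * (x + a))" if "algebraic_int (y * x)"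
      using algebraic_int_add_mult(1)[OF that ya] by (simp add: algebra_simps)
  qed
  then show ?thesis by (auto simp: denom_def)
qed

lemma denom_frac_part: "denom (frac_part x) = denom x"
  using denom_add[OF algebraic_int_diff_frac_part[of x], of "frac_part x"] by simp

lemma denom_in_inv_ideal: "\<gamma> \<in> inv_ideal (denom (\<gamma> :: 'k))"
  by (auto simp: inv_ideal_def denom_def mult.commute)

lemma frac_part_in_inv_ideal:
  assumes "nzideal (n :: 'k set)" "x \<in> inv_ideal n" shows "frac_part x \<in> inv_ideal n"
  unfolding frac_part_def
  by (rule inv_ideal_diff[OF assms(2) algebraic_int_in_inv_ideal[OF assms(1) floor_part_algebraic_int]])

lemma denom_unit_mult:
  assumes \<gamma>: "denom \<gamma> = (n :: 'k set)" and r: "algebraic_int r" "algebraic_int s" "r * s - 1 \<in> n"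
  shows "denom (r * \<gamma>) = n"
proof -
  have n: "nzideal n" using nzideal_denom \<gamma> by blast
  have "x \<in> n" if "algebraic_int x" "algebraic_int (x * (r * \<gamma>))" for x
  proof -
    have "x * r \<in> n" using that r algebraic_int_add_mult(2)[of x r]
      unfolding \<gamma>[symmetric] denom_def by (simp add: mult.assoc)
    then have "s * (x * r) - x * (r * s - 1) \<in> n"
      using nzidealD(6)[OF n nzidealD(4)[OF n r(2)] nzidealD(4)[OF n that(1) r(3)]] by blast
    then show ?thesis by (simp add: algebra_simps)
  qed
  moreover have "algebraic_int (x * (r * \<gamma>))" if "x \<in> n" for x
  proof -
    have "algebraic_int (x * \<gamma>)" using that \<gamma> by (auto simp: denom_def)
    from algebraic_int_add_mult(2)[OF r(1) this] show ?thesis by (simp add: mult_ac)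
  qed
  ultimately show ?thesis using nzidealD(1)[OF n] by (auto simp: denom_def)
qed

definition reduced_fractions :: "'k set \<Rightarrow> 'k set" where
  "reduced_fractions n = {\<gamma> \<in> cell. denom \<gamma> = n}"

definition fractions :: "'k set \<Rightarrow> 'k set" where
  "fractions n = {\<gamma> \<in> cell. \<gamma> \<in> inv_ideal n}"

lemma reduced_fractions_subset: "reduced_fractions n \<subseteq> fractions n"
  using denom_in_inv_ideal by (auto simp: reduced_fractions_def fractions_def)

text \<open>For any \<gamma> with denominator \<open>n\<close>, the map
  \<open>r \<mapsto> r * \<gamma>\<close> identifies the residue ring of \<open>n\<close> with the
  inverse of \<open>n\<close> modulo integers. Units correspond to generators of this cyclic module,
  and these are the reduced fractions.\<close>

lemma
  assumes n: "nzideal (n :: 'k set)"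
  shows card_fractions: "card (fractions n) = ideal_Nm n"
    and card_reduced_fractions: "card (reduced_fractions n) = ideal_\<Phi> n"
    and finite_fractions: "finite (fractions n)"
proof -
  obtain \<gamma> where \<gamma>: "denom \<gamma> = n" using denom_surjective[OF n] by blast
  let ?U = "{r. algebraic_int r \<and> (\<exists>s. algebraic_int s \<and> r * s - 1 \<in> n)}"
  have iff: "algebraic_int (x * \<gamma>) \<longleftrightarrow> x \<in> n" if "algebraic_int x" for x
    using that unfolding \<gamma>[symmetric] by (simp add: denom_def)
  have ker: "coset n x = coset n y \<longleftrightarrow> frac_part (x * \<gamma>) = frac_part (y * \<gamma>)"
    if "algebraic_int x" "algebraic_int y" for x y
    using iff[of "x - y"] algebraic_int_diff[OF that]
    by (simp add: coset_eq_iff[OF n] frac_part_eq_iff left_diff_distrib)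
  obtain y z where yz: "y \<in> n" "z \<in> n" "\<gamma> * y + z = 1" using denom_coprime[of \<gamma>] \<gamma> by blast
  \<comment> \<open>The multiplier is \<open>x * y\<close>: it is integral, and
    \<open>x = x * y * \<gamma> + x * z\<close> with \<open>x * z\<close> integral.\<close>
  have cyc: "\<exists>r. algebraic_int r \<and> frac_part (r * \<gamma>) = x" if "x \<in> fractions n" for x
  proof (intro exI conjI)
    have xi: "algebraic_int (x * y)" "algebraic_int (x * z)"
      using that yz by (auto simp: fractions_def inv_ideal_def)
    show "algebraic_int (x * y)" by (rule xi)
    have "x * y * \<gamma> - x = - (x * z)" using arg_cong[OF yz(3), of "\<lambda>w. x * w"] by (simp add: algebra_simps)
    then have "frac_part (x * y * \<gamma>) = frac_part x" using xi(2) by (simp add: frac_part_eq_iff)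
    then show "frac_part (x * y * \<gamma>) = x" using that frac_part_cell by (simp add: fractions_def)
  qed
  have Fr: "(\<lambda>r. frac_part (r * \<gamma>)) ` {r. algebraic_int r} = fractions n"
  proof (intro equalityI subsetI)
    show "x \<in> (\<lambda>r. frac_part (r * \<gamma>)) ` {r. algebraic_int r}" if "x \<in> fractions n" for x
      using cyc[OF that] by blast
    show "x \<in> fractions n" if x: "x \<in> (\<lambda>r. frac_part (r * \<gamma>)) ` {r. algebraic_int r}" for x
    proof -
      obtain r where r: "algebraic_int r" "x = frac_part (r * \<gamma>)" using x by blast
      have "r * \<gamma> \<in> inv_ideal n" using inv_ideal_mult[OF denom_in_inv_ideal r(1)] \<gamma> by metis
      then show ?thesis using frac_part_in_inv_ideal[OF n] frac_part_in_cell r(2) by (simp add: fractions_def)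
    qed
  qed
  show "finite (fractions n)"
  proof -
    obtain M where M: "M > (0::int)" "of_int M \<in> n" using pos_int_in_ideal[OF n] by blast
    have "fractions n \<subseteq> {x \<in> cell. algebraic_int (of_int M * x)}"
      using M(2) by (auto simp: fractions_def inv_ideal_def mult.commute)
    then show ?thesis using finite_cell_denominator[OF M(1)] finite_subset by blast
  qed
  have "card (quo n) = card ((\<lambda>r. frac_part (r * \<gamma>)) ` {r. algebraic_int r})"
    unfolding quo_def by (rule card_image_same_kernel) (use ker in simp)
  then show "card (fractions n) = ideal_Nm n" by (simp add: ideal_Nm_quo Fr)
  have Q: "(\<lambda>r. frac_part (r * \<gamma>)) ` ?U = reduced_fractions n"
  proof (intro equalityI subsetI)
    show "x \<in> reduced_fractions n" if "x \<in> (\<lambda>r. frac_part (r * \<gamma>)) ` ?U" for x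
      using that denom_unit_mult[OF \<gamma>] by (auto simp: reduced_fractions_def denom_frac_part frac_part_in_cell)
    show "x \<in> (\<lambda>r. frac_part (r * \<gamma>)) ` ?U" if x: "x \<in> reduced_fractions n" for x
    proof -
      obtain r where r: "algebraic_int r" "frac_part (r * \<gamma>) = x"
        using cyc[of x] x reduced_fractions_subset by blast
      have dr: "denom (r * \<gamma>) = n" using x r denom_frac_part[of "r * \<gamma>"] by (simp add: reduced_fractions_def)
      obtain y z where yz: "y \<in> n" "z \<in> n" "r * \<gamma> * y + z = 1" using denom_coprime[of "r * \<gamma>"] dr by blast
      have "algebraic_int (y * \<gamma>)" using yz(1) \<gamma> by (auto simp: denom_def)
      moreover have "r * (y * \<gamma>) - 1 = - z" using yz(3) by (simp add: algebra_simps add_eq_0_iff)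
      ultimately have "r \<in> ?U" using r(1) nzidealD(5)[OF n yz(2)] by auto
      then show ?thesis using r(2) by blast
    qed
  qed
  have "card (coset n ` ?U) = card ((\<lambda>r. frac_part (r * \<gamma>)) ` ?U)"
    by (rule card_image_same_kernel) (use ker in simp)
  then show "card (reduced_fractions n) = ideal_\<Phi> n" by (simp add: ideal_\<Phi>_quo[OF n] Q)
qed

lemma finite_reduced_fractions: "nzideal (n :: 'k set) \<Longrightarrow> finite (reduced_fractions n)"
  using finite_fractions reduced_fractions_subset finite_subset by blast

lemma ideal_Nm_pos: "nzideal (n :: 'k set) \<Longrightarrow> ideal_Nm n > 0"
  using finite_quo[of n] by (auto simp: ideal_Nm_quo card_gt_0_iff quo_def intro: exI[of _ 0])

lemma ideal_\<Phi>_pos: assumes n: "nzideal (n :: 'k set)" shows "ideal_\<Phi> n > 0"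
proof -
  obtain \<gamma> where \<gamma>: "denom \<gamma> = n" using denom_surjective[OF n] by blast
  have "frac_part \<gamma> \<in> reduced_fractions n"
    using \<gamma> frac_part_in_cell by (simp add: reduced_fractions_def denom_frac_part)
  then show ?thesis
    using finite_reduced_fractions[OF n] card_gt_0_iff unfolding card_reduced_fractions[OF n, symmetric] by blast
qed

text \<open>Among the integers from 0 to \<open>R\<close> two are congruent modulo \<open>n\<close>,
  so \<open>n\<close> contains a positive integer up to \<open>R\<close> and with it
  \<open>fact R\<close>. All these ideals lie above one fixed ideal.\<close>

lemma finite_ideals_bounded_Nm: "finite {n :: 'k set. nzideal n \<and> ideal_Nm n \<le> R}"
proof -
  let ?I = "{x :: 'k. algebraic_int (x / of_int (fact R))}"
  have "?I \<subseteq> n" if n: "nzideal n" "ideal_Nm n \<le> R" for n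
  proof -
    let ?f = "\<lambda>k :: nat. coset n (of_nat k)"
    have "card (?f ` {0..R}) \<le> card (quo n)"
      by (intro card_mono finite_quo[OF n(1)]) (auto simp: quo_def)
    then have "card (?f ` {0..R}) < card {0..R}" using n(2) by (simp add: ideal_Nm_quo)
    then have "\<not> inj_on ?f {0..R}" by (rule pigeonhole)
    then obtain i j where "i \<noteq> j" "i \<le> R" "j \<le> R" "?f i = ?f j" unfolding inj_on_def by auto
    then obtain i j where ij: "i < j" "j \<le> R" "?f j = ?f i" by (metis linorder_neqE_nat)
    then have ji: "(of_nat (j - i) :: 'k) \<in> n" using coset_eq_iff[OF n(1)] by (simp add: of_nat_diff)
    have "(j - i) dvd fact R" using ij by (intro dvd_fact) auto
    then obtain k where "fact R = (j - i) * k" by (elim dvdE)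
    then have "(of_int (fact R) :: 'k) = of_nat k * of_nat (j - i)"
      by (metis mult.commute of_int_of_nat_eq of_nat_fact of_nat_mult)
    then have F: "(of_int (fact R) :: 'k) \<in> n" using nzidealD(4)[OF n(1) _ ji, of "of_nat k"] by simp
    show ?thesis
    proof
      fix x :: 'k assume "x \<in> ?I"
      from nzidealD(4)[OF n(1) _ F, of "x / of_int (fact R)"] this show "x \<in> n" by simp
    qed
  qed
  then have "{n :: 'k set. nzideal n \<and> ideal_Nm n \<le> R} \<subseteq> {n. nzideal n \<and> ?I \<subseteq> n}" by blast
  moreover have "nzideal ?I" by (rule nzideal_principal) simp
  ultimately show ?thesis using finite_ideals_above finite_subset by blast
qed

text \<open>Sending \<open>(x, y)\<close> to \<open>(x, x + y)\<close> is injective from classes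
  modulo \<open>m \<inter> n\<close> and \<open>m + n\<close> to classes modulo \<open>m\<close> and
  \<open>n\<close>. Representatives are fixed because the second component depends on the choice of
  \<open>y\<close> in its class.\<close>

lemma ideal_Nm_Int_sum_le:
  assumes m: "nzideal (m :: 'k set)" and n: "nzideal n"
  shows "ideal_Nm (m \<inter> n) * ideal_Nm (ideal_sum m n) \<le> ideal_Nm m * ideal_Nm n"
proof -
  have i: "nzideal (m \<inter> n)" and s: "nzideal (ideal_sum m n)"
    using nzideal_Int[OF m n] nzideal_ideal_sum[OF m n] .
  define rep where "rep J X = (SOME x. algebraic_int x \<and> coset J x = X)" for J :: "'k set" and X
  have rep: "algebraic_int (rep J X)" "coset J (rep J X) = X" if "X \<in> quo J" for J X
  proof -
    have "\<exists>x. algebraic_int x \<and> coset J x = X" using that by (auto simp: quo_def)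
    from someI_ex[OF this] show "algebraic_int (rep J X)" "coset J (rep J X) = X" by (auto simp: rep_def)
  qed
  let ?f = "\<lambda>(X, Y). (coset m (rep (m \<inter> n) X), coset n (rep (m \<inter> n) X + rep (ideal_sum m n) Y))"
  have "inj_on ?f (quo (m \<inter> n) \<times> quo (ideal_sum m n))"
  proof (rule inj_onI, clarsimp)
    fix X Y X' Y'
    assume q: "X \<in> quo (m \<inter> n)" "Y \<in> quo (ideal_sum m n)" "X' \<in> quo (m \<inter> n)" "Y' \<in> quo (ideal_sum m n)"
      and e: "coset m (rep (m \<inter> n) X) = coset m (rep (m \<inter> n) X')"
        "coset n (rep (m \<inter> n) X + rep (ideal_sum m n) Y) = coset n (rep (m \<inter> n) X' + rep (ideal_sum m n) Y')"
    let ?x = "rep (m \<inter> n) X" and ?x' = "rep (m \<inter> n) X'"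
    let ?y = "rep (ideal_sum m n) Y" and ?y' = "rep (ideal_sum m n) Y'"
    have 1: "?x - ?x' \<in> m" "(?x + ?y) - (?x' + ?y') \<in> n"
      using e coset_eq_iff[OF m] coset_eq_iff[OF n] by auto
    have "?y - ?y' = - (?x - ?x') + ((?x + ?y) - (?x' + ?y'))" by simp
    moreover have "- (?x - ?x') \<in> m" using nzidealD(5)[OF m 1(1)] .
    ultimately have "?y - ?y' \<in> ideal_sum m n" using 1(2) unfolding ideal_sum_def by blast
    then have Y: "Y = Y'" using coset_eq_iff[OF s, of ?y ?y'] rep(2)[OF q(2)] rep(2)[OF q(4)] by simp
    with 1 have "?x - ?x' \<in> m \<inter> n" by simp
    then have "X = X'" using coset_eq_iff[OF i, of ?x ?x'] rep(2)[OF q(1)] rep(2)[OF q(3)] by simp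
    with Y show "X = X' \<and> Y = Y'" by simp
  qed
  moreover have "?f ` (quo (m \<inter> n) \<times> quo (ideal_sum m n)) \<subseteq> quo m \<times> quo n"
    using rep(1) by (auto simp: quo_def intro!: imageI algebraic_int_add_mult(1))
  ultimately have "card (quo (m \<inter> n) \<times> quo (ideal_sum m n)) \<le> card (quo m \<times> quo n)"
    using finite_quo[OF m] finite_quo[OF n] by (intro card_inj_on_le[where f = ?f]) auto
  then show ?thesis by (simp add: ideal_Nm_quo card_cartesian_product)
qed

text \<open>Two such fractions differ by an element of the inverses of both \<open>m\<close> and
  \<open>n\<close>, thus of the inverse of \<open>m + n\<close>, which has as many classes modulo
  integers as the norm of \<open>m + n\<close>.\<close>

lemma card_common_difference_le:
  assumes m: "nzideal (m :: 'k set)" and n: "nzideal n"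
  shows "card {\<gamma> \<in> reduced_fractions m. denom (\<gamma> - \<delta>) = n} \<le> ideal_Nm (ideal_sum m n)"
proof (cases "{\<gamma> \<in> reduced_fractions m. denom (\<gamma> - \<delta>) = n} = {}")
  case True
  show ?thesis unfolding True by simp
next
  case False
  let ?S = "{\<gamma> \<in> reduced_fractions m. denom (\<gamma> - \<delta>) = n}"
  obtain \<gamma>1 where g1: "\<gamma>1 \<in> ?S" using False by blast
  have s: "nzideal (ideal_sum m n)" using nzideal_ideal_sum[OF m n] .
  have "card ?S \<le> card (fractions (ideal_sum m n))"
  proof (rule card_inj_on_le)
    show "finite (fractions (ideal_sum m n))" by (rule finite_fractions[OF s])
    show "inj_on (\<lambda>\<gamma>. frac_part (\<gamma> - \<gamma>1)) ?S"
    proof (rule inj_onI)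
      fix x y assume xy: "x \<in> ?S" "y \<in> ?S" "frac_part (x - \<gamma>1) = frac_part (y - \<gamma>1)"
      then have "algebraic_int (x - y)" by (simp add: frac_part_eq_iff)
      then show "x = y" using cell_eqI xy(1,2) by (simp add: reduced_fractions_def)
    qed
    show "(\<lambda>\<gamma>. frac_part (\<gamma> - \<gamma>1)) ` ?S \<subseteq> fractions (ideal_sum m n)"
    proof
      fix w assume "w \<in> (\<lambda>\<gamma>. frac_part (\<gamma> - \<gamma>1)) ` ?S"
      then obtain x where x: "x \<in> ?S" "w = frac_part (x - \<gamma>1)" by blast
      have "x - \<gamma>1 \<in> inv_ideal m"
        using x g1 denom_in_inv_ideal[of x] denom_in_inv_ideal[of \<gamma>1]
        by (auto simp: reduced_fractions_def intro: inv_ideal_diff)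
      moreover have "x - \<delta> \<in> inv_ideal n" "\<gamma>1 - \<delta> \<in> inv_ideal n"
        using x g1 denom_in_inv_ideal[of "x - \<delta>"] denom_in_inv_ideal[of "\<gamma>1 - \<delta>"] by auto
      then have "(x - \<delta>) - (\<gamma>1 - \<delta>) \<in> inv_ideal n" by (rule inv_ideal_diff)
      ultimately have "x - \<gamma>1 \<in> inv_ideal (ideal_sum m n)"
        by (auto simp: inv_ideal_def ideal_sum_def distrib_left intro!: algebraic_int_add_mult(1))
      then show "w \<in> fractions (ideal_sum m n)"
        using frac_part_in_inv_ideal[OF s] frac_part_in_cell x(2) by (simp add: fractions_def)
    qed
  qed
  then show ?thesis by (simp add: card_fractions[OF s])
qed

text \<open>Multiplication by a unit modulo \<open>n\<close> permutes the reduced fractions, so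
  \<open>S\<close> occurs \<Phi>(n) times among the twisted sums \<open>T X\<close>. Their total
  second moment is found by orthogonality: a pair of fractions contributes, at most Nm(n), only if
  all multiples of its difference have character value 1, and each fraction has at most
  \<open>card ?K\<close> such partners.\<close>

lemma character_sum_le:
  fixes \<xi> :: "'k \<Rightarrow> complex"
  assumes add: "\<And>x y. \<xi> (x + y) = \<xi> x * \<xi> y" and norm: "\<And>x. cmod (\<xi> x) = 1"
    and int: "\<And>a. algebraic_int a \<Longrightarrow> \<xi> a = 1"
    and fin: "finite {x \<in> cell. \<forall>a. algebraic_int a \<longrightarrow> \<xi> (a * x) = 1}"
    and n: "nzideal (n :: 'k set)"
  shows "(cmod (\<Sum>\<gamma>\<in>reduced_fractions n. \<xi> \<gamma>))\<^sup>2
    \<le> card {x \<in> cell. \<forall>a. algebraic_int a \<longrightarrow> \<xi> (a * x) = 1} * ideal_Nm n"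
proof -
  let ?K = "{x \<in> cell. \<forall>a. algebraic_int a \<longrightarrow> \<xi> (a * x) = 1}"
  let ?Q = "reduced_fractions n"
  define S where "S = (\<Sum>\<gamma>\<in>?Q. \<xi> \<gamma>)"
  have \<xi>0: "\<xi> 0 = 1" using int by simp
  have neg: "\<xi> (- x) = cnj (\<xi> x)" for x
  proof -
    have "\<xi> x * \<xi> (- x) = 1" using add[of x "- x"] \<xi>0 by simp
    moreover have "\<xi> x * cnj (\<xi> x) = 1" using norm[of x] by (simp add: complex_norm_square[symmetric])
    moreover have "\<xi> x \<noteq> 0" using norm[of x] by auto
    ultimately show ?thesis by (metis mult_left_cancel)
  qed
  have eqint: "\<xi> x = \<xi> y" if "algebraic_int (x - y)" for x y
    using add[of "x - y" y] int[OF that] by simp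
  define rep where "rep X = (SOME x. algebraic_int x \<and> coset n x = X)" for X
  have rep: "algebraic_int (rep X)" "coset n (rep X) = X" if "X \<in> quo n" for X
  proof -
    have "\<exists>x. algebraic_int x \<and> coset n x = X" using that by (auto simp: quo_def)
    from someI_ex[OF this] show "algebraic_int (rep X)" "coset n (rep X) = X" by (auto simp: rep_def)
  qed
  let ?U = "coset n ` {r. algebraic_int r \<and> (\<exists>s. algebraic_int s \<and> r * s - 1 \<in> n)}"
  have UQ: "?U \<subseteq> quo n" by (auto simp: quo_def)
  have finq: "finite (quo n)" by (rule finite_quo[OF n])
  have finQ: "finite ?Q" by (rule finite_reduced_fractions[OF n])
  have inv: "x - y \<in> inv_ideal n" if "x \<in> ?Q" "y \<in> ?Q" for x y
    using that denom_in_inv_ideal[of x] denom_in_inv_ideal[of y]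
    by (auto simp: reduced_fractions_def intro: inv_ideal_diff)
  define T where "T X = (\<Sum>\<gamma>\<in>?Q. \<xi> (rep X * \<gamma>))" for X
  have TU: "T X = S" if X: "X \<in> ?U" for X
  proof -
    obtain r s where rs: "algebraic_int r" "algebraic_int s" "r * s - 1 \<in> n" "X = coset n r" using X by auto
    have "coset n (rep X) = coset n r" using rep(2) UQ X rs(4) by blast
    then have "rep X - r \<in> n" by (simp add: coset_eq_iff[OF n])
    then have "(rep X - r) * s + (r * s - 1) \<in> n"
      using nzidealD(3)[OF n nzidealD(4)[OF n rs(2)] rs(3), of "rep X - r"] by (simp add: mult.commute)
    then have rs': "rep X * s - 1 \<in> n" by (simp add: algebra_simps)
    have ri: "algebraic_int (rep X)" using rep(1) UQ X by blast
    let ?g = "\<lambda>\<gamma>. frac_part (rep X * \<gamma>)"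
    have "?g ` ?Q \<subseteq> ?Q"
      using denom_unit_mult[OF _ ri rs(2) rs'] by (auto simp: reduced_fractions_def denom_frac_part frac_part_in_cell)
    moreover have inj: "inj_on ?g ?Q"
    proof (rule inj_onI)
      fix x y assume xy: "x \<in> ?Q" "y \<in> ?Q" "?g x = ?g y"
      then have "algebraic_int (rep X * x - rep X * y)" by (simp add: frac_part_eq_iff)
      then have 1: "algebraic_int (s * (rep X * x - rep X * y))" using rs(2) by (rule algebraic_int_add_mult(2)[rotated])
      have 2: "algebraic_int ((x - y) * (rep X * s - 1))" using inv[OF xy(1,2)] rs' by (simp add: inv_ideal_def)
      have "x - y = s * (rep X * x - rep X * y) - (x - y) * (rep X * s - 1)" by (simp add: algebra_simps)
      then have "algebraic_int (x - y)" using algebraic_int_diff[OF 1 2] by simp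
      then show "x = y" using cell_eqI xy by (simp add: reduced_fractions_def)
    qed
    ultimately have "bij_betw ?g ?Q ?Q" using finQ by (simp add: bij_betw_def endo_inj_surj)
    from sum.reindex_bij_betw[OF this, of \<xi>] have "S = (\<Sum>\<gamma>\<in>?Q. \<xi> (?g \<gamma>))" by (simp add: S_def)
    also have "\<dots> = T X" unfolding T_def
    proof (rule sum.cong)
      fix \<gamma>
      have "algebraic_int (?g \<gamma> - rep X * \<gamma>)"
        using algebraic_int_diff_frac_part[of "rep X * \<gamma>"] algebraic_int_minus_iff[of "rep X * \<gamma> - ?g \<gamma>"] by simp
      then show "\<xi> (?g \<gamma>) = \<xi> (rep X * \<gamma>)" by (rule eqint)
    qed simp
    finally show ?thesis by simp
  qed
  \<comment> \<open>Shifting the classes by \<open>a\<close> multiplies this sum by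
    \<open>\<xi> (a * \<delta>)\<close>, so it vanishes unless all these values are 1.\<close>
  define E where "E \<delta> = (\<Sum>X\<in>quo n. \<xi> (rep X * \<delta>))" for \<delta>
  have E0: "E \<delta> = 0" if \<delta>: "\<delta> \<in> inv_ideal n" and a: "algebraic_int a" "\<xi> (a * \<delta>) \<noteq> 1" for \<delta> a
  proof -
    let ?t = "\<lambda>X. coset n (rep X + a)"
    have tq: "?t X \<in> quo n" if "X \<in> quo n" for X
      using rep(1)[OF that] a(1) by (auto simp: quo_def intro!: imageI algebraic_int_add_mult(1))
    have "inj_on ?t (quo n)"
    proof (rule inj_onI)
      fix X Y assume XY: "X \<in> quo n" "Y \<in> quo n" "?t X = ?t Y"
      then have "coset n (rep X) = coset n (rep Y)" by (simp add: coset_eq_iff[OF n])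
      then show "X = Y" using rep(2) XY by simp
    qed
    then have "bij_betw ?t (quo n) (quo n)" using finq tq by (simp add: bij_betw_def endo_inj_surj image_subsetI)
    from sum.reindex_bij_betw[OF this, of "\<lambda>X. \<xi> (rep X * \<delta>)"]
    have "E \<delta> = (\<Sum>X\<in>quo n. \<xi> (rep (?t X) * \<delta>))" by (simp add: E_def)
    also have "\<dots> = (\<Sum>X\<in>quo n. \<xi> (rep X * \<delta>) * \<xi> (a * \<delta>))"
    proof (rule sum.cong)
      fix X assume X: "X \<in> quo n"
      have "coset n (rep (?t X)) = coset n (rep X + a)" using rep(2)[OF tq[OF X]] .
      then have "rep (?t X) - (rep X + a) \<in> n" by (simp add: coset_eq_iff[OF n])
      then have "algebraic_int (\<delta> * (rep (?t X) - (rep X + a)))" using \<delta> by (simp add: inv_ideal_def)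
      then have "\<xi> (rep (?t X) * \<delta>) = \<xi> ((rep X + a) * \<delta>)" by (intro eqint) (simp add: algebra_simps)
      then show "\<xi> (rep (?t X) * \<delta>) = \<xi> (rep X * \<delta>) * \<xi> (a * \<delta>)" by (simp add: distrib_right add)
    qed simp
    also have "\<dots> = E \<delta> * \<xi> (a * \<delta>)" by (simp add: E_def sum_distrib_right)
    finally show ?thesis using a(2) by simp
  qed
  have "of_real (\<Sum>X\<in>quo n. (cmod (T X))\<^sup>2) = (\<Sum>X\<in>quo n. T X * cnj (T X))"
    by (simp only: of_real_sum complex_norm_square)
  also have "\<dots> = (\<Sum>X\<in>quo n. \<Sum>\<gamma>\<in>?Q. \<Sum>\<gamma>'\<in>?Q. \<xi> (rep X * (\<gamma> - \<gamma>')))"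
  proof (rule sum.cong)
    fix X
    have "\<xi> (rep X * (\<gamma> - \<gamma>')) = \<xi> (rep X * \<gamma>) * cnj (\<xi> (rep X * \<gamma>'))" for \<gamma> \<gamma>'
      using add[of "rep X * \<gamma>" "- (rep X * \<gamma>')"] by (simp add: right_diff_distrib neg)
    then show "T X * cnj (T X) = (\<Sum>\<gamma>\<in>?Q. \<Sum>\<gamma>'\<in>?Q. \<xi> (rep X * (\<gamma> - \<gamma>')))"
      by (simp add: T_def sum_product)
  qed simp
  also have "\<dots> = (\<Sum>\<gamma>\<in>?Q. \<Sum>\<gamma>'\<in>?Q. E (\<gamma> - \<gamma>'))"
    unfolding E_def by (subst sum.swap) (intro sum.cong refl, subst sum.swap, rule refl)
  finally have e: "complex_of_real (\<Sum>X\<in>quo n. (cmod (T X))\<^sup>2) = (\<Sum>\<gamma>\<in>?Q. \<Sum>\<gamma>'\<in>?Q. E (\<gamma> - \<gamma>'))" .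
  have "(\<Sum>X\<in>quo n. (cmod (T X))\<^sup>2) = cmod (complex_of_real (\<Sum>X\<in>quo n. (cmod (T X))\<^sup>2))"
    unfolding norm_of_real by (rule abs_of_nonneg[symmetric]) (simp add: sum_nonneg)
  also have "\<dots> = cmod (\<Sum>\<gamma>\<in>?Q. \<Sum>\<gamma>'\<in>?Q. E (\<gamma> - \<gamma>'))" by (simp only: e)
  also have "\<dots> \<le> (\<Sum>\<gamma>'\<in>?Q. \<Sum>\<gamma>\<in>?Q. cmod (E (\<gamma> - \<gamma>')))"
    by (subst sum.swap) (intro order.trans[OF norm_sum] sum_mono norm_sum)
  also have "\<dots> \<le> (\<Sum>\<gamma>'\<in>?Q. real (card ?K) * ideal_Nm n)"
  proof (rule sum_mono)
    fix y assume y: "y \<in> ?Q"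
    let ?B = "{\<gamma> \<in> ?Q. \<forall>a. algebraic_int a \<longrightarrow> \<xi> (a * (\<gamma> - y)) = 1}"
    have "(\<Sum>\<gamma>\<in>?Q. cmod (E (\<gamma> - y))) = (\<Sum>\<gamma>\<in>?B. cmod (E (\<gamma> - y)))"
      using E0 inv[OF _ y] by (intro sum.mono_neutral_right finQ) auto
    also have "\<dots> \<le> (\<Sum>\<gamma>\<in>?B. real (ideal_Nm n))"
    proof (rule sum_mono)
      fix \<gamma>
      have "cmod (E (\<gamma> - y)) \<le> (\<Sum>X\<in>quo n. 1)"
        unfolding E_def by (rule order.trans[OF norm_sum]) (simp add: norm)
      then show "cmod (E (\<gamma> - y)) \<le> real (ideal_Nm n)" by (simp add: ideal_Nm_quo)
    qed
    also have "\<dots> = real (card ?B) * ideal_Nm n" by simp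
    also have "card ?B \<le> card ?K"
    proof (rule card_inj_on_le[of "\<lambda>\<gamma>. frac_part (\<gamma> - y)"])
      show "inj_on (\<lambda>\<gamma>. frac_part (\<gamma> - y)) ?B"
        by (rule inj_onI) (auto simp: frac_part_eq_iff reduced_fractions_def intro: cell_eqI)
      show "(\<lambda>\<gamma>. frac_part (\<gamma> - y)) ` ?B \<subseteq> ?K"
      proof
        fix w assume "w \<in> (\<lambda>\<gamma>. frac_part (\<gamma> - y)) ` ?B"
        then obtain x where x: "x \<in> ?B" "w = frac_part (x - y)" by blast
        have "\<xi> (a * w) = 1" if "algebraic_int a" for a
        proof -
          have "algebraic_int (a * (x - y - w))" unfolding x(2)
            by (rule algebraic_int_add_mult(2)[OF that algebraic_int_diff_frac_part])
          then have "\<xi> (a * (x - y)) = \<xi> (a * w)" by (intro eqint) (simp add: algebra_simps)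
          then show ?thesis using x(1) that by simp
        qed
        then show "w \<in> ?K" using x(2) frac_part_in_cell by simp
      qed
    qed (rule fin)
    then have "real (card ?B) * ideal_Nm n \<le> real (card ?K) * ideal_Nm n" by (intro mult_right_mono) auto
    finally show "(\<Sum>\<gamma>\<in>?Q. cmod (E (\<gamma> - y))) \<le> real (card ?K) * ideal_Nm n" by simp
  qed
  also have "\<dots> = ideal_\<Phi> n * (real (card ?K) * ideal_Nm n)" by (simp add: card_reduced_fractions[OF n])
  finally have le: "(\<Sum>X\<in>quo n. (cmod (T X))\<^sup>2) \<le> ideal_\<Phi> n * (real (card ?K) * ideal_Nm n)" .
  \<comment> \<open>The unit classes alone give \<Phi>(n) copies of \<open>S\<close>, and this
    factor cancels against the number of reduced fractions in the bound.\<close>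
  have "ideal_\<Phi> n * (cmod S)\<^sup>2 = (\<Sum>X\<in>?U. (cmod (T X))\<^sup>2)" by (simp add: TU ideal_\<Phi>_quo[OF n])
  also have "\<dots> \<le> (\<Sum>X\<in>quo n. (cmod (T X))\<^sup>2)" using UQ finq by (intro sum_mono2) auto
  also note le
  finally have "(cmod S)\<^sup>2 \<le> real (card ?K) * ideal_Nm n" using ideal_\<Phi>_pos[OF n] by simp
  then show ?thesis unfolding S_def by simp
qed

definition int_functional :: "(nat \<Rightarrow> int) \<Rightarrow> 'k \<Rightarrow> rat" where
  "int_functional k x = (\<Sum>j<d. of_int (k j) * \<phi> j x)"

lemma int_functional_add: "int_functional k (x + y) = int_functional k x + int_functional k y"
  by (simp add: int_functional_def coord_add distrib_left sum.distrib)

text \<open>The constant is the number of \<open>x\<close> in the cell all of whose integral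
  multiples have character value 1. It is finite because the functional is nonzero, and it depends
  on \<open>k\<close> alone.\<close>

lemma exponential_sum_le:
  assumes k: "\<exists>j<d. k j \<noteq> 0"
  shows "\<exists>C::real. \<forall>n. nzideal n \<longrightarrow>
    (cmod (\<Sum>\<gamma>\<in>reduced_fractions n. cis (2 * pi * of_rat (int_functional k \<gamma>))))\<^sup>2 \<le> C * real (ideal_Nm n)"
proof -
  define \<xi> where "\<xi> x = cis (2 * pi * of_rat (int_functional k x))" for x
  let ?K = "{x \<in> cell. \<forall>a. algebraic_int a \<longrightarrow> \<xi> (a * x) = 1}"
  have add: "\<xi> (x + y) = \<xi> x * \<xi> y" for x y
    by (simp add: \<xi>_def int_functional_add of_rat_add distrib_left cis_mult)
  have one: "\<xi> x = 1 \<longleftrightarrow> int_functional k x \<in> \<int>" for x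
  proof
    assume "\<xi> x = 1"
    then have "cos (2 * pi * of_rat (int_functional k x)) = 1" by (simp add: \<xi>_def complex_eq_iff)
    then obtain m :: int where "2 * pi * real_of_rat (int_functional k x) = real_of_int m * 2 * pi"
      using cos_one_2pi_int by blast
    then have "real_of_rat (int_functional k x) = of_rat (of_int m)" by simp
    then show "int_functional k x \<in> \<int>" by (simp only: of_rat_eq_iff Ints_of_int)
  next
    assume "int_functional k x \<in> \<int>"
    then obtain m where "int_functional k x = of_int m" by (rule Ints_cases)
    then show "\<xi> x = 1" using cis_multiple_2pi[of "of_int m"] by (simp add: \<xi>_def)
  qed
  obtain j where j: "j < d" "k j \<noteq> 0" using k by blast
  have "int_functional k (b j) = (\<Sum>i<d. if i = j then of_int (k j) else 0)"
    unfolding int_functional_def using j by (intro sum.cong) (auto simp: coord_basis)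
  then have nz: "int_functional k (b j) \<noteq> 0" using j by simp
  have bint: "algebraic_int (b i)" if "i < d" for i
    using that by (simp add: algebraic_int_iff_coords coord_basis)
  have "finite ?K"
  proof (rule finite_subset)
    show "finite {x. (\<forall>j<d. \<phi> j x \<in> {0..<1}) \<and> (\<forall>i<d. int_functional k (b i * x) \<in> \<int>)}"
      by (rule finite_integral_functional[of "int_functional k", OF int_functional_add nz])
    show "?K \<subseteq> {x. (\<forall>j<d. \<phi> j x \<in> {0..<1}) \<and> (\<forall>i<d. int_functional k (b i * x) \<in> \<int>)}"
      using bint one by (auto simp: cell_def)
  qed
  moreover have "\<xi> a = 1" if "algebraic_int a" for a
    using that by (auto simp: one int_functional_def algebraic_int_iff_coords intro!: Ints_sum Ints_mult)
  ultimately have "\<forall>n. nzideal n \<longrightarrow> (cmod (\<Sum>\<gamma>\<in>reduced_fractions n. \<xi> \<gamma>))\<^sup>2 \<le> real (card ?K) * ideal_Nm n"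
    using character_sum_le[of \<xi>, OF add] by (simp add: \<xi>_def)
  then have "\<exists>C::real. \<forall>n. nzideal n \<longrightarrow> (cmod (\<Sum>\<gamma>\<in>reduced_fractions n. \<xi> \<gamma>))\<^sup>2 \<le> C * real (ideal_Nm n)" by (rule exI)
  then show ?thesis unfolding \<xi>_def .
qed

end

section \<open>The space of archimedean places\<close>

declare One_nat_def [simp del]

lemma PiM_lborel_translate:
  fixes c :: "'i \<Rightarrow> 'a::euclidean_space"
  assumes I: "finite I"
  shows "distr (\<Pi>\<^sub>M i\<in>I. lborel) (\<Pi>\<^sub>M i\<in>I. lborel) (\<lambda>x. \<lambda>i\<in>I. x i + c i) = (\<Pi>\<^sub>M i\<in>I. (lborel :: 'a measure))"
proof -
  interpret product_sigma_finite "\<lambda>_::'i. lborel :: 'a measure" by standard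
  let ?P = "\<Pi>\<^sub>M i\<in>I. (lborel :: 'a measure)"
  let ?f = "\<lambda>x. \<lambda>i\<in>I. x i + c i"
  have f: "?f \<in> measurable ?P ?P" by (rule measurable_restrict) measurable
  show ?thesis
  proof (rule PiM_eqI[OF I])
    fix A assume A: "\<And>i. i \<in> I \<Longrightarrow> A i \<in> sets (lborel :: 'a measure)"
    have vA: "(+) (c i) -` A i \<in> sets borel" if "i \<in> I" for i
      using A[OF that] by (intro measurable_sets_borel[of _ borel]) auto
    have "emeasure (distr ?P ?P ?f) (PiE I A) = emeasure ?P (?f -` PiE I A \<inter> space ?P)"
      by (rule emeasure_distr[OF f]) (use A I in \<open>auto intro: sets_PiM_I_finite\<close>)
    also have "?f -` PiE I A \<inter> space ?P = PiE I (\<lambda>i. (+) (c i) -` A i)"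
      by (auto simp: space_PiM PiE_iff add.commute)
    also have "emeasure ?P \<dots> = (\<Prod>i\<in>I. emeasure lborel ((+) (c i) -` A i))"
      by (rule emeasure_PiM[OF I]) (use vA in auto)
    also have "\<dots> = (\<Prod>i\<in>I. emeasure lborel (A i))"
    proof (rule prod.cong)
      fix i assume "i \<in> I"
      then have "emeasure (distr lborel borel ((+) (c i))) (A i) = emeasure lborel ((+) (c i) -` A i)"
        using A by (subst emeasure_distr) auto
      then show "emeasure lborel ((+) (c i) -` A i) = emeasure lborel (A i)" by (simp add: lborel_distr_plus)
    qed simp
    finally show "emeasure (distr ?P ?P ?f) (PiE I A) = (\<Prod>i\<in>I. emeasure lborel (A i))" .
  qed simp
qed

locale number_field_points = integral_basis d b \<phi>
  for d and b :: "nat \<Rightarrow> 'k::field_char_0" and \<phi> +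
  fixes s t :: nat and \<sigma> :: "nat \<Rightarrow> 'k \<Rightarrow> real" and \<tau> :: "nat \<Rightarrow> 'k \<Rightarrow> complex"
  assumes real_embeddings: "enumerates_real_embeddings s \<sigma>"
    and complex_embeddings: "represents_complex_pairs t \<tau>"
begin

text \<open>The Borel product measure before completion; only null sets have to be carried over to
  \<open>lebesgue_st\<close> afterwards.\<close>

definition PM :: "point measure" where
  "PM = (\<Pi>\<^sub>M i\<in>{1..s}. lborel) \<Otimes>\<^sub>M (\<Pi>\<^sub>M j\<in>{1..t}. lborel)"

definition tr :: "'k \<Rightarrow> point \<Rightarrow> point" where
  "tr \<gamma> x = point_add s t x (\<iota> s t \<sigma> \<tau> \<gamma>)"

definition polydisc :: "(nat \<Rightarrow> real) \<Rightarrow> (nat \<Rightarrow> real) \<Rightarrow> point set" where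
  "polydisc r R = PiE {1..s} (\<lambda>i. cball 0 (r i)) \<times> PiE {1..t} (\<lambda>j. cball 0 (R j))"

definition vol :: "(nat \<Rightarrow> real) \<Rightarrow> (nat \<Rightarrow> real) \<Rightarrow> real" where
  "vol r R = (\<Prod>i\<in>{1..s}. 2 * r i) * (\<Prod>j\<in>{1..t}. pi * (R j)\<^sup>2)"

lemma space_PM: "space PM = PiE {1..s} (\<lambda>_. UNIV) \<times> PiE {1..t} (\<lambda>_. UNIV)"
  by (simp add: PM_def space_pair_measure space_PiM)

lemma sigma_finite_components:
  "sigma_finite_measure (\<Pi>\<^sub>M i\<in>{1..s}. (lborel :: real measure))"
  "sigma_finite_measure (\<Pi>\<^sub>M j\<in>{1..t}. (lborel :: complex measure))"
proof -
  interpret r: product_sigma_finite "\<lambda>_::nat. lborel :: real measure" by standard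
  interpret c: product_sigma_finite "\<lambda>_::nat. lborel :: complex measure" by standard
  show "sigma_finite_measure (\<Pi>\<^sub>M i\<in>{1..s}. (lborel :: real measure))" by (rule r.sigma_finite) simp
  show "sigma_finite_measure (\<Pi>\<^sub>M j\<in>{1..t}. (lborel :: complex measure))" by (rule c.sigma_finite) simp
qed

lemma emeasure_PM_Times:
  assumes "A \<in> sets (\<Pi>\<^sub>M i\<in>{1..s}. lborel)" "B \<in> sets (\<Pi>\<^sub>M j\<in>{1..t}. lborel)"
  shows "emeasure PM (A \<times> B) = emeasure (\<Pi>\<^sub>M i\<in>{1..s}. lborel) A * emeasure (\<Pi>\<^sub>M j\<in>{1..t}. lborel) B"
  unfolding PM_def using sigma_finite_measure.emeasure_pair_measure_Times[OF sigma_finite_components(2) assms] .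

lemma measurable_tr [measurable]: "tr \<gamma> \<in> measurable PM PM"
  unfolding tr_def point_add_def PM_def \<iota>_def
  by (intro measurable_Pair measurable_restrict) auto

lemma tr_in_space: "tr \<gamma> x \<in> space PM"
  by (simp add: space_PM tr_def point_add_def)

lemma fst_tr: "i \<in> {1..s} \<Longrightarrow> fst (tr \<gamma> x) i = fst x i + \<sigma> i \<gamma>"
  by (simp add: tr_def point_add_def \<iota>_def)

lemma snd_tr: "j \<in> {1..t} \<Longrightarrow> snd (tr \<gamma> x) j = snd x j + \<tau> j \<gamma>"
  by (simp add: tr_def point_add_def \<iota>_def)

lemma point_eqI:
  assumes "x \<in> space PM" "y \<in> space PM" "\<And>i. i \<in> {1..s} \<Longrightarrow> fst x i = fst y i"
    "\<And>j. j \<in> {1..t} \<Longrightarrow> snd x j = snd y j"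
  shows "x = y"
proof (rule prod_eqI)
  show "fst x = fst y" by (rule PiE_ext[of _ "{1..s}" "\<lambda>_. UNIV"]) (use assms in \<open>auto simp: space_PM\<close>)
  show "snd x = snd y" by (rule PiE_ext[of _ "{1..t}" "\<lambda>_. UNIV"]) (use assms in \<open>auto simp: space_PM\<close>)
qed

lemma field_embedding_\<sigma>: "i \<in> {1..s} \<Longrightarrow> field_embedding (\<sigma> i)"
  using real_embeddings by (auto simp: enumerates_real_embeddings_def bij_betw_def)

lemma field_embedding_\<tau>: "j \<in> {1..t} \<Longrightarrow> field_embedding (\<tau> j)"
  using complex_embeddings by (auto simp: represents_complex_pairs_def nonreal_embeddings_def)

lemma tr_add: "tr \<gamma> (tr \<gamma>' x) = tr (\<gamma> + \<gamma>') x"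
  by (rule point_eqI)
    (auto simp: tr_in_space fst_tr snd_tr field_embedding_simps field_embedding_\<sigma> field_embedding_\<tau>)

lemma tr_zero: "x \<in> space PM \<Longrightarrow> tr 0 x = x"
  by (rule point_eqI)
    (auto simp: tr_in_space fst_tr snd_tr field_embedding_simps field_embedding_\<sigma> field_embedding_\<tau>)

lemma distr_tr: "distr PM PM (tr \<gamma>) = PM"
proof -
  let ?A = "\<Pi>\<^sub>M i\<in>{1..s}. (lborel :: real measure)" and ?B = "\<Pi>\<^sub>M j\<in>{1..t}. (lborel :: complex measure)"
  let ?f = "\<lambda>x. \<lambda>i\<in>{1..s}. x i + \<sigma> i \<gamma>" and ?g = "\<lambda>x. \<lambda>j\<in>{1..t}. x j + \<tau> j \<gamma>"
  have f: "distr ?A ?A ?f = ?A" and g: "distr ?B ?B ?g = ?B"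
    by (rule PiM_lborel_translate, simp)+
  have "distr ?A ?A ?f \<Otimes>\<^sub>M distr ?B ?B ?g = distr (?A \<Otimes>\<^sub>M ?B) (?A \<Otimes>\<^sub>M ?B) (\<lambda>(x, y). (?f x, ?g y))"
  proof (rule pair_measure_distr)
    show "?f \<in> measurable ?A ?A" by (rule measurable_restrict) measurable
    show "?g \<in> measurable ?B ?B" by (rule measurable_restrict) measurable
    show "sigma_finite_measure (distr ?B ?B ?g)" unfolding g by (rule sigma_finite_components)
  qed
  moreover have "tr \<gamma> = (\<lambda>(x, y). (?f x, ?g y))"
    by (auto simp: tr_def point_add_def \<iota>_def fun_eq_iff)
  ultimately show ?thesis unfolding f g PM_def by simp
qed

lemma nn_integral_tr:
  assumes [measurable]: "h \<in> borel_measurable PM"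
  shows "(\<integral>\<^sup>+x. h (tr \<gamma> x) \<partial>PM) = (\<integral>\<^sup>+x. h x \<partial>PM)"
proof -
  have "(\<integral>\<^sup>+x. h x \<partial>PM) = (\<integral>\<^sup>+x. h x \<partial>distr PM PM (tr \<gamma>))" by (simp add: distr_tr)
  also have "\<dots> = (\<integral>\<^sup>+x. h (tr \<gamma> x) \<partial>PM)" by (rule nn_integral_distr) auto
  finally show ?thesis by simp
qed

lemma sets_polydisc [measurable]: "polydisc r R \<in> sets PM"
  unfolding polydisc_def PM_def by (intro pair_measureI sets_PiM_I_finite) auto

lemma mem_polydisc_iff:
  "x \<in> space PM \<Longrightarrow> x \<in> polydisc r R \<longleftrightarrow>
     (\<forall>i\<in>{1..s}. \<bar>fst x i\<bar> \<le> r i) \<and> (\<forall>j\<in>{1..t}. cmod (snd x j) \<le> R j)"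
  by (cases x) (auto simp: polydisc_def space_PM PiE_iff)

lemma emeasure_polydisc:
  assumes "\<And>i. i \<in> {1..s} \<Longrightarrow> r i \<ge> 0" "\<And>j. j \<in> {1..t} \<Longrightarrow> R j \<ge> 0"
  shows "emeasure PM (polydisc r R) = ennreal (vol r R)"
proof -
  interpret r: product_sigma_finite "\<lambda>_::nat. lborel :: real measure" by standard
  interpret c: product_sigma_finite "\<lambda>_::nat. lborel :: complex measure" by standard
  have "emeasure PM (polydisc r R) = (\<Prod>i\<in>{1..s}. emeasure lborel (cball (0::real) (r i)))
      * (\<Prod>j\<in>{1..t}. emeasure lborel (cball (0::complex) (R j)))"
    unfolding polydisc_def
    by (subst emeasure_PM_Times) (auto intro!: sets_PiM_I_finite simp: r.emeasure_PiM c.emeasure_PiM)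
  also have "(\<Prod>i\<in>{1..s}. emeasure lborel (cball (0::real) (r i))) = (\<Prod>i\<in>{1..s}. ennreal (2 * r i))"
    by (intro prod.cong) (use assms in \<open>auto simp: emeasure_cball\<close>)
  also have "(\<Prod>j\<in>{1..t}. emeasure lborel (cball (0::complex) (R j))) = (\<Prod>j\<in>{1..t}. ennreal (pi * (R j)\<^sup>2))"
    by (intro prod.cong) (use assms in \<open>auto simp: emeasure_cball unit_ball_vol_2\<close>)
  also have "(\<Prod>i\<in>{1..s}. ennreal (2 * r i)) * (\<Prod>j\<in>{1..t}. ennreal (pi * (R j)\<^sup>2)) = ennreal (vol r R)"
  proof -
    have "(\<Prod>i\<in>{1..s}. ennreal (2 * r i)) = ennreal (\<Prod>i\<in>{1..s}. 2 * r i)"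
      using assms(1) by (intro prod_ennreal) simp
    moreover have "(\<Prod>j\<in>{1..t}. ennreal (pi * (R j)\<^sup>2)) = ennreal (\<Prod>j\<in>{1..t}. pi * (R j)\<^sup>2)"
      by (intro prod_ennreal) simp
    ultimately show ?thesis unfolding vol_def using assms
      by (simp add: ennreal_mult'' prod_nonneg)
  qed
  finally show ?thesis .
qed

section \<open>Lattice coordinates of points at the archimedean places\<close>

abbreviation \<sigma>' :: "nat \<Rightarrow> 'k \<Rightarrow> complex" where "\<sigma>' i \<equiv> of_real \<circ> \<sigma> i"

abbreviation \<tau>' :: "nat \<Rightarrow> 'k \<Rightarrow> complex" where "\<tau>' j \<equiv> cnj \<circ> \<tau> j"

lemma embeddings_in_Emb: "i \<in> {1..s} \<Longrightarrow> \<sigma>' i \<in> Emb" "j \<in> {1..t} \<Longrightarrow> \<tau> j \<in> Emb" "j \<in> {1..t} \<Longrightarrow> \<tau>' j \<in> Emb"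
  using field_embedding_\<sigma>[of i] field_embedding_\<tau>[of j] by (auto simp: Emb_def field_embedding_def)

lemma \<tau>_nonreal: assumes "j \<in> {1..t}" shows "\<exists>x. \<tau> j x \<noteq> cnj (\<tau> j x)"
proof -
  have "\<tau> j \<in> nonreal_embeddings" using complex_embeddings assms by (simp add: represents_complex_pairs_def)
  then obtain x where "\<tau> j x \<notin> \<real>" unfolding nonreal_embeddings_def by blast
  then show ?thesis unfolding Reals_cnj_iff by metis
qed

lemma Emb_cases:
  assumes "f \<in> Emb"
  shows "(\<exists>i\<in>{1..s}. f = \<sigma>' i) \<or> (\<exists>j\<in>{1..t}. f = \<tau> j \<or> f = \<tau>' j)"
proof (cases "range f \<subseteq> \<real>")
  case True
  have re: "f x = of_real (Re (f x))" for x using True by (metis rangeI subset_eq of_real_Re)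
  have fe: "field_embedding f" using assms by (simp add: Emb_def)
  have im: "Im (f x) = 0" for x using re[of x] by (metis Im_complex_of_real)
  have "field_embedding (\<lambda>x. Re (f x))"
    unfolding field_embedding_def using fe im by (auto simp: field_embedding_simps)
  then have "(\<lambda>x. Re (f x)) \<in> \<sigma> ` {1..s}"
    using real_embeddings by (simp add: enumerates_real_embeddings_def bij_betw_def)
  then obtain i where i: "i \<in> {1..s}" "(\<lambda>x. Re (f x)) = \<sigma> i" by (rule imageE)
  have "f = \<sigma>' i" unfolding i(2)[symmetric] using re by (auto simp: fun_eq_iff)
  with i(1) show ?thesis by blast
next
  case False
  then have "f \<in> nonreal_embeddings" using assms by (simp add: nonreal_embeddings_def Emb_def)
  then show ?thesis using complex_embeddings unfolding represents_complex_pairs_def by blast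
qed

lemma \<sigma>_inj: "i \<in> {1..s} \<Longrightarrow> i' \<in> {1..s} \<Longrightarrow> \<sigma>' i = \<sigma>' i' \<longleftrightarrow> i = i'"
  using real_embeddings unfolding enumerates_real_embeddings_def bij_betw_def inj_on_def
  by (metis (no_types, lifting) comp_apply ext of_real_eq_iff)

lemma \<sigma>_neq_\<tau>: "j \<in> {1..t} \<Longrightarrow> \<sigma>' i \<noteq> \<tau> j" "j \<in> {1..t} \<Longrightarrow> \<sigma>' i \<noteq> \<tau>' j"
  using \<tau>_nonreal[of j] by (metis comp_apply complex_cnj_complex_of_real complex_cnj_cnj)+

lemma \<tau>_inj: "j \<in> {1..t} \<Longrightarrow> j' \<in> {1..t} \<Longrightarrow> \<tau> j = \<tau> j' \<longleftrightarrow> j = j'"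
  and \<tau>_neq_cnj: "j \<in> {1..t} \<Longrightarrow> j' \<in> {1..t} \<Longrightarrow> \<tau> j \<noteq> \<tau>' j'"
proof -
  assume j: "j \<in> {1..t}" "j' \<in> {1..t}"
  have "\<tau> j \<in> nonreal_embeddings" using complex_embeddings j by (auto simp: represents_complex_pairs_def)
  then have ex1: "\<exists>!i. i \<in> {1..t} \<and> (\<tau> j = \<tau> i \<or> \<tau> j = cnj \<circ> \<tau> i)"
    using complex_embeddings by (auto simp: represents_complex_pairs_def)
  show "\<tau> j = \<tau> j' \<longleftrightarrow> j = j'" using ex1 j by blast
  show "\<tau> j \<noteq> \<tau>' j'"
  proof
    assume e: "\<tau> j = \<tau>' j'"
    then have "j = j'" using ex1 j by blast
    with e \<tau>_nonreal[OF j(1)] show False by (metis comp_apply)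
  qed
qed

lemma sum_Emb:
  fixes g :: "('k \<Rightarrow> complex) \<Rightarrow> 'a::comm_monoid_add"
  shows "(\<Sum>f\<in>Emb. g f) = (\<Sum>i\<in>{1..s}. g (\<sigma>' i)) + (\<Sum>j\<in>{1..t}. g (\<tau> j) + g (\<tau>' j))"
proof -
  let ?S = "\<sigma>' ` {1..s}" and ?T = "\<tau> ` {1..t}" and ?T' = "\<tau>' ` {1..t}"
  have inj: "inj_on \<sigma>' {1..s}" "inj_on \<tau> {1..t}" "inj_on \<tau>' {1..t}"
  proof -
    show "inj_on \<sigma>' {1..s}" by (rule inj_onI) (use \<sigma>_inj in blast)
    show "inj_on \<tau> {1..t}" by (rule inj_onI) (use \<tau>_inj in blast)
    show "inj_on \<tau>' {1..t}"
    proof (rule inj_onI)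
      fix j j' assume j: "j \<in> {1..t}" "j' \<in> {1..t}" "\<tau>' j = \<tau>' j'"
      then have "\<tau> j x = \<tau> j' x" for x by (metis comp_apply complex_cnj_cancel_iff)
      then show "j = j'" using \<tau>_inj j by blast
    qed
  qed
  have E: "Emb = ?S \<union> (?T \<union> ?T')" using Emb_cases embeddings_in_Emb by blast
  have "(\<Sum>f\<in>Emb. g f) = sum g ?S + sum g (?T \<union> ?T')"
    unfolding E using \<sigma>_neq_\<tau> by (intro sum.union_disjoint) auto
  also have "sum g (?T \<union> ?T') = sum g ?T + sum g ?T'"
    using \<tau>_neq_cnj by (intro sum.union_disjoint) auto
  moreover have "sum g ?S = (\<Sum>i\<in>{1..s}. g (\<sigma>' i))"
    by (subst sum.reindex[OF inj(1)], rule sum.cong[OF refl], simp only: comp_apply)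
  moreover have "sum g ?T = (\<Sum>j\<in>{1..t}. g (\<tau> j))"
    by (subst sum.reindex[OF inj(2)], rule sum.cong[OF refl], simp only: comp_apply)
  moreover have "sum g ?T' = (\<Sum>j\<in>{1..t}. g (\<tau>' j))"
    by (subst sum.reindex[OF inj(3)], rule sum.cong[OF refl], simp only: comp_apply)
  ultimately show ?thesis by (simp only: sum.distrib)
qed

text \<open>The real-linear extension of the coordinate \<open>\<phi> j\<close> from the embedded
  field to the whole space; \<open>2 * Re\<close> collects the contributions of a complex embedding
  and its conjugate.\<close>

definition lin :: "nat \<Rightarrow> point \<Rightarrow> real" where
  "lin j x = (\<Sum>i\<in>{1..s}. Re (emb_coeff j (\<sigma>' i)) * fst x i)
     + (\<Sum>i\<in>{1..t}. 2 * Re (emb_coeff j (\<tau> i) * snd x i))"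

lemma emb_coeff_\<sigma>_real: "j < d \<Longrightarrow> i \<in> {1..s} \<Longrightarrow> of_real (Re (emb_coeff j (\<sigma>' i))) = emb_coeff j (\<sigma>' i)"
proof -
  assume j: "j < d" "i \<in> {1..s}"
  have "cnj \<circ> \<sigma>' i = \<sigma>' i" by (auto simp: fun_eq_iff)
  then have "emb_coeff j (\<sigma>' i) = cnj (emb_coeff j (\<sigma>' i))"
    using emb_coeff_cnj[OF j(1) embeddings_in_Emb(1)[OF j(2)]] by metis
  then show ?thesis by (metis Reals_cnj_iff of_real_Re)
qed

lemma lin_complex:
  assumes "j < d"
  shows "of_real (lin j x) = (\<Sum>i\<in>{1..s}. emb_coeff j (\<sigma>' i) * of_real (fst x i))
     + (\<Sum>i\<in>{1..t}. emb_coeff j (\<tau> i) * snd x i + emb_coeff j (\<tau>' i) * cnj (snd x i))"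
proof -
  have 1: "of_real (2 * Re z) = z + cnj z" for z by (simp add: complex_add_cnj)
  have "(\<Sum>i\<in>{1..t}. of_real (2 * Re (emb_coeff j (\<tau> i) * snd x i)))
      = (\<Sum>i\<in>{1..t}. emb_coeff j (\<tau> i) * snd x i + emb_coeff j (\<tau>' i) * cnj (snd x i))"
    by (intro sum.cong refl, subst 1) (use emb_coeff_cnj[OF assms] embeddings_in_Emb in simp)
  moreover have "(\<Sum>i\<in>{1..s}. of_real (Re (emb_coeff j (\<sigma>' i)) * fst x i))
      = (\<Sum>i\<in>{1..s}. emb_coeff j (\<sigma>' i) * of_real (fst x i))"
    using emb_coeff_\<sigma>_real[OF assms] by (intro sum.cong) (auto simp: of_real_mult)
  ultimately show ?thesis unfolding lin_def of_real_add of_real_sum by simp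
qed

lemma lin_\<iota>: assumes "j < d" shows "lin j (tr \<gamma> x) = lin j x + of_rat (\<phi> j \<gamma>)"
proof -
  have "complex_of_real (lin j (tr \<gamma> x)) = of_real (lin j x) + ((\<Sum>i\<in>{1..s}. emb_coeff j (\<sigma>' i) * of_real (\<sigma> i \<gamma>))
     + (\<Sum>i\<in>{1..t}. emb_coeff j (\<tau> i) * \<tau> i \<gamma> + emb_coeff j (\<tau>' i) * cnj (\<tau> i \<gamma>)))"
  proof -
    have "(\<Sum>i\<in>{1..s}. emb_coeff j (\<sigma>' i) * of_real (fst (tr \<gamma> x) i))
        = (\<Sum>i\<in>{1..s}. emb_coeff j (\<sigma>' i) * of_real (fst x i)) + (\<Sum>i\<in>{1..s}. emb_coeff j (\<sigma>' i) * of_real (\<sigma> i \<gamma>))"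
      unfolding sum.distrib[symmetric] by (intro sum.cong) (auto simp: fst_tr distrib_left)
    moreover have "(\<Sum>i\<in>{1..t}. emb_coeff j (\<tau> i) * snd (tr \<gamma> x) i + emb_coeff j (\<tau>' i) * cnj (snd (tr \<gamma> x) i))
        = (\<Sum>i\<in>{1..t}. emb_coeff j (\<tau> i) * snd x i + emb_coeff j (\<tau>' i) * cnj (snd x i))
          + (\<Sum>i\<in>{1..t}. emb_coeff j (\<tau> i) * \<tau> i \<gamma> + emb_coeff j (\<tau>' i) * cnj (\<tau> i \<gamma>))"
      unfolding sum.distrib[symmetric] by (intro sum.cong) (auto simp: snd_tr distrib_left)
    ultimately show ?thesis unfolding lin_complex[OF assms] by (simp only: add_ac)
  qed
  also have "(\<Sum>i\<in>{1..s}. emb_coeff j (\<sigma>' i) * of_real (\<sigma> i \<gamma>))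
     + (\<Sum>i\<in>{1..t}. emb_coeff j (\<tau> i) * \<tau> i \<gamma> + emb_coeff j (\<tau>' i) * cnj (\<tau> i \<gamma>)) = of_rat (\<phi> j \<gamma>)"
    unfolding coord_emb_coeff[OF assms] sum_Emb by simp
  also have "\<dots> = of_real (of_rat (\<phi> j \<gamma>))"
    using additive_rat_linear[of complex_of_real "\<phi> j \<gamma>" 1] by simp
  finally show ?thesis by (simp only: of_real_add[symmetric] of_real_eq_iff)
qed

text \<open>The duality of \<open>emb_coeff\<close> with the values \<open>g (b j)\<close> inverts
  the coordinate map. Distinctness of the embeddings leaves a single term on the right.\<close>

lemma point_from_lin:
  assumes x: "x \<in> space PM"
  shows "i \<in> {1..s} \<Longrightarrow> fst x i = (\<Sum>j<d. lin j x * \<sigma> i (b j))"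
    and "i \<in> {1..t} \<Longrightarrow> snd x i = (\<Sum>j<d. of_real (lin j x) * \<tau> i (b j))"
proof -
  have main: "(\<Sum>j<d. of_real (lin j x) * g (b j))
      = (\<Sum>i\<in>{1..s}. (if \<sigma>' i = g then 1 else 0) * of_real (fst x i))
        + (\<Sum>i\<in>{1..t}. (if \<tau> i = g then 1 else 0) * snd x i + (if \<tau>' i = g then 1 else 0) * cnj (snd x i))"
    (is "_ = ?R") if g: "g \<in> Emb" for g
  proof -
    have dual: "(\<Sum>j<d. g (b j) * emb_coeff j f) = (if f = g then 1 else 0)" if "f \<in> Emb" for f
      using emb_coeff_dual[OF that g] by (simp add: mult.commute)
    have "(\<Sum>j<d. of_real (lin j x) * g (b j))
      = (\<Sum>j<d. (\<Sum>i\<in>{1..s}. (g (b j) * emb_coeff j (\<sigma>' i)) * of_real (fst x i))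
        + (\<Sum>i\<in>{1..t}. (g (b j) * emb_coeff j (\<tau> i)) * snd x i + (g (b j) * emb_coeff j (\<tau>' i)) * cnj (snd x i)))"
    proof (rule sum.cong)
      fix j assume "j \<in> {..<d}"
      then show "of_real (lin j x) * g (b j) = (\<Sum>i\<in>{1..s}. (g (b j) * emb_coeff j (\<sigma>' i)) * of_real (fst x i))
        + (\<Sum>i\<in>{1..t}. (g (b j) * emb_coeff j (\<tau> i)) * snd x i + (g (b j) * emb_coeff j (\<tau>' i)) * cnj (snd x i))"
        using lin_complex[of j x] by (simp add: distrib_left distrib_right sum_distrib_left mult_ac)
    qed simp
    also have "\<dots> = (\<Sum>i\<in>{1..s}. (\<Sum>j<d. g (b j) * emb_coeff j (\<sigma>' i)) * of_real (fst x i))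
        + (\<Sum>i\<in>{1..t}. (\<Sum>j<d. g (b j) * emb_coeff j (\<tau> i)) * snd x i
            + (\<Sum>j<d. g (b j) * emb_coeff j (\<tau>' i)) * cnj (snd x i))"
      unfolding sum.distrib sum_distrib_right by (subst (1 2 3) sum.swap) simp
    also have "\<dots> = ?R" using dual embeddings_in_Emb by simp
    finally show ?thesis .
  qed
  show "fst x i = (\<Sum>j<d. lin j x * \<sigma> i (b j))" if i: "i \<in> {1..s}"
  proof -
    have "complex_of_real (\<Sum>j<d. lin j x * \<sigma> i (b j)) = (\<Sum>j<d. of_real (lin j x) * \<sigma>' i (b j))" by simp
    also have "\<dots> = (\<Sum>i'\<in>{1..s}. if i' = i then of_real (fst x i') else 0)"
    proof -
      have "\<tau> i' \<noteq> \<sigma>' i" "\<tau>' i' \<noteq> \<sigma>' i" if "i' \<in> {1..t}" for i' using \<sigma>_neq_\<tau>[OF that, of i] by metis+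
      then have "(\<Sum>i'\<in>{1..t}. (if \<tau> i' = \<sigma>' i then 1 else 0) * snd x i'
          + (if \<tau>' i' = \<sigma>' i then 1 else 0) * cnj (snd x i')) = 0"
        by (intro sum.neutral ballI) (simp only: if_False mult_zero_left add_0_left)
      moreover have "(\<Sum>i'\<in>{1..s}. (if \<sigma>' i' = \<sigma>' i then 1 else 0) * complex_of_real (fst x i'))
          = (\<Sum>i'\<in>{1..s}. if i' = i then of_real (fst x i') else 0)"
        using \<sigma>_inj[OF _ i] by (intro sum.cong refl) (simp del: comp_apply)
      ultimately show ?thesis unfolding main[OF embeddings_in_Emb(1)[OF i]] by (simp only: add_0_right)
    qed
    also have "\<dots> = of_real (fst x i)" using i by simp
    finally show ?thesis by (metis of_real_eq_iff)
  qed
  show "snd x i = (\<Sum>j<d. of_real (lin j x) * \<tau> i (b j))" if i: "i \<in> {1..t}"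
  proof -
    have ne: "\<tau>' i' \<noteq> \<tau> i" if "i' \<in> {1..t}" for i' using \<tau>_neq_cnj[OF i that] by metis
    have "(\<Sum>j<d. of_real (lin j x) * \<tau> i (b j)) = (\<Sum>i'\<in>{1..t}. if i' = i then snd x i' else 0)"
    proof -
      have "(\<Sum>i'\<in>{1..s}. (if \<sigma>' i' = \<tau> i then 1 else 0) * complex_of_real (fst x i')) = 0"
        using \<sigma>_neq_\<tau>(1)[OF i] by (intro sum.neutral ballI) (simp only: if_False mult_zero_left)
      moreover have "(\<Sum>i'\<in>{1..t}. (if \<tau> i' = \<tau> i then 1 else 0) * snd x i'
          + (if \<tau>' i' = \<tau> i then 1 else 0) * cnj (snd x i')) = (\<Sum>i'\<in>{1..t}. if i' = i then snd x i' else 0)"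
        using \<tau>_inj[OF _ i] ne by (intro sum.cong refl) (simp del: comp_apply)
      ultimately show ?thesis unfolding main[OF embeddings_in_Emb(2)[OF i]] by (simp only: add_0_left)
    qed
    also have "\<dots> = snd x i" using i by simp
    finally show ?thesis by simp
  qed
qed

lemma measurable_lin [measurable]: "lin j \<in> borel_measurable PM"
proof -
  have 1: "(\<lambda>x. fst x i) \<in> measurable PM lborel" if "i \<in> {1..s}" for i
    unfolding PM_def by (rule measurable_compose[OF measurable_fst measurable_component_singleton[OF that]])
  have 2: "(\<lambda>x. snd x i) \<in> measurable PM lborel" if "i \<in> {1..t}" for i
    unfolding PM_def by (rule measurable_compose[OF measurable_snd measurable_component_singleton[OF that]])
  have [measurable]: "i \<in> {1..s} \<Longrightarrow> (\<lambda>x. fst x i) \<in> borel_measurable PM"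
    "j \<in> {1..t} \<Longrightarrow> (\<lambda>x. snd x j) \<in> borel_measurable PM" for i j using 1[of i] 2[of j] by simp_all
  show ?thesis unfolding lin_def[abs_def] by (intro borel_measurable_add borel_measurable_sum) auto
qed

section \<open>The fundamental parallelepiped and periodisation\<close>

abbreviation OK :: "'k set" where "OK \<equiv> {a. algebraic_int a}"

lemma countable_field: "countable (UNIV :: 'k set)"
proof -
  have "(UNIV :: 'k set) \<subseteq> (\<lambda>q. \<Sum>j<d. of_rat (q j) * b j) ` PiE {..<d} (\<lambda>_. UNIV)"
  proof
    fix x :: 'k
    have "x = (\<Sum>j<d. of_rat ((\<lambda>j\<in>{..<d}. \<phi> j x) j) * b j)" using expand[of x] by simp
    then show "x \<in> (\<lambda>q. \<Sum>j<d. of_rat (q j) * b j) ` PiE {..<d} (\<lambda>_. UNIV)"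
      by (intro image_eqI[of _ _ "\<lambda>j\<in>{..<d}. \<phi> j x"]) simp_all
  qed
  moreover have "countable (PiE {..<d} (\<lambda>_. UNIV :: rat set))" by (intro countable_PiE) auto
  ultimately show ?thesis by (rule countable_subset[OF _ countable_image])
qed

lemma countable_OK: "countable OK"
  by (rule countable_subset[OF subset_UNIV countable_field])

text \<open>The half-open parallelepiped of the integral basis. Every point, not merely almost every
  one, has exactly one integral translate in it.\<close>

definition D0 :: "point set" where
  "D0 = {x \<in> space PM. \<forall>j\<in>{..<d}. 0 \<le> lin j x \<and> lin j x < 1}"

lemma sets_D0 [measurable]: "D0 \<in> sets PM"
  unfolding D0_def by measurable

lemma D0_subset_space: "D0 \<subseteq> space PM"
  by (auto simp: D0_def)

lemma D0_translate_unique: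
  assumes x: "x \<in> space PM"
  obtains a where "a \<in> OK" "\<And>c. c \<in> OK \<Longrightarrow> tr c x \<in> D0 \<longleftrightarrow> c = a"
proof -
  define a where "a = (\<Sum>j<d. of_rat (of_int (- \<lfloor>lin j x\<rfloor>)) * b j)"
  have \<phi>a: "\<phi> j a = of_int (- \<lfloor>lin j x\<rfloor>)" if "j < d" for j unfolding a_def by (rule coord_combination[OF that])
  have a: "a \<in> OK" using \<phi>a by (simp add: algebraic_int_iff_coords)
  have "tr c x \<in> D0 \<longleftrightarrow> c = a" if c: "c \<in> OK" for c
  proof
    assume cD: "tr c x \<in> D0"
    show "c = a"
    proof (rule coord_eqI)
      fix j assume j: "j < d"
      have "\<phi> j c \<in> \<int>" using c j by (simp add: algebraic_int_iff_coords)
      then obtain m where m: "\<phi> j c = of_int m" by (rule Ints_cases)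
      have "0 \<le> lin j (tr c x) \<and> lin j (tr c x) < 1" using cD j by (auto simp: D0_def)
      then have "0 \<le> lin j x + of_int m" "lin j x + of_int m < 1"
        unfolding lin_\<iota>[OF j] m by simp_all
      then have "m = - \<lfloor>lin j x\<rfloor>" by linarith
      then show "\<phi> j c = \<phi> j a" using m \<phi>a[OF j] by simp
    qed
  next
    assume "c = a"
    moreover have "0 \<le> lin j (tr a x) \<and> lin j (tr a x) < 1" if "j < d" for j
    proof -
      have "lin j (tr a x) = lin j x - of_int \<lfloor>lin j x\<rfloor>"
        unfolding lin_\<iota>[OF that] \<phi>a[OF that] of_rat_of_int_eq by simp
      then show ?thesis by linarith
    qed
    ultimately show "tr c x \<in> D0" unfolding D0_def using tr_in_space by simp
  qed
  with a show ?thesis by (rule that)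
qed

lemma sum_translates_D0:
  assumes x: "x \<in> space PM"
  shows "(\<integral>\<^sup>+a. indicator D0 (tr (- a) x) \<partial>count_space OK) = (1 :: ennreal)"
proof -
  obtain a where a: "a \<in> OK" "\<And>c. c \<in> OK \<Longrightarrow> tr c x \<in> D0 \<longleftrightarrow> c = a" using D0_translate_unique[OF x] by blast
  have "(\<integral>\<^sup>+c. indicator D0 (tr (- c) x) \<partial>count_space OK) = (\<integral>\<^sup>+c. indicator {- a} c \<partial>count_space OK)"
  proof (rule nn_integral_cong)
    fix c assume "c \<in> space (count_space OK)"
    then have "tr (- c) x \<in> D0 \<longleftrightarrow> - c = a" using a(2)[of "- c"] by simp
    then show "indicator D0 (tr (- c) x) = (indicator {- a} c :: ennreal)" by (auto split: split_indicator)
  qed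
  also have "\<dots> = 1" using a(1) by simp
  finally show ?thesis .
qed

text \<open>Periodisation over the lattice, written as an integral against counting measure so that
  sums and integrals can be exchanged.\<close>

definition per :: "(point \<Rightarrow> ennreal) \<Rightarrow> point \<Rightarrow> ennreal" where
  "per h x = (\<integral>\<^sup>+a. h (tr a x) \<partial>count_space OK)"

lemma measurable_per [measurable]:
  assumes [measurable]: "h \<in> borel_measurable PM"
  shows "per h \<in> borel_measurable PM"
proof -
  interpret sigma_finite_measure "count_space OK"
    by (rule sigma_finite_measure_count_space_countable[OF countable_OK])
  have "(\<lambda>(a, x). h (tr a x)) \<in> borel_measurable (count_space OK \<Otimes>\<^sub>M PM)"
    by (rule measurable_pair_measure_countable1[OF countable_OK]) auto
  then have "(\<lambda>(x, a). h (tr a x)) \<in> borel_measurable (PM \<Otimes>\<^sub>M count_space OK)"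
    by (subst (asm) measurable_pair_swap_iff) (simp add: case_prod_beta')
  then show ?thesis unfolding per_def[abs_def] by (rule borel_measurable_nn_integral)
qed

lemma per_periodic: "c \<in> OK \<Longrightarrow> per h (tr c x) = per h x"
proof -
  assume c: "c \<in> OK"
  have "bij_betw (\<lambda>a. a + c) OK OK"
    by (rule bij_betw_byWitness[where f' = "\<lambda>a. a - c"])
      (use c in \<open>auto intro: algebraic_int_add_mult algebraic_int_diff\<close>)
  from nn_integral_bij_count_space[OF this, of "\<lambda>a. h (tr a x)"]
  show ?thesis by (simp add: per_def tr_add)
qed

text \<open>After exchanging sum and integral and translating each term, the translated indicators
  of \<open>D0\<close> add up to 1 at every point.\<close>

theorem unfolding_integral:
  assumes [measurable]: "h \<in> borel_measurable PM" "g \<in> borel_measurable PM"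
    and g: "\<And>a x. a \<in> OK \<Longrightarrow> x \<in> space PM \<Longrightarrow> g (tr a x) = g x"
  shows "(\<integral>\<^sup>+x. per h x * g x * indicator D0 x \<partial>PM) = (\<integral>\<^sup>+x. h x * g x \<partial>PM)"
proof -
  have "(\<integral>\<^sup>+x. per h x * g x * indicator D0 x \<partial>PM)
      = (\<integral>\<^sup>+x. \<integral>\<^sup>+a. h (tr a x) * (g x * indicator D0 x) \<partial>count_space OK \<partial>PM)"
    unfolding per_def by (simp add: nn_integral_multc mult.assoc)
  also have "\<dots> = (\<integral>\<^sup>+a. \<integral>\<^sup>+x. h (tr a x) * (g x * indicator D0 x) \<partial>PM \<partial>count_space OK)"
    by (rule nn_integral_count_space_nn_integral[OF countable_OK]) measurable
  also have "\<dots> = (\<integral>\<^sup>+a. \<integral>\<^sup>+x. h x * g x * indicator D0 (tr (- a) x) \<partial>PM \<partial>count_space OK)"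
  proof (rule nn_integral_cong)
    fix a assume a: "a \<in> space (count_space OK)"
    let ?k = "\<lambda>y. h y * g y * indicator D0 (tr (- a) y)"
    have "(\<integral>\<^sup>+x. h (tr a x) * (g x * indicator D0 x) \<partial>PM) = (\<integral>\<^sup>+x. ?k (tr a x) \<partial>PM)"
      by (rule nn_integral_cong) (use a g in \<open>simp add: tr_add tr_zero mult.assoc\<close>)
    also have "\<dots> = (\<integral>\<^sup>+x. ?k x \<partial>PM)" by (rule nn_integral_tr) measurable
    finally show "(\<integral>\<^sup>+x. h (tr a x) * (g x * indicator D0 x) \<partial>PM) = (\<integral>\<^sup>+x. ?k x \<partial>PM)" .
  qed
  also have "\<dots> = (\<integral>\<^sup>+x. \<integral>\<^sup>+a. h x * g x * indicator D0 (tr (- a) x) \<partial>count_space OK \<partial>PM)"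
    by (rule nn_integral_count_space_nn_integral[OF countable_OK, symmetric]) measurable
  also have "\<dots> = (\<integral>\<^sup>+x. h x * g x \<partial>PM)"
    by (rule nn_integral_cong) (simp add: nn_integral_cmult sum_translates_D0)
  finally show ?thesis .
qed

lemma emeasure_tr_vimage:
  assumes A: "A \<in> sets PM"
  shows "emeasure PM {x \<in> space PM. tr \<gamma> x \<in> A} = emeasure PM A"
proof -
  have "emeasure PM A = emeasure (distr PM PM (tr \<gamma>)) A" by (simp add: distr_tr)
  also have "\<dots> = emeasure PM (tr \<gamma> -` A \<inter> space PM)" by (rule emeasure_distr) (use A in auto)
  also have "tr \<gamma> -` A \<inter> space PM = {x \<in> space PM. tr \<gamma> x \<in> A}" by auto
  finally show ?thesis by simp
qed

lemma mem_polydisc_tr: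
  "tr (- \<gamma>) x \<in> polydisc r R \<longleftrightarrow>
     (\<forall>i\<in>{1..s}. \<bar>fst x i - \<sigma> i \<gamma>\<bar> \<le> r i) \<and> (\<forall>j\<in>{1..t}. cmod (snd x j - \<tau> j \<gamma>) \<le> R j)"
proof -
  have "fst (tr (- \<gamma>) x) i = fst x i - \<sigma> i \<gamma>" if "i \<in> {1..s}" for i
    using fst_tr[OF that] field_embedding_simps(5)[OF field_embedding_\<sigma>[OF that]] by simp
  moreover have "snd (tr (- \<gamma>) x) j = snd x j - \<tau> j \<gamma>" if "j \<in> {1..t}" for j
    using snd_tr[OF that] field_embedding_simps(5)[OF field_embedding_\<tau>[OF that]] by simp
  ultimately show ?thesis unfolding mem_polydisc_iff[OF tr_in_space] by simp
qed

lemma D0_bounded: "\<exists>R > 0. D0 \<subseteq> polydisc (\<lambda>_. R) (\<lambda>_. R)"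
proof -
  define A where "A = (\<Sum>i\<in>{1..s}. \<Sum>j<d. \<bar>\<sigma> i (b j)\<bar>)"
  define B where "B = (\<Sum>i\<in>{1..t}. \<Sum>j<d. cmod (\<tau> i (b j)))"
  have AB: "A \<ge> 0" "B \<ge> 0" by (auto simp: A_def B_def intro!: sum_nonneg)
  have "x \<in> polydisc (\<lambda>_. 1 + A + B) (\<lambda>_. 1 + A + B)" if x: "x \<in> D0" for x
  proof -
    have xs: "x \<in> space PM" and l: "\<And>j. j < d \<Longrightarrow> 0 \<le> lin j x" "\<And>j. j < d \<Longrightarrow> lin j x \<le> 1"
      using x by (auto simp: D0_def less_imp_le)
    have "\<bar>fst x i\<bar> \<le> 1 + A + B" if i: "i \<in> {1..s}" for i
    proof -
      have "\<bar>fst x i\<bar> \<le> (\<Sum>j<d. \<bar>\<sigma> i (b j)\<bar>)"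
        unfolding point_from_lin(1)[OF xs i]
        by (rule order.trans[OF sum_abs sum_mono]) (use l in \<open>auto simp: abs_mult intro!: mult_left_le_one_le\<close>)
      also have "\<dots> \<le> A" unfolding A_def
        by (rule member_le_sum[OF i]) (auto intro: sum_nonneg)
      finally show ?thesis using AB by simp
    qed
    moreover have "cmod (snd x i) \<le> 1 + A + B" if i: "i \<in> {1..t}" for i
    proof -
      have "cmod (snd x i) \<le> (\<Sum>j<d. cmod (\<tau> i (b j)))"
        unfolding point_from_lin(2)[OF xs i]
        by (rule order.trans[OF norm_sum sum_mono]) (use l in \<open>auto simp: norm_mult intro!: mult_left_le_one_le\<close>)
      also have "\<dots> \<le> B" unfolding B_def
        by (rule member_le_sum[OF i]) (auto intro: sum_nonneg)
      finally show ?thesis using AB by simp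
    qed
    ultimately show ?thesis using xs by (simp add: mem_polydisc_iff)
  qed
  then show ?thesis using AB by (intro exI[of _ "1 + A + B"]) auto
qed

lemma vol_scale: "vol (\<lambda>i. k * r i) (\<lambda>j. k * R j) = k ^ (s + 2 * t) * vol r R"
proof -
  have "(\<Prod>i\<in>{1..s}. 2 * (k * r i)) = k ^ s * (\<Prod>i\<in>{1..s}. 2 * r i)"
    by (simp add: prod.distrib mult_ac)
  moreover have "(\<Prod>j\<in>{1..t}. pi * (k * R j)\<^sup>2) = k ^ (2 * t) * (\<Prod>j\<in>{1..t}. pi * (R j)\<^sup>2)"
    unfolding power_mult by (simp add: prod.distrib power_mult_distrib mult_ac)
  ultimately show ?thesis by (simp add: vol_def power_add mult_ac)
qed

lemma vol_pos:
  assumes "\<And>i. i \<in> {1..s} \<Longrightarrow> r i > 0" "\<And>j. j \<in> {1..t} \<Longrightarrow> R j > 0" shows "vol r R > 0"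
proof -
  have "0 < (\<Prod>i\<in>{1..s}. 2 * r i)" by (rule prod_pos) (use assms(1) in simp)
  moreover have "0 < pi * (R j)\<^sup>2" if "j \<in> {1..t}" for j using assms(2)[OF that] by simp
  then have "0 < (\<Prod>j\<in>{1..t}. pi * (R j)\<^sup>2)" by (rule prod_pos)
  ultimately show ?thesis unfolding vol_def by (rule mult_pos_pos)
qed

lemma vol_nonneg: "(\<And>i. i \<in> {1..s} \<Longrightarrow> r i \<ge> 0) \<Longrightarrow> vol r R \<ge> 0"
  unfolding vol_def by (intro mult_nonneg_nonneg prod_nonneg) auto

lemma emeasure_D0: "emeasure PM D0 < \<infinity>" "emeasure PM D0 > 0"
proof -
  obtain R where R: "R > 0" "D0 \<subseteq> polydisc (\<lambda>_. R) (\<lambda>_. R)" using D0_bounded by blast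
  have "emeasure PM D0 \<le> emeasure PM (polydisc (\<lambda>_. R) (\<lambda>_. R))" using R(2) by (intro emeasure_mono) auto
  also have "\<dots> < \<infinity>" using R(1) by (subst emeasure_polydisc) auto
  finally show "emeasure PM D0 < \<infinity>" .
  let ?P = "polydisc (\<lambda>_. 1) (\<lambda>_. 1)"
  show "emeasure PM D0 > 0"
  proof (rule ccontr)
    \<comment> \<open>If \<open>D0\<close> were null, unfolding the indicator of the unit polydisc
      would give that polydisc volume 0.\<close>
    assume "\<not> emeasure PM D0 > 0"
    then have "D0 \<in> null_sets PM" by auto
    then have "AE x in PM. x \<notin> D0" by (rule AE_not_in)
    then have "(\<integral>\<^sup>+x. per (indicator ?P) x * 1 * indicator D0 x \<partial>PM) = (\<integral>\<^sup>+x. 0 \<partial>PM)"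
      by (intro nn_integral_cong_AE) (auto elim!: eventually_mono)
    also have "(\<integral>\<^sup>+x. per (indicator ?P) x * 1 * indicator D0 x \<partial>PM) = (\<integral>\<^sup>+x. indicator ?P x * 1 \<partial>PM)"
      by (rule unfolding_integral) auto
    also have "\<dots> = ennreal (vol (\<lambda>_. 1) (\<lambda>_. 1))" by (simp add: emeasure_polydisc)
    finally have "ennreal (vol (\<lambda>_. 1) (\<lambda>_. 1)) = 0" by simp
    then show False using vol_pos[of "\<lambda>_. 1" "\<lambda>_. 1"] by (simp add: ennreal_eq_0_iff)
  qed
qed

section \<open>Geometry of numbers with the absolute value \<open>nrm\<close> of the field
  norm\<close>

definition nrm :: "'k \<Rightarrow> real" where
  "nrm \<delta> = (\<Prod>i\<in>{1..s}. \<bar>\<sigma> i \<delta>\<bar>) * (\<Prod>j\<in>{1..t}. (cmod (\<tau> j \<delta>))\<^sup>2)"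

text \<open>
  The translates of \<open>\<delta> D0\<close> by \<open>\<delta> J \<subseteq> \<O>\<close> and by representatives of \<open>\<O>/J\<close> cover the space.
\<close>

lemma nrm_lower_bound:
  "\<exists>c > 0. \<forall>J \<delta>. nzideal J \<longrightarrow> \<delta> \<in> inv_ideal J \<longrightarrow> \<delta> \<noteq> 0 \<longrightarrow> c \<le> ideal_Nm J * nrm \<delta>"
proof -
  obtain R where R: "R > 0" "D0 \<subseteq> polydisc (\<lambda>_. R) (\<lambda>_. R)" using D0_bounded by blast
  define V where "V = vol (\<lambda>_. R) (\<lambda>_. R)"
  have V: "V > 0" unfolding V_def using R(1) by (intro vol_pos)
  define c where "c = measure PM D0 / V"
  have mD: "measure PM D0 > 0" "emeasure PM D0 = ennreal (measure PM D0)"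
    using emeasure_D0 by (auto simp: measure_def enn2real_positive_iff)
  have "c \<le> ideal_Nm J * nrm \<delta>" if J: "nzideal J" and \<delta>: "\<delta> \<in> inv_ideal J" "\<delta> \<noteq> 0" for J \<delta>
  proof -
    have nz: "i \<in> {1..s} \<Longrightarrow> \<sigma> i \<delta> \<noteq> 0" "j \<in> {1..t} \<Longrightarrow> \<tau> j \<delta> \<noteq> 0" for i j
      using field_embedding_nonzero[OF _ \<delta>(2)] field_embedding_\<sigma> field_embedding_\<tau> by auto
    define rep where "rep X = (SOME x. algebraic_int x \<and> coset J x = X)" for X
    have rep: "coset J (rep X) = X" if "X \<in> quo J" for X
    proof -
      have "\<exists>x. algebraic_int x \<and> coset J x = X" using that by (auto simp: quo_def)
      from someI_ex[OF this] show "coset J (rep X) = X" by (auto simp: rep_def)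
    qed
    let ?r = "\<lambda>i. \<bar>\<sigma> i \<delta>\<bar> * R" and ?R = "\<lambda>j. cmod (\<tau> j \<delta>) * R"
    define S where "S X = {x \<in> space PM. tr (- (\<delta> * rep X)) x \<in> polydisc ?r ?R}" for X
    have [measurable]: "S X \<in> sets PM" for X unfolding S_def by measurable
    have V\<delta>: "vol ?r ?R = nrm \<delta> * V"
      unfolding V_def vol_def nrm_def by (simp add: prod.distrib power_mult_distrib mult_ac)
    have mS: "emeasure PM (S X) = ennreal (nrm \<delta> * V)" for X
      unfolding S_def using R(1) by (simp add: emeasure_tr_vimage emeasure_polydisc V\<delta>)
    have cover: "1 \<le> (\<Sum>X\<in>quo J. per (indicator (S X)) x)" if x: "x \<in> space PM" for x
    proof -
      \<comment> \<open>Divide \<open>x\<close> by \<delta> at each place, move the quotient into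
        \<open>D0\<close> by an integer \<open>a\<close>, and multiply back: \<open>x\<close> has
        moved by \<open>\<delta> * a\<close>. The class of \<open>- a\<close> modulo
        \<open>J\<close> selects one of the boxes, and the remaining shift
        \<open>- (\<delta> * z)\<close> is integral since \<open>z\<close> lies in
        \<open>J\<close>.\<close>
      define y :: point where "y = (\<lambda>i\<in>{1..s}. fst x i / \<sigma> i \<delta>, \<lambda>j\<in>{1..t}. snd x j / \<tau> j \<delta>)"
      have "y \<in> space PM" by (simp add: y_def space_PM)
      then obtain a where a: "a \<in> OK" "tr a y \<in> D0" using D0_translate_unique[of y] by blast
      define X where "X = coset J (- a)"
      have X: "X \<in> quo J" using a(1) by (simp add: X_def quo_def)
      define z where "z = - a - rep X"
      have z: "z \<in> J" using rep[OF X] coset_eq_iff[OF J, of "- a" "rep X"] by (simp add: X_def z_def)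
      have o: "- (\<delta> * z) \<in> OK" using \<delta>(1) z by (simp add: inv_ideal_def)
      have P: "tr a y \<in> polydisc (\<lambda>_. R) (\<lambda>_. R)" using a(2) R(2) by blast
      have "tr (- (\<delta> * rep X)) (tr (- (\<delta> * z)) x) \<in> polydisc ?r ?R"
        unfolding mem_polydisc_iff[OF tr_in_space]
      proof (intro conjI ballI)
        have e: "- (\<delta> * rep X) + - (\<delta> * z) = \<delta> * a" by (simp add: z_def algebra_simps)
        show "\<bar>fst (tr (- (\<delta> * rep X)) (tr (- (\<delta> * z)) x)) i\<bar> \<le> \<bar>\<sigma> i \<delta>\<bar> * R" if i: "i \<in> {1..s}" for i
        proof -
          have "fst (tr (- (\<delta> * rep X)) (tr (- (\<delta> * z)) x)) i = fst x i + \<sigma> i \<delta> * \<sigma> i a"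
            unfolding tr_add e using fst_tr[OF i] field_embedding_simps(4)[OF field_embedding_\<sigma>[OF i]] by simp
          also have "\<dots> = \<sigma> i \<delta> * fst (tr a y) i"
            using nz(1)[OF i] i by (simp add: fst_tr y_def distrib_left)
          finally show ?thesis
            using P i by (simp add: mem_polydisc_iff[OF tr_in_space] abs_mult mult_left_mono)
        qed
        show "cmod (snd (tr (- (\<delta> * rep X)) (tr (- (\<delta> * z)) x)) i) \<le> cmod (\<tau> i \<delta>) * R" if i: "i \<in> {1..t}" for i
        proof -
          have "snd (tr (- (\<delta> * rep X)) (tr (- (\<delta> * z)) x)) i = snd x i + \<tau> i \<delta> * \<tau> i a"
            unfolding tr_add e using snd_tr[OF i] field_embedding_simps(4)[OF field_embedding_\<tau>[OF i]] by simp
          also have "\<dots> = \<tau> i \<delta> * snd (tr a y) i"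
            using nz(2)[OF i] i by (simp add: snd_tr y_def distrib_left)
          finally show ?thesis
            using P i by (simp add: mem_polydisc_iff[OF tr_in_space] norm_mult mult_left_mono)
        qed
      qed
      then have inS: "tr (- (\<delta> * z)) x \<in> S X" by (simp add: S_def tr_in_space)
      have "(1::ennreal) = (\<integral>\<^sup>+c. indicator {- (\<delta> * z)} c \<partial>count_space OK)" using o by simp
      also have "\<dots> \<le> per (indicator (S X)) x"
        unfolding per_def by (rule nn_integral_mono) (use inS in \<open>auto split: split_indicator\<close>)
      also have "\<dots> \<le> (\<Sum>X\<in>quo J. per (indicator (S X)) x)"
        using finite_quo[OF J] X by (intro member_le_sum) auto
      finally show ?thesis .
    qed
    \<comment> \<open>Integrating the covering over \<open>D0\<close> bounds its volume by that of
      Nm(J) boxes, each of volume \<open>nrm \<delta> * V\<close>.\<close>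
    have "ennreal (measure PM D0) = (\<integral>\<^sup>+x. indicator D0 x \<partial>PM)" using mD by simp
    also have "\<dots> \<le> (\<integral>\<^sup>+x. (\<Sum>X\<in>quo J. per (indicator (S X)) x * 1 * indicator D0 x) \<partial>PM)"
    proof (rule nn_integral_mono)
      fix x assume "x \<in> space PM"
      from mult_right_mono[OF cover[OF this], of "indicator D0 x"]
      show "indicator D0 x \<le> (\<Sum>X\<in>quo J. per (indicator (S X)) x * 1 * indicator D0 x)"
        by (simp add: sum_distrib_right)
    qed
    also have "\<dots> = (\<Sum>X\<in>quo J. \<integral>\<^sup>+x. per (indicator (S X)) x * 1 * indicator D0 x \<partial>PM)"
      by (rule nn_integral_sum) measurable
    also have "\<dots> = (\<Sum>X\<in>quo J. \<integral>\<^sup>+x. indicator (S X) x * 1 \<partial>PM)"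
      by (intro sum.cong refl unfolding_integral) auto
    also have "\<dots> = (\<Sum>X\<in>quo J. ennreal (nrm \<delta> * V))" by (simp add: mS)
    also have "\<dots> = ennreal (ideal_Nm J * (nrm \<delta> * V))"
      by (simp add: ideal_Nm_quo ennreal_of_nat_eq_real_of_nat ennreal_mult')
    finally have "measure PM D0 \<le> ideal_Nm J * (nrm \<delta> * V)"
      using V by (subst (asm) ennreal_le_iff) (auto simp: nrm_def intro!: mult_nonneg_nonneg prod_nonneg)
    then show ?thesis using V by (simp add: c_def field_simps)
  qed
  moreover have "c > 0" using mD V by (simp add: c_def)
  ultimately show ?thesis by blast
qed

lemma number_of_places_pos: "s + 2 * t > 0"
proof (rule ccontr)
  assume "\<not> ?thesis"
  then have "Emb = {}" using Emb_cases by auto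
  then have "(of_rat (Tr 1) :: complex) = 0" using Tr_embeddings[of 1] by simp
  then show False using Tr_one by simp
qed

definition near_zero :: "(nat \<Rightarrow> real) \<Rightarrow> (nat \<Rightarrow> real) \<Rightarrow> 'k set" where
  "near_zero r R = {\<delta>. (\<forall>i\<in>{1..s}. \<bar>\<sigma> i \<delta>\<bar> \<le> r i) \<and> (\<forall>j\<in>{1..t}. cmod (\<tau> j \<delta>) \<le> R j)}"

text \<open>
  Since the norm of the nonzero points is bounded below, translates of a small multiple of the
  polydisc by these points are disjoint; no condition on the shape of the polydisc is needed.
\<close>

lemma nonzero_points_in_polydisc:
  "\<exists>C::real. C > 0 \<and> (\<forall>J r R F. nzideal J \<longrightarrow> (\<forall>i. r i \<ge> 0) \<longrightarrow> (\<forall>j. R j \<ge> 0) \<longrightarrow> finite F \<longrightarrow>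
     F \<subseteq> inv_ideal J \<inter> near_zero r R - {0} \<longrightarrow> card F \<le> C * real (ideal_Nm J) * vol r R)"
proof -
  obtain c where c: "c > 0" "\<And>J \<delta>. nzideal J \<Longrightarrow> \<delta> \<in> inv_ideal J \<Longrightarrow> \<delta> \<noteq> 0 \<Longrightarrow> c \<le> ideal_Nm J * nrm \<delta>"
    using nrm_lower_bound by blast
  let ?d = "s + 2 * t"
  \<comment> \<open>One factor \<open>2 ^ ?d\<close> comes from the doubled polydisc, the other from
    passing from \<open>e\<close> to \<open>2 * e\<close>; the factor \<open>2 / c\<close> inverts
    \<open>(2 * e) ^ ?d = c / (2 * (N * v))\<close>.\<close>
  define C where "C = 4 ^ ?d * 2 / c"
  have main: "card F \<le> C * ideal_Nm J * vol r R"
    if J: "nzideal J" and nn: "\<forall>i. r i \<ge> 0" "\<forall>j. R j \<ge> 0" and F: "finite F"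
      "F \<subseteq> inv_ideal J \<inter> near_zero r R - {0}" for J F and r R :: "nat \<Rightarrow> real"
  proof (cases "F = {}")
    case True
    then show ?thesis using c(1) nn vol_nonneg[of r R] by (simp add: C_def)
  next
    case False
    define N where "N = real (ideal_Nm J)"
    have N: "N > 0" using ideal_Nm_pos[OF J] by (simp add: N_def)
    define v where "v = (\<Prod>i\<in>{1..s}. r i) * (\<Prod>j\<in>{1..t}. (R j)\<^sup>2)"
    have nrm_le: "nrm \<delta> \<le> k ^ ?d * v" if "\<delta> \<in> near_zero (\<lambda>i. k * r i) (\<lambda>j. k * R j)" "k \<ge> 0" for k \<delta>
    proof -
      have "nrm \<delta> \<le> (\<Prod>i\<in>{1..s}. k * r i) * (\<Prod>j\<in>{1..t}. (k * R j)\<^sup>2)"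
        unfolding nrm_def using that nn
        by (intro mult_mono prod_mono prod_nonneg) (auto simp: near_zero_def intro!: power_mono)
      also have "\<dots> = k ^ ?d * v"
        unfolding power_add power_mult by (simp add: v_def prod.distrib power_mult_distrib mult_ac)
      finally show ?thesis .
    qed
    \<comment> \<open>A single nonzero point already forces \<open>c \<le> N * v\<close>. This makes
      \<open>e \<le> 1\<close> below, which keeps the small translates inside the doubled
      polydisc.\<close>
    obtain \<delta> where \<delta>: "\<delta> \<in> F" using False by blast
    then have "\<delta> \<in> inv_ideal J" "\<delta> \<noteq> 0" "\<delta> \<in> near_zero r R" using F(2) by auto
    then have "c \<le> N * v" using c(2)[OF J, of \<delta>] nrm_le[of \<delta> 1] N
      by (simp add: N_def) (meson mult_left_mono of_nat_0_le_iff order.trans)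
    then have Nv: "N * v > 0" "c / (2 * (N * v)) \<le> 1" using c(1) by (auto simp: field_simps)
    then have v: "v > 0" using N by (simp add: zero_less_mult_iff)
    \<comment> \<open>Chosen so that a nonzero difference inside the box scaled by
      \<open>2 * e\<close> would have norm at most half of the lower bound
      \<open>c / N\<close>.\<close>
    define e where "e = (c / (2 * (N * v))) powr (1 / ?d) / 2"
    have base: "c / (2 * (N * v)) > 0" using c(1) Nv by simp
    have e0: "e > 0" using c(1) N v by (simp add: e_def)
    have "(c / (2 * (N * v))) powr (1 / ?d) \<le> 1 powr (1 / ?d)"
      using base Nv by (intro powr_mono2) auto
    then have e1: "e \<le> 1" by (simp add: e_def)
    have ed: "(2 * e) ^ ?d = c / (2 * (N * v))"
    proof -
      define y where "y = c / (2 * (N * v))"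
      have y: "y > 0" using base by (simp only: y_def)
      have "(2 * e) ^ ?d = (y powr (1 / ?d)) powr ?d"
        using y by (simp add: e_def y_def[symmetric] powr_realpow[symmetric] del: of_nat_add of_nat_mult)
      moreover have "1 / real ?d * real ?d = 1"
        using number_of_places_pos by (simp del: of_nat_add of_nat_mult)
      then have "(y powr (1 / ?d)) powr ?d = y powr 1" by (simp only: powr_powr)
      ultimately show ?thesis using y unfolding y_def[symmetric] by simp
    qed
    let ?P = "polydisc (\<lambda>i. e * r i) (\<lambda>j. e * R j)" and ?Q = "polydisc (\<lambda>i. 2 * r i) (\<lambda>j. 2 * R j)"
    define A where "A \<delta> = {x \<in> space PM. tr (- \<delta>) x \<in> ?P}" for \<delta>
    have [measurable]: "A \<delta> \<in> sets PM" for \<delta> unfolding A_def by measurable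
    have mA: "emeasure PM (A \<delta>) = ennreal (e ^ ?d * vol r R)" for \<delta>
      unfolding A_def using nn e0 by (simp add: emeasure_tr_vimage emeasure_polydisc vol_scale)
    have disj: "disjoint_family_on A F"
      unfolding disjoint_family_on_def
    proof (intro ballI impI)
      fix \<delta> \<delta>' assume dd: "\<delta> \<in> F" "\<delta>' \<in> F" "\<delta> \<noteq> \<delta>'"
      show "A \<delta> \<inter> A \<delta>' = {}"
      proof (rule ccontr)
        assume "A \<delta> \<inter> A \<delta>' \<noteq> {}"
        then obtain x where x: "tr (- \<delta>) x \<in> ?P" "tr (- \<delta>') x \<in> ?P" by (auto simp: A_def)
        have "\<delta> - \<delta>' \<in> near_zero (\<lambda>i. (2 * e) * r i) (\<lambda>j. (2 * e) * R j)"
          unfolding near_zero_def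
        proof (intro CollectI conjI ballI)
          fix i assume i: "i \<in> {1..s}"
          have "\<bar>fst x i - \<sigma> i \<delta>\<bar> \<le> e * r i" "\<bar>fst x i - \<sigma> i \<delta>'\<bar> \<le> e * r i"
            using x i by (auto simp: mem_polydisc_tr)
          then show "\<bar>\<sigma> i (\<delta> - \<delta>')\<bar> \<le> 2 * e * r i"
            unfolding field_embedding_simps(6)[OF field_embedding_\<sigma>[OF i]] by linarith
        next
          fix i assume i: "i \<in> {1..t}"
          have "cmod (snd x i - \<tau> i \<delta>) \<le> e * R i" "cmod (snd x i - \<tau> i \<delta>') \<le> e * R i"
            using x i by (auto simp: mem_polydisc_tr)
          then have "cmod ((snd x i - \<tau> i \<delta>') - (snd x i - \<tau> i \<delta>)) \<le> e * R i + e * R i"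
            using norm_triangle_ineq4[of "snd x i - \<tau> i \<delta>'" "snd x i - \<tau> i \<delta>"] by linarith
          then show "cmod (\<tau> i (\<delta> - \<delta>')) \<le> 2 * e * R i"
            unfolding field_embedding_simps(6)[OF field_embedding_\<tau>[OF i]] by simp
        qed
        then have "nrm (\<delta> - \<delta>') \<le> c / (2 * (N * v)) * v" using nrm_le[of "\<delta> - \<delta>'" "2 * e"] e0 ed by simp
        then have "N * nrm (\<delta> - \<delta>') \<le> N * (c / (2 * (N * v)) * v)" using N by (intro mult_left_mono) auto
        also have "\<dots> = c / 2" using N v by (simp add: field_simps)
        also have "\<dots> < c" using c(1) by simp
        also have "c \<le> N * nrm (\<delta> - \<delta>')"
          using c(2)[OF J, of "\<delta> - \<delta>'"] dd F(2) inv_ideal_diff[of \<delta> J \<delta>'] unfolding N_def by auto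
        finally show False by simp
      qed
    qed
    have sub: "A \<delta> \<subseteq> ?Q" if "\<delta> \<in> F" for \<delta>
    proof
      fix x assume x: "x \<in> A \<delta>"
      then have xs: "x \<in> space PM" and xP: "tr (- \<delta>) x \<in> ?P" by (auto simp: A_def)
      have dn: "\<delta> \<in> near_zero r R" using that F(2) by blast
      have er: "e * r i \<le> r i" "e * R i \<le> R i" for i using e0 e1 nn by (auto intro: mult_left_le_one_le)
      show "x \<in> ?Q" unfolding mem_polydisc_iff[OF xs]
      proof (intro conjI ballI)
        fix i assume i: "i \<in> {1..s}"
        have "\<bar>fst x i - \<sigma> i \<delta>\<bar> \<le> e * r i" "\<bar>\<sigma> i \<delta>\<bar> \<le> r i"
          using xP dn i by (auto simp: near_zero_def mem_polydisc_tr)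
        then show "\<bar>fst x i\<bar> \<le> 2 * r i" using er(1)[of i] by linarith
      next
        fix i assume i: "i \<in> {1..t}"
        have "cmod (snd x i - \<tau> i \<delta>) \<le> e * R i" "cmod (\<tau> i \<delta>) \<le> R i"
          using xP dn i by (auto simp: near_zero_def mem_polydisc_tr)
        then have "cmod ((snd x i - \<tau> i \<delta>) + \<tau> i \<delta>) \<le> e * R i + R i"
          using norm_triangle_ineq[of "snd x i - \<tau> i \<delta>" "\<tau> i \<delta>"] by linarith
        then show "cmod (snd x i) \<le> 2 * R i" using er(2)[of i] by simp
      qed
    qed
    have volnn: "vol r R \<ge> 0" using nn by (intro vol_nonneg) auto
    have "ennreal (card F * (e ^ ?d * vol r R)) = (\<Sum>\<delta>\<in>F. emeasure PM (A \<delta>))"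
      by (simp add: mA ennreal_of_nat_eq_real_of_nat ennreal_mult')
    also have "\<dots> = emeasure PM (\<Union>\<delta>\<in>F. A \<delta>)"
      by (rule sum_emeasure[OF _ disj F(1)]) auto
    also have "\<dots> \<le> emeasure PM ?Q" using sub by (intro emeasure_mono) auto
    also have "\<dots> = ennreal (2 ^ ?d * vol r R)"
      using nn by (simp add: emeasure_polydisc vol_scale)
    finally have "card F * (e ^ ?d * vol r R) \<le> 2 ^ ?d * vol r R"
      using volnn by (subst (asm) ennreal_le_iff) auto
    moreover have vv: "vol r R = (2 ^ s * pi ^ t) * v" by (simp add: vol_def v_def prod.distrib mult_ac)
    then have volp: "vol r R > 0" using v by simp
    ultimately have "card F * e ^ ?d \<le> 2 ^ ?d" by (simp add: mult.assoc[symmetric])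
    then have "card F * (2 * e) ^ ?d \<le> 4 ^ ?d"
    proof -
      have "card F * (2 * e) ^ ?d = 2 ^ ?d * (card F * e ^ ?d)" by (simp only: power_mult_distrib mult_ac)
      also have "\<dots> \<le> 2 ^ ?d * 2 ^ ?d" using \<open>card F * e ^ ?d \<le> 2 ^ ?d\<close> by (intro mult_left_mono) auto
      also have "\<dots> = (2 * 2) ^ ?d" by (simp only: power_mult_distrib)
      finally show ?thesis by simp
    qed
    then have "card F \<le> C * (N * v)"
      unfolding ed C_def using Nv c(1) by (simp add: field_simps)
    also have "v \<le> vol r R"
    proof -
      have "1 \<le> (2::real) ^ s * pi ^ t"
        using pi_gt3 by (intro mult_ge1_I one_le_power) auto
      then show ?thesis unfolding vv using v by simp
    qed
    then have "C * (N * v) \<le> C * (N * vol r R)" using N c(1) by (intro mult_left_mono) (auto simp: C_def)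
    finally show ?thesis by (simp add: N_def mult.assoc)
  qed
  show ?thesis
  proof (intro exI[of _ C] conjI allI impI)
    show "C > 0" using c(1) by (simp add: C_def)
  qed (rule main)
qed

lemma emeasure_centred_polydisc:
  assumes "\<And>i. r i \<ge> 0" "\<And>j. R j \<ge> 0"
  shows "PiE {1..s} (\<lambda>i. cball (c i) (r i)) \<times> PiE {1..t} (\<lambda>j. cball (C j) (R j)) \<in> sets PM"
    and "emeasure PM (PiE {1..s} (\<lambda>i. cball (c i) (r i)) \<times> PiE {1..t} (\<lambda>j. cball (C j) (R j))) = ennreal (vol r R)"
proof -
  interpret r: product_sigma_finite "\<lambda>_::nat. lborel :: real measure" by standard
  interpret c: product_sigma_finite "\<lambda>_::nat. lborel :: complex measure" by standard
  show "PiE {1..s} (\<lambda>i. cball (c i) (r i)) \<times> PiE {1..t} (\<lambda>j. cball (C j) (R j)) \<in> sets PM"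
    unfolding PM_def by (intro pair_measureI sets_PiM_I_finite) auto
  have "emeasure PM (PiE {1..s} (\<lambda>i. cball (c i) (r i)) \<times> PiE {1..t} (\<lambda>j. cball (C j) (R j)))
      = (\<Prod>i\<in>{1..s}. emeasure lborel (cball (c i) (r i))) * (\<Prod>j\<in>{1..t}. emeasure lborel (cball (C j) (R j)))"
    by (subst emeasure_PM_Times) (auto intro!: sets_PiM_I_finite simp: r.emeasure_PiM c.emeasure_PiM)
  also have "\<dots> = (\<Prod>i\<in>{1..s}. emeasure lborel (cball (0::real) (r i))) * (\<Prod>j\<in>{1..t}. emeasure lborel (cball (0::complex) (R j)))"
    by (simp only: emeasure_cball[OF assms(1)] emeasure_cball[OF assms(2)])
  also have "\<dots> = emeasure PM (polydisc r R)" unfolding polydisc_def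
    by (subst emeasure_PM_Times) (auto intro!: sets_PiM_I_finite simp: r.emeasure_PiM c.emeasure_PiM)
  also have "\<dots> = ennreal (vol r R)" using assms by (intro emeasure_polydisc)
  finally show "emeasure PM (PiE {1..s} (\<lambda>i. cball (c i) (r i)) \<times> PiE {1..t} (\<lambda>j. cball (C j) (R j))) = ennreal (vol r R)" .
qed

lemma vol_mult:
  "vol r R * vol r' R' = (\<Prod>i\<in>{1..s}. 4 * (r i * r' i)) * (\<Prod>j\<in>{1..t}. pi\<^sup>2 * (R j * R' j)\<^sup>2)"
proof -
  have 1: "(\<Prod>i\<in>{1..s}. 2 * r i) * (\<Prod>i\<in>{1..s}. 2 * r' i) = (\<Prod>i\<in>{1..s}. 4 * (r i * r' i))"
    unfolding prod.distrib[symmetric] by (rule prod.cong) auto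
  have 2: "(\<Prod>j\<in>{1..t}. pi * (R j)\<^sup>2) * (\<Prod>j\<in>{1..t}. pi * (R' j)\<^sup>2) = (\<Prod>j\<in>{1..t}. pi\<^sup>2 * (R j * R' j)\<^sup>2)"
    unfolding prod.distrib[symmetric] by (rule prod.cong) (auto simp: power2_eq_square)
  have "vol r R * vol r' R' = ((\<Prod>i\<in>{1..s}. 2 * r i) * (\<Prod>i\<in>{1..s}. 2 * r' i))
     * ((\<Prod>j\<in>{1..t}. pi * (R j)\<^sup>2) * (\<Prod>j\<in>{1..t}. pi * (R' j)\<^sup>2))"
    by (simp only: vol_def mult_ac)
  then show ?thesis unfolding 1 2 .
qed

lemma vol_mono:
  assumes "\<And>i. 0 \<le> r i" "\<And>i. r i \<le> r' i" "\<And>j. 0 \<le> R j" "\<And>j. R j \<le> R' j"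
  shows "vol r R \<le> vol r' R'"
  unfolding vol_def
  by (intro mult_mono prod_mono prod_nonneg conjI mult_left_mono power_mono ballI)
    (use assms order.trans[OF assms(1) assms(2)] in auto)

text \<open>At each place the sum of two radii is at most twice their maximum, and minimum times
  maximum is their product. In this way the small size of an intersection compensates for the number
  of close pairs.\<close>

lemma vol_min_sum_le:
  assumes "\<And>i. 0 \<le> r i" "\<And>i. 0 \<le> r' i" "\<And>j. 0 \<le> R j" "\<And>j. 0 \<le> R' j"
  shows "vol (\<lambda>i. min (r i) (r' i)) (\<lambda>j. min (R j) (R' j)) * vol (\<lambda>i. r i + r' i) (\<lambda>j. R j + R' j)
    \<le> 2 ^ (s + 2 * t) * (vol r R * vol r' R')"
proof -
  let ?m = "vol (\<lambda>i. min (r i) (r' i)) (\<lambda>j. min (R j) (R' j))"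
  have mm: "min x y * max x y = x * y" for x y :: real by (auto simp: min_def max_def)
  have "vol (\<lambda>i. r i + r' i) (\<lambda>j. R j + R' j) \<le> vol (\<lambda>i. 2 * max (r i) (r' i)) (\<lambda>j. 2 * max (R j) (R' j))"
    using assms by (intro vol_mono add_nonneg_nonneg) (auto simp: max_def)
  also have "\<dots> = 2 ^ (s + 2 * t) * vol (\<lambda>i. max (r i) (r' i)) (\<lambda>j. max (R j) (R' j))"
    by (rule vol_scale)
  finally have "?m * vol (\<lambda>i. r i + r' i) (\<lambda>j. R j + R' j)
      \<le> ?m * (2 ^ (s + 2 * t) * vol (\<lambda>i. max (r i) (r' i)) (\<lambda>j. max (R j) (R' j)))"
    using assms by (intro mult_left_mono vol_nonneg) auto
  also have "\<dots> = 2 ^ (s + 2 * t) * (?m * vol (\<lambda>i. max (r i) (r' i)) (\<lambda>j. max (R j) (R' j)))" by simp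
  also have "?m * vol (\<lambda>i. max (r i) (r' i)) (\<lambda>j. max (R j) (R' j)) = vol r R * vol r' R'"
    unfolding vol_mult mm ..
  finally show ?thesis .
qed

end

section \<open>Overlaps of approximation domains\<close>

locale approximation_radii = number_field_points d b \<phi> s t \<sigma> \<tau>
  for d and b :: "nat \<Rightarrow> 'k::field_char_0" and \<phi> s t \<sigma> \<tau> +
  fixes r R :: "'k set \<Rightarrow> nat \<Rightarrow> real"
  assumes r_nonneg: "0 \<le> r n i" and R_nonneg: "0 \<le> R n i"
begin

definition V :: "'k set \<Rightarrow> real" where "V n = vol (r n) (R n)"

definition nbhd :: "'k set \<Rightarrow> 'k \<Rightarrow> point set" where
  "nbhd n q = {x \<in> space PM. tr (- q) x \<in> polydisc (r n) (R n)}"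

text \<open>Counts all fractions with exact denominator \<open>n\<close>, those in the cell and
  their integral translates, whose neighbourhood contains \<open>x\<close>.\<close>

definition fcount :: "'k set \<Rightarrow> point \<Rightarrow> ennreal" where
  "fcount n x = (\<Sum>q\<in>reduced_fractions n. per (indicator (nbhd n q)) x)"

lemma V_nonneg: "V n \<ge> 0"
  unfolding V_def using r_nonneg by (intro vol_nonneg) auto

lemma sets_nbhd [measurable]: "nbhd n q \<in> sets PM"
  unfolding nbhd_def by measurable

lemma emeasure_nbhd: "emeasure PM (nbhd n q) = ennreal (V n)"
  unfolding nbhd_def V_def using r_nonneg R_nonneg
  by (simp add: emeasure_tr_vimage emeasure_polydisc)

lemma measurable_fcount [measurable]: "fcount n \<in> borel_measurable PM"
  unfolding fcount_def[abs_def] by measurable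

lemma fcount_periodic: "a \<in> OK \<Longrightarrow> fcount n (tr a x) = fcount n x"
  by (simp add: fcount_def per_periodic)

lemma fcount_pos:
  assumes "x \<in> space PM" "fcount n x \<noteq> 0"
  shows "\<exists>\<gamma>. denom \<gamma> = n \<and> x \<in> nbhd n \<gamma>"
proof -
  obtain q where q: "q \<in> reduced_fractions n" "per (indicator (nbhd n q)) x \<noteq> 0"
    using assms(2) unfolding fcount_def by (meson sum.neutral)
  have "\<exists>a\<in>OK. (indicator (nbhd n q) (tr a x) :: ennreal) \<noteq> 0"
  proof (rule ccontr)
    assume "\<not> ?thesis"
    then have "per (indicator (nbhd n q)) x = (\<integral>\<^sup>+a. 0 \<partial>count_space OK)"
      unfolding per_def by (intro nn_integral_cong) auto
    with q(2) show False by simp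
  qed
  then obtain a where a: "a \<in> OK" "tr a x \<in> nbhd n q" by (auto simp: indicator_def split: if_splits)
  have "denom (q + - a) = denom q" using a(1) by (intro denom_add) simp
  moreover have "x \<in> nbhd n (q - a)" using a(2) assms(1) by (simp add: nbhd_def tr_add)
  ultimately show ?thesis using q(1) by (intro exI[of _ "q - a"]) (simp add: reduced_fractions_def)
qed

lemma integral_fcount:
  assumes [measurable]: "g \<in> borel_measurable PM"
    and g: "\<And>a x. a \<in> OK \<Longrightarrow> x \<in> space PM \<Longrightarrow> g (tr a x) = g x"
  shows "(\<integral>\<^sup>+x. fcount n x * g x * indicator D0 x \<partial>PM)
    = (\<Sum>q\<in>reduced_fractions n. \<integral>\<^sup>+x. indicator (nbhd n q) x * g x \<partial>PM)"
proof -
  have "(\<integral>\<^sup>+x. fcount n x * g x * indicator D0 x \<partial>PM)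
      = (\<integral>\<^sup>+x. (\<Sum>q\<in>reduced_fractions n. per (indicator (nbhd n q)) x * g x * indicator D0 x) \<partial>PM)"
    by (simp add: fcount_def sum_distrib_right)
  also have "\<dots> = (\<Sum>q\<in>reduced_fractions n. \<integral>\<^sup>+x. per (indicator (nbhd n q)) x * g x * indicator D0 x \<partial>PM)"
    by (rule nn_integral_sum) measurable
  also have "\<dots> = (\<Sum>q\<in>reduced_fractions n. \<integral>\<^sup>+x. indicator (nbhd n q) x * g x \<partial>PM)"
    by (intro sum.cong refl unfolding_integral g) measurable
  finally show ?thesis .
qed

lemma integral_fcount_one:
  assumes "nzideal n"
  shows "(\<integral>\<^sup>+x. fcount n x * indicator D0 x \<partial>PM) = ennreal (ideal_\<Phi> n * V n)"
proof -
  have "(\<integral>\<^sup>+x. fcount n x * indicator D0 x \<partial>PM) = (\<integral>\<^sup>+x. fcount n x * 1 * indicator D0 x \<partial>PM)" by simp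
  also have "\<dots> = (\<Sum>q\<in>reduced_fractions n. \<integral>\<^sup>+x. indicator (nbhd n q) x * 1 \<partial>PM)"
    by (rule integral_fcount) auto
  also have "\<dots> = ennreal (ideal_\<Phi> n * V n)"
    by (simp add: emeasure_nbhd card_reduced_fractions[OF assms] ennreal_of_nat_eq_real_of_nat ennreal_mult')
  finally show ?thesis .
qed

text \<open>At each place the intersection lies in the smaller of the two balls, so the centre is
  chosen place by place.\<close>

lemma emeasure_nbhd_Int_le:
  "emeasure PM (nbhd m p \<inter> nbhd n q) \<le> ennreal (vol (\<lambda>i. min (r m i) (r n i)) (\<lambda>j. min (R m j) (R n j)))"
proof -
  define c where "c i = (if r m i \<le> r n i then \<sigma> i p else \<sigma> i q)" for i
  define C where "C j = (if R m j \<le> R n j then \<tau> j p else \<tau> j q)" for j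
  let ?P = "PiE {1..s} (\<lambda>i. cball (c i) (min (r m i) (r n i))) \<times> PiE {1..t} (\<lambda>j. cball (C j) (min (R m j) (R n j)))"
  have "nbhd m p \<inter> nbhd n q \<subseteq> ?P"
  proof
    fix x assume "x \<in> nbhd m p \<inter> nbhd n q"
    then have x: "x \<in> space PM" "tr (- p) x \<in> polydisc (r m) (R m)" "tr (- q) x \<in> polydisc (r n) (R n)"
      by (auto simp: nbhd_def)
    have "fst x i \<in> cball (c i) (min (r m i) (r n i))" if i: "i \<in> {1..s}" for i
    proof -
      have "\<bar>fst x i - \<sigma> i p\<bar> \<le> r m i" "\<bar>fst x i - \<sigma> i q\<bar> \<le> r n i"
        using x i by (auto simp: mem_polydisc_tr)
      then show ?thesis by (auto simp: c_def dist_real_def abs_minus_commute)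
    qed
    moreover have "snd x i \<in> cball (C i) (min (R m i) (R n i))" if i: "i \<in> {1..t}" for i
    proof -
      have "cmod (snd x i - \<tau> i p) \<le> R m i" "cmod (snd x i - \<tau> i q) \<le> R n i"
        using x i by (auto simp: mem_polydisc_tr)
      then show ?thesis by (auto simp: C_def dist_norm norm_minus_commute)
    qed
    ultimately show "x \<in> ?P" using x(1) unfolding space_PM by (cases x) (auto simp: PiE_iff)
  qed
  then have "emeasure PM (nbhd m p \<inter> nbhd n q) \<le> emeasure PM ?P"
    using r_nonneg R_nonneg by (intro emeasure_mono emeasure_centred_polydisc(1)) auto
  then show ?thesis using r_nonneg R_nonneg by (subst (asm) emeasure_centred_polydisc(2)) auto
qed

lemma nbhd_meet_near:
  assumes "x \<in> nbhd m p" "x \<in> nbhd n q"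
  shows "p - q \<in> near_zero (\<lambda>i. r m i + r n i) (\<lambda>j. R m j + R n j)"
  unfolding near_zero_def
proof (intro CollectI conjI ballI)
  have x: "tr (- p) x \<in> polydisc (r m) (R m)" "tr (- q) x \<in> polydisc (r n) (R n)"
    using assms by (auto simp: nbhd_def)
  fix i assume i: "i \<in> {1..s}"
  have "\<bar>fst x i - \<sigma> i p\<bar> \<le> r m i" "\<bar>fst x i - \<sigma> i q\<bar> \<le> r n i"
    using x i by (auto simp: mem_polydisc_tr)
  then show "\<bar>\<sigma> i (p - q)\<bar> \<le> r m i + r n i"
    unfolding field_embedding_simps(6)[OF field_embedding_\<sigma>[OF i]] by linarith
next
  have x: "tr (- p) x \<in> polydisc (r m) (R m)" "tr (- q) x \<in> polydisc (r n) (R n)"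
    using assms by (auto simp: nbhd_def)
  fix i assume i: "i \<in> {1..t}"
  have "cmod (snd x i - \<tau> i p) \<le> R m i" "cmod (snd x i - \<tau> i q) \<le> R n i"
    using x i by (auto simp: mem_polydisc_tr)
  then have "cmod ((snd x i - \<tau> i q) - (snd x i - \<tau> i p)) \<le> R n i + R m i"
    using norm_triangle_ineq4[of "snd x i - \<tau> i q" "snd x i - \<tau> i p"] by linarith
  then show "cmod (\<tau> i (p - q)) \<le> R m i + R n i"
    unfolding field_embedding_simps(6)[OF field_embedding_\<tau>[OF i]] by (simp add: add.commute)
qed

lemma inv_ideal_antimono: "m \<subseteq> n \<Longrightarrow> inv_ideal n \<subseteq> inv_ideal (m :: 'k set)"
  by (auto simp: inv_ideal_def)

text \<open>A triple is determined by the difference \<open>p - (q - a)\<close> together with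
  \<open>p\<close>. The differences lie in the inverse of \<open>m \<inter> n\<close>, where packing
  counts them; each leaves at most Nm(m + n) choices for \<open>p\<close>. The two norms multiply to
  at most Nm(m) Nm(n).\<close>

lemma card_close_pairs:
  assumes C: "\<And>J r R F. nzideal J \<Longrightarrow> (\<forall>i. r i \<ge> 0) \<Longrightarrow> (\<forall>j. R j \<ge> 0) \<Longrightarrow> finite F \<Longrightarrow>
      F \<subseteq> inv_ideal J \<inter> near_zero r R - {0} \<Longrightarrow> card F \<le> C * real (ideal_Nm J) * vol r R" "C > 0"
    and m: "nzideal m" and n: "nzideal n"
  defines "T \<equiv> {((p, q), a). (p, q) \<in> reduced_fractions m \<times> reduced_fractions n \<and> a \<in> OK \<and>
      p - (q - a) \<in> near_zero (\<lambda>i. r m i + r n i) (\<lambda>j. R m j + R n j) - {0}}"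
  shows "finite T" "card T \<le> C * real (ideal_Nm m * ideal_Nm n) * vol (\<lambda>i. r m i + r n i) (\<lambda>j. R m j + R n j)"
proof -
  let ?v = "vol (\<lambda>i. r m i + r n i) (\<lambda>j. R m j + R n j)"
  let ?D = "inv_ideal (m \<inter> n) \<inter> near_zero (\<lambda>i. r m i + r n i) (\<lambda>j. R m j + R n j) - {0}"
  let ?B = "\<lambda>\<delta>. {p \<in> reduced_fractions m. denom (p - \<delta>) = n}"
  have i: "nzideal (m \<inter> n)" by (rule nzideal_Int[OF m n])
  have v: "?v \<ge> 0" using r_nonneg by (intro vol_nonneg add_nonneg_nonneg) auto
  have le: "card F \<le> C * real (ideal_Nm (m \<inter> n)) * ?v" if "finite F" "F \<subseteq> ?D" for F
    using r_nonneg R_nonneg that by (intro C(1)[OF i]) (auto intro: add_nonneg_nonneg)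
  have "card F \<le> nat \<lfloor>C * real (ideal_Nm (m \<inter> n)) * ?v\<rfloor>" if "F \<subseteq> ?D" "finite F" for F
    using le[OF that(2,1)] by (simp add: le_nat_floor)
  then have finD: "finite ?D" using finite_if_finite_subsets_card_bdd by blast
  let ?f = "\<lambda>((p, q), a). (p - (q - a), p)"
  have sub: "?f ` T \<subseteq> Sigma ?D ?B"
  proof
    fix w assume "w \<in> ?f ` T"
    then obtain p q a where w: "w = (p - (q - a), p)" "p \<in> reduced_fractions m" "q \<in> reduced_fractions n"
      "a \<in> OK" "p - (q - a) \<in> near_zero (\<lambda>i. r m i + r n i) (\<lambda>j. R m j + R n j) - {0}"
      by (auto simp: T_def)
    have dq: "denom (q - a) = n" using denom_add[of "- a" q] w(3,4) by (simp add: reduced_fractions_def)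
    have "p \<in> inv_ideal m" using denom_in_inv_ideal[of p] w(2) by (simp add: reduced_fractions_def)
    moreover have "q - a \<in> inv_ideal n" using denom_in_inv_ideal[of "q - a"] dq by simp
    ultimately have "p \<in> inv_ideal (m \<inter> n)" "q - a \<in> inv_ideal (m \<inter> n)"
      using inv_ideal_antimono[of "m \<inter> n" m] inv_ideal_antimono[of "m \<inter> n" n] by auto
    then have "p - (q - a) \<in> inv_ideal (m \<inter> n)" by (rule inv_ideal_diff)
    then show "w \<in> Sigma ?D ?B" using w dq by simp
  qed
  have inj: "inj_on ?f T"
  proof (rule inj_onI)
    fix u v assume uv: "u \<in> T" "v \<in> T" "?f u = ?f v"
    obtain p q a where u: "u = ((p, q), a)" by (metis surj_pair)
    obtain p' q' a' where v: "v = ((p', q'), a')" by (metis surj_pair)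
    have "p = p'" "a - q = a' - q'" using uv(3) u v by auto
    then have e: "p = p'" "q - a = q' - a'" by (auto simp: algebra_simps)
    have "q - q' = a - a'" using e(2) by (simp add: algebra_simps)
    then have "algebraic_int (q - q')" using uv u v by (auto simp: T_def intro: algebraic_int_diff)
    then have "q = q'" using uv u v cell_eqI by (auto simp: T_def reduced_fractions_def)
    with e show "u = v" using u v by simp
  qed
  have finB: "finite (?B \<delta>)" for \<delta> using finite_reduced_fractions[OF m] by simp
  have finS: "finite (Sigma ?D ?B)" using finD finB by (rule finite_SigmaI)
  show "finite T" by (rule inj_on_finite[OF inj sub finS])
  have "card T \<le> card (Sigma ?D ?B)" by (rule card_inj_on_le[OF inj sub finS])
  also have "\<dots> = (\<Sum>\<delta>\<in>?D. card (?B \<delta>))" using finD finB by (intro card_SigmaI) auto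
  also have "\<dots> \<le> (\<Sum>\<delta>\<in>?D. ideal_Nm (ideal_sum m n))"
    by (intro sum_mono card_common_difference_le[OF m n])
  finally have "card T \<le> card ?D * ideal_Nm (ideal_sum m n)" by simp
  then have "real (card T) \<le> real (card ?D * ideal_Nm (ideal_sum m n))" by (simp only: of_nat_le_iff)
  also have "\<dots> = real (card ?D) * real (ideal_Nm (ideal_sum m n))" by simp
  also have "\<dots> \<le> (C * real (ideal_Nm (m \<inter> n)) * ?v) * ideal_Nm (ideal_sum m n)"
    using le[OF finD order_refl] by (intro mult_right_mono) auto
  also have "\<dots> = C * ?v * real (ideal_Nm (m \<inter> n) * ideal_Nm (ideal_sum m n))" by simp
  also have "\<dots> \<le> C * ?v * real (ideal_Nm m * ideal_Nm n)"
    using C(2) v ideal_Nm_Int_sum_le[OF m n] by (intro mult_left_mono of_nat_mono) auto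
  finally show "card T \<le> C * real (ideal_Nm m * ideal_Nm n) * ?v" by (simp add: mult_ac)
qed

text \<open>Unfolding one factor leaves intersections of a neighbourhood with the integral
  translates of another. Equal centres force \<open>m = n\<close> and give the diagonal term. Every
  other intersecting pair costs at most \<open>W\<close>, and \<open>vol_min_sum_le\<close> bounds
  \<open>W\<close> times the number of close pairs.\<close>

theorem overlap_estimate:
  "\<exists>C > 0. \<forall>m n. nzideal m \<longrightarrow> nzideal n \<longrightarrow>
    (\<integral>\<^sup>+x. fcount m x * fcount n x * indicator D0 x \<partial>PM)
      \<le> ennreal ((if m = n then ideal_\<Phi> n * V n else 0) + C * (ideal_Nm m * V m) * (ideal_Nm n * V n))"
proof -
  obtain C where C: "C > 0" "\<And>J r R F. nzideal J \<Longrightarrow> (\<forall>i. r i \<ge> 0) \<Longrightarrow> (\<forall>j. R j \<ge> 0) \<Longrightarrow> finite F \<Longrightarrow>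
      F \<subseteq> inv_ideal J \<inter> near_zero r R - {0} \<Longrightarrow> card F \<le> C * real (ideal_Nm J) * vol r R"
    using nonzero_points_in_polydisc by blast
  let ?d = "s + 2 * t"
  have "(\<integral>\<^sup>+x. fcount m x * fcount n x * indicator D0 x \<partial>PM)
      \<le> ennreal ((if m = n then ideal_\<Phi> n * V n else 0) + (C * 2 ^ ?d) * (ideal_Nm m * V m) * (ideal_Nm n * V n))"
    if m: "nzideal m" and n: "nzideal n" for m n
  proof -
    let ?Qm = "reduced_fractions m" and ?Qn = "reduced_fractions n"
    let ?Y = "near_zero (\<lambda>i. r m i + r n i) (\<lambda>j. R m j + R n j)"
    let ?v = "vol (\<lambda>i. r m i + r n i) (\<lambda>j. R m j + R n j)"
    define W where "W = vol (\<lambda>i. min (r m i) (r n i)) (\<lambda>j. min (R m j) (R n j))"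
    have W: "W \<ge> 0" unfolding W_def using r_nonneg by (intro vol_nonneg) auto
    define A where "A p q = {a \<in> OK. p - (q - a) \<in> ?Y - {0}}" for p q
    have finQ: "finite ?Qm" "finite ?Qn" using finite_reduced_fractions m n by auto
    have T: "{((p, q), a). (p, q) \<in> ?Qm \<times> ?Qn \<and> a \<in> OK \<and> p - (q - a) \<in> ?Y - {0}}
        = Sigma (?Qm \<times> ?Qn) (\<lambda>(p, q). A p q)" by (auto simp: A_def)
    note cp = card_close_pairs[OF C(2) C(1) m n, unfolded T]
    have finA: "finite (A p q)" if "p \<in> ?Qm" "q \<in> ?Qn" for p q
    proof -
      have "Pair (p, q) ` A p q \<subseteq> Sigma (?Qm \<times> ?Qn) (\<lambda>(p, q). A p q)" using that by auto
      then have "finite (Pair (p, q) ` A p q)" using cp(1) finite_subset by blast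
      then show ?thesis by (rule finite_imageD) (auto intro: inj_onI)
    qed
    have cardT: "(\<Sum>p\<in>?Qm. \<Sum>q\<in>?Qn. card (A p q)) = card (Sigma (?Qm \<times> ?Qn) (\<lambda>(p, q). A p q))"
      using finQ finA by (subst card_SigmaI) (auto simp: sum.cartesian_product intro!: sum.cong)
    have merge: "(\<integral>\<^sup>+a. indicator (nbhd m p) x * indicator (nbhd n q) (tr a x) \<partial>count_space OK) = 
        (\<integral>\<^sup>+a. indicator (nbhd m p \<inter> nbhd n (q - a)) x \<partial>count_space OK)" if "x \<in> space PM" for p q x
      by (rule nn_integral_cong) (use that in \<open>auto simp: nbhd_def tr_add tr_in_space split: split_indicator\<close>)
    have pair: "(\<integral>\<^sup>+x. indicator (nbhd m p) x * per (indicator (nbhd n q)) x \<partial>PM)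
        \<le> ennreal W * card (A p q) + (if m = n \<and> p = q then ennreal (V m) else 0)"
      if p: "p \<in> ?Qm" and q: "q \<in> ?Qn" for p q
    proof -
      have "(\<integral>\<^sup>+x. indicator (nbhd m p) x * per (indicator (nbhd n q)) x \<partial>PM)
          = (\<integral>\<^sup>+x. \<integral>\<^sup>+a. indicator (nbhd m p \<inter> nbhd n (q - a)) x \<partial>count_space OK \<partial>PM)"
        by (rule nn_integral_cong) (simp add: per_def nn_integral_cmult[symmetric] merge)
      also have "\<dots> = (\<integral>\<^sup>+a. \<integral>\<^sup>+x. indicator (nbhd m p \<inter> nbhd n (q - a)) x \<partial>PM \<partial>count_space OK)"
        by (rule nn_integral_count_space_nn_integral[OF countable_OK]) measurable
      also have "\<dots> = (\<integral>\<^sup>+a. emeasure PM (nbhd m p \<inter> nbhd n (q - a)) \<partial>count_space OK)"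
        by simp
      also have "\<dots> \<le> (\<integral>\<^sup>+a. ennreal W * indicator (A p q) a
          + (if m = n \<and> p = q then ennreal (V m) else 0) * indicator {0} a \<partial>count_space OK)"
      proof (rule nn_integral_mono)
        fix a assume "a \<in> space (count_space OK)"
        then have a: "a \<in> OK" by simp
        show "emeasure PM (nbhd m p \<inter> nbhd n (q - a)) \<le> ennreal W * indicator (A p q) a
          + (if m = n \<and> p = q then ennreal (V m) else 0) * indicator {0} a"
        proof (cases "p = q - a")
          case True
          then have "algebraic_int (p - q)" using a by simp
          then have "p = q" using cell_eqI p q by (auto simp: reduced_fractions_def)
          moreover have "a = 0" using True \<open>p = q\<close> by simp
          moreover have "m = n" using p q \<open>p = q\<close> by (simp add: reduced_fractions_def)
          ultimately show ?thesis by (simp add: emeasure_nbhd)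
        next
          case False
          show ?thesis
          proof (cases "nbhd m p \<inter> nbhd n (q - a) = {}")
            case nonempty: False
            then have "p - (q - a) \<in> ?Y" using nbhd_meet_near by blast
            then have "a \<in> A p q" using a False by (simp add: A_def)
            then show ?thesis
              using emeasure_nbhd_Int_le[of m p n "q - a"] unfolding W_def[symmetric]
              by (auto intro: order.trans)
          qed simp
        qed
      qed
      also have "\<dots> = ennreal W * (\<integral>\<^sup>+a. indicator (A p q) a \<partial>count_space OK)
          + (if m = n \<and> p = q then ennreal (V m) else 0) * (\<integral>\<^sup>+a. indicator {0} a \<partial>count_space OK)"
        by (simp add: nn_integral_add nn_integral_cmult)
      also have "(\<integral>\<^sup>+a. indicator (A p q) a \<partial>count_space OK) = card (A p q)"
      proof -
        have "A p q \<subseteq> OK" by (auto simp: A_def)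
        then show ?thesis using finA[OF p q] by (simp add: emeasure_count_space_finite)
      qed
      finally show ?thesis by simp
    qed
    have "(\<integral>\<^sup>+x. fcount m x * fcount n x * indicator D0 x \<partial>PM)
        = (\<Sum>p\<in>?Qm. \<integral>\<^sup>+x. indicator (nbhd m p) x * fcount n x \<partial>PM)"
      by (rule integral_fcount) (auto simp: fcount_periodic)
    also have "\<dots> = (\<Sum>p\<in>?Qm. \<Sum>q\<in>?Qn. \<integral>\<^sup>+x. indicator (nbhd m p) x * per (indicator (nbhd n q)) x \<partial>PM)"
      unfolding fcount_def sum_distrib_left by (intro sum.cong refl nn_integral_sum) measurable
    also have "\<dots> \<le> (\<Sum>p\<in>?Qm. \<Sum>q\<in>?Qn. ennreal W * card (A p q) + (if m = n \<and> p = q then ennreal (V m) else 0))"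
      by (intro sum_mono pair)
    also have "\<dots> = ennreal W * (\<Sum>p\<in>?Qm. \<Sum>q\<in>?Qn. card (A p q))
        + (\<Sum>p\<in>?Qm. \<Sum>q\<in>?Qn. if m = n \<and> p = q then ennreal (V m) else 0)"
      by (simp add: sum.distrib sum_distrib_left)
    also have "(\<Sum>p\<in>?Qm. \<Sum>q\<in>?Qn. if m = n \<and> p = q then ennreal (V m) else 0)
        = (if m = n then ennreal (ideal_\<Phi> n * V n) else 0)"
    proof (cases "m = n")
      case True
      then show ?thesis using finQ
        by (simp add: card_reduced_fractions[OF n] ennreal_of_nat_eq_real_of_nat ennreal_mult')
    qed simp
    also have "ennreal W * (\<Sum>p\<in>?Qm. \<Sum>q\<in>?Qn. card (A p q)) 
        = ennreal (W * card (Sigma (?Qm \<times> ?Qn) (\<lambda>(p, q). A p q)))"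
      using W unfolding cardT[symmetric] by (simp add: ennreal_mult' ennreal_of_nat_eq_real_of_nat)
    also have "\<dots> + (if m = n then ennreal (ideal_\<Phi> n * V n) else 0)
        = ennreal ((if m = n then ideal_\<Phi> n * V n else 0) + W * card (Sigma (?Qm \<times> ?Qn) (\<lambda>(p, q). A p q)))"
      using W V_nonneg[of n] by (simp add: ennreal_plus add.commute)
    also have "\<dots> \<le> ennreal ((if m = n then ideal_\<Phi> n * V n else 0) + (C * 2 ^ ?d) * (ideal_Nm m * V m) * (ideal_Nm n * V n))"
    proof (intro ennreal_leI add_left_mono)
      have "W * card (Sigma (?Qm \<times> ?Qn) (\<lambda>(p, q). A p q)) \<le> W * (C * real (ideal_Nm m * ideal_Nm n) * ?v)"
        by (rule mult_left_mono[OF cp(2) W])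
      also have "\<dots> = C * real (ideal_Nm m * ideal_Nm n) * (W * ?v)" by simp
      also have "\<dots> \<le> C * real (ideal_Nm m * ideal_Nm n) * (2 ^ ?d * (V m * V n))"
      proof (rule mult_left_mono)
        show "W * ?v \<le> 2 ^ ?d * (V m * V n)"
          unfolding W_def V_def by (rule vol_min_sum_le) (rule r_nonneg R_nonneg)+
      qed (use C(1) in simp)
      finally show "W * card (Sigma (?Qm \<times> ?Qn) (\<lambda>(p, q). A p q)) \<le> (C * 2 ^ ?d) * (ideal_Nm m * V m) * (ideal_Nm n * V n)"
        by (simp add: mult_ac)
    qed
    finally show ?thesis .
  qed
  then show ?thesis using C(1) by (intro exI[of _ "C * 2 ^ ?d"]) auto
qed

section \<open>Equidistribution of the neighbourhoods of reduced fractions\<close>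

definition int_lin :: "(nat \<Rightarrow> int) \<Rightarrow> point \<Rightarrow> real" where
  "int_lin k x = (\<Sum>j<d. of_int (k j) * lin j x)"

lemma measurable_int_lin [measurable]: "int_lin k \<in> borel_measurable PM"
  unfolding int_lin_def[abs_def] by measurable

lemma int_lin_tr: "int_lin k (tr \<gamma> x) = int_lin k x + of_rat (int_functional k \<gamma>)"
  unfolding int_lin_def int_functional_def
  by (simp add: lin_\<iota> of_rat_sum of_rat_mult distrib_left sum.distrib)

lemma int_functional_algebraic_int: "algebraic_int a \<Longrightarrow> int_functional k a \<in> \<int>"
  unfolding int_functional_def algebraic_int_iff_coords by (intro Ints_sum Ints_mult) auto

text \<open>Unfolding moves the integral to the polydisc around 0, where the character multiplies
  the exponential sum over reduced fractions. Adding 1 to the cosine keeps the integrand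
  nonnegative, and the phase \<theta> covers sines as well.\<close>

theorem equidistribution_estimate:
  assumes k: "\<exists>j<d. k j \<noteq> 0"
  shows "\<exists>C::real. C \<ge> 0 \<and> (\<forall>n \<theta>. nzideal n \<longrightarrow>
    (\<integral>\<^sup>+x. fcount n x * ennreal (1 + cos (2 * pi * (int_lin k x + \<theta>))) * indicator D0 x \<partial>PM)
       \<le> ennreal ((ideal_\<Phi> n + sqrt (C * ideal_Nm n)) * V n) \<and>
    ennreal ((ideal_\<Phi> n - sqrt (C * ideal_Nm n)) * V n) \<le>
    (\<integral>\<^sup>+x. fcount n x * ennreal (1 + cos (2 * pi * (int_lin k x + \<theta>))) * indicator D0 x \<partial>PM))"
proof -
  obtain C0 :: real where C0: "\<And>n. nzideal n \<Longrightarrow>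
    (cmod (\<Sum>\<gamma>\<in>reduced_fractions n. cis (2 * pi * of_rat (int_functional k \<gamma>))))\<^sup>2 \<le> C0 * real (ideal_Nm n)"
    using exponential_sum_le[OF k] by blast
  define C where "C = max 0 C0"
  have "(\<integral>\<^sup>+x. fcount n x * ennreal (1 + cos (2 * pi * (int_lin k x + \<theta>))) * indicator D0 x \<partial>PM)
       \<le> ennreal ((ideal_\<Phi> n + sqrt (C * ideal_Nm n)) * V n)" (is "?I \<le> _")
    "ennreal ((ideal_\<Phi> n - sqrt (C * ideal_Nm n)) * V n) \<le>
    (\<integral>\<^sup>+x. fcount n x * ennreal (1 + cos (2 * pi * (int_lin k x + \<theta>))) * indicator D0 x \<partial>PM)"
    if n: "nzideal n" for n \<theta>
  proof -
    let ?Q = "reduced_fractions n" and ?X = "polydisc (r n) (R n)"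
    define S where "S = (\<Sum>\<gamma>\<in>?Q. cis (2 * pi * of_rat (int_functional k \<gamma>)))"
    define E where "E = sqrt (C * ideal_Nm n)"
    have "(cmod S)\<^sup>2 \<le> C * ideal_Nm n"
      using C0[OF n] mult_right_mono[of C0 C "real (ideal_Nm n)"] by (simp add: S_def C_def)
    then have SE: "cmod S \<le> E" unfolding E_def by (rule real_le_rsqrt)
    define g where "g x = ennreal (1 + cos (2 * pi * (int_lin k x + \<theta>)))" for x
    have [measurable]: "g \<in> borel_measurable PM" unfolding g_def[abs_def] by measurable
    have gper: "g (tr a x) = g x" if "a \<in> OK" for a x
    proof -
      have "int_functional k a \<in> \<int>" using int_functional_algebraic_int that by simp
      then obtain l where "int_functional k a = of_int l" by (rule Ints_cases)
      then have "2 * pi * (int_lin k (tr a x) + \<theta>) = 2 * pi * (int_lin k x + \<theta>) + of_int l * 2 * pi"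
        by (simp add: int_lin_tr algebra_simps)
      then show ?thesis unfolding g_def
        using cos.plus_of_int[of "2 * pi * (int_lin k x + \<theta>)" l] by (simp add: mult_ac)
    qed
    have sumg: "(\<Sum>q\<in>?Q. g (tr q y)) = ennreal (ideal_\<Phi> n + Re (cis (2 * pi * (int_lin k y + \<theta>)) * S))" for y
    proof -
      have "(\<Sum>q\<in>?Q. g (tr q y)) = ennreal (\<Sum>q\<in>?Q. 1 + cos (2 * pi * (int_lin k (tr q y) + \<theta>)))"
      proof -
        have "0 \<le> 1 + cos z" for z :: real using cos_ge_minus_one[of z] by linarith
        then show ?thesis unfolding g_def by (intro sum_ennreal)
      qed
      also have "(\<Sum>q\<in>?Q. 1 + cos (2 * pi * (int_lin k (tr q y) + \<theta>)))
          = ideal_\<Phi> n + (\<Sum>q\<in>?Q. Re (cis (2 * pi * (int_lin k y + \<theta>)) * cis (2 * pi * of_rat (int_functional k q))))"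
        by (simp add: sum.distrib card_reduced_fractions[OF n] int_lin_tr cis_mult distrib_left add_ac)
      also have "(\<Sum>q\<in>?Q. Re (cis (2 * pi * (int_lin k y + \<theta>)) * cis (2 * pi * of_rat (int_functional k q))))
          = Re (cis (2 * pi * (int_lin k y + \<theta>)) * S)"
        unfolding S_def by (simp only: Re_sum sum_distrib_left)
      finally show ?thesis .
    qed
    have reS: "\<bar>Re (cis (2 * pi * (int_lin k y + \<theta>)) * S)\<bar> \<le> E" for y
      using abs_Re_le_cmod[of "cis (2 * pi * (int_lin k y + \<theta>)) * S"] SE by (simp add: norm_mult)
    have "?I = (\<Sum>q\<in>?Q. \<integral>\<^sup>+x. indicator (nbhd n q) x * g x \<partial>PM)"
      unfolding g_def[symmetric] by (rule integral_fcount) (use gper in auto)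
    also have "\<dots> = (\<Sum>q\<in>?Q. \<integral>\<^sup>+y. indicator ?X y * g (tr q y) \<partial>PM)"
    proof (rule sum.cong)
      fix q
      have "(\<integral>\<^sup>+x. indicator (nbhd n q) x * g x \<partial>PM) = (\<integral>\<^sup>+y. indicator (nbhd n q) (tr q y) * g (tr q y) \<partial>PM)"
        by (rule nn_integral_tr[symmetric]) measurable
      also have "\<dots> = (\<integral>\<^sup>+y. indicator ?X y * g (tr q y) \<partial>PM)"
        by (rule nn_integral_cong)
          (auto simp: nbhd_def tr_add tr_zero tr_in_space split: split_indicator)
      finally show "(\<integral>\<^sup>+x. indicator (nbhd n q) x * g x \<partial>PM) = (\<integral>\<^sup>+y. indicator ?X y * g (tr q y) \<partial>PM)" .
    qed simp
    also have "\<dots> = (\<integral>\<^sup>+y. (\<Sum>q\<in>?Q. indicator ?X y * g (tr q y)) \<partial>PM)"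
      by (rule nn_integral_sum[symmetric]) measurable
    also have "\<dots> = (\<integral>\<^sup>+y. ennreal (ideal_\<Phi> n + Re (cis (2 * pi * (int_lin k y + \<theta>)) * S)) * indicator ?X y \<partial>PM)"
      by (rule nn_integral_cong, subst sum_distrib_left[symmetric], subst sumg, rule mult.commute)
    finally have I: "?I = \<dots>" .
    have X: "emeasure PM ?X = ennreal (V n)" unfolding V_def using r_nonneg R_nonneg by (intro emeasure_polydisc)
    have "?I \<le> (\<integral>\<^sup>+y. ennreal (ideal_\<Phi> n + E) * indicator ?X y \<partial>PM)"
      unfolding I using reS by (intro nn_integral_mono mult_right_mono ennreal_leI add_left_mono) (auto simp: abs_le_iff)
    also have "\<dots> = ennreal ((ideal_\<Phi> n + E) * V n)"
      using V_nonneg[of n] by (simp add: nn_integral_cmult_indicator X ennreal_mult'')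
    finally show "?I \<le> ennreal ((ideal_\<Phi> n + sqrt (C * ideal_Nm n)) * V n)" by (simp add: E_def)
    have "ennreal ((ideal_\<Phi> n - E) * V n) = (\<integral>\<^sup>+y. ennreal (ideal_\<Phi> n - E) * indicator ?X y \<partial>PM)"
      using V_nonneg[of n] by (simp add: nn_integral_cmult_indicator X ennreal_mult'')
    also have "\<dots> \<le> ?I"
    proof -
      have "ideal_\<Phi> n - E \<le> ideal_\<Phi> n + Re (cis (2 * pi * (int_lin k y + \<theta>)) * S)" for y
        using reS[of y] by (simp add: abs_le_iff)
      then show ?thesis unfolding I by (intro nn_integral_mono mult_right_mono ennreal_leI) auto
    qed
    finally show "ennreal ((ideal_\<Phi> n - sqrt (C * ideal_Nm n)) * V n) \<le> ?I" by (simp add: E_def)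
  qed
  then show ?thesis by (intro exI[of _ C]) (auto simp: C_def)
qed

end

text \<open>The ramps \<open>h m\<close> increase to the indicator and vanish at \<open>c\<close>,
  so the strict inequality is reached exactly. Polynomials within \<open>1 / Suc m\<close> of them
  inherit the limit and the bound 1 + 1.\<close>

lemma indicator_greater_poly_approx:
  fixes c :: real
  shows "\<exists>p. (\<forall>m. real_polynomial_function (p m)) \<and> (\<forall>m. \<forall>v\<in>{-1..1}. \<bar>p m v\<bar> \<le> (2::real))
    \<and> (\<forall>v\<in>{-1..1}. (\<lambda>m::nat. p m v) \<longlonglongrightarrow> (if v > c then 1 else 0))"
proof -
  define h where "h m v = min 1 (max 0 (real m * (v - c)))" for m :: nat and v :: real
  have "\<exists>g. real_polynomial_function g \<and> (\<forall>v\<in>{-1..1}. \<bar>h m v - g v\<bar> < 1 / Suc m)" for m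
  proof -
    have "continuous_on {-1..1} (h m)" unfolding h_def[abs_def] by (intro continuous_intros)
    then obtain g where "real_polynomial_function g" "\<And>v. v \<in> {-1..1} \<Longrightarrow> \<bar>h m v - g v\<bar> < 1 / Suc m"
      using Stone_Weierstrass_real_polynomial_function[of "{-1..1::real}" "h m" "1 / Suc m"] by auto
    then show ?thesis by blast
  qed
  then obtain p where p: "\<And>m. real_polynomial_function (p m)"
    "\<And>m v. v \<in> {-1..1} \<Longrightarrow> \<bar>h m v - p m v\<bar> < 1 / Suc m" by metis
  have "\<bar>p m v\<bar> \<le> 2" if "v \<in> {-1..1}" for m v
  proof -
    have "0 \<le> h m v" "h m v \<le> 1" by (auto simp: h_def)
    moreover have "1 / real (Suc m) \<le> 1" by simp
    ultimately show ?thesis using p(2)[OF that, of m] by linarith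
  qed
  moreover have "(\<lambda>m. p m v) \<longlonglongrightarrow> (if v > c then 1 else 0)" if v: "v \<in> {-1..1}" for v
  proof -
    have "(\<lambda>m. h m v - p m v) \<longlonglongrightarrow> 0"
    proof (rule Lim_null_comparison)
      show "\<forall>\<^sub>F m in sequentially. norm (h m v - p m v) \<le> 1 / Suc m"
        using p(2)[OF v] by (intro always_eventually) (auto intro: less_imp_le)
      show "(\<lambda>m. 1 / real (Suc m)) \<longlonglongrightarrow> 0" by (rule LIMSEQ_Suc[OF lim_1_over_n])
    qed
    moreover have "h m v = (if v > c then 1 else 0)" if "real m \<ge> 1 / (v - c)" for m
    proof (cases "v > c")
      case True
      then have "real m * (v - c) \<ge> 1" using that by (simp add: field_simps)
      then show ?thesis using True by (simp add: h_def)
    next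
      case False
      then have "real m * (v - c) \<le> 0" by (simp add: mult_nonneg_nonpos)
      then show ?thesis using False by (simp add: h_def)
    qed
    then have "\<forall>\<^sub>F m in sequentially. h m v = (if v > c then 1 else 0)"
      using eventually_ge_at_top[of "nat \<lceil>1 / (v - c)\<rceil>"] by (auto elim!: eventually_mono simp: le_nat_iff ceiling_le_iff nat_le_iff)
    then have "(\<lambda>m. h m v) \<longlonglongrightarrow> (if v > c then 1 else 0)" by (rule tendsto_eventually)
    ultimately have "(\<lambda>m. h m v - (h m v - p m v)) \<longlonglongrightarrow> (if v > c then 1 else 0) - 0"
      by (intro tendsto_diff)
    then show ?thesis by simp
  qed
  ultimately show ?thesis using p(1) by blast
qed

text \<open>The interval from \<open>a\<close> to 1 is the arc around \<open>(a + 1) / 2\<close>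
  with half-angle \<open>pi * (1 - a)\<close>, and an arc is a superlevel set of a shifted cosine.
  At \<open>a = 0\<close> it is the circle without the point 0, as strictness requires.\<close>

lemma arc_characterisation:
  fixes a l :: real
  assumes "0 \<le> a" "a < 1" "0 \<le> l" "l < 1"
  shows "l > a \<longleftrightarrow> cos (2 * pi * (l + - (a + 1) / 2)) > cos (pi * (1 - a))"
proof -
  define y where "y = 2 * pi * (l + - (a + 1) / 2)"
  define \<beta> where "\<beta> = pi * (1 - a)"
  have \<beta>: "0 < \<beta>" "\<beta> \<le> pi" using assms by (auto simp: \<beta>_def mult_le_cancel_left1)
  have y: "y = 2 * pi * (l - a) - \<beta>" by (simp add: y_def \<beta>_def field_simps)
  have y2: "y = \<beta> - 2 * pi * (1 - l)" by (simp add: y_def \<beta>_def field_simps)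
  have pl: "2 * pi * (1 - l) > 0" using assms by simp
  show ?thesis
  proof (cases "l > a")
    case True
    then have "2 * pi * (l - a) > 0" by simp
    then have "\<bar>y\<bar> < \<beta>" using y y2 pl by linarith
    then have "cos \<beta> < cos \<bar>y\<bar>" using \<beta> by (intro cos_monotone_0_pi) auto
    then show ?thesis using True unfolding y_def[symmetric] \<beta>_def[symmetric] by simp
  next
    case False
    then have "2 * pi * (l - a) \<le> 0" by (simp add: mult_nonneg_nonpos)
    then have my: "- y \<ge> \<beta>" using y by linarith
    have "2 * pi * (1 - l) \<le> 2 * pi" using assms by simp
    then have my2: "- y \<le> 2 * pi - \<beta>" using y2 by linarith
    have "cos (- y) \<le> cos \<beta>"
    proof (cases "- y \<le> pi")
      case True
      then show ?thesis using my \<beta> by (intro cos_monotone_0_pi_le) auto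
    next
      case False
      have "cos (- y) = cos (2 * pi - (- y))" using cos_periodic[of y] by (simp add: add.commute)
      also have "\<dots> \<le> cos \<beta>" using False my2 \<beta> by (intro cos_monotone_0_pi_le) auto
      finally show ?thesis .
    qed
    then show ?thesis using False unfolding y_def[symmetric] \<beta>_def[symmetric] by simp
  qed
qed

lemma young_inequality:
  fixes u v e :: real
  assumes "e > 0" shows "u * v \<le> e / 2 * u\<^sup>2 + 1 / (2 * e) * v\<^sup>2"
proof -
  have "0 \<le> (e * u - v)\<^sup>2" by simp
  then have "u * v * (2 * e) \<le> e\<^sup>2 * u\<^sup>2 + v\<^sup>2" by (simp add: power2_diff power_mult_distrib mult_ac)
  then have "u * v \<le> (e\<^sup>2 * u\<^sup>2 + v\<^sup>2) / (2 * e)" using assms by (simp add: le_divide_eq)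
  also have "\<dots> = e / 2 * u\<^sup>2 + 1 / (2 * e) * v\<^sup>2" using assms by (simp add: add_divide_distrib power2_eq_square)
  finally show ?thesis .
qed

section \<open>First and second moments of the counting functions\<close>

locale divergent_radii = approximation_radii d b \<phi> s t \<sigma> \<tau> r R
  for d and b :: "nat \<Rightarrow> 'k::field_char_0" and \<phi> s t \<sigma> \<tau> r R +
  fixes G :: "'k set set" and \<delta> :: real
  assumes G_nzideal: "n \<in> G \<Longrightarrow> nzideal n"
    and \<delta>_pos: "\<delta> > 0"
    and G_\<Phi>: "n \<in> G \<Longrightarrow> \<delta> * ideal_Nm n \<le> ideal_\<Phi> n"
    and G_divergent: "\<exists>k::nat. B \<le> (\<Sum>n\<in>{n\<in>G. ideal_Nm n \<le> k}. ideal_\<Phi> n * V n)"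
begin

definition Gk :: "nat \<Rightarrow> 'k set set" where "Gk k = {n \<in> G. ideal_Nm n \<le> k}"

definition S :: "nat \<Rightarrow> real" where "S k = (\<Sum>n\<in>Gk k. ideal_\<Phi> n * V n)"

definition A :: "nat \<Rightarrow> point \<Rightarrow> ennreal" where "A k x = (\<Sum>n\<in>Gk k. fcount n x)"

definition N :: "point measure" where "N = restrict_space PM D0"

lemma finite_Gk: "finite (Gk k)"
  by (rule finite_subset[OF _ finite_ideals_bounded_Nm[of k]]) (auto simp: Gk_def G_nzideal)

lemma Gk_mono: "k \<le> k' \<Longrightarrow> Gk k \<subseteq> Gk k'"
  by (auto simp: Gk_def)

lemma \<Phi>V_nonneg: "0 \<le> ideal_\<Phi> n * V n"
  using V_nonneg by simp

lemma S_mono: "k \<le> k' \<Longrightarrow> S k \<le> S k'"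
  unfolding S_def using finite_Gk Gk_mono \<Phi>V_nonneg by (intro sum_mono2) auto

lemma S_at_top: "filterlim S at_top sequentially"
  unfolding filterlim_at_top
proof
  fix B
  obtain k where "B \<le> S k" using G_divergent[of B] by (auto simp: S_def Gk_def)
  then have "\<forall>k'\<ge>k. B \<le> S k'" using S_mono order.trans by blast
  then show "\<forall>\<^sub>F k in sequentially. B \<le> S k" by (auto simp: eventually_sequentially)
qed

lemma measurable_A [measurable]: "A k \<in> borel_measurable PM"
  unfolding A_def[abs_def] by measurable

lemma space_N: "space N = D0"
  unfolding N_def using D0_subset_space by (simp add: space_restrict_space Int_absorb2)

lemma measurable_N: "f \<in> measurable PM M' \<Longrightarrow> f \<in> measurable N M'"
  unfolding N_def by (rule measurable_restrict_space1)

lemma nn_integral_N: "(\<integral>\<^sup>+x. f x \<partial>N) = (\<integral>\<^sup>+x. f x * indicator D0 x \<partial>PM)"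
  unfolding N_def by (rule nn_integral_restrict_space) (simp add: sets.Int_space_eq2)

lemma emeasure_N: "B \<in> sets N \<Longrightarrow> emeasure N B = emeasure PM B"
  unfolding N_def by (subst emeasure_restrict_space) (auto simp: sets.Int_space_eq2 sets_restrict_space)

lemma finite_measure_N: "finite_measure N"
proof (rule finite_measureI)
  have "D0 \<in> sets N" using sets.top[of N] by (simp add: space_N)
  then show "emeasure N (space N) \<noteq> \<infinity>" using emeasure_D0(1) by (simp add: space_N emeasure_N)
qed

sublocale N: finite_measure N by (rule finite_measure_N)

definition \<mu>0 :: real where "\<mu>0 = measure N (space N)"

lemma \<mu>0_pos: "\<mu>0 > 0"
proof -
  have "D0 \<in> sets N" using sets.top[of N] by (simp add: space_N)
  then show ?thesis unfolding \<mu>0_def space_N measure_def emeasure_N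
    using emeasure_D0 by (simp add: emeasure_N enn2real_positive_iff)
qed

lemma integral_A: "(\<integral>\<^sup>+x. A k x \<partial>N) = ennreal (S k)"
proof -
  have "(\<integral>\<^sup>+x. A k x \<partial>N) = (\<Sum>n\<in>Gk k. \<integral>\<^sup>+x. fcount n x * indicator D0 x \<partial>PM)"
    unfolding nn_integral_N A_def sum_distrib_right by (rule nn_integral_sum) measurable
  also have "\<dots> = (\<Sum>n\<in>Gk k. ennreal (ideal_\<Phi> n * V n))"
    by (intro sum.cong refl integral_fcount_one) (simp add: Gk_def G_nzideal)
  also have "\<dots> = ennreal (S k)" unfolding S_def using \<Phi>V_nonneg by (intro sum_ennreal)
  finally show ?thesis .
qed

text \<open>The diagonal of the overlap estimate sums to \<open>S k\<close>. In the rest, Nm(n) is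
  at most \<Phi>(n) / \<delta> on \<open>G\<close>, which turns the double sum into a multiple of
  the square of \<open>S k\<close>.\<close>

lemma integral_A_squared: "\<exists>C > 0. \<forall>k. (\<integral>\<^sup>+x. A k x * A k x \<partial>N) \<le> ennreal (S k + C * (S k)\<^sup>2)"
proof -
  obtain C where C: "C > 0" "\<And>m n. nzideal m \<Longrightarrow> nzideal n \<Longrightarrow>
    (\<integral>\<^sup>+x. fcount m x * fcount n x * indicator D0 x \<partial>PM)
      \<le> ennreal ((if m = n then ideal_\<Phi> n * V n else 0) + C * (ideal_Nm m * V m) * (ideal_Nm n * V n))"
    using overlap_estimate by blast
  have "(\<integral>\<^sup>+x. A k x * A k x \<partial>N) \<le> ennreal (S k + (C / \<delta>\<^sup>2) * (S k)\<^sup>2)" for k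
  proof -
    let ?w = "\<lambda>n. real (ideal_Nm n) * V n"
    have w: "?w n \<ge> 0" for n using V_nonneg by simp
    have "(\<integral>\<^sup>+x. A k x * A k x \<partial>N) = (\<integral>\<^sup>+x. (\<Sum>m\<in>Gk k. \<Sum>n\<in>Gk k. fcount m x * fcount n x * indicator D0 x) \<partial>PM)"
      unfolding nn_integral_N A_def sum_product by (simp only: sum_distrib_right)
    also have "\<dots> = (\<Sum>m\<in>Gk k. \<Sum>n\<in>Gk k. \<integral>\<^sup>+x. fcount m x * fcount n x * indicator D0 x \<partial>PM)"
      by (subst nn_integral_sum, measurable, intro sum.cong refl nn_integral_sum) measurable
    also have "\<dots> \<le> (\<Sum>m\<in>Gk k. \<Sum>n\<in>Gk k. ennreal ((if m = n then ideal_\<Phi> n * V n else 0) + C * ?w m * ?w n))"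
      by (intro sum_mono C(2)) (auto simp: Gk_def G_nzideal)
    also have "\<dots> = ennreal (\<Sum>m\<in>Gk k. \<Sum>n\<in>Gk k. (if m = n then ideal_\<Phi> n * V n else 0) + C * ?w m * ?w n)"
    proof -
      have nn: "0 \<le> (if m = n then ideal_\<Phi> n * V n else 0) + C * ?w m * ?w n" for m n
        using mult_nonneg_nonneg[OF mult_nonneg_nonneg[OF less_imp_le[OF C(1)] w] w, of m n] \<Phi>V_nonneg by simp
      show ?thesis using nn by (simp add: sum_ennreal sum_nonneg)
    qed
    also have "(\<Sum>m\<in>Gk k. \<Sum>n\<in>Gk k. (if m = n then ideal_\<Phi> n * V n else 0) + C * ?w m * ?w n)
        = S k + C * (\<Sum>n\<in>Gk k. ?w n)\<^sup>2"
    proof -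
      have "(\<Sum>m\<in>Gk k. \<Sum>n\<in>Gk k. if m = n then ideal_\<Phi> n * V n else 0) = S k"
        unfolding S_def using finite_Gk by (intro sum.cong) auto
      moreover have "(\<Sum>m\<in>Gk k. \<Sum>n\<in>Gk k. C * ?w m * ?w n) = C * (\<Sum>n\<in>Gk k. ?w n)\<^sup>2"
        unfolding power2_eq_square sum_product by (simp only: sum_distrib_left mult.assoc)
      ultimately show ?thesis by (simp add: sum.distrib)
    qed
    also have "ennreal (S k + C * (\<Sum>n\<in>Gk k. ?w n)\<^sup>2) \<le> ennreal (S k + (C / \<delta>\<^sup>2) * (S k)\<^sup>2)"
    proof (intro ennreal_leI add_left_mono)
      have "(\<Sum>n\<in>Gk k. ?w n) \<le> (\<Sum>n\<in>Gk k. ideal_\<Phi> n * V n / \<delta>)"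
      proof (rule sum_mono)
        fix n assume "n \<in> Gk k"
        then have "\<delta> * ideal_Nm n \<le> ideal_\<Phi> n" by (simp add: Gk_def G_\<Phi>)
        then have "\<delta> * ideal_Nm n * V n \<le> ideal_\<Phi> n * V n" using V_nonneg by (rule mult_right_mono)
        then show "?w n \<le> ideal_\<Phi> n * V n / \<delta>" using \<delta>_pos by (simp add: field_simps)
      qed
      also have "\<dots> = S k / \<delta>" by (simp add: S_def sum_divide_distrib)
      finally have "(\<Sum>n\<in>Gk k. ?w n)\<^sup>2 \<le> (S k / \<delta>)\<^sup>2" using w by (intro power_mono sum_nonneg)
      then have "C * (\<Sum>n\<in>Gk k. ?w n)\<^sup>2 \<le> C * (S k / \<delta>)\<^sup>2" using C(1) by (intro mult_left_mono) auto
      then show "C * (\<Sum>n\<in>Gk k. ?w n)\<^sup>2 \<le> (C / \<delta>\<^sup>2) * (S k)\<^sup>2" by (simp add: power_divide)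
    qed
    finally show ?thesis .
  qed
  then show ?thesis using C(1) \<delta>_pos by (intro exI[of _ "C / \<delta>\<^sup>2"]) auto
qed

text \<open>The counting function divided by its integral over \<open>D0\<close>. The value 0 of
  \<open>enn2real\<close> at infinity affects a null set only.\<close>

definition a :: "nat \<Rightarrow> point \<Rightarrow> real" where "a k x = enn2real (A k x) / S k"

lemma measurable_a [measurable]: "a k \<in> borel_measurable N"
  unfolding a_def[abs_def] by (intro borel_measurable_divide measurable_compose[OF measurable_N[OF measurable_A]]) auto

lemma A_finite_AE: "AE x in N. A k x < \<infinity>"
proof -
  have "(\<integral>\<^sup>+x. A k x \<partial>N) \<noteq> \<infinity>" by (simp add: integral_A)
  from nn_integral_PInf_AE[OF measurable_N[OF measurable_A] this] show ?thesis
    by (auto elim!: eventually_mono simp: less_top)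
qed

lemma S_pos_eventually: "\<exists>k0. \<forall>k\<ge>k0. S k \<ge> 1"
  using S_at_top unfolding filterlim_at_top eventually_sequentially by blast

lemma a_nonneg: "S k \<ge> 1 \<Longrightarrow> a k x \<ge> 0"
  by (simp add: a_def)

lemma ennreal_a: "S k \<ge> 1 \<Longrightarrow> A k x < \<infinity> \<Longrightarrow> ennreal (a k x) = A k x * ennreal (1 / S k)"
  by (simp add: a_def divide_inverse ennreal_mult less_top[symmetric])

lemma nn_integral_a:
  assumes S: "S k \<ge> 1" and g: "g \<in> borel_measurable N"
  shows "(\<integral>\<^sup>+x. ennreal (a k x) * g x \<partial>N) = ennreal (1 / S k) * (\<integral>\<^sup>+x. A k x * g x \<partial>N)"
proof -
  have [measurable]: "A k \<in> borel_measurable N" by (rule measurable_N[OF measurable_A])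
  have "(\<integral>\<^sup>+x. ennreal (a k x) * g x \<partial>N) = (\<integral>\<^sup>+x. ennreal (1 / S k) * (A k x * g x) \<partial>N)"
    by (rule nn_integral_cong_AE) (use A_finite_AE[of k] in \<open>auto elim!: eventually_mono simp: ennreal_a[OF S] mult_ac\<close>)
  also have "\<dots> = ennreal (1 / S k) * (\<integral>\<^sup>+x. A k x * g x \<partial>N)"
    using g by (intro nn_integral_cmult) measurable
  finally show ?thesis .
qed

lemma integrable_a: assumes S: "S k \<ge> 1" shows "integrable N (a k)" "integral\<^sup>L N (a k) = 1"
proof -
  have "(\<integral>\<^sup>+x. ennreal (a k x) \<partial>N) = (\<integral>\<^sup>+x. ennreal (a k x) * 1 \<partial>N)" by simp
  also have "\<dots> = ennreal (1 / S k) * ennreal (S k)"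
    unfolding nn_integral_a[OF S borel_measurable_const] by (simp add: integral_A)
  also have "\<dots> = 1" using S by (simp flip: ennreal_mult')
  finally have e: "(\<integral>\<^sup>+x. ennreal (a k x) \<partial>N) = 1" .
  show "integrable N (a k)" using e a_nonneg[OF S] by (intro integrableI_nonneg) auto
  show "integral\<^sup>L N (a k) = 1" using e a_nonneg[OF S] by (subst integral_eq_nn_integral) auto
qed

text \<open>After division by the square of \<open>S k\<close> the diagonal contributes
  \<open>1 / S k\<close>, at most 1, and the rest a constant.\<close>

lemma a_squared:
  "\<exists>C > 0. \<forall>k. S k \<ge> 1 \<longrightarrow> integrable N (\<lambda>x. (a k x)\<^sup>2) \<and> (\<integral>x. (a k x)\<^sup>2 \<partial>N) \<le> C"
proof -
  obtain C where C: "C > 0" "\<And>k. (\<integral>\<^sup>+x. A k x * A k x \<partial>N) \<le> ennreal (S k + C * (S k)\<^sup>2)"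
    using integral_A_squared by blast
  have "integrable N (\<lambda>x. (a k x)\<^sup>2) \<and> (\<integral>x. (a k x)\<^sup>2 \<partial>N) \<le> 1 + C" if S: "S k \<ge> 1" for k
  proof -
    have [measurable]: "A k \<in> borel_measurable N" by (rule measurable_N[OF measurable_A])
    have "(\<integral>\<^sup>+x. ennreal ((a k x)\<^sup>2) \<partial>N) = (\<integral>\<^sup>+x. ennreal (a k x) * ennreal (a k x) \<partial>N)"
      using a_nonneg[OF S] by (simp add: power2_eq_square ennreal_mult')
    also have "\<dots> = ennreal (1 / S k) * (\<integral>\<^sup>+x. A k x * ennreal (a k x) \<partial>N)"
      by (rule nn_integral_a[OF S]) measurable
    also have "(\<integral>\<^sup>+x. A k x * ennreal (a k x) \<partial>N) = (\<integral>\<^sup>+x. ennreal (a k x) * A k x \<partial>N)"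
      by (simp add: mult.commute)
    also have "\<dots> = ennreal (1 / S k) * (\<integral>\<^sup>+x. A k x * A k x \<partial>N)"
      by (rule nn_integral_a[OF S]) measurable
    also have "ennreal (1 / S k) * \<dots> \<le> ennreal (1 / S k) * (ennreal (1 / S k) * ennreal (S k + C * (S k)\<^sup>2))"
      by (intro mult_left_mono C(2)) auto
    also have "\<dots> = ennreal (1 / S k * (1 / S k * (S k + C * (S k)\<^sup>2)))"
    proof -
      have "ennreal (1 / S k * X) = ennreal (1 / S k) * ennreal X" for X
        using S by (intro ennreal_mult') simp
      then show ?thesis by (simp only:)
    qed
    also have "\<dots> \<le> ennreal (1 + C)"
    proof (rule ennreal_leI)
      have "S k \<noteq> 0" using S by simp
      then have "1 / S k * (1 / S k * (S k + C * (S k)\<^sup>2)) = 1 / S k + C"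
        by (simp add: power2_eq_square distrib_left)
      also have "\<dots> \<le> 1 + C" using S by simp
      finally show "1 / S k * (1 / S k * (S k + C * (S k)\<^sup>2)) \<le> 1 + C" .
    qed
    finally have le: "(\<integral>\<^sup>+x. ennreal ((a k x)\<^sup>2) \<partial>N) \<le> ennreal (1 + C)" .
    have int: "integrable N (\<lambda>x. (a k x)\<^sup>2)"
      using le by (intro integrableI_nonneg) (auto intro: le_less_trans)
    have "ennreal (\<integral>x. (a k x)\<^sup>2 \<partial>N) = (\<integral>\<^sup>+x. ennreal ((a k x)\<^sup>2) \<partial>N)"
      by (rule nn_integral_eq_integral[symmetric, OF int]) auto
    with le have "ennreal (\<integral>x. (a k x)\<^sup>2 \<partial>N) \<le> ennreal (1 + C)" by simp
    then show ?thesis using int C(1) by (subst (asm) ennreal_le_iff) auto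
  qed
  then show ?thesis using C(1) by (intro exI[of _ "1 + C"]) auto
qed

text \<open>
  The bounded test functions against which the normalised counting functions \<open>a k\<close> behave as if
  they converged weakly to the uniform distribution on \<open>D0\<close>.
\<close>

definition equi :: "(point \<Rightarrow> real) set" where
  "equi = {g. g \<in> borel_measurable N \<and> (\<exists>c. \<forall>x\<in>D0. \<bar>g x\<bar> \<le> c) \<and>
     (\<lambda>k. \<integral>x. a k x * g x \<partial>N) \<longlonglongrightarrow> (\<integral>x. g x \<partial>N) / \<mu>0}"

lemma integrable_bounded:
  assumes "g \<in> borel_measurable N" "\<And>x. x \<in> D0 \<Longrightarrow> \<bar>g x\<bar> \<le> (c::real)"
  shows "integrable N g"
  by (rule N.integrable_const_bound[of _ c]) (use assms in \<open>auto simp: space_N\<close>)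

lemma integrable_a_bounded:
  assumes S: "S k \<ge> 1" and g: "g \<in> borel_measurable N" "\<And>x. x \<in> D0 \<Longrightarrow> \<bar>g x\<bar> \<le> (c::real)"
  shows "integrable N (\<lambda>x. a k x * g x)"
proof (rule Bochner_Integration.integrable_bound)
  show "integrable N (\<lambda>x. c * a k x)" using integrable_a(1)[OF S] by simp
  show "(\<lambda>x. a k x * g x) \<in> borel_measurable N" using g(1) by measurable
  show "AE x in N. norm (a k x * g x) \<le> norm (c * a k x)"
  proof (rule AE_I2)
    fix x assume "x \<in> space N"
    then have "\<bar>g x\<bar> \<le> c" using g(2) by (simp add: space_N)
    then have "\<bar>a k x\<bar> * \<bar>g x\<bar> \<le> \<bar>c\<bar> * \<bar>a k x\<bar>"
      by (subst mult.commute) (intro mult_right_mono, auto)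
    then show "norm (a k x * g x) \<le> norm (c * a k x)" by (simp add: abs_mult)
  qed
qed

lemma S_ge_1_eventually: "\<forall>\<^sub>F k in sequentially. S k \<ge> 1"
  using S_pos_eventually by (auto simp: eventually_sequentially)

lemma equi_add: assumes "f \<in> equi" "g \<in> equi" shows "(\<lambda>x. f x + g x) \<in> equi"
proof -
  obtain c e where ce: "\<And>x. x \<in> D0 \<Longrightarrow> \<bar>f x\<bar> \<le> c" "\<And>x. x \<in> D0 \<Longrightarrow> \<bar>g x\<bar> \<le> e"
    using assms by (auto simp: equi_def)
  have m: "f \<in> borel_measurable N" "g \<in> borel_measurable N" using assms by (auto simp: equi_def)
  have "(\<lambda>k. (\<integral>x. a k x * f x \<partial>N) + (\<integral>x. a k x * g x \<partial>N)) \<longlonglongrightarrow> (\<integral>x. f x \<partial>N) / \<mu>0 + (\<integral>x. g x \<partial>N) / \<mu>0"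
    using assms by (intro tendsto_add) (auto simp: equi_def)
  also have "(\<integral>x. f x \<partial>N) / \<mu>0 + (\<integral>x. g x \<partial>N) / \<mu>0 = (\<integral>x. f x + g x \<partial>N) / \<mu>0"
    using integrable_bounded[OF m(1) ce(1)] integrable_bounded[OF m(2) ce(2)]
    by (simp add: add_divide_distrib)
  finally have "(\<lambda>k. \<integral>x. a k x * (f x + g x) \<partial>N) \<longlonglongrightarrow> (\<integral>x. f x + g x \<partial>N) / \<mu>0"
  proof (rule Lim_transform_eventually)
    show "\<forall>\<^sub>F k in sequentially. (\<integral>x. a k x * f x \<partial>N) + (\<integral>x. a k x * g x \<partial>N) = (\<integral>x. a k x * (f x + g x) \<partial>N)"
      using S_ge_1_eventually
      by (rule eventually_mono)
        (simp add: distrib_left integrable_a_bounded[OF _ m(1) ce(1)] integrable_a_bounded[OF _ m(2) ce(2)])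
  qed
  moreover have "\<forall>x\<in>D0. \<bar>f x + g x\<bar> \<le> c + e" by (intro ballI order.trans[OF abs_triangle_ineq] add_mono ce)
  ultimately show ?thesis using m unfolding equi_def by auto
qed

lemma equi_scale: assumes "f \<in> equi" shows "(\<lambda>x. c * f x) \<in> equi"
proof -
  obtain e where e: "\<And>x. x \<in> D0 \<Longrightarrow> \<bar>f x\<bar> \<le> e" using assms by (auto simp: equi_def)
  have m: "f \<in> borel_measurable N" using assms by (auto simp: equi_def)
  have "(\<lambda>k. c * (\<integral>x. a k x * f x \<partial>N)) \<longlonglongrightarrow> c * ((\<integral>x. f x \<partial>N) / \<mu>0)"
    using assms by (intro tendsto_mult tendsto_const) (auto simp: equi_def)
  then have "(\<lambda>k. \<integral>x. a k x * (c * f x) \<partial>N) \<longlonglongrightarrow> (\<integral>x. c * f x \<partial>N) / \<mu>0"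
    by (simp add: mult.left_commute[of _ c])
  moreover have "\<forall>x\<in>D0. \<bar>c * f x\<bar> \<le> \<bar>c\<bar> * e" using e by (auto simp: abs_mult intro!: mult_left_mono)
  ultimately show ?thesis using m unfolding equi_def by auto
qed

lemma equi_const: "(\<lambda>x. c) \<in> equi"
proof -
  have "(\<lambda>k. \<integral>x. a k x * 1 \<partial>N) \<longlonglongrightarrow> 1"
    by (rule tendsto_eventually, rule eventually_mono[OF S_ge_1_eventually]) (simp add: integrable_a)
  moreover have "(\<integral>x. (1::real) \<partial>N) / \<mu>0 = 1" using \<mu>0_pos by (simp add: \<mu>0_def)
  ultimately have "(\<lambda>x. 1) \<in> equi" unfolding equi_def by (auto intro!: exI[of _ 1])
  from equi_scale[OF this, of c] show ?thesis by simp
qed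

text \<open>Dominated convergence makes \<open>g m - f\<close> small in square mean. The common
  bound for the square means of the \<open>a k\<close> transfers this to integrals against
  \<open>a k\<close>, uniformly in \<open>k\<close>.\<close>

lemma equi_limit:
  assumes g: "\<And>m::nat. g m \<in> equi" and bd: "\<And>m x. x \<in> D0 \<Longrightarrow> \<bar>g m x\<bar> \<le> c"
    and lim: "\<And>x. x \<in> D0 \<Longrightarrow> (\<lambda>m. g m x) \<longlonglongrightarrow> f x"
  shows "f \<in> equi"
proof -
  have gm: "g m \<in> borel_measurable N" for m using g by (auto simp: equi_def)
  have fm: "f \<in> borel_measurable N"
    by (rule borel_measurable_LIMSEQ_real[OF _ gm]) (use lim in \<open>simp add: space_N\<close>)
  have fb: "\<bar>f x\<bar> \<le> c" if "x \<in> D0" for x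
    by (rule Lim_bounded[of "\<lambda>m. \<bar>g m x\<bar>"]) (use lim[OF that] bd[OF that] in \<open>auto intro: tendsto_rabs\<close>)
  obtain C where C: "C > 0" "\<And>k. S k \<ge> 1 \<Longrightarrow> integrable N (\<lambda>x. (a k x)\<^sup>2)"
    "\<And>k. S k \<ge> 1 \<Longrightarrow> (\<integral>x. (a k x)\<^sup>2 \<partial>N) \<le> C" using a_squared by blast
  have lim2: "(\<lambda>m. \<integral>x. (g m x - f x)\<^sup>2 \<partial>N) \<longlonglongrightarrow> (\<integral>x. 0 \<partial>N)"
  proof (rule integral_dominated_convergence[where w = "\<lambda>x. (2 * c)\<^sup>2"])
    show "AE x in N. (\<lambda>m. (g m x - f x)\<^sup>2) \<longlonglongrightarrow> 0"
    proof (rule AE_I2)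
      fix x assume "x \<in> space N"
      then have "(\<lambda>m. (g m x - f x)\<^sup>2) \<longlonglongrightarrow> (f x - f x)\<^sup>2"
        using lim by (intro tendsto_intros) (simp add: space_N)
      then show "(\<lambda>m. (g m x - f x)\<^sup>2) \<longlonglongrightarrow> 0" by simp
    qed
    show "AE x in N. norm ((g m x - f x)\<^sup>2) \<le> (2 * c)\<^sup>2" for m
    proof (rule AE_I2)
      fix x assume "x \<in> space N"
      then have "\<bar>g m x - f x\<bar> \<le> 2 * c" using bd[of x m] fb[of x] by (simp add: space_N)
      then have "\<bar>g m x - f x\<bar>\<^sup>2 \<le> (2 * c)\<^sup>2" by (intro power_mono) auto
      then show "norm ((g m x - f x)\<^sup>2) \<le> (2 * c)\<^sup>2" by simp
    qed
  qed (use gm fm in measurable)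
  have lim1: "(\<lambda>m. \<integral>x. g m x \<partial>N) \<longlonglongrightarrow> (\<integral>x. f x \<partial>N)"
    by (rule integral_dominated_convergence[where w = "\<lambda>x. c"])
      (use gm fm lim bd in \<open>auto simp: space_N\<close>)
  have "(\<lambda>k. \<integral>x. a k x * f x \<partial>N) \<longlonglongrightarrow> (\<integral>x. f x \<partial>N) / \<mu>0"
  proof (rule LIMSEQ_I)
    fix e :: real assume e: "e > 0"
    \<comment> \<open>With this weight both halves of Young's inequality are at most
      \<open>e / 4\<close>: one is \<open>\<epsilon> / 2 * C\<close>, the other uses the bound
      \<open>\<epsilon> * e / 2\<close> on the square mean. The remaining two quarters go to the
      limit in \<open>k\<close> for \<open>g m\<close> and to the integral of
      \<open>g m\<close>.\<close>
    define \<epsilon> where "\<epsilon> = e / (2 * C)"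
    have \<epsilon>: "\<epsilon> > 0" using e C(1) by (simp add: \<epsilon>_def)
    have "\<forall>\<^sub>F m in sequentially. (\<integral>x. (g m x - f x)\<^sup>2 \<partial>N) < \<epsilon> * e / 2"
      using lim2 \<epsilon> e by (intro order_tendstoD(2)[of _ 0]) auto
    moreover have "\<forall>\<^sub>F m in sequentially. dist (\<integral>x. g m x \<partial>N) (\<integral>x. f x \<partial>N) < e / 4 * \<mu>0"
      using lim1 e \<mu>0_pos by (intro tendstoD) auto
    ultimately have "\<forall>\<^sub>F m in sequentially. (\<integral>x. (g m x - f x)\<^sup>2 \<partial>N) < \<epsilon> * e / 2 \<and>
        dist (\<integral>x. g m x \<partial>N) (\<integral>x. f x \<partial>N) < e / 4 * \<mu>0" by (rule eventually_conj)
    then obtain m where m: "(\<integral>x. (g m x - f x)\<^sup>2 \<partial>N) < \<epsilon> * e / 2"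
      "\<bar>(\<integral>x. g m x \<partial>N) - (\<integral>x. f x \<partial>N)\<bar> < e / 4 * \<mu>0"
      by (auto simp: eventually_sequentially dist_real_def)
    have m3: "\<bar>(\<integral>x. g m x \<partial>N) / \<mu>0 - (\<integral>x. f x \<partial>N) / \<mu>0\<bar> < e / 4"
    proof -
      have "\<bar>(\<integral>x. g m x \<partial>N) / \<mu>0 - (\<integral>x. f x \<partial>N) / \<mu>0\<bar> = \<bar>(\<integral>x. g m x \<partial>N) - (\<integral>x. f x \<partial>N)\<bar> / \<mu>0"
        using \<mu>0_pos by (simp add: diff_divide_distrib[symmetric] abs_divide)
      also have "\<dots> < e / 4" using m(2) \<mu>0_pos by (simp add: divide_less_eq)
      finally show ?thesis .
    qed
    have "(\<lambda>k. \<integral>x. a k x * g m x \<partial>N) \<longlonglongrightarrow> (\<integral>x. g m x \<partial>N) / \<mu>0" using g by (simp add: equi_def)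
    then have "\<forall>\<^sub>F k in sequentially. dist (\<integral>x. a k x * g m x \<partial>N) ((\<integral>x. g m x \<partial>N) / \<mu>0) < e / 4"
      using e by (intro tendstoD) auto
    then have "\<forall>\<^sub>F k in sequentially. norm ((\<integral>x. a k x * f x \<partial>N) - (\<integral>x. f x \<partial>N) / \<mu>0) < e"
      using S_ge_1_eventually
    proof eventually_elim
      case (elim k)
      let ?h = "\<lambda>x. g m x - f x"
      have hm: "?h \<in> borel_measurable N" using gm fm by measurable
      have hb: "\<bar>?h x\<bar> \<le> 2 * c" if "x \<in> D0" for x using bd[OF that, of m] fb[OF that] by linarith
      have ih: "integrable N (\<lambda>x. a k x * ?h x)" by (rule integrable_a_bounded[OF elim(2) hm hb])
      have ih2: "integrable N (\<lambda>x. (?h x)\<^sup>2)"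
      proof (rule integrable_bounded)
        show "\<bar>(?h x)\<^sup>2\<bar> \<le> (2 * c)\<^sup>2" if "x \<in> D0" for x
          using power_mono[OF hb[OF that], of 2] by simp
      qed (use hm in measurable)
      have "\<bar>\<integral>x. a k x * ?h x \<partial>N\<bar> \<le> (\<integral>x. \<bar>a k x * ?h x\<bar> \<partial>N)" by (rule integral_abs_bound)
      also have "\<dots> \<le> (\<integral>x. \<epsilon> / 2 * (a k x)\<^sup>2 + 1 / (2 * \<epsilon>) * (?h x)\<^sup>2 \<partial>N)"
      proof (rule integral_mono)
        show "integrable N (\<lambda>x. \<bar>a k x * ?h x\<bar>)" using ih by simp
        show "integrable N (\<lambda>x. \<epsilon> / 2 * (a k x)\<^sup>2 + 1 / (2 * \<epsilon>) * (?h x)\<^sup>2)"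
          using C(2)[OF elim(2)] ih2 by simp
        show "\<bar>a k x * ?h x\<bar> \<le> \<epsilon> / 2 * (a k x)\<^sup>2 + 1 / (2 * \<epsilon>) * (?h x)\<^sup>2" for x
          using young_inequality[OF \<epsilon>, of "\<bar>a k x\<bar>" "\<bar>?h x\<bar>"] by (simp only: abs_mult power2_abs)
      qed
      also have "\<dots> = \<epsilon> / 2 * (\<integral>x. (a k x)\<^sup>2 \<partial>N) + 1 / (2 * \<epsilon>) * (\<integral>x. (?h x)\<^sup>2 \<partial>N)"
        using C(2)[OF elim(2)] ih2 by simp
      also have "\<dots> \<le> \<epsilon> / 2 * C + 1 / (2 * \<epsilon>) * (\<epsilon> * e / 2)"
        using C(3)[OF elim(2)] m(1) \<epsilon> by (intro add_mono mult_left_mono) auto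
      also have "\<dots> = e / 4 + e / 4" using \<epsilon> C(1) by (simp add: \<epsilon>_def)
      finally have h: "\<bar>\<integral>x. a k x * ?h x \<partial>N\<bar> \<le> e / 2" by simp
      have "(\<integral>x. a k x * ?h x \<partial>N) = (\<integral>x. a k x * g m x \<partial>N) - (\<integral>x. a k x * f x \<partial>N)"
        using integrable_a_bounded[OF elim(2) gm bd] integrable_a_bounded[OF elim(2) fm fb]
        by (simp add: right_diff_distrib)
      then show ?case using h m3 elim(1) unfolding dist_real_def real_norm_def by linarith
    qed
    then show "\<exists>no. \<forall>k\<ge>no. norm ((\<integral>x. a k x * f x \<partial>N) - (\<integral>x. f x \<partial>N) / \<mu>0) < e"
      by (simp add: eventually_sequentially)
  qed
  moreover have "\<exists>c. \<forall>x\<in>D0. \<bar>f x\<bar> \<le> c" using fb by blast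
  ultimately show ?thesis using fm unfolding equi_def by simp
qed

end

section \<open>Weak convergence of the counting functions\<close>

text \<open>Real trigonometric polynomials with frequencies from \<open>L\<close>; arbitrary phases
  take the place of sines, so that the product formula stays within cosines.\<close>

inductive_set cosine_sums :: "('k \<Rightarrow> point \<Rightarrow> real) \<Rightarrow> (point \<Rightarrow> real) set" for L :: "'k \<Rightarrow> point \<Rightarrow> real" where
  cosine: "(\<lambda>x. cos (2 * pi * (L k x + \<theta>))) \<in> cosine_sums L"
| add: "f \<in> cosine_sums L \<Longrightarrow> g \<in> cosine_sums L \<Longrightarrow> (\<lambda>x. f x + g x) \<in> cosine_sums L"
| scale: "f \<in> cosine_sums L \<Longrightarrow> (\<lambda>x. c * f x) \<in> cosine_sums L"

text \<open>A product of two cosines is half the sum of the cosines of the difference and the sum of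
  their arguments; hence the closure conditions on the frequencies.\<close>

lemma cosine_sums_mult:
  assumes L_add: "\<And>k l. \<exists>m. \<forall>x. L m x = L k x + L l x"
    and L_diff: "\<And>k l. \<exists>m. \<forall>x. L m x = L k x - L l x"
    and "f \<in> cosine_sums L" "g \<in> cosine_sums L"
  shows "(\<lambda>x. f x * g x) \<in> cosine_sums L"
  using assms(3)
proof (induction rule: cosine_sums.induct)
  case (cosine k \<theta>)
  show ?case using assms(4)
  proof (induction rule: cosine_sums.induct)
    case (cosine l \<theta>')
    obtain u v where uv: "\<And>x. L u x = L k x - L l x" "\<And>x. L v x = L k x + L l x"
      using L_add L_diff by metis
    have "(\<lambda>x. 1 / 2 * cos (2 * pi * (L u x + (\<theta> - \<theta>'))) + 1 / 2 * cos (2 * pi * (L v x + (\<theta> + \<theta>')))) \<in> cosine_sums L"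
      by (intro cosine_sums.add cosine_sums.scale cosine_sums.cosine)
    moreover have "cos (2 * pi * (L k x + \<theta>)) * cos (2 * pi * (L l x + \<theta>'))
        = 1 / 2 * cos (2 * pi * (L u x + (\<theta> - \<theta>'))) + 1 / 2 * cos (2 * pi * (L v x + (\<theta> + \<theta>')))" for x
    proof -
      have "2 * pi * (L u x + (\<theta> - \<theta>')) = 2 * pi * (L k x + \<theta>) - 2 * pi * (L l x + \<theta>')"
        "2 * pi * (L v x + (\<theta> + \<theta>')) = 2 * pi * (L k x + \<theta>) + 2 * pi * (L l x + \<theta>')"
        by (simp_all add: uv algebra_simps)
      then show ?thesis unfolding cos_times_cos by (simp add: add_divide_distrib)
    qed
    ultimately show ?case by simp
  next
    case (add f g)
    then show ?case using cosine_sums.add by (fastforce simp: distrib_left)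
  next
    case (scale f c)
    then have "(\<lambda>x. c * (cos (2 * pi * (L k x + \<theta>)) * f x)) \<in> cosine_sums L" by (intro cosine_sums.scale)
    then show ?case by (simp add: mult_ac)
  qed
next
  case (add f h)
  then show ?case using cosine_sums.add[of "\<lambda>x. f x * g x" L "\<lambda>x. h x * g x"] by (simp add: distrib_right)
next
  case (scale f c)
  then show ?case using cosine_sums.scale[of "\<lambda>x. f x * g x" L c] by (simp add: mult.assoc)
qed

context divergent_radii
begin

text \<open>The translate of \<open>D0\<close> by any field element, integral or not, is again a
  fundamental domain, and periodic functions have the same integral over both.\<close>

lemma integral_D0_translate:
  assumes [measurable]: "g \<in> borel_measurable PM"
    and g: "\<And>a x. a \<in> OK \<Longrightarrow> x \<in> space PM \<Longrightarrow> g (tr a x) = g x"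
  shows "(\<integral>\<^sup>+x. g (tr \<gamma> x) * indicator D0 x \<partial>PM) = (\<integral>\<^sup>+x. g x * indicator D0 x \<partial>PM)"
proof -
  let ?h = "\<lambda>x. indicator D0 (tr (- \<gamma>) x) :: ennreal"
  have per1: "per ?h x = 1" if "x \<in> space PM" for x
  proof -
    obtain a where a: "a \<in> OK" "\<And>c. c \<in> OK \<Longrightarrow> tr c (tr (- \<gamma>) x) \<in> D0 \<longleftrightarrow> c = a"
      using D0_translate_unique[OF tr_in_space] by blast
    have "per ?h x = (\<integral>\<^sup>+c. indicator {a} c \<partial>count_space OK)"
      unfolding per_def
      by (rule nn_integral_cong) (use a(2) in \<open>auto simp: tr_add add.commute[of "- \<gamma>"] split: split_indicator\<close>)
    then show ?thesis using a(1) by simp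
  qed
  have "(\<integral>\<^sup>+x. g x * indicator D0 x \<partial>PM) = (\<integral>\<^sup>+x. per ?h x * g x * indicator D0 x \<partial>PM)"
    by (rule nn_integral_cong) (simp add: per1)
  also have "\<dots> = (\<integral>\<^sup>+x. ?h x * g x \<partial>PM)" by (rule unfolding_integral[OF _ _ g]) measurable
  also have "\<dots> = (\<integral>\<^sup>+x. ?h (tr \<gamma> x) * g (tr \<gamma> x) \<partial>PM)" by (rule nn_integral_tr[symmetric]) measurable
  also have "\<dots> = (\<integral>\<^sup>+x. g (tr \<gamma> x) * indicator D0 x \<partial>PM)"
    by (rule nn_integral_cong) (simp add: tr_add tr_zero mult.commute)
  finally show ?thesis by simp
qed

lemma cos_int_lin_periodic:
  assumes "c \<in> OK"
  shows "cos (2 * pi * (int_lin k (tr c x) + \<theta>)) = cos (2 * pi * (int_lin k x + \<theta>))"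
proof -
  have "int_functional k c \<in> \<int>" using int_functional_algebraic_int assms by simp
  then obtain l where "int_functional k c = of_int l" by (rule Ints_cases)
  then have "2 * pi * (int_lin k (tr c x) + \<theta>) = 2 * pi * (int_lin k x + \<theta>) + of_int l * (2 * pi)"
    by (simp add: int_lin_tr algebra_simps)
  then show ?thesis using cos.plus_of_int[of "2 * pi * (int_lin k x + \<theta>)" l] by simp
qed

text \<open>Translation by an element with \<open>int_functional\<close> equal to \<open>1/2\<close> changes the sign of the cosine.\<close>

lemma integral_cos:
  assumes k: "\<exists>j<d. k j \<noteq> 0"
  shows "(\<integral>x. cos (2 * pi * (int_lin k x + \<theta>)) \<partial>N) = 0"
proof -
  let ?c = "\<lambda>x. cos (2 * pi * (int_lin k x + \<theta>))"
  obtain j where j: "j < d" "k j \<noteq> 0" using k by blast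
  define \<gamma> where "\<gamma> = of_rat (1 / (2 * of_int (k j))) * b j"
  have "int_functional k \<gamma> = (\<Sum>i<d. if i = j then 1 / 2 else 0)"
    unfolding int_functional_def \<gamma>_def using j by (intro sum.cong) (auto simp: coord_rat_linear coord_basis)
  then have \<gamma>: "int_functional k \<gamma> = 1 / 2" using j by simp
  have c\<gamma>: "?c (tr \<gamma> x) = - ?c x" for x
  proof -
    have "2 * pi * (int_lin k (tr \<gamma> x) + \<theta>) = 2 * pi * (int_lin k x + \<theta>) + pi"
      by (simp add: int_lin_tr \<gamma> of_rat_divide algebra_simps)
    then show ?thesis by simp
  qed
  have [measurable]: "?c \<in> borel_measurable PM" by measurable
  have b: "0 \<le> 1 + ?c x" "0 \<le> 1 - ?c x" "\<bar>?c x\<bar> \<le> 1" "\<bar>1 + ?c x\<bar> \<le> 2" "\<bar>1 - ?c x\<bar> \<le> 2" for x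
    using cos_ge_minus_one[of "2 * pi * (int_lin k x + \<theta>)"] cos_le_one[of "2 * pi * (int_lin k x + \<theta>)"] by linarith+
  have m: "?c \<in> borel_measurable N" by (rule measurable_N) measurable
  have i: "integrable N ?c" by (rule integrable_bounded[OF m b(3)])
  have "(\<integral>\<^sup>+x. ennreal (1 + ?c (tr \<gamma> x)) * indicator D0 x \<partial>PM) = (\<integral>\<^sup>+x. ennreal (1 + ?c x) * indicator D0 x \<partial>PM)"
    by (rule integral_D0_translate) (auto simp: cos_int_lin_periodic)
  then have "(\<integral>\<^sup>+x. ennreal (1 - ?c x) \<partial>N) = (\<integral>\<^sup>+x. ennreal (1 + ?c x) \<partial>N)"
    unfolding c\<gamma> nn_integral_N by simp
  then have "ennreal (\<integral>x. 1 - ?c x \<partial>N) = ennreal (\<integral>x. 1 + ?c x \<partial>N)"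
    using i b by (simp add: nn_integral_eq_integral)
  then have "(\<integral>x. 1 - ?c x \<partial>N) = (\<integral>x. 1 + ?c x \<partial>N)"
    using b(1,2) by (subst (asm) ennreal_inj) (auto intro!: integral_nonneg_AE)
  then show ?thesis using i by simp
qed

text \<open>The integral against \<open>a l\<close> is at most \<open>E l / S l\<close> in absolute
  value, the relative size of the character sum errors. On \<open>G\<close> the error of a single
  ideal relative to \<Phi>(n) tends to 0 with growing norm, and the finitely many ideals of small
  norm are outweighed as \<open>S l\<close> diverges.\<close>

lemma cos_equi:
  assumes k: "\<exists>j<d. k j \<noteq> 0"
  shows "(\<lambda>x. cos (2 * pi * (int_lin k x + \<theta>))) \<in> equi"
proof -
  let ?c = "\<lambda>x. cos (2 * pi * (int_lin k x + \<theta>))"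
  obtain C :: real where C: "C \<ge> 0" "\<And>n. nzideal n \<Longrightarrow>
    (\<integral>\<^sup>+x. fcount n x * ennreal (1 + ?c x) * indicator D0 x \<partial>PM) \<le> ennreal ((ideal_\<Phi> n + sqrt (C * ideal_Nm n)) * V n)"
    "\<And>n. nzideal n \<Longrightarrow> ennreal ((ideal_\<Phi> n - sqrt (C * ideal_Nm n)) * V n) \<le>
    (\<integral>\<^sup>+x. fcount n x * ennreal (1 + ?c x) * indicator D0 x \<partial>PM)"
    using equidistribution_estimate[OF k] by blast
  define w where "w n = ideal_\<Phi> n * V n" for n
  define e where "e n = sqrt (C * ideal_Nm n) * V n" for n
  have w0: "w n \<ge> 0" and e0: "e n \<ge> 0" for n using V_nonneg C(1) by (auto simp: w_def e_def)
  have m: "?c \<in> borel_measurable N" by (rule measurable_N) measurable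
  have b: "0 \<le> 1 + ?c x" "\<bar>?c x\<bar> \<le> 1" "\<bar>1 + ?c x\<bar> \<le> 2" for x
    using cos_ge_minus_one[of "2 * pi * (int_lin k x + \<theta>)"] cos_le_one[of "2 * pi * (int_lin k x + \<theta>)"] by linarith+
  define E where "E k = (\<Sum>n\<in>Gk k. e n)" for k
  have est: "\<bar>\<integral>x. a l x * ?c x \<partial>N\<bar> \<le> E l / S l" if S: "S l \<ge> 1" for l
  proof -
    let ?I = "\<lambda>n. \<integral>\<^sup>+x. fcount n x * ennreal (1 + ?c x) * indicator D0 x \<partial>PM"
    have nz: "nzideal n" if "n \<in> Gk l" for n using that by (simp add: Gk_def G_nzideal)
    have i1: "integrable N (\<lambda>x. a l x * (1 + ?c x))"
      by (rule integrable_a_bounded[OF S _ b(3)]) (use m in measurable)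
    have i2: "integrable N (\<lambda>x. a l x * ?c x)" by (rule integrable_a_bounded[OF S m b(2)])
    have split: "(\<integral>x. a l x * (1 + ?c x) \<partial>N) = 1 + (\<integral>x. a l x * ?c x \<partial>N)"
      using integrable_a[OF S] i2 by (simp add: distrib_left)
    have "ennreal (\<integral>x. a l x * (1 + ?c x) \<partial>N) = (\<integral>\<^sup>+x. ennreal (a l x * (1 + ?c x)) \<partial>N)"
      by (rule nn_integral_eq_integral[symmetric, OF i1]) (use a_nonneg[OF S] b(1) in auto)
    also have "\<dots> = (\<integral>\<^sup>+x. ennreal (a l x) * ennreal (1 + ?c x) \<partial>N)"
      using a_nonneg[OF S] b(1) by (simp add: ennreal_mult')
    also have "\<dots> = ennreal (1 / S l) * (\<integral>\<^sup>+x. A l x * ennreal (1 + ?c x) \<partial>N)"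
      by (rule nn_integral_a[OF S]) (use m in measurable)
    also have "(\<integral>\<^sup>+x. A l x * ennreal (1 + ?c x) \<partial>N) = (\<Sum>n\<in>Gk l. ?I n)"
      unfolding nn_integral_N A_def sum_distrib_right by (rule nn_integral_sum) measurable
    finally have eq: "ennreal (\<integral>x. a l x * (1 + ?c x) \<partial>N) = ennreal (1 / S l) * (\<Sum>n\<in>Gk l. ?I n)" .
    have "(\<Sum>n\<in>Gk l. ?I n) \<le> (\<Sum>n\<in>Gk l. ennreal (w n + e n))"
      using C(2) nz by (intro sum_mono) (auto simp: w_def e_def distrib_right)
    also have "\<dots> = ennreal (S l + E l)"
      using w0 e0 by (subst sum_ennreal) (auto simp: sum.distrib S_def E_def w_def)
    finally have "ennreal (\<integral>x. a l x * (1 + ?c x) \<partial>N) \<le> ennreal (1 / S l) * ennreal (S l + E l)"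
      unfolding eq by (intro mult_left_mono) auto
    also have "\<dots> = ennreal (1 / S l * (S l + E l))" using S by (intro ennreal_mult'[symmetric]) simp
    also have "1 / S l * (S l + E l) = 1 + E l / S l" using S by (simp add: add_divide_distrib)
    finally have up: "(\<integral>x. a l x * (1 + ?c x) \<partial>N) \<le> 1 + E l / S l"
      using S e0 by (subst (asm) ennreal_le_iff) (auto simp: E_def intro!: add_nonneg_nonneg divide_nonneg_nonneg sum_nonneg)
    have "ennreal (S l - E l) = ennreal (\<Sum>n\<in>Gk l. w n - e n)"
      by (simp add: S_def E_def w_def sum_subtractf)
    \<comment> \<open>The truncation makes the summands nonnegative, so that the sum may be pulled
      out of \<open>ennreal\<close>, which reads negative numbers as 0.\<close>
    also have "\<dots> \<le> ennreal (\<Sum>n\<in>Gk l. max 0 (w n - e n))" by (intro ennreal_leI sum_mono) simp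
    also have "\<dots> = (\<Sum>n\<in>Gk l. ennreal (max 0 (w n - e n)))" by (rule sum_ennreal[symmetric]) simp
    also have "\<dots> \<le> (\<Sum>n\<in>Gk l. ?I n)"
    proof (rule sum_mono)
      fix n assume "n \<in> Gk l"
      from C(3)[OF nz[OF this]] have "ennreal (w n - e n) \<le> ?I n" by (simp add: w_def e_def left_diff_distrib)
      then show "ennreal (max 0 (w n - e n)) \<le> ?I n" by (simp add: max_def)
    qed
    finally have "ennreal (1 / S l) * ennreal (S l - E l) \<le> ennreal (\<integral>x. a l x * (1 + ?c x) \<partial>N)"
      unfolding eq by (intro mult_left_mono) auto
    moreover have "ennreal (1 / S l) * ennreal (S l - E l) = ennreal (1 / S l * (S l - E l))"
      using S by (intro ennreal_mult'[symmetric]) simp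
    moreover have "1 / S l * (S l - E l) = 1 - E l / S l" using S by (simp add: diff_divide_distrib)
    ultimately have "ennreal (1 - E l / S l) \<le> ennreal (\<integral>x. a l x * (1 + ?c x) \<partial>N)" by simp
    moreover have "0 \<le> (\<integral>x. a l x * (1 + ?c x) \<partial>N)"
      using a_nonneg[OF S] b(1) by (intro integral_nonneg_AE AE_I2 mult_nonneg_nonneg)
    ultimately have lo: "1 - E l / S l \<le> (\<integral>x. a l x * (1 + ?c x) \<partial>N)"
      by (cases "1 - E l / S l \<ge> 0") (auto simp: ennreal_le_iff)
    from up lo show ?thesis unfolding split by (simp add: abs_le_iff)
  qed
  have "(\<lambda>l. E l / S l) \<longlonglongrightarrow> 0"
  proof (rule LIMSEQ_I)
    fix \<eta> :: real assume \<eta>: "\<eta> > 0"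
    \<comment> \<open>The threshold beyond which \<open>sqrt (C * Nm n)\<close> is at most
      \<open>\<eta> / 2 * \<delta> * Nm n\<close>, found by squaring.\<close>
    obtain M :: nat where M: "real M \<ge> C * 4 / (\<delta> * \<eta>)\<^sup>2" using real_arch_simple by blast
    have small: "e n \<le> \<eta> / 2 * w n" if n: "n \<in> G" "ideal_Nm n > M" for n
    proof -
      let ?N = "real (ideal_Nm n)"
      have N0: "?N > 0" using n by simp
      have "C * 4 \<le> ?N * (\<delta> * \<eta>)\<^sup>2"
        using M n(2) \<eta> \<delta>_pos by (simp add: divide_le_eq) (meson less_imp_le mult_right_mono of_nat_mono order.trans zero_le_power2)
      then have "C * ?N \<le> ?N * (\<delta> * \<eta>)\<^sup>2 / 4 * ?N" using N0 by (intro mult_right_mono) auto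
      also have "\<dots> = (\<delta> * \<eta> * ?N / 2)\<^sup>2" by (simp add: power2_eq_square)
      finally have "sqrt (C * ?N) \<le> \<delta> * \<eta> * ?N / 2"
        using \<delta>_pos \<eta> by (intro real_le_lsqrt) (use C(1) in auto)
      also have "\<dots> = \<eta> / 2 * (\<delta> * ?N)" by simp
      also have "\<dots> \<le> \<eta> / 2 * ideal_\<Phi> n" using G_\<Phi>[OF n(1)] \<eta> by (intro mult_left_mono) auto
      finally show ?thesis unfolding e_def w_def
        using V_nonneg[of n] mult_right_mono[of "sqrt (C * ?N)" "\<eta> / 2 * ideal_\<Phi> n" "V n"] by (simp add: mult.assoc)
    qed
    have Ele: "E l \<le> E M + \<eta> / 2 * S l" for l
    proof -
      have "E l = (\<Sum>n\<in>Gk l \<inter> Gk M. e n) + (\<Sum>n\<in>Gk l - Gk M. e n)"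
        unfolding E_def using finite_Gk by (rule sum.Int_Diff)
      also have "(\<Sum>n\<in>Gk l \<inter> Gk M. e n) \<le> E M" unfolding E_def using finite_Gk e0 by (intro sum_mono2) auto
      also have "(\<Sum>n\<in>Gk l - Gk M. e n) \<le> (\<Sum>n\<in>Gk l - Gk M. \<eta> / 2 * w n)"
        by (intro sum_mono small) (auto simp: Gk_def)
      also have "\<dots> \<le> (\<Sum>n\<in>Gk l. \<eta> / 2 * w n)" using finite_Gk w0 \<eta> by (intro sum_mono2) auto
      also have "\<dots> = \<eta> / 2 * S l" by (simp add: S_def w_def sum_distrib_left)
      finally show ?thesis by simp
    qed
    have "\<forall>\<^sub>F l in sequentially. S l \<ge> 2 * E M / \<eta> + 1"
      using S_at_top unfolding filterlim_at_top by blast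
    then have "\<forall>\<^sub>F l in sequentially. norm (E l / S l - 0) < \<eta>"
    proof eventually_elim
      case (elim l)
      have EM: "E M \<ge> 0" unfolding E_def using e0 by (intro sum_nonneg)
      have "2 * E M / \<eta> \<ge> 0" using EM \<eta> by simp
      then have Sp: "S l > 0" using elim by linarith
      have "2 * E M / \<eta> < S l" using elim by linarith
      then have "2 * E M < \<eta> * S l" using \<eta> by (simp add: divide_less_eq mult.commute)
      then have "E l < \<eta> * S l" using Ele[of l] by simp
      then have "E l / S l < \<eta>" using Sp by (simp add: divide_less_eq)
      moreover have "E l / S l \<ge> 0" using Sp e0 by (simp add: E_def sum_nonneg)
      ultimately show ?case by simp
    qed
    then show "\<exists>no. \<forall>l\<ge>no. norm (E l / S l - 0) < \<eta>" by (simp add: eventually_sequentially)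
  qed
  then have "(\<lambda>l. \<integral>x. a l x * ?c x \<partial>N) \<longlonglongrightarrow> 0"
    by (rule Lim_null_comparison[rotated]) (use est S_ge_1_eventually in \<open>auto elim!: eventually_mono\<close>)
  moreover have "\<exists>c. \<forall>x\<in>D0. \<bar>?c x\<bar> \<le> c" using b(2) by blast
  ultimately show ?thesis using m integral_cos[OF k] unfolding equi_def by simp
qed

lemma cosine_sums_equi: "f \<in> cosine_sums int_lin \<Longrightarrow> f \<in> equi"
proof (induction rule: cosine_sums.induct)
  case (cosine k \<theta>)
  show ?case
  proof (cases "\<exists>j<d. k j \<noteq> 0")
    case True
    then show ?thesis by (rule cos_equi)
  next
    case False
    then have "int_lin k x = 0" for x by (simp add: int_lin_def)
    then show ?thesis using equi_const by simp
  qed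
qed (auto intro: equi_add equi_scale)

end

lemma real_polynomial_cosine_sums:
  fixes p :: "real \<Rightarrow> real"
  assumes L_add: "\<And>k l. \<exists>m. \<forall>x. L m x = L k x + L l x"
    and L_diff: "\<And>k l. \<exists>m. \<forall>x. L m x = L k x - L l x"
    and one: "(\<lambda>x. 1) \<in> cosine_sums L" and u: "u \<in> cosine_sums L"
    and p: "real_polynomial_function p"
  shows "(\<lambda>x. p (u x)) \<in> cosine_sums L"
  using p
proof (induction rule: real_polynomial_function.induct)
  case (linear f)
  then obtain c where "f = (\<lambda>x. x * c)" using real_bounded_linear by blast
  then show ?case using cosine_sums.scale[OF u, of c] by (simp add: mult.commute)
next
  case (const c)
  then show ?case using cosine_sums.scale[OF one, of c] by simp
next
  case (add f g)
  then show ?case by (intro cosine_sums.add)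
next
  case (mult f g)
  then show ?case by (intro cosine_sums_mult[OF L_add L_diff])
qed

context divergent_radii
begin

lemma int_lin_closed:
  "\<exists>m. \<forall>x. int_lin m x = int_lin k x + int_lin l x"
  "\<exists>m. \<forall>x. int_lin m x = int_lin k x - int_lin l x"
proof -
  show "\<exists>m. \<forall>x. int_lin m x = int_lin k x + int_lin l x"
    by (intro exI[of _ "\<lambda>j. k j + l j"]) (simp add: int_lin_def distrib_right sum.distrib)
  show "\<exists>m. \<forall>x. int_lin m x = int_lin k x - int_lin l x"
    by (intro exI[of _ "\<lambda>j. k j - l j"]) (simp add: int_lin_def left_diff_distrib sum_subtractf)
qed

lemma one_cosine_sums: "(\<lambda>x. 1) \<in> cosine_sums int_lin"
  using cosine_sums.cosine[of int_lin "\<lambda>_. 0" 0] by (simp add: int_lin_def)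

text \<open>Each \<open>w\<close> packs a coordinate index, a phase and a threshold. Intersecting
  two such sets unites their families of conditions, which makes \<open>arcs\<close> stable under
  intersection.\<close>

definition arc :: "(nat \<times> real \<times> real) set \<Rightarrow> point set" where
  "arc W = {x \<in> D0. \<forall>w\<in>W. cos (2 * pi * (lin (fst w) x + fst (snd w))) > snd (snd w)}"

definition arcs :: "point set set" where
  "arcs = {arc W | W. finite W \<and> (\<forall>w\<in>W. fst w < d)}"

text \<open>Polynomials in cosines are again cosine sums. Those approximating half-lines exhibit the
  indicator as a pointwise limit, bounded by 2 for each condition.\<close>

lemma indicator_arc_equi:
  assumes W: "finite W" "\<forall>w\<in>W. fst w < d"
  shows "indicator (arc W) \<in> equi"
proof -
  have "\<forall>c. \<exists>p. (\<forall>m. real_polynomial_function (p m)) \<and> (\<forall>m. \<forall>v\<in>{-1..1}. \<bar>p m v\<bar> \<le> (2::real))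
    \<and> (\<forall>v\<in>{-1..1}. (\<lambda>m::nat. p m v) \<longlonglongrightarrow> (if v > (c::real) then 1 else 0))"
    using indicator_greater_poly_approx by blast
  then obtain p where p: "\<And>c m. real_polynomial_function (p c m)"
    "\<And>c m v. v \<in> {-1..1} \<Longrightarrow> \<bar>p c m v\<bar> \<le> (2::real)"
    "\<And>c v. v \<in> {-1..1} \<Longrightarrow> (\<lambda>m::nat. p c m v) \<longlonglongrightarrow> (if v > (c::real) then 1 else 0)"
    by metis
  define u where "u w x = cos (2 * pi * (lin (fst w) x + fst (snd w)))" for w :: "nat \<times> real \<times> real" and x
  have u1: "u w x \<in> {-1..1}" for w x unfolding u_def by simp
  have uT: "u w \<in> cosine_sums int_lin" if "fst w < d" for w
  proof -
    have "int_lin (\<lambda>i. if i = fst w then 1 else 0) x = lin (fst w) x" for x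
    proof -
      have "int_lin (\<lambda>i. if i = fst w then 1 else 0) x = (\<Sum>j<d. if j = fst w then lin j x else 0)"
        unfolding int_lin_def by (intro sum.cong) auto
      then show ?thesis using that by simp
    qed
    then show ?thesis
      using cosine_sums.cosine[of int_lin "\<lambda>i. if i = fst w then 1 else 0" "fst (snd w)"] by (simp add: u_def[abs_def])
  qed
  define g where "g m x = (\<Prod>w\<in>W. p (snd (snd w)) m (u w x))" for m :: nat and x
  have gT: "g m \<in> cosine_sums int_lin" for m
    unfolding g_def[abs_def] using W
  proof (induction W rule: finite_induct)
    case empty
    then show ?case using one_cosine_sums by simp
  next
    case (insert w W)
    then show ?case
      using cosine_sums_mult[OF int_lin_closed real_polynomial_cosine_sums[OF int_lin_closed one_cosine_sums uT p(1)]]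
      by simp
  qed
  show ?thesis
  proof (rule equi_limit[where g = g and c = "2 ^ card W"])
    show "g m \<in> equi" for m using gT by (rule cosine_sums_equi)
    show "\<bar>g m x\<bar> \<le> 2 ^ card W" for m x
    proof -
      have "\<bar>g m x\<bar> \<le> (\<Prod>w\<in>W. 2)"
        unfolding g_def abs_prod using p(2)[OF u1] by (intro prod_mono) auto
      then show ?thesis by simp
    qed
    show "(\<lambda>m. g m x) \<longlonglongrightarrow> indicator (arc W) x" if x: "x \<in> D0" for x
    proof -
      have "(\<lambda>m. g m x) \<longlonglongrightarrow> (\<Prod>w\<in>W. if u w x > snd (snd w) then 1 else 0)"
        unfolding g_def by (intro tendsto_prod p(3) u1)
      also have "(\<Prod>w\<in>W. if u w x > snd (snd w) then 1 else 0) = (indicator (arc W) x :: real)"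
      proof (cases "\<forall>w\<in>W. u w x > snd (snd w)")
        case True
        then have "x \<in> arc W" using x by (auto simp: arc_def u_def)
        then show ?thesis using True by simp
      next
        case False
        then have "(\<Prod>w\<in>W. if u w x > snd (snd w) then 1 else 0) = (0::real)"
          using W(1) by (auto intro!: prod_zero)
        moreover have "x \<notin> arc W" using False by (auto simp: arc_def u_def)
        ultimately show ?thesis by simp
      qed
      finally show ?thesis .
    qed
  qed
qed

lemma arcs_subset: "arcs \<subseteq> Pow D0"
  by (auto simp: arcs_def arc_def)

lemma Int_stable_arcs: "Int_stable arcs"
proof (rule Int_stableI)
  fix X Y assume "X \<in> arcs" "Y \<in> arcs"
  then obtain W W' where W: "X = arc W" "Y = arc W'" "finite W" "finite W'" "\<forall>w\<in>W \<union> W'. fst w < d"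
    unfolding arcs_def by blast
  have "arc W \<inter> arc W' = arc (W \<union> W')" by (auto simp: arc_def)
  then show "X \<inter> Y \<in> arcs" using W unfolding arcs_def by (intro CollectI exI[of _ "W \<union> W'"]) simp
qed

text \<open>On \<open>D0\<close> the coordinates lie in [0, 1), so each condition
  \<open>y < lin j x\<close> is trivial or an arc. The coordinates are thus measurable for the
  algebra generated by the arcs, and by \<open>point_from_lin\<close> so is the point
  itself.\<close>

lemma sets_N_arcs: "sets N \<subseteq> sigma_sets D0 arcs"
proof
  let ?M = "sigma D0 arcs"
  have sets: "sets ?M = sigma_sets D0 arcs" and space: "space ?M = D0"
    using arcs_subset by (auto simp: sets_measure_of space_measure_of)
  have D0_arc: "D0 \<in> sets ?M" using sets.top[of ?M] by (simp only: space)
  have lin: "lin j \<in> borel_measurable ?M" if j: "j < d" for j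
  proof (rule borel_measurableI_greater)
    fix y :: real
    consider "y < 0" | "y \<ge> 1" | "0 \<le> y" "y < 1" by linarith
    then show "{x \<in> space ?M. y < lin j x} \<in> sets ?M"
    proof cases
      case 1
      then have "{x \<in> space ?M. y < lin j x} = D0" using j unfolding space by (force simp: D0_def)
      then show ?thesis using D0_arc by (simp only:)
    next
      case 2
      then have "{x \<in> space ?M. y < lin j x} = {}" using j unfolding space by (force simp: D0_def)
      then show ?thesis by (simp only: sets.empty_sets)
    next
      case 3
      have "y < lin j x \<longleftrightarrow> cos (2 * pi * (lin j x + - (y + 1) / 2)) > cos (pi * (1 - y))" if "x \<in> D0" for x
        using that j 3 by (intro arc_characterisation) (auto simp: D0_def)
      then have "{x \<in> space ?M. y < lin j x} = arc {(j, - (y + 1) / 2, cos (pi * (1 - y)))}"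
        unfolding space by (auto simp: arc_def)
      also have "\<dots> \<in> arcs" using j unfolding arcs_def
        by (intro CollectI exI[of _ "{(j, - (y + 1) / 2, cos (pi * (1 - y)))}"]) simp
      finally show ?thesis unfolding sets by (rule sigma_sets.Basic)
    qed
  qed
  have cl: "(\<lambda>x. complex_of_real (lin j x)) \<in> borel_measurable ?M" if "j < d" for j
    by (rule measurable_compose[OF lin[OF that], of complex_of_real])
      (intro borel_measurable_continuous_onI continuous_intros)
  have id: "(\<lambda>x. x) \<in> measurable ?M PM"
  proof -
    have f: "(\<lambda>x. \<lambda>i\<in>{1..s}. \<Sum>j<d. lin j x * \<sigma> i (b j)) \<in> measurable ?M (\<Pi>\<^sub>M i\<in>{1..s}. lborel)"
    proof (intro measurable_restrict)
      fix i
      have "(\<lambda>x. \<Sum>j<d. lin j x * \<sigma> i (b j)) \<in> borel_measurable ?M"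
        by (intro borel_measurable_sum borel_measurable_times borel_measurable_const lin) simp
      then show "(\<lambda>x. \<Sum>j<d. lin j x * \<sigma> i (b j)) \<in> measurable ?M lborel" by (simp only: measurable_cong_sets[OF refl sets_lborel])
    qed
    have g: "(\<lambda>x. \<lambda>i\<in>{1..t}. \<Sum>j<d. complex_of_real (lin j x) * \<tau> i (b j)) \<in> measurable ?M (\<Pi>\<^sub>M i\<in>{1..t}. lborel)"
    proof (intro measurable_restrict)
      fix i
      have "(\<lambda>x. \<Sum>j<d. complex_of_real (lin j x) * \<tau> i (b j)) \<in> borel_measurable ?M"
        by (intro borel_measurable_sum borel_measurable_times borel_measurable_const cl) simp
      then show "(\<lambda>x. \<Sum>j<d. complex_of_real (lin j x) * \<tau> i (b j)) \<in> measurable ?M lborel"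
        by (simp only: measurable_cong_sets[OF refl sets_lborel])
    qed
    have "(\<lambda>x. (\<lambda>i\<in>{1..s}. \<Sum>j<d. lin j x * \<sigma> i (b j), \<lambda>i\<in>{1..t}. \<Sum>j<d. complex_of_real (lin j x) * \<tau> i (b j)))
        \<in> measurable ?M PM" unfolding PM_def by (rule measurable_Pair[OF f g])
    moreover have "(\<lambda>i\<in>{1..s}. \<Sum>j<d. lin j x * \<sigma> i (b j), \<lambda>i\<in>{1..t}. \<Sum>j<d. complex_of_real (lin j x) * \<tau> i (b j)) = x"
      if "x \<in> space ?M" for x
    proof (rule point_eqI)
      show xs: "x \<in> space PM" using that D0_subset_space by (auto simp only: space)
      show "fst (\<lambda>i\<in>{1..s}. \<Sum>j<d. lin j x * \<sigma> i (b j), \<lambda>i\<in>{1..t}. \<Sum>j<d. complex_of_real (lin j x) * \<tau> i (b j)) i = fst x i"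
        if "i \<in> {1..s}" for i using point_from_lin(1)[OF xs that] that by simp
      show "snd (\<lambda>i\<in>{1..s}. \<Sum>j<d. lin j x * \<sigma> i (b j), \<lambda>i\<in>{1..t}. \<Sum>j<d. complex_of_real (lin j x) * \<tau> i (b j)) i = snd x i"
        if "i \<in> {1..t}" for i using point_from_lin(2)[OF xs that] that by simp
    qed (simp add: space_PM)
    ultimately show ?thesis by (simp cong: measurable_cong)
  qed
  fix B assume "B \<in> sets N"
  then obtain X where X: "X \<in> sets PM" "B = D0 \<inter> X" by (auto simp: N_def sets_restrict_space)
  have "(\<lambda>x. x) -` X \<inter> space ?M \<in> sets ?M" by (rule measurable_sets[OF id X(1)])
  moreover have "(\<lambda>x. x) -` X \<inter> space ?M = B" unfolding space X(2) by auto
  ultimately show "B \<in> sigma_sets D0 arcs" by (simp only: sets)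
qed

lemma equi_cong:
  assumes f: "f \<in> equi" and eq: "\<And>x. x \<in> D0 \<Longrightarrow> f x = g x" shows "g \<in> equi"
proof -
  obtain c where c: "\<And>x. x \<in> D0 \<Longrightarrow> \<bar>f x\<bar> \<le> c" using f by (auto simp: equi_def)
  show ?thesis by (rule equi_limit[where g = "\<lambda>_. f"]) (use f c eq in auto)
qed

lemma equi_sum: "finite I \<Longrightarrow> (\<And>i. i \<in> I \<Longrightarrow> f i \<in> equi) \<Longrightarrow> (\<lambda>x. \<Sum>i\<in>I. f i x) \<in> equi"
proof (induction I rule: finite_induct)
  case empty
  show ?case using equi_const[of 0] by simp
next
  case (insert i I)
  then show ?case using equi_add[of "f i" "\<lambda>x. \<Sum>i\<in>I. f i x"] by simp
qed

text \<open>A Dynkin system argument from the arcs: complements use linearity, and countable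
  disjoint unions use \<open>equi_limit\<close>, their partial sums being bounded by 1.\<close>

theorem indicator_equi:
  assumes "B \<in> sets N" shows "indicator B \<in> equi"
proof -
  have "B \<in> sigma_sets D0 arcs" using assms sets_N_arcs by blast
  from Int_stable_arcs arcs_subset this show ?thesis
  proof (induction rule: sigma_sets_induct_disjoint)
    case (basic X)
    then obtain W where "X = arc W" "finite W" "\<forall>w\<in>W. fst w < d" unfolding arcs_def by blast
    then show ?case using indicator_arc_equi by simp
  next
    case empty
    show ?case using equi_const[of 0] by simp
  next
    case (compl X)
    have "(\<lambda>x. 1 + - 1 * indicator X x) \<in> equi" using compl by (intro equi_add equi_const equi_scale)
    then show ?case by (rule equi_cong) (auto split: split_indicator)
  next
    case (union X)
    show ?case
    proof (rule equi_limit[where g = "\<lambda>m x. \<Sum>i<m. indicator (X i) x" and c = 1])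
      have sum: "(\<Sum>i<m. indicator (X i) x) = (indicator (\<Union>i<m. X i) x :: real)" for m x
        using union(1) by (intro indicator_UN_disjoint[symmetric]) (auto simp: disjoint_family_on_def)
      show "(\<lambda>x. \<Sum>i<m. indicator (X i) x) \<in> equi" for m using union(3) by (intro equi_sum) auto
      show "\<bar>\<Sum>i<m. indicator (X i) x\<bar> \<le> (1::real)" for m x unfolding sum by (simp add: indicator_def)
      show "(\<lambda>m. \<Sum>i<m. indicator (X i) x) \<longlonglongrightarrow> (indicator (\<Union>i. X i) x :: real)" for x
        unfolding sum by (rule LIMSEQ_indicator_UN)
    qed
  qed
qed

section \<open>Full measure of the points with infinitely many approximations\<close>

definition Z :: "nat \<Rightarrow> point set" where "Z M = {x \<in> D0. \<forall>k. A k x \<le> ennreal M}"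

lemma sets_Z: "Z M \<in> sets N"
proof -
  have [measurable]: "A k \<in> borel_measurable N" for k by (rule measurable_N[OF measurable_A])
  have "{x \<in> space N. \<forall>k. A k x \<le> ennreal M} \<in> sets N" by measurable
  then show ?thesis by (simp add: Z_def space_N)
qed

text \<open>
  On \<open>Z M\<close> the normalised counting functions tend to zero uniformly, although by equidistribution
  their integrals tend to a multiple of the measure of \<open>Z M\<close>.
\<close>

lemma Z_null: "Z M \<in> null_sets N"
proof -
  let ?I = "\<lambda>k. \<integral>x. a k x * indicator (Z M) x \<partial>N"
  have "?I \<longlonglongrightarrow> (\<integral>x. indicator (Z M) x \<partial>N) / \<mu>0" using indicator_equi[OF sets_Z] by (simp add: equi_def)
  then have l1: "?I \<longlonglongrightarrow> measure N (Z M) / \<mu>0" using sets_Z by simp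
  have bnd: "norm (?I k) \<le> M * \<mu>0 * inverse (S k)" if S: "S k \<ge> 1" for k
  proof -
    have le: "a k x * indicator (Z M) x \<le> M / S k" for x
    proof (cases "x \<in> Z M")
      case True
      then have "enn2real (A k x) \<le> M" by (intro enn2real_leI) (auto simp: Z_def)
      then show ?thesis using S True by (simp add: a_def divide_right_mono)
    qed (use S in simp)
    have int: "integrable N (\<lambda>x. a k x * indicator (Z M) x)"
      by (rule integrable_a_bounded[OF S, of _ 1]) (use sets_Z in \<open>auto split: split_indicator\<close>)
    have "?I k \<le> (\<integral>x. M / S k \<partial>N)"
      by (rule integral_mono[OF int _ le]) simp
    also have "\<dots> = M * \<mu>0 * inverse (S k)" by (simp add: \<mu>0_def divide_inverse)
    finally have "?I k \<le> M * \<mu>0 * inverse (S k)" .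
    moreover have "?I k \<ge> 0" using a_nonneg[OF S] by (intro integral_nonneg_AE AE_I2) simp
    ultimately show ?thesis by simp
  qed
  have "(\<lambda>k. M * \<mu>0 * inverse (S k)) \<longlonglongrightarrow> M * \<mu>0 * 0"
    by (intro tendsto_mult tendsto_const tendsto_inverse_0_at_top S_at_top)
  then have "(\<lambda>k. M * \<mu>0 * inverse (S k)) \<longlonglongrightarrow> 0" by simp
  then have "?I \<longlonglongrightarrow> 0"
    by (rule Lim_null_comparison[rotated]) (rule eventually_mono[OF S_ge_1_eventually bnd])
  with l1 have "measure N (Z M) / \<mu>0 = 0" by (rule LIMSEQ_unique)
  then have "measure N (Z M) = 0" using \<mu>0_pos by simp
  then show ?thesis using sets_Z by (auto simp: null_sets_def N.emeasure_eq_measure)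
qed

text \<open>If only finitely many denominators counted at \<open>x\<close>, all \<open>A k x\<close>
  would be bounded by their finite total, so \<open>x\<close> would lie in one of the countably many
  null sets \<open>Z M\<close>.\<close>

lemma infinitely_many_denominators_in_D0:
  "AE x in N. infinite {n \<in> G. fcount n x \<noteq> 0}"
proof -
  have "G = (\<Union>k. Gk k)" by (auto simp: Gk_def)
  moreover have "countable (\<Union>k. Gk k)" using finite_Gk by (intro countable_UN) (auto intro: countable_finite)
  ultimately have cG: "countable G" by simp
  have "AE x in N. fcount n x < \<infinity>" if "n \<in> G" for n
  proof -
    have "(\<integral>\<^sup>+x. fcount n x \<partial>N) \<noteq> \<infinity>"
      unfolding nn_integral_N integral_fcount_one[OF G_nzideal[OF that]] by simp
    from nn_integral_PInf_AE[OF measurable_N[OF measurable_fcount] this] show ?thesis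
      by (auto elim!: eventually_mono simp: less_top)
  qed
  then have 1: "AE x in N. \<forall>n\<in>G. fcount n x < \<infinity>" by (intro AE_ball_countable[THEN iffD2, OF cG]) auto
  have 2: "AE x in N. \<forall>M. x \<notin> Z M" unfolding AE_all_countable using Z_null AE_not_in by blast
  show ?thesis using 1 2 AE_space
  proof eventually_elim
    case (elim x)
    show ?case
    proof
      let ?F = "{n \<in> G. fcount n x \<noteq> 0}"
      assume fin: "finite ?F"
      define v where "v = (\<Sum>n\<in>?F. fcount n x)"
      have "v < \<infinity>" unfolding v_def using fin elim(1) by (simp add: ennreal_sum_less_top)
      then obtain M :: nat where M: "v \<le> ennreal M"
      proof -
        assume that: "\<And>M. v \<le> ennreal (real M) \<Longrightarrow> thesis"
        obtain M :: nat where "enn2real v \<le> real M" using real_arch_simple by blast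
        have "v = ennreal (enn2real v)" using \<open>v < \<infinity>\<close> by simp
        also have "\<dots> \<le> ennreal (real M)" using \<open>enn2real v \<le> real M\<close> by (rule ennreal_leI)
        finally show thesis by (rule that)
      qed
      have "A k x \<le> v" for k
      proof -
        have "A k x = (\<Sum>n\<in>Gk k \<inter> ?F. fcount n x)"
          unfolding A_def using finite_Gk by (intro sum.mono_neutral_right) (auto simp: Gk_def)
        also have "\<dots> \<le> v" unfolding v_def using fin by (intro sum_mono2) auto
        finally show ?thesis .
      qed
      then have "x \<in> Z M" using M elim(3) unfolding Z_def space_N by (auto intro: order.trans)
      with elim(2) show False by blast
    qed
  qed
qed

text \<open>Each point has an integral translate in \<open>D0\<close> and the counting functions are
  periodic; countably many translations preserve null sets. Infinitely many denominators require
  infinitely many \<gamma>, since each \<gamma> has just one.\<close>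

theorem infinitely_many_approximations:
  "AE x in PM. infinite {\<gamma>. denom \<gamma> \<in> G \<and> x \<in> nbhd (denom \<gamma>) \<gamma>}"
proof -
  have "AE x in PM. x \<in> D0 \<longrightarrow> infinite {n \<in> G. fcount n x \<noteq> 0}"
    using infinitely_many_denominators_in_D0 unfolding N_def
    by (subst (asm) AE_restrict_space_iff) (auto simp: sets.Int_space_eq2)
  then have "AE x in PM. tr c x \<in> D0 \<longrightarrow> infinite {n \<in> G. fcount n (tr c x) \<noteq> 0}" for c
    by (rule AE_distrD[OF measurable_tr[of c], of "\<lambda>x. x \<in> D0 \<longrightarrow> infinite {n \<in> G. fcount n x \<noteq> 0}", unfolded distr_tr])
  then have "AE x in PM. \<forall>c\<in>OK. tr c x \<in> D0 \<longrightarrow> infinite {n \<in> G. fcount n (tr c x) \<noteq> 0}"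
    by (intro AE_ball_countable[THEN iffD2, OF countable_OK]) auto
  then show ?thesis using AE_space
  proof eventually_elim
    case (elim x)
    obtain c where c: "c \<in> OK" "tr c x \<in> D0" using D0_translate_unique[OF elim(2)] by blast
    have "infinite {n \<in> G. fcount n (tr c x) \<noteq> 0}" using elim(1) c by blast
    then have inf: "infinite {n \<in> G. fcount n x \<noteq> 0}" unfolding fcount_periodic[OF c(1)] .
    have "{n \<in> G. fcount n x \<noteq> 0} \<subseteq> denom ` {\<gamma>. denom \<gamma> \<in> G \<and> x \<in> nbhd (denom \<gamma>) \<gamma>}"
      using fcount_pos[OF elim(2)] by blast
    then show ?case using inf finite_surj by blast
  qed
qed

end

section \<open>Divergence on ideals with large totient\<close>

lemma Limsup_pos_frequently:
  fixes f :: "real \<Rightarrow> real"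
  assumes "Limsup at_top (\<lambda>x. ereal (f x)) > 0"
  shows "\<exists>c>0. \<forall>x0. \<exists>x\<ge>x0. f x > c"
proof -
  obtain c where c: "0 < ereal c" "ereal c < Limsup at_top (\<lambda>x. ereal (f x))"
    using ereal_dense2[OF assms] by auto
  have "\<exists>x\<ge>x0. f x > c" for x0
  proof (rule ccontr)
    assume "\<not> ?thesis"
    then have "\<forall>\<^sub>F x in at_top. ereal (f x) \<le> ereal c"
      unfolding eventually_at_top_linorder by (auto simp: not_less)
    then have "Limsup at_top (\<lambda>x. ereal (f x)) \<le> ereal c" by (rule Limsup_bounded)
    with c(2) show False by simp
  qed
  with c(1) show ?thesis by auto
qed

lemma ennreal_infsum_top_finite_sum:
  fixes f :: "'a \<Rightarrow> real"
  assumes "(\<Sum>\<^sub>\<infinity>x\<in>A. ennreal (f x)) = \<infinity>" and nn: "\<And>x. x \<in> A \<Longrightarrow> 0 \<le> f x"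
  shows "\<exists>F. finite F \<and> F \<subseteq> A \<and> B \<le> sum f F"
proof (rule ccontr)
  assume neg: "\<not> ?thesis"
  have "(\<Sum>\<^sub>\<infinity>x\<in>A. ennreal (f x)) = (SUP F\<in>{F. finite F \<and> F \<subseteq> A}. \<Sum>x\<in>F. ennreal (f x))"
    by (rule nonneg_infsum_complete) simp
  also have "\<dots> \<le> ennreal B"
  proof (rule SUP_least)
    fix F assume F: "F \<in> {F. finite F \<and> F \<subseteq> A}"
    then have "\<not> B \<le> sum f F" using neg by blast
    then have "sum f F \<le> B" by simp
    moreover have "(\<Sum>x\<in>F. ennreal (f x)) = ennreal (sum f F)" using F nn by (intro sum_ennreal) auto
    ultimately show "(\<Sum>x\<in>F. ennreal (f x)) \<le> ennreal B" by (simp add: ennreal_leI)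
  qed
  finally show False using assms(1) by (simp add: top_unique)
qed

text \<open>
  The limsup condition allows to discard the ideals for which \<open>\<Phi>\<close> is small compared to the norm:
  they carry at most half of the sum along a sequence of radii.
\<close>

lemma divergence_on_large_totient:
  fixes P w N :: "'a \<Rightarrow> real"
  assumes fin: "\<And>R. finite {n \<in> I. N n \<le> R}"
    and nn: "\<And>n. n \<in> I \<Longrightarrow> 0 \<le> w n" "\<And>n. n \<in> I \<Longrightarrow> 0 \<le> P n" "\<And>n. n \<in> I \<Longrightarrow> 0 \<le> N n"
    and div: "(\<Sum>\<^sub>\<infinity>n\<in>I. ennreal (P n * w n)) = \<infinity>"
    and c: "c > 0" "\<And>R0. \<exists>R\<ge>R0. (\<Sum>n\<in>{n\<in>I. N n \<le> R}. P n * w n) / (\<Sum>n\<in>{n\<in>I. N n \<le> R}. N n * w n) > c"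
  shows "\<exists>R\<ge>0. B \<le> (\<Sum>n\<in>{n\<in>I. c / 2 * N n \<le> P n \<and> N n \<le> R}. P n * w n)"
proof -
  \<comment> \<open>Twice \<open>B\<close> is requested because the discarded ideals carry at most
    half of the sum: their share is at most \<open>c / 2 * U\<close>, while
    \<open>c * U < T\<close>.\<close>
  obtain F where F: "finite F" "F \<subseteq> I" "2 * B \<le> (\<Sum>n\<in>F. P n * w n)"
    using ennreal_infsum_top_finite_sum[OF div, of "2 * B"] nn by auto
  \<comment> \<open>From this radius on all of \<open>F\<close> is included; the inserted 0 covers
    an empty \<open>F\<close> and makes the radius nonnegative.\<close>
  define R0 where "R0 = Max (insert 0 (N ` F))"
  obtain R where R: "R \<ge> R0" "(\<Sum>n\<in>{n\<in>I. N n \<le> R}. P n * w n) / (\<Sum>n\<in>{n\<in>I. N n \<le> R}. N n * w n) > c"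
    using c(2) by blast
  have R0: "0 \<le> R0" "\<And>n. n \<in> F \<Longrightarrow> N n \<le> R0" unfolding R0_def using F(1) by auto
  let ?X = "{n\<in>I. N n \<le> R}" and ?G = "{n\<in>I. c / 2 * N n \<le> P n \<and> N n \<le> R}"
  define T where "T = (\<Sum>n\<in>?X. P n * w n)"
  define U where "U = (\<Sum>n\<in>?X. N n * w n)"
  have U: "U \<ge> 0" unfolding U_def using nn by (intro sum_nonneg) auto
  have TU: "T / U > c" using R(2) by (simp add: T_def U_def)
  \<comment> \<open>For \<open>U = 0\<close> the quotient would take the default value 0, which does
    not exceed \<open>c\<close>.\<close>
  have "U \<noteq> 0" using TU c(1) by auto
  with U have Up: "U > 0" by simp
  then have TcU: "c * U < T" using TU by (simp add: less_divide_eq)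
  have "2 * B \<le> T" unfolding T_def
  proof (rule order.trans[OF F(3)])
    show "(\<Sum>n\<in>F. P n * w n) \<le> (\<Sum>n\<in>?X. P n * w n)"
      using fin F(2) R0(2) R(1) nn by (intro sum_mono2) (auto intro: order.trans)
  qed
  moreover have "T = (\<Sum>n\<in>?X \<inter> ?G. P n * w n) + (\<Sum>n\<in>?X - ?G. P n * w n)"
    unfolding T_def using fin by (rule sum.Int_Diff)
  moreover have "(\<Sum>n\<in>?X - ?G. P n * w n) \<le> (\<Sum>n\<in>?X - ?G. c / 2 * (N n * w n))"
  proof (rule sum_mono)
    fix n assume "n \<in> ?X - ?G"
    then have "P n \<le> c / 2 * N n" "0 \<le> w n" using nn by auto
    then show "P n * w n \<le> c / 2 * (N n * w n)" using mult_right_mono[of "P n" "c / 2 * N n" "w n"] by simp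
  qed
  moreover have "(\<Sum>n\<in>?X - ?G. c / 2 * (N n * w n)) \<le> (\<Sum>n\<in>?X. c / 2 * (N n * w n))"
    using fin nn c(1) by (intro sum_mono2) auto
  moreover have "(\<Sum>n\<in>?X. c / 2 * (N n * w n)) = c / 2 * U" by (simp add: U_def sum_distrib_left)
  moreover have "?X \<inter> ?G = ?G" by auto
  ultimately have "B \<le> (\<Sum>n\<in>?G. P n * w n)" using TcU by simp
  then show ?thesis using R0(1) R(1) by (intro exI[of _ R]) auto
qed

text \<open>The exceptional points of \<open>D\<close> lie in a null set of the Borel product.
  Completion makes them measurable, and removing a null set from \<open>D\<close> preserves its
  measure.\<close>

lemma approximable_set_full_measure:
  assumes D: "D \<in> sets (lebesgue_st s t)"
    and ae: "AE x in (\<Pi>\<^sub>M i\<in>{1..s}. (lborel :: real measure)) \<Otimes>\<^sub>M (\<Pi>\<^sub>M j\<in>{1..t}. (lborel :: complex measure)).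
      infinite {\<gamma>. good_approximation s t \<sigma> \<tau> \<psi>\<^sub>r \<psi>\<^sub>c x \<gamma>}"
  shows "approximable_set s t \<sigma> \<tau> \<psi>\<^sub>r \<psi>\<^sub>c D \<in> sets (lebesgue_st s t) \<and>
    emeasure (lebesgue_st s t) (approximable_set s t \<sigma> \<tau> \<psi>\<^sub>r \<psi>\<^sub>c D) = emeasure (lebesgue_st s t) D"
proof -
  let ?M = "(\<Pi>\<^sub>M i\<in>{1..s}. (lborel :: real measure)) \<Otimes>\<^sub>M (\<Pi>\<^sub>M j\<in>{1..t}. (lborel :: complex measure))"
  let ?A = "approximable_set s t \<sigma> \<tau> \<psi>\<^sub>r \<psi>\<^sub>c D"
  obtain N where N: "N \<in> null_sets ?M"
    "{x \<in> space ?M. \<not> infinite {\<gamma>. good_approximation s t \<sigma> \<tau> \<psi>\<^sub>r \<psi>\<^sub>c x \<gamma>}} \<subseteq> N"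
    by (rule AE_E[OF ae]) (blast intro: null_setsI)
  have "D \<subseteq> space ?M" using sets.sets_into_space[OF D] by (simp add: lebesgue_st_def)
  then have sub: "D - ?A \<subseteq> N" using N(2) by (auto simp: approximable_set_def)
  have null: "D - ?A \<in> null_sets (completion ?M)"
    by (rule null_sets_completion_subset[OF sub null_sets_completionI[OF N(1)]])
  have DM: "D \<in> sets (completion ?M)" using D by (simp add: lebesgue_st_def)
  have A: "?A = D - (D - ?A)" by (auto simp: approximable_set_def)
  have "?A \<in> sets (completion ?M)" by (subst A) (use DM null in auto)
  moreover have "emeasure (completion ?M) ?A = emeasure (completion ?M) D"
    by (subst A) (rule emeasure_Diff_null_set[OF null DM])
  ultimately show ?thesis by (simp add: lebesgue_st_def)
qed

theorem theorem1p2: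
  fixes n s t :: nat
    and \<sigma> :: "nat \<Rightarrow> 'k::field_char_0 \<Rightarrow> real"
    and \<tau> :: "nat \<Rightarrow> 'k \<Rightarrow> complex"
    and \<psi>\<^sub>r \<psi>\<^sub>c :: "nat \<Rightarrow> 'k set \<Rightarrow> real"
    and D :: "point set"
  assumes number_field: "number_field TYPE('k)"
    and degree: "field_degree TYPE('k) = n"
    and real_embeddings: "enumerates_real_embeddings s \<sigma>"
    and complex_embeddings: "represents_complex_pairs t \<tau>"
    and domain: "fundamental_domain s t (\<iota> s t \<sigma> \<tau> ` carrier \<O>) D"
    and nonneg_real: "\<forall>i\<in>{1..s}. \<forall>\<nn>\<in>integral_ideals. 0 \<le> \<psi>\<^sub>r i \<nn>"
    and nonneg_complex: "\<forall>j\<in>{1..t}. \<forall>\<nn>\<in>integral_ideals. 0 \<le> \<psi>\<^sub>c j \<nn>"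
    and divergence:
      "(\<Sum>\<^sub>\<infinity>\<nn>\<in>integral_ideals. ennreal (real (ideal_\<Phi> \<nn>) * \<Psi> s t \<psi>\<^sub>r \<psi>\<^sub>c \<nn>)) = \<infinity>"
    and limsup_pos:
      "Limsup at_top (\<lambda>R::real. ereal (
          (\<Sum>\<nn>\<in>{\<nn>\<in>integral_ideals. real (ideal_Nm \<nn>) \<le> R}. real (ideal_\<Phi> \<nn>) * \<Psi> s t \<psi>\<^sub>r \<psi>\<^sub>c \<nn>) /
          (\<Sum>\<nn>\<in>{\<nn>\<in>integral_ideals. real (ideal_Nm \<nn>) \<le> R}. real (ideal_Nm \<nn>) * \<Psi> s t \<psi>\<^sub>r \<psi>\<^sub>c \<nn>))) > 0"
    and bound_real: "\<forall>i\<in>{1..s}. \<forall>\<nn>\<in>integral_ideals.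
      \<psi>\<^sub>r i \<nn> \<le> 1 / (2 * real (ideal_Nm \<nn>) powr (1 / real (s + t)))"
    and bound_complex: "\<forall>j\<in>{1..t}. \<forall>\<nn>\<in>integral_ideals.
      \<psi>\<^sub>c j \<nn> \<le> 1 / (2 * real (ideal_Nm \<nn>) powr (1 / real (s + t)))"
  shows "approximable_set s t \<sigma> \<tau> \<psi>\<^sub>r \<psi>\<^sub>c D \<in> sets (lebesgue_st s t) \<and>
    emeasure (lebesgue_st s t) (approximable_set s t \<sigma> \<tau> \<psi>\<^sub>r \<psi>\<^sub>c D) = emeasure (lebesgue_st s t) D"
proof (rule approximable_set_full_measure)
  show "D \<in> sets (lebesgue_st s t)" using domain by (simp add: fundamental_domain_def)
  obtain d and b0 :: "nat \<Rightarrow> 'k" and \<phi>0 where "qbasis d b0 \<phi>0" using number_field_qbasis[OF number_field] by blast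
  then obtain b :: "nat \<Rightarrow> 'k" and \<phi> where ib: "integral_basis d b \<phi>" using qbasis.integral_basis_exists by blast
  define r where "r \<nn> i = max 0 (\<psi>\<^sub>r i \<nn>)" for \<nn> :: "'k set" and i
  \<comment> \<open>The ordinary absolute value at a complex place is the square root of \<open>|\<sqdot>|\<^sub>\<rho>\<close>, so the
    radius could be \<open>sqrt \<psi>\<^sub>c\<close>; the smaller \<open>\<psi>\<^sub>c \<le> 1\<close> makes the volumes proportional to \<open>\<Psi>\<close>.
    Outside \<open>integral_ideals\<close> the functions may be negative.\<close>
  define R where "R \<nn> j = max 0 (\<psi>\<^sub>c j \<nn>)" for \<nn> :: "'k set" and j
  interpret approximation_radii d b \<phi> s t \<sigma> \<tau> r R
  proof (intro approximation_radii.intro number_field_points.intro ib)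
    show "number_field_points_axioms s t \<sigma> \<tau>"
      by unfold_locales (rule real_embeddings complex_embeddings)+
    show "approximation_radii_axioms r R" by unfold_locales (auto simp: r_def R_def)
  qed
  have idl: "\<nn> \<in> integral_ideals \<longleftrightarrow> nzideal \<nn>" for \<nn> :: "'k set" by (rule integral_ideals_iff)
  \<comment> \<open>The volume of the unit polydisc: a factor 2 for each real place and pi for each
    complex one.\<close>
  define \<kappa> where "\<kappa> = 2 ^ s * pi ^ t"
  have \<kappa>: "\<kappa> > 0" by (simp add: \<kappa>_def)
  have VPsi: "V \<nn> = \<kappa> * \<Psi> s t \<psi>\<^sub>r \<psi>\<^sub>c \<nn>" if "\<nn> \<in> integral_ideals" for \<nn>
  proof -
    have "(\<Prod>i\<in>{1..s}. 2 * r \<nn> i) = 2 ^ s * (\<Prod>i\<in>{1..s}. \<psi>\<^sub>r i \<nn>)"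
      using nonneg_real that by (simp add: prod.distrib r_def max_def)
    moreover have "(\<Prod>j\<in>{1..t}. pi * (R \<nn> j)\<^sup>2) = pi ^ t * (\<Prod>j\<in>{1..t}. (\<psi>\<^sub>c j \<nn>)\<^sup>2)"
      using nonneg_complex that by (simp add: prod.distrib R_def max_def)
    ultimately show ?thesis by (simp add: V_def vol_def \<Psi>_def \<kappa>_def)
  qed
  have Psi_nonneg: "0 \<le> \<Psi> s t \<psi>\<^sub>r \<psi>\<^sub>c \<nn>" if "\<nn> \<in> integral_ideals" for \<nn>
    unfolding \<Psi>_def using nonneg_real that by (intro mult_nonneg_nonneg prod_nonneg) auto
  obtain c where c: "c > 0" "\<And>R0. \<exists>R\<ge>R0.
      (\<Sum>\<nn>\<in>{\<nn>\<in>integral_ideals. real (ideal_Nm \<nn>) \<le> R}. real (ideal_\<Phi> \<nn>) * \<Psi> s t \<psi>\<^sub>r \<psi>\<^sub>c \<nn>) /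
      (\<Sum>\<nn>\<in>{\<nn>\<in>integral_ideals. real (ideal_Nm \<nn>) \<le> R}. real (ideal_Nm \<nn>) * \<Psi> s t \<psi>\<^sub>r \<psi>\<^sub>c \<nn>) > c"
    using Limsup_pos_frequently[OF limsup_pos] by blast
  have fin: "finite {\<nn> \<in> (integral_ideals :: 'k set set). real (ideal_Nm \<nn>) \<le> R}" for R
    by (rule finite_subset[OF _ finite_ideals_bounded_Nm[of "nat \<lceil>R\<rceil>"]])
      (auto simp: idl, linarith)
  \<comment> \<open>Half of the constant \<open>c\<close> exceeded by the quotients;
    \<open>c / 2\<close> then plays the part of \<delta> in \<open>divergent_radii\<close>.\<close>
  define G where "G = {\<nn>. nzideal (\<nn> :: 'k set) \<and> c / 2 * ideal_Nm \<nn> \<le> ideal_\<Phi> \<nn>}"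
  have div: "\<exists>k::nat. B \<le> (\<Sum>\<nn>\<in>{\<nn>\<in>G. ideal_Nm \<nn> \<le> k}. ideal_\<Phi> \<nn> * V \<nn>)" for B
  proof -
    obtain R where R: "R \<ge> 0" "B / \<kappa> \<le> (\<Sum>\<nn>\<in>{\<nn>\<in>integral_ideals. c / 2 * real (ideal_Nm \<nn>) \<le> real (ideal_\<Phi> \<nn>)
        \<and> real (ideal_Nm \<nn>) \<le> R}. real (ideal_\<Phi> \<nn>) * \<Psi> s t \<psi>\<^sub>r \<psi>\<^sub>c \<nn>)"
      using divergence_on_large_totient[where B = "B / \<kappa>" and w = "\<Psi> s t \<psi>\<^sub>r \<psi>\<^sub>c" and P = "\<lambda>\<nn>. real (ideal_\<Phi> \<nn>)"
          and N = "\<lambda>\<nn>. real (ideal_Nm \<nn>)" and I = "integral_ideals :: 'k set set", OF fin Psi_nonneg _ _ divergence c]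
      by auto
    \<comment> \<open>Norms are natural numbers, so the real radius may be rounded down.\<close>
    have eq: "{\<nn>\<in>integral_ideals. c / 2 * real (ideal_Nm \<nn>) \<le> real (ideal_\<Phi> \<nn>) \<and> real (ideal_Nm \<nn>) \<le> R}
        = {\<nn>\<in>G. ideal_Nm \<nn> \<le> nat \<lfloor>R\<rfloor>}"
      using R(1) by (auto simp: G_def idl le_nat_floor le_nat_iff le_floor_iff)
    have "B \<le> \<kappa> * (\<Sum>\<nn>\<in>{\<nn>\<in>G. ideal_Nm \<nn> \<le> nat \<lfloor>R\<rfloor>}. real (ideal_\<Phi> \<nn>) * \<Psi> s t \<psi>\<^sub>r \<psi>\<^sub>c \<nn>)"
      using R(2) \<kappa> unfolding eq by (simp add: divide_le_eq mult.commute)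
    also have "\<dots> = (\<Sum>\<nn>\<in>{\<nn>\<in>G. ideal_Nm \<nn> \<le> nat \<lfloor>R\<rfloor>}. ideal_\<Phi> \<nn> * V \<nn>)"
      unfolding sum_distrib_left by (intro sum.cong) (auto simp: VPsi G_def idl)
    finally show ?thesis by blast
  qed
  interpret divergent_radii d b \<phi> s t \<sigma> \<tau> r R G "c / 2"
    by unfold_locales (use c(1) div in \<open>auto simp: G_def\<close>)
  have "AE x in PM. infinite {\<gamma>. good_approximation s t \<sigma> \<tau> \<psi>\<^sub>r \<psi>\<^sub>c x \<gamma>}"
    using infinitely_many_approximations
  proof eventually_elim
    case (elim x)
    have "{\<gamma>. denom \<gamma> \<in> G \<and> x \<in> nbhd (denom \<gamma>) \<gamma>} \<subseteq> {\<gamma>. good_approximation s t \<sigma> \<tau> \<psi>\<^sub>r \<psi>\<^sub>c x \<gamma>}"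
    proof (intro subsetI CollectI)
      fix \<gamma> assume "\<gamma> \<in> {\<gamma>. denom \<gamma> \<in> G \<and> x \<in> nbhd (denom \<gamma>) \<gamma>}"
      then have \<gamma>: "nzideal (denom \<gamma>)" "tr (- \<gamma>) x \<in> polydisc (r (denom \<gamma>)) (R (denom \<gamma>))"
        by (auto simp: G_def nbhd_def)
      have I: "denom \<gamma> \<in> integral_ideals" using \<gamma>(1) idl by blast
      show "good_approximation s t \<sigma> \<tau> \<psi>\<^sub>r \<psi>\<^sub>c x \<gamma>"
        unfolding good_approximation_def dnm_eq_denom
      proof (intro conjI ballI)
        show "\<bar>fst x i - \<sigma> i \<gamma>\<bar> \<le> \<psi>\<^sub>r i (denom \<gamma>)" if "i \<in> {1..s}" for i
          using \<gamma>(2) that nonneg_real I by (auto simp: mem_polydisc_tr r_def max_def)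
        show "(cmod (snd x j - \<tau> j \<gamma>))\<^sup>2 \<le> \<psi>\<^sub>c j (denom \<gamma>)" if j: "j \<in> {1..t}" for j
        proof -
          have nn: "0 \<le> \<psi>\<^sub>c j (denom \<gamma>)" using nonneg_complex j I by blast
          have "cmod (snd x j - \<tau> j \<gamma>) \<le> R (denom \<gamma>) j"
            using \<gamma>(2) j by (auto simp: mem_polydisc_tr)
          then have le: "cmod (snd x j - \<tau> j \<gamma>) \<le> \<psi>\<^sub>c j (denom \<gamma>)" using nn by (simp add: R_def)
          \<comment> \<open>A norm is at least 1, so the assumed bound gives
            \<open>\<psi>\<^sub>c \<le> 1\<close>. Hence the square of the radius
            \<open>\<psi>\<^sub>c\<close> is at most \<open>\<psi>\<^sub>c\<close>, as the
            normalised absolute value requires.\<close>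
          have "1 \<le> real (ideal_Nm (denom \<gamma>)) powr (1 / real (s + t))"
            using ideal_Nm_pos[OF \<gamma>(1)] by (intro ge_one_powr_ge_zero) auto
          then have "1 / (2 * real (ideal_Nm (denom \<gamma>)) powr (1 / real (s + t))) \<le> 1"
            by (simp add: divide_le_eq)
          moreover have "\<psi>\<^sub>c j (denom \<gamma>) \<le> 1 / (2 * real (ideal_Nm (denom \<gamma>)) powr (1 / real (s + t)))"
            using bound_complex j I by blast
          ultimately have "\<psi>\<^sub>c j (denom \<gamma>) \<le> 1" by linarith
          have "(cmod (snd x j - \<tau> j \<gamma>))\<^sup>2 \<le> (\<psi>\<^sub>c j (denom \<gamma>))\<^sup>2" using le by (intro power_mono) auto
          also have "\<dots> \<le> \<psi>\<^sub>c j (denom \<gamma>)"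
            using nn \<open>\<psi>\<^sub>c j (denom \<gamma>) \<le> 1\<close> by (simp add: power2_eq_square mult_left_le)
          finally show ?thesis .
        qed
      qed
    qed
    then show ?case using elim finite_subset by blast
  qed
  then show "AE x in (\<Pi>\<^sub>M i\<in>{1..s}. (lborel :: real measure)) \<Otimes>\<^sub>M (\<Pi>\<^sub>M j\<in>{1..t}. (lborel :: complex measure)).
      infinite {\<gamma>. good_approximation s t \<sigma> \<tau> \<psi>\<^sub>r \<psi>\<^sub>c x \<gamma>}"
    unfolding PM_def .
qed

end
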